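(* Let $n\ge 1$. Let $(\mathscr C,\mathbb E,\mathfrak s)$ be an extriangulated (equivalently, $1$-exangulated) category with enough projectives and enough injectives, equipped with chosen data $(\Sigma A,\iota^A)$, $(\Omega A,\omega_A)$ for every $A\in\mathscr C$ as in the context. Assume: (W) for all morphisms $f\in\mathscr C(A,B)$, $g\in\mathscr C(B,C)$: if $g\circ f$ is an $\mathfrak s$-inflation then so is $f$; and if $g\circ f$ is an $\mathfrak s$-deflation then so is $g$. Let $\mathcal T\subseteq\mathscr C$ be an $n$-cluster tilting subcategory satisfying: (c1) if $C\in\mathscr C$ satisfies $\mathbb E^{n-1}(\mathcal T,C)=0$, then there is an $\mathfrak s$-triangle $D\xrightarrow{q}P\to C\dashrightarrow$ with $P$ projective such that $\mathscr C(T,q):\mathscr C(T,D)\to\mathscr C(T,P)$ is injective for every $T\in\mathcal T$; (c2) if $A\in\mathscr C$ satisfies $\mathbb E^{n-1}(A,\mathcal T)=0$, then there is an $\mathfrak s$-triangle $A\to I\xrightarrow{j}S\dashrightarrow$ with $I$ injective such that $\mathscr C(j,T):\mathscr C(S,T)\to\mathscr C(I,T)$ is injective for every $T\in\mathcal T$. (For $n=1$, where $\mathcal T=\mathscr C$, conditions (c1) and (c2) are void.) For $A,C\in\mathcal T$ and $\delta\in\mathbb E^n(C,A)$ define $\mathfrak s^n(\delta)=[X^\bullet]$, the homotopy equivalence class in $\mathbf C^{n+2}_{(\mathcal T;A,C)}$ of any $X^\bullet$ such that $\langle X^\bullet,\delta\rangle$ is an $\mathfrak s$-decomposable object (this is well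 defined). Then $(\mathcal T,\mathbb E^n,\mathfrak s^n)$, with $\mathbb E^n$ restricted to $\mathcal T^{op}\times\mathcal T$, is an $n$-exangulated category.
   Context: **$n$-exangulated categories.** Let $n\ge1$, $\mathscr C$ an additive category, $\mathbb E:\mathscr C^{op}\times\mathscr C\to Ab$ a biadditive functor. Extensions: an element $\delta\in\mathbb E(C,A)$ is an extension; for $a:A\to A'$, $c:C'\to C$ put $a_*\delta=\mathbb E(C,a)(\delta)$, $c^*\delta=\mathbb E(c,A)(\delta)$. For $\delta\in\mathbb E(C,A)$, $\rho\in\mathbb E(D,B)$ a morphism of extensions $(a,c):\delta\to\rho$ is a pair $a:A\to B$, $c:C\to D$ with $a_*\delta=c^*\rho$. Put $\delta_\sharp:\mathscr C(-,C)\to\mathbb E(-,A)$, $f\mapsto f^*\delta$, and $\delta^\sharp:\mathscr C(A,-)\to\mathbb E(C,-)$, $g\mapsto g_*\delta$. Complexes: $\mathbf C^{n+2}_{\mathscr C}$ is the category of complexes $X^\bullet=(X^0\xrightarrow{d_X^0}\cdots\xrightarrow{d_X^n}X^{n+1})$ in $\mathscr C$ concentrated in degrees $0,\dots,n+1$, with the usual chain homotopy. For $A,C\in\mathscr C$, $\mathbf C^{n+2}_{(\mathscr C;A,C)}$ has as objects the complexes with $X^0=A$, $X^{n+1}=C$ and as morphisms the chain maps $f^\bullet$ with $f^0=1_A$, $f^{n+1}=1_C$; the homotopy relation is the same chain homotopy relation, a homotopy equivalence is a morphism with an inverse up to homotopy within this category, and $[X^\bullet]$ is the homotopy equivalence class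 of $X^\bullet$ in it. $n$-exangles: an $\mathbb E$-attached complex is a pair $\langle X^\bullet,\delta\rangle$, $\delta\in\mathbb E(X^{n+1},X^0)$, with $(d_X^0)_*\delta=0$, $(d_X^n)^*\delta=0$; these form a category $\text{Æ}^{n+2}_{(\mathscr C,\mathbb E)}$ whose morphisms $\langle X^\bullet,\delta\rangle\to\langle Y^\bullet,\rho\rangle$ are chain maps $f^\bullet$ with $(f^0)_*\delta=(f^{n+1})^*\rho$. It is an $n$-exangle if $\mathscr C(-,X^0)\to\cdots\to\mathscr C(-,X^{n+1})\xrightarrow{\delta_\sharp}\mathbb E(-,X^0)$ and $\mathscr C(X^{n+1},-)\to\cdots\to\mathscr C(X^0,-)\xrightarrow{\delta^\sharp}\mathbb E(X^{n+1},-)$ are exact (at all inner terms). Exact realization: a correspondence $\mathfrak s$ assigning to each $\delta\in\mathbb E(C,A)$ a class $\mathfrak s(\delta)=[X^\bullet]$ of an object of $\mathbf C^{n+2}_{(\mathscr C;A,C)}$ such that: (R0) if $\mathfrak s(\delta)=[X^\bullet]$, $\mathfrak s(\rho)=[Y^\bullet]$, every morphism $(a,c):\delta\to\rho$ has a lift, i.e. a chain map $f^\bullet:X^\bullet\to Y^\bullet$ with $f^0=a$, $f^{n+1}=c$; (R1) if $\mathfrak s(\delta)=[X^\bullet]$ then $\langle X^\bullet,\delta\rangle$ is an $n$-exangle; (R2) for every $A$, $0\in\mathbb E(0,A)$ has $\mathfrak s(0)=[A\xrightarrow{1}A\to0\to\cdots\to0]$ and $0\in\mathbb E(A,0)$ has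 $\mathfrak s(0)=[0\to\cdots\to0\to A\xrightarrow{1}A]$. If $\mathfrak s(\delta)=[X^\bullet]$, $\langle X^\bullet,\delta\rangle$ is called ($\mathfrak s$-)distinguished, $X^\bullet$ a conflation, $d_X^0$ an $\mathfrak s$-inflation, $d_X^n$ an $\mathfrak s$-deflation. Cones: for $f^\bullet:X^\bullet\to Y^\bullet$ with $f^0=1_A$, the mapping cone $M_f^\bullet$ is $X^1\to X^2\oplus Y^1\to\cdots\to X^{n+1}\oplus Y^n\to Y^{n+1}$ with $d^0=\begin{bmatrix}-d_X^1\\ f^1\end{bmatrix}$, $d^i=\begin{bmatrix}-d_X^{i+1}&0\\ f^{i+1}&d_Y^i\end{bmatrix}$ ($1\le i\le n-1$), $d^n=[f^{n+1}\ d_Y^n]$. Dually for $h^\bullet:X^\bullet\to Y^\bullet$ with $h^{n+1}=1$, the mapping cocone is $X^0\to X^1\oplus Y^0\to\cdots\to X^n\oplus Y^{n-1}\to Y^n$ with $\begin{bmatrix}d_X^0\\ h^0\end{bmatrix}$, $\begin{bmatrix}d_X^i&0\\ h^i&-d_Y^{i-1}\end{bmatrix}$, $[h^n\ -d_Y^{n-1}]$. $(\mathscr C,\mathbb E,\mathfrak s)$ is $n$-exangulated if $\mathfrak s$ is an exact realization of $\mathbb E$ and: (EA1) inflations are closed under composition, and so are deflations; (EA2) for $\rho\in\mathbb E(D,A)$, $c:C\to D$ and distinguished $\langle X^\bullet,c^*\rho\rangle$, $\langle Y^\bullet,\rho\rangle$, the morphism $(1_A,c)$ has a lift $f^\bullet:X^\bullet\to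 Y^\bullet$ such that $\langle M_f^\bullet,(d_X^0)_*\rho\rangle$ is distinguished; (EA2$^{op}$) for $\delta\in\mathbb E(C,A)$, $a:A\to B$ and distinguished $\langle X^\bullet,\delta\rangle$, $\langle Y^\bullet,a_*\delta\rangle$, the morphism $(a,1_C)$ has a lift whose mapping cocone with extension $(d_Y^n)^*\delta$ is distinguished. **Extriangulated setting.** Extriangulated categories are the same as $1$-exangulated categories. Let $(\mathscr C,\mathbb E,\mathfrak s)$ be one. A distinguished $1$-exangle $A\to B\to C\overset{\delta}{\dashrightarrow}$ is called an $\mathfrak s$-triangle. $P\in\mathscr C$ is projective if for every $\mathfrak s$-triangle $A\to B\xrightarrow{y}C\dashrightarrow$ every $P\to C$ factors through $y$; enough projectives: every $C$ has an $\mathfrak s$-triangle $A\to P\to C\dashrightarrow$ with $P$ projective. Injectives and enough injectives are dual. $\mathcal P,\mathcal I$ are the full subcategories of projectives, injectives; $\underline{\mathscr C}=\mathscr C/\mathcal P$, $\overline{\mathscr C}=\mathscr C/\mathcal I$ the ideal quotients. $\mathbb E$ factors through $\underline{\mathscr C}^{op}\times\overline{\mathscr C}$. For each $A$ fix $\Sigma A$ and $\iota^A\in\mathbb E(\Sigma A,A)$ realized by $A\to I\to\Sigma A$ with $I\in\mathcal I$, and $\Omega A$ and $\omega_A\in\mathbb E(A,\Omega A)$ realized by $\Omega A\to P\to A$ with $P\in\mathcal P$. $\Sigma$ becomes an additive endofunctor of $\overline{\mathscr C}$: $\Sigma\overline a=\overline s$ for any $s:\Sigma A\to\Sigma A'$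 with $a_*\iota^A=s^*\iota^{A'}$. Higher extensions: for $i\ge1$, $\mathbb E^i(C,A)=\mathbb E(C,\Sigma^{i-1}A)$, with $\mathbb E^i(c,a)=(\Sigma^{i-1}\overline a)_*c^*$; this is a biadditive functor $\mathscr C^{op}\times\mathscr C\to Ab$. For $\delta\in\mathbb E^i(X,A)$ let $\overline\delta\in\overline{\mathscr C}(X,\Sigma^iA)$ be the class of any $d:X\to\Sigma^iA$ with $d^*\iota^{\Sigma^{i-1}A}=\delta$ (well defined). Cup product $\cup:\mathbb E^i(X,A)\times\mathbb E^j(C,X)\to\mathbb E^{i+j}(C,A)$, $\delta\cup\theta=(\Sigma^{j-1}\overline\delta)_*\theta$; it is associative. $n$-cluster tilting: a full additive subcategory $\mathcal T\subseteq\mathscr C$ closed under isomorphisms and direct summands is $n$-cluster tilting if it is functorially finite and for every $C\in\mathscr C$ the following are equivalent: $C\in\mathcal T$; $\mathbb E^i(C,\mathcal T)=0$ for $1\le i\le n-1$; $\mathbb E^i(\mathcal T,C)=0$ for $1\le i\le n-1$. (For $n=1$: $\mathcal T=\mathscr C$.) $\mathfrak s$-decomposable: for $A,C\in\mathcal T$, $\delta\in\mathbb E^n(C,A)$, an object $\langle X^\bullet,\delta\rangle\in\text{Æ}^{n+2}_{(\mathcal T,\mathbb E^n)}$ with $X^0=A$, $X^{n+1}=C$, all $X^i\in\mathcal T$, is $\mathfrak s$-decomposable if there are $\mathfrak s$-triangles $A\xrightarrow{d_X^0}X^1\xrightarrow{e^1}M^1\overset{\delta_{(1)}}{\dashrightarrow}$,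 $M^i\xrightarrow{m^i}X^{i+1}\xrightarrow{e^{i+1}}M^{i+1}\overset{\delta_{(i+1)}}{\dashrightarrow}$ ($1\le i\le n-2$), $M^{n-1}\xrightarrow{m^{n-1}}X^n\xrightarrow{d_X^n}C\overset{\delta_{(n)}}{\dashrightarrow}$ with $d_X^i=m^i\circ e^i$ ($1\le i\le n-1$) and $\delta=\delta_{(1)}\cup\cdots\cup\delta_{(n)}$. (For $n=1$ this just means that $\langle X^\bullet,\delta\rangle$ is an $\mathfrak s$-triangle.) For every $\delta$ such an $X^\bullet$ exists, and under the hypotheses of the statement those $X^\bullet$ form exactly one homotopy equivalence class in $\mathbf C^{n+2}_{(\mathcal T;A,C)}$. *)

theory Defs
  imports "HOL-Algebra.Coset"
begin

section \<open>Additive categories\<close>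

text \<open>
  Abelian groups are \<^locale>\<open>comm_group\<close>s of HOL-Algebra, hence written multiplicatively:
  the unit of \<open>Hom C A B\<close> is the zero morphism, its product is the addition of morphisms.
  Fields are only meaningful on objects in \<open>Ob C\<close> and on elements of the carriers; in particular
  a full subcategory is obtained by shrinking \<open>Ob C\<close>.
\<close>

record ('o, 'm) category =
  Ob :: "'o set"
  Hom :: "'o \<Rightarrow> 'o \<Rightarrow> 'm monoid"
  src :: "'m \<Rightarrow> 'o"
  trg :: "'m \<Rightarrow> 'o"
  idn :: "'o \<Rightarrow> 'm"
  comp :: "'m \<Rightarrow> 'm \<Rightarrow> 'm" (infixl "\<cdot>\<index>" 70)

abbreviation arr :: "('o, 'm) category \<Rightarrow> 'o \<Rightarrow> 'o \<Rightarrow> 'm set" where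
  "arr C A B \<equiv> carrier (Hom C A B)"

abbreviation zero_arr :: "('o, 'm) category \<Rightarrow> 'o \<Rightarrow> 'o \<Rightarrow> 'm" where
  "zero_arr C A B \<equiv> \<one>\<^bsub>Hom C A B\<^esub>"

definition add_arr :: "('o, 'm) category \<Rightarrow> 'm \<Rightarrow> 'm \<Rightarrow> 'm" (infixl "\<boxplus>\<index>" 65) where
  "f \<boxplus>\<^bsub>C\<^esub> g = f \<otimes>\<^bsub>Hom C (src C f) (trg C f)\<^esub> g"

definition minus_arr :: "('o, 'm) category \<Rightarrow> 'm \<Rightarrow> 'm \<Rightarrow> 'm" (infixl "\<boxminus>\<index>" 65) where
  "f \<boxminus>\<^bsub>C\<^esub> g = f \<otimes>\<^bsub>Hom C (src C f) (trg C f)\<^esub> inv\<^bsub>Hom C (src C f) (trg C f)\<^esub> g"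

definition neg_arr :: "('o, 'm) category \<Rightarrow> 'm \<Rightarrow> 'm" where
  "neg_arr C f = inv\<^bsub>Hom C (src C f) (trg C f)\<^esub> f"

locale preadditive_category =
  fixes C :: "('o, 'm) category"
  assumes hom_group: "\<lbrakk>A \<in> Ob C; B \<in> Ob C\<rbrakk> \<Longrightarrow> comm_group (Hom C A B)"
    and src_trg: "\<lbrakk>A \<in> Ob C; B \<in> Ob C; f \<in> arr C A B\<rbrakk> \<Longrightarrow> src C f = A \<and> trg C f = B"
    and idn_arr: "A \<in> Ob C \<Longrightarrow> idn C A \<in> arr C A A"
    and comp_arr: "\<lbrakk>A \<in> Ob C; B \<in> Ob C; D \<in> Ob C; f \<in> arr C A B; g \<in> arr C B D\<rbrakk>
      \<Longrightarrow> g \<cdot>\<^bsub>C\<^esub> f \<in> arr C A D"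
    and comp_assoc: "\<lbrakk>A \<in> Ob C; B \<in> Ob C; D \<in> Ob C; F \<in> Ob C;
        f \<in> arr C A B; g \<in> arr C B D; h \<in> arr C D F\<rbrakk>
      \<Longrightarrow> (h \<cdot>\<^bsub>C\<^esub> g) \<cdot>\<^bsub>C\<^esub> f = h \<cdot>\<^bsub>C\<^esub> (g \<cdot>\<^bsub>C\<^esub> f)"
    and comp_idn: "\<lbrakk>A \<in> Ob C; B \<in> Ob C; f \<in> arr C A B\<rbrakk>
      \<Longrightarrow> f \<cdot>\<^bsub>C\<^esub> idn C A = f \<and> idn C B \<cdot>\<^bsub>C\<^esub> f = f"
    and comp_add_right: "\<lbrakk>A \<in> Ob C; B \<in> Ob C; D \<in> Ob C;
        f \<in> arr C A B; f' \<in> arr C A B; g \<in> arr C B D\<rbrakk>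
      \<Longrightarrow> g \<cdot>\<^bsub>C\<^esub> (f \<boxplus>\<^bsub>C\<^esub> f') = (g \<cdot>\<^bsub>C\<^esub> f) \<boxplus>\<^bsub>C\<^esub> (g \<cdot>\<^bsub>C\<^esub> f')"
    and comp_add_left: "\<lbrakk>A \<in> Ob C; B \<in> Ob C; D \<in> Ob C;
        f \<in> arr C A B; g \<in> arr C B D; g' \<in> arr C B D\<rbrakk>
      \<Longrightarrow> (g \<boxplus>\<^bsub>C\<^esub> g') \<cdot>\<^bsub>C\<^esub> f = (g \<cdot>\<^bsub>C\<^esub> f) \<boxplus>\<^bsub>C\<^esub> (g' \<cdot>\<^bsub>C\<^esub> f)"

definition zero_object :: "('o, 'm) category \<Rightarrow> 'o \<Rightarrow> bool" where
  "zero_object C Z \<longleftrightarrow> Z \<in> Ob C \<and>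
     (\<forall>A\<in>Ob C. (\<exists>!f. f \<in> arr C A Z) \<and> (\<exists>!f. f \<in> arr C Z A))"

definition biproduct ::
  "('o, 'm) category \<Rightarrow> 'o \<Rightarrow> 'o \<Rightarrow> 'o \<Rightarrow> 'm \<Rightarrow> 'm \<Rightarrow> 'm \<Rightarrow> 'm \<Rightarrow> bool" where
  "biproduct C A B S i\<^sub>1 i\<^sub>2 p\<^sub>1 p\<^sub>2 \<longleftrightarrow>
     A \<in> Ob C \<and> B \<in> Ob C \<and> S \<in> Ob C \<and>
     i\<^sub>1 \<in> arr C A S \<and> i\<^sub>2 \<in> arr C B S \<and> p\<^sub>1 \<in> arr C S A \<and> p\<^sub>2 \<in> arr C S B \<and>
     p\<^sub>1 \<cdot>\<^bsub>C\<^esub> i\<^sub>1 = idn C A \<and> p\<^sub>2 \<cdot>\<^bsub>C\<^esub> i\<^sub>2 = idn C B \<and>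
     p\<^sub>1 \<cdot>\<^bsub>C\<^esub> i\<^sub>2 = zero_arr C B A \<and> p\<^sub>2 \<cdot>\<^bsub>C\<^esub> i\<^sub>1 = zero_arr C A B \<and>
     (i\<^sub>1 \<cdot>\<^bsub>C\<^esub> p\<^sub>1) \<boxplus>\<^bsub>C\<^esub> (i\<^sub>2 \<cdot>\<^bsub>C\<^esub> p\<^sub>2) = idn C S"

locale additive_category = preadditive_category +
  assumes zero_object_exists: "\<exists>Z. zero_object C Z"
    and biproduct_exists: "\<lbrakk>A \<in> Ob C; B \<in> Ob C\<rbrakk>
      \<Longrightarrow> \<exists>S i\<^sub>1 i\<^sub>2 p\<^sub>1 p\<^sub>2. biproduct C A B S i\<^sub>1 i\<^sub>2 p\<^sub>1 p\<^sub>2"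

definition isomorphic :: "('o, 'm) category \<Rightarrow> 'o \<Rightarrow> 'o \<Rightarrow> bool" where
  "isomorphic C A B \<longleftrightarrow>
     (\<exists>f\<in>arr C A B. \<exists>g\<in>arr C B A. g \<cdot>\<^bsub>C\<^esub> f = idn C A \<and> f \<cdot>\<^bsub>C\<^esub> g = idn C B)"

definition full_subcategory :: "('o, 'm) category \<Rightarrow> 'o set \<Rightarrow> ('o, 'm) category" where
  "full_subcategory C T = C\<lparr>Ob := T\<rparr>"

section \<open>Complexes concentrated in degrees 0, ..., n+1\<close>

text \<open>
  Only \<open>obj X i\<close> with \<open>i \<le> n + 1\<close> and \<open>diff X i\<close> with \<open>i \<le> n\<close> are part of the complex; the values
  in other degrees never matter, and homotopy classes below are closed under changing them.
\<close>

record ('o, 'm) cpx =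
  obj :: "nat \<Rightarrow> 'o"
  diff :: "nat \<Rightarrow> 'm"

definition is_complex :: "('o, 'm) category \<Rightarrow> nat \<Rightarrow> ('o, 'm) cpx \<Rightarrow> bool" where
  "is_complex C n X \<longleftrightarrow>
     (\<forall>i\<le>n + 1. obj X i \<in> Ob C) \<and>
     (\<forall>i\<le>n. diff X i \<in> arr C (obj X i) (obj X (i + 1))) \<and>
     (\<forall>i<n. diff X (i + 1) \<cdot>\<^bsub>C\<^esub> diff X i = zero_arr C (obj X i) (obj X (i + 2)))"

definition chain_map ::
  "('o, 'm) category \<Rightarrow> nat \<Rightarrow> ('o, 'm) cpx \<Rightarrow> ('o, 'm) cpx \<Rightarrow> (nat \<Rightarrow> 'm) \<Rightarrow> bool" where
  "chain_map C n X Y f \<longleftrightarrow>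
     (\<forall>i\<le>n + 1. f i \<in> arr C (obj X i) (obj Y i)) \<and>
     (\<forall>i\<le>n. f (i + 1) \<cdot>\<^bsub>C\<^esub> diff X i = diff Y i \<cdot>\<^bsub>C\<^esub> f i)"

definition homotopic ::
  "('o, 'm) category \<Rightarrow> nat \<Rightarrow> ('o, 'm) cpx \<Rightarrow> ('o, 'm) cpx \<Rightarrow> (nat \<Rightarrow> 'm) \<Rightarrow> (nat \<Rightarrow> 'm) \<Rightarrow> bool" where
  "homotopic C n X Y f g \<longleftrightarrow>
     (\<exists>h. (\<forall>i\<in>{1..n + 1}. h i \<in> arr C (obj X i) (obj Y (i - 1))) \<and>
          f 0 = g 0 \<boxplus>\<^bsub>C\<^esub> (h 1 \<cdot>\<^bsub>C\<^esub> diff X 0) \<and>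
          (\<forall>i\<in>{1..n}. f i = g i \<boxplus>\<^bsub>C\<^esub>
             ((h (i + 1) \<cdot>\<^bsub>C\<^esub> diff X i) \<boxplus>\<^bsub>C\<^esub> (diff Y (i - 1) \<cdot>\<^bsub>C\<^esub> h i))) \<and>
          f (n + 1) = g (n + 1) \<boxplus>\<^bsub>C\<^esub> (diff Y n \<cdot>\<^bsub>C\<^esub> h (n + 1)))"

text \<open>Complexes with end terms \<open>X\<^sup>0 = A\<close>, \<open>X\<^sup>n\<^sup>+\<^sup>1 = Z\<close>, and the maps that are the identity there.\<close>

definition complexes_between :: "('o, 'm) category \<Rightarrow> nat \<Rightarrow> 'o \<Rightarrow> 'o \<Rightarrow> ('o, 'm) cpx set" where
  "complexes_between C n A Z = {X. is_complex C n X \<and> obj X 0 = A \<and> obj X (n + 1) = Z}"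

definition end_fixing_map ::
  "('o, 'm) category \<Rightarrow> nat \<Rightarrow> ('o, 'm) cpx \<Rightarrow> ('o, 'm) cpx \<Rightarrow> (nat \<Rightarrow> 'm) \<Rightarrow> bool" where
  "end_fixing_map C n X Y f \<longleftrightarrow> chain_map C n X Y f \<and>
     f 0 = idn C (obj X 0) \<and> f (n + 1) = idn C (obj X (n + 1))"

definition homotopy_equivalent ::
  "('o, 'm) category \<Rightarrow> nat \<Rightarrow> ('o, 'm) cpx \<Rightarrow> ('o, 'm) cpx \<Rightarrow> bool" where
  "homotopy_equivalent C n X Y \<longleftrightarrow>
     (\<exists>f g. end_fixing_map C n X Y f \<and> end_fixing_map C n Y X g \<and>
        homotopic C n X X (\<lambda>i. g i \<cdot>\<^bsub>C\<^esub> f i) (\<lambda>i. idn C (obj X i)) \<and>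
        homotopic C n Y Y (\<lambda>i. f i \<cdot>\<^bsub>C\<^esub> g i) (\<lambda>i. idn C (obj Y i)))"

definition homotopy_class :: "('o, 'm) category \<Rightarrow> nat \<Rightarrow> ('o, 'm) cpx \<Rightarrow> ('o, 'm) cpx set" where
  "homotopy_class C n X =
     {Y \<in> complexes_between C n (obj X 0) (obj X (n + 1)). homotopy_equivalent C n X Y}"

section \<open>Extensions and n-exangles\<close>

text \<open>
  \<open>Ext E Z A\<close> is the group of extensions and \<open>Emap E c a : Ext E Z A \<rightarrow> Ext E Z' A'\<close> the map induced
  by \<open>c : Z' \<rightarrow> Z\<close> and \<open>a : A \<rightarrow> A'\<close>. The sets \<open>Ext E Z A\<close> need not be disjoint (the higher extension
  groups below are not), so the end terms are always carried along with an extension.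
\<close>

record ('o, 'm, 'e) bifunctor =
  Ext :: "'o \<Rightarrow> 'o \<Rightarrow> 'e monoid"
  Emap :: "'m \<Rightarrow> 'm \<Rightarrow> 'e \<Rightarrow> 'e"

abbreviation exts :: "('o, 'm, 'e) bifunctor \<Rightarrow> 'o \<Rightarrow> 'o \<Rightarrow> 'e set" where
  "exts E Z A \<equiv> carrier (Ext E Z A)"

abbreviation zero_ext :: "('o, 'm, 'e) bifunctor \<Rightarrow> 'o \<Rightarrow> 'o \<Rightarrow> 'e" where
  "zero_ext E Z A \<equiv> \<one>\<^bsub>Ext E Z A\<^esub>"

locale biadditive_functor = additive_category C for C :: "('o, 'm) category" +
  fixes E :: "('o, 'm, 'e) bifunctor"
  assumes ext_group: "\<lbrakk>Z \<in> Ob C; A \<in> Ob C\<rbrakk> \<Longrightarrow> comm_group (Ext E Z A)"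
    and Emap_hom: "\<lbrakk>Z \<in> Ob C; Z' \<in> Ob C; A \<in> Ob C; A' \<in> Ob C; c \<in> arr C Z' Z; a \<in> arr C A A'\<rbrakk>
      \<Longrightarrow> Emap E c a \<in> hom (Ext E Z A) (Ext E Z' A')"
    and Emap_idn: "\<lbrakk>Z \<in> Ob C; A \<in> Ob C; \<delta> \<in> exts E Z A\<rbrakk> \<Longrightarrow> Emap E (idn C Z) (idn C A) \<delta> = \<delta>"
    and Emap_comp: "\<lbrakk>Z \<in> Ob C; Z' \<in> Ob C; Z'' \<in> Ob C; A \<in> Ob C; A' \<in> Ob C; A'' \<in> Ob C;
        c \<in> arr C Z' Z; c' \<in> arr C Z'' Z'; a \<in> arr C A A'; a' \<in> arr C A' A''; \<delta> \<in> exts E Z A\<rbrakk>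
      \<Longrightarrow> Emap E (c \<cdot>\<^bsub>C\<^esub> c') (a' \<cdot>\<^bsub>C\<^esub> a) \<delta> = Emap E c' a' (Emap E c a \<delta>)"
    and Emap_add_left: "\<lbrakk>Z \<in> Ob C; Z' \<in> Ob C; A \<in> Ob C; A' \<in> Ob C;
        c \<in> arr C Z' Z; c' \<in> arr C Z' Z; a \<in> arr C A A'; \<delta> \<in> exts E Z A\<rbrakk>
      \<Longrightarrow> Emap E (c \<boxplus>\<^bsub>C\<^esub> c') a \<delta> = Emap E c a \<delta> \<otimes>\<^bsub>Ext E Z' A'\<^esub> Emap E c' a \<delta>"
    and Emap_add_right: "\<lbrakk>Z \<in> Ob C; Z' \<in> Ob C; A \<in> Ob C; A' \<in> Ob C;
        c \<in> arr C Z' Z; a \<in> arr C A A'; a' \<in> arr C A A'; \<delta> \<in> exts E Z A\<rbrakk>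
      \<Longrightarrow> Emap E c (a \<boxplus>\<^bsub>C\<^esub> a') \<delta> = Emap E c a \<delta> \<otimes>\<^bsub>Ext E Z' A'\<^esub> Emap E c a' \<delta>"

text \<open>\<open>a\<^sub>* \<delta>\<close> and \<open>c\<^sup>* \<delta>\<close>, for \<open>\<delta>\<close> in \<open>Ext E Z A\<close> with \<open>A\<close> the source of \<open>a\<close>, \<open>Z\<close> the target of \<open>c\<close>.\<close>

definition push :: "('o, 'm) category \<Rightarrow> ('o, 'm, 'e) bifunctor \<Rightarrow> 'o \<Rightarrow> 'm \<Rightarrow> 'e \<Rightarrow> 'e" where
  "push C E Z a \<delta> = Emap E (idn C Z) a \<delta>"

definition pull :: "('o, 'm) category \<Rightarrow> ('o, 'm, 'e) bifunctor \<Rightarrow> 'o \<Rightarrow> 'm \<Rightarrow> 'e \<Rightarrow> 'e" where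
  "pull C E A c \<delta> = Emap E c (idn C A) \<delta>"

definition attached_complex ::
  "('o, 'm) category \<Rightarrow> ('o, 'm, 'e) bifunctor \<Rightarrow> nat \<Rightarrow> ('o, 'm) cpx \<Rightarrow> 'e \<Rightarrow> bool" where
  "attached_complex C E n X \<delta> \<longleftrightarrow>
     is_complex C n X \<and> \<delta> \<in> exts E (obj X (n + 1)) (obj X 0) \<and>
     push C E (obj X (n + 1)) (diff X 0) \<delta> = zero_ext E (obj X (n + 1)) (obj X 1) \<and>
     pull C E (obj X 0) (diff X n) \<delta> = zero_ext E (obj X n) (obj X 0)"

definition exangle ::
  "('o, 'm) category \<Rightarrow> ('o, 'm, 'e) bifunctor \<Rightarrow> nat \<Rightarrow> ('o, 'm) cpx \<Rightarrow> 'e \<Rightarrow> bool" where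
  "exangle C E n X \<delta> \<longleftrightarrow> attached_complex C E n X \<delta> \<and>
     (\<forall>T\<in>Ob C.
        (\<forall>i\<in>{1..n}.
           kernel (Hom C T (obj X i)) (Hom C T (obj X (i + 1))) (\<lambda>f. diff X i \<cdot>\<^bsub>C\<^esub> f) =
           (\<lambda>f. diff X (i - 1) \<cdot>\<^bsub>C\<^esub> f) ` arr C T (obj X (i - 1))) \<and>
        kernel (Hom C T (obj X (n + 1))) (Ext E T (obj X 0)) (\<lambda>f. pull C E (obj X 0) f \<delta>) =
          (\<lambda>f. diff X n \<cdot>\<^bsub>C\<^esub> f) ` arr C T (obj X n) \<and>
        (\<forall>i\<in>{1..n}.
           kernel (Hom C (obj X i) T) (Hom C (obj X (i - 1)) T) (\<lambda>f. f \<cdot>\<^bsub>C\<^esub> diff X (i - 1)) =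
           (\<lambda>f. f \<cdot>\<^bsub>C\<^esub> diff X i) ` arr C (obj X (i + 1)) T) \<and>
        kernel (Hom C (obj X 0) T) (Ext E (obj X (n + 1)) T) (\<lambda>f. push C E (obj X (n + 1)) f \<delta>) =
          (\<lambda>f. f \<cdot>\<^bsub>C\<^esub> diff X 0) ` arr C (obj X 1) T)"

section \<open>n-exangulated categories\<close>

text \<open>A correspondence assigns to \<open>\<delta>\<close> in \<open>Ext E Z A\<close> the class \<open>s Z A \<delta>\<close>.\<close>

type_synonym ('o, 'm, 'e) correspondence = "'o \<Rightarrow> 'o \<Rightarrow> 'e \<Rightarrow> ('o, 'm) cpx set"

definition distinguished ::
  "('o, 'm) category \<Rightarrow> ('o, 'm, 'e) bifunctor \<Rightarrow> ('o, 'm, 'e) correspondence \<Rightarrow> nat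
     \<Rightarrow> ('o, 'm) cpx \<Rightarrow> 'e \<Rightarrow> bool" where
  "distinguished C E s n X \<delta> \<longleftrightarrow>
     obj X 0 \<in> Ob C \<and> obj X (n + 1) \<in> Ob C \<and> \<delta> \<in> exts E (obj X (n + 1)) (obj X 0) \<and>
     X \<in> s (obj X (n + 1)) (obj X 0) \<delta>"

definition lift_of ::
  "('o, 'm) category \<Rightarrow> nat \<Rightarrow> ('o, 'm) cpx \<Rightarrow> ('o, 'm) cpx \<Rightarrow> 'm \<Rightarrow> 'm \<Rightarrow> (nat \<Rightarrow> 'm) \<Rightarrow> bool" where
  "lift_of C n X Y a c f \<longleftrightarrow> chain_map C n X Y f \<and> f 0 = a \<and> f (n + 1) = c"

text \<open>The complexes \<open>A = A \<rightarrow> 0 \<rightarrow> \<dots> \<rightarrow> 0\<close> and \<open>0 \<rightarrow> \<dots> \<rightarrow> 0 \<rightarrow> A = A\<close>, for a zero object \<open>N\<close>.\<close>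

definition left_trivial :: "('o, 'm) category \<Rightarrow> 'o \<Rightarrow> 'o \<Rightarrow> ('o, 'm) cpx" where
  "left_trivial C N A =
     \<lparr>obj = (\<lambda>i. if i \<le> 1 then A else N),
      diff = (\<lambda>i. if i = 0 then idn C A else zero_arr C (if i = 1 then A else N) N)\<rparr>"

definition right_trivial :: "('o, 'm) category \<Rightarrow> nat \<Rightarrow> 'o \<Rightarrow> 'o \<Rightarrow> ('o, 'm) cpx" where
  "right_trivial C n N A =
     \<lparr>obj = (\<lambda>i. if i < n then N else A),
      diff = (\<lambda>i. if i = n then idn C A else zero_arr C N (if i + 1 = n then A else N))\<rparr>"

locale exact_realization = biadditive_functor C E
  for C :: "('o, 'm) category" and E :: "('o, 'm, 'e) bifunctor" +
  fixes s :: "('o, 'm, 'e) correspondence" and n :: nat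
  assumes realization_class: "\<lbrakk>A \<in> Ob C; Z \<in> Ob C; \<delta> \<in> exts E Z A\<rbrakk>
      \<Longrightarrow> \<exists>X\<in>complexes_between C n A Z. s Z A \<delta> = homotopy_class C n X"
    and R0: "\<lbrakk>distinguished C E s n X \<delta>; distinguished C E s n Y \<rho>;
        a \<in> arr C (obj X 0) (obj Y 0); c \<in> arr C (obj X (n + 1)) (obj Y (n + 1));
        push C E (obj X (n + 1)) a \<delta> = pull C E (obj Y 0) c \<rho>\<rbrakk>
      \<Longrightarrow> \<exists>f. lift_of C n X Y a c f"
    and R1: "distinguished C E s n X \<delta> \<Longrightarrow> exangle C E n X \<delta>"
    and R2_left: "\<lbrakk>A \<in> Ob C; zero_object C N\<rbrakk>
      \<Longrightarrow> s N A (zero_ext E N A) = homotopy_class C n (left_trivial C N A)"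
    and R2_right: "\<lbrakk>A \<in> Ob C; zero_object C N\<rbrakk>
      \<Longrightarrow> s A N (zero_ext E A N) = homotopy_class C n (right_trivial C n N A)"

definition inflation ::
  "('o, 'm) category \<Rightarrow> ('o, 'm, 'e) bifunctor \<Rightarrow> ('o, 'm, 'e) correspondence \<Rightarrow> nat \<Rightarrow> 'm \<Rightarrow> bool" where
  "inflation C E s n f \<longleftrightarrow> (\<exists>X \<delta>. distinguished C E s n X \<delta> \<and> f = diff X 0)"

definition deflation ::
  "('o, 'm) category \<Rightarrow> ('o, 'm, 'e) bifunctor \<Rightarrow> ('o, 'm, 'e) correspondence \<Rightarrow> nat \<Rightarrow> 'm \<Rightarrow> bool" where
  "deflation C E s n f \<longleftrightarrow> (\<exists>X \<delta>. distinguished C E s n X \<delta> \<and> f = diff X n)"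

text \<open>
  \<open>M\<close> is the mapping cone, respectively cocone, for some choice of the direct sums involved. Two
  choices give complexes isomorphic by maps that are identities at the ends, so they lie in the
  same homotopy class.
\<close>

definition mapping_cone ::
  "('o, 'm) category \<Rightarrow> nat \<Rightarrow> ('o, 'm) cpx \<Rightarrow> ('o, 'm) cpx \<Rightarrow> (nat \<Rightarrow> 'm) \<Rightarrow> ('o, 'm) cpx \<Rightarrow> bool" where
  "mapping_cone C n X Y f M \<longleftrightarrow>
     obj M 0 = obj X 1 \<and> obj M (n + 1) = obj Y (n + 1) \<and>
     (\<exists>i\<^sub>1 i\<^sub>2 p\<^sub>1 p\<^sub>2.
        (\<forall>k\<in>{1..n}. biproduct C (obj X (k + 1)) (obj Y k) (obj M k) (i\<^sub>1 k) (i\<^sub>2 k) (p\<^sub>1 k) (p\<^sub>2 k)) \<and>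
        diff M 0 = (i\<^sub>1 1 \<cdot>\<^bsub>C\<^esub> neg_arr C (diff X 1)) \<boxplus>\<^bsub>C\<^esub> (i\<^sub>2 1 \<cdot>\<^bsub>C\<^esub> f 1) \<and>
        (\<forall>k\<in>{1..<n}. diff M k =
           (i\<^sub>1 (k + 1) \<cdot>\<^bsub>C\<^esub> (neg_arr C (diff X (k + 1)) \<cdot>\<^bsub>C\<^esub> p\<^sub>1 k)) \<boxplus>\<^bsub>C\<^esub>
           (i\<^sub>2 (k + 1) \<cdot>\<^bsub>C\<^esub> ((f (k + 1) \<cdot>\<^bsub>C\<^esub> p\<^sub>1 k) \<boxplus>\<^bsub>C\<^esub> (diff Y k \<cdot>\<^bsub>C\<^esub> p\<^sub>2 k)))) \<and>
        diff M n = (f (n + 1) \<cdot>\<^bsub>C\<^esub> p\<^sub>1 n) \<boxplus>\<^bsub>C\<^esub> (diff Y n \<cdot>\<^bsub>C\<^esub> p\<^sub>2 n))"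

definition mapping_cocone ::
  "('o, 'm) category \<Rightarrow> nat \<Rightarrow> ('o, 'm) cpx \<Rightarrow> ('o, 'm) cpx \<Rightarrow> (nat \<Rightarrow> 'm) \<Rightarrow> ('o, 'm) cpx \<Rightarrow> bool" where
  "mapping_cocone C n X Y h M \<longleftrightarrow>
     obj M 0 = obj X 0 \<and> obj M (n + 1) = obj Y n \<and>
     (\<exists>i\<^sub>1 i\<^sub>2 p\<^sub>1 p\<^sub>2.
        (\<forall>k\<in>{1..n}. biproduct C (obj X k) (obj Y (k - 1)) (obj M k) (i\<^sub>1 k) (i\<^sub>2 k) (p\<^sub>1 k) (p\<^sub>2 k)) \<and>
        diff M 0 = (i\<^sub>1 1 \<cdot>\<^bsub>C\<^esub> diff X 0) \<boxplus>\<^bsub>C\<^esub> (i\<^sub>2 1 \<cdot>\<^bsub>C\<^esub> h 0) \<and>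
        (\<forall>k\<in>{1..<n}. diff M k =
           (i\<^sub>1 (k + 1) \<cdot>\<^bsub>C\<^esub> (diff X k \<cdot>\<^bsub>C\<^esub> p\<^sub>1 k)) \<boxplus>\<^bsub>C\<^esub>
           (i\<^sub>2 (k + 1) \<cdot>\<^bsub>C\<^esub> ((h k \<cdot>\<^bsub>C\<^esub> p\<^sub>1 k) \<boxminus>\<^bsub>C\<^esub> (diff Y (k - 1) \<cdot>\<^bsub>C\<^esub> p\<^sub>2 k)))) \<and>
        diff M n = (h n \<cdot>\<^bsub>C\<^esub> p\<^sub>1 n) \<boxminus>\<^bsub>C\<^esub> (diff Y (n - 1) \<cdot>\<^bsub>C\<^esub> p\<^sub>2 n))"

locale n_exangulated_category = exact_realization C E s n
  for C :: "('o, 'm) category" and E :: "('o, 'm, 'e) bifunctor"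
    and s :: "('o, 'm, 'e) correspondence" and n :: nat +
  assumes n_pos: "1 \<le> n"
    and EA1_inflation: "\<lbrakk>A \<in> Ob C; B \<in> Ob C; D \<in> Ob C; f \<in> arr C A B; g \<in> arr C B D;
        inflation C E s n f; inflation C E s n g\<rbrakk> \<Longrightarrow> inflation C E s n (g \<cdot>\<^bsub>C\<^esub> f)"
    and EA1_deflation: "\<lbrakk>A \<in> Ob C; B \<in> Ob C; D \<in> Ob C; f \<in> arr C A B; g \<in> arr C B D;
        deflation C E s n f; deflation C E s n g\<rbrakk> \<Longrightarrow> deflation C E s n (g \<cdot>\<^bsub>C\<^esub> f)"
    and EA2: "\<lbrakk>distinguished C E s n Y \<rho>; c \<in> arr C (obj X (n + 1)) (obj Y (n + 1));
        obj X 0 = obj Y 0; distinguished C E s n X (pull C E (obj Y 0) c \<rho>)\<rbrakk>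
      \<Longrightarrow> \<exists>f M. lift_of C n X Y (idn C (obj X 0)) c f \<and> mapping_cone C n X Y f M \<and>
            distinguished C E s n M (push C E (obj Y (n + 1)) (diff X 0) \<rho>)"
    and EA2_op: "\<lbrakk>distinguished C E s n X \<delta>; a \<in> arr C (obj X 0) (obj Y 0);
        obj X (n + 1) = obj Y (n + 1); distinguished C E s n Y (push C E (obj X (n + 1)) a \<delta>)\<rbrakk>
      \<Longrightarrow> \<exists>h M. lift_of C n X Y a (idn C (obj X (n + 1))) h \<and> mapping_cocone C n X Y h M \<and>
            distinguished C E s n M (pull C E (obj X 0) (diff Y n) \<delta>)"

section \<open>Extriangulated categories\<close>

definition s_triangle ::
  "('o, 'm) category \<Rightarrow> ('o, 'm, 'e) bifunctor \<Rightarrow> ('o, 'm, 'e) correspondence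
     \<Rightarrow> 'o \<Rightarrow> 'm \<Rightarrow> 'o \<Rightarrow> 'm \<Rightarrow> 'o \<Rightarrow> 'e \<Rightarrow> bool" where
  "s_triangle C E s A x B y Z \<delta> \<longleftrightarrow>
     distinguished C E s 1
       \<lparr>obj = (\<lambda>i. if i = 0 then A else if i = 1 then B else Z),
        diff = (\<lambda>i. if i = 0 then x else y)\<rparr> \<delta>"

definition projectives ::
  "('o, 'm) category \<Rightarrow> ('o, 'm, 'e) bifunctor \<Rightarrow> ('o, 'm, 'e) correspondence \<Rightarrow> 'o set" where
  "projectives C E s = {P \<in> Ob C. \<forall>A x B y Z \<delta>. s_triangle C E s A x B y Z \<delta> \<longrightarrow>
     (\<forall>f\<in>arr C P Z. \<exists>g\<in>arr C P B. f = y \<cdot>\<^bsub>C\<^esub> g)}"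

definition injectives ::
  "('o, 'm) category \<Rightarrow> ('o, 'm, 'e) bifunctor \<Rightarrow> ('o, 'm, 'e) correspondence \<Rightarrow> 'o set" where
  "injectives C E s = {I \<in> Ob C. \<forall>A x B y Z \<delta>. s_triangle C E s A x B y Z \<delta> \<longrightarrow>
     (\<forall>f\<in>arr C A I. \<exists>g\<in>arr C B I. f = g \<cdot>\<^bsub>C\<^esub> x)}"

definition enough_projectives ::
  "('o, 'm) category \<Rightarrow> ('o, 'm, 'e) bifunctor \<Rightarrow> ('o, 'm, 'e) correspondence \<Rightarrow> bool" where
  "enough_projectives C E s \<longleftrightarrow>
     (\<forall>Z\<in>Ob C. \<exists>A x P y \<delta>. P \<in> projectives C E s \<and> s_triangle C E s A x P y Z \<delta>)"

definition enough_injectives ::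
  "('o, 'm) category \<Rightarrow> ('o, 'm, 'e) bifunctor \<Rightarrow> ('o, 'm, 'e) correspondence \<Rightarrow> bool" where
  "enough_injectives C E s \<longleftrightarrow>
     (\<forall>A\<in>Ob C. \<exists>x I y Z \<delta>. I \<in> injectives C E s \<and> s_triangle C E s A x I y Z \<delta>)"

definition suspension_data ::
  "('o, 'm) category \<Rightarrow> ('o, 'm, 'e) bifunctor \<Rightarrow> ('o, 'm, 'e) correspondence
     \<Rightarrow> ('o \<Rightarrow> 'o) \<Rightarrow> ('o \<Rightarrow> 'e) \<Rightarrow> bool" where
  "suspension_data C E s \<Sigma> \<iota> \<longleftrightarrow>
     (\<forall>A\<in>Ob C. \<exists>x I y. I \<in> injectives C E s \<and> s_triangle C E s A x I y (\<Sigma> A) (\<iota> A))"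

definition loop_data ::
  "('o, 'm) category \<Rightarrow> ('o, 'm, 'e) bifunctor \<Rightarrow> ('o, 'm, 'e) correspondence
     \<Rightarrow> ('o \<Rightarrow> 'o) \<Rightarrow> ('o \<Rightarrow> 'e) \<Rightarrow> bool" where
  "loop_data C E s \<Omega> \<omega> \<longleftrightarrow>
     (\<forall>A\<in>Ob C. \<exists>x P y. P \<in> projectives C E s \<and> s_triangle C E s (\<Omega> A) x P y A (\<omega> A))"

text \<open>
  The class of \<open>f\<close> in the ideal quotient modulo the morphisms factoring through an object of \<open>\<X>\<close>
  (these form an ideal when \<open>\<X>\<close> is closed under finite direct sums, as the injectives are).
\<close>

definition factors_through :: "('o, 'm) category \<Rightarrow> 'o set \<Rightarrow> 'm \<Rightarrow> bool" where
  "factors_through C \<X> f \<longleftrightarrow>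
     (\<exists>B\<in>\<X>. \<exists>g\<in>arr C (src C f) B. \<exists>h\<in>arr C B (trg C f). f = h \<cdot>\<^bsub>C\<^esub> g)"

definition ideal_class :: "('o, 'm) category \<Rightarrow> 'o set \<Rightarrow> 'm \<Rightarrow> 'm set" where
  "ideal_class C \<X> f = {f' \<in> arr C (src C f) (trg C f). factors_through C \<X> (f' \<boxminus>\<^bsub>C\<^esub> f)}"

text \<open>
  The suspension on morphisms of the quotient by the injectives. Here and below the results do
  not depend on the representatives picked by \<open>SOME\<close>.
\<close>

definition susp_class ::
  "('o, 'm) category \<Rightarrow> ('o, 'm, 'e) bifunctor \<Rightarrow> ('o, 'm, 'e) correspondence
     \<Rightarrow> ('o \<Rightarrow> 'o) \<Rightarrow> ('o \<Rightarrow> 'e) \<Rightarrow> 'm set \<Rightarrow> 'm set" where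
  "susp_class C E s \<Sigma> \<iota> F = ideal_class C (injectives C E s)
     (SOME t. \<exists>a\<in>F. t \<in> arr C (\<Sigma> (src C a)) (\<Sigma> (trg C a)) \<and>
        push C E (\<Sigma> (src C a)) a (\<iota> (src C a)) = pull C E (trg C a) t (\<iota> (trg C a)))"

text \<open>\<open>F\<^sub>* \<delta>\<close> for a class \<open>F\<close> modulo injectives and \<open>\<delta>\<close> in \<open>Ext E Z A\<close>.\<close>

definition push_class ::
  "('o, 'm) category \<Rightarrow> ('o, 'm, 'e) bifunctor \<Rightarrow> 'o \<Rightarrow> 'm set \<Rightarrow> 'e \<Rightarrow> 'e" where
  "push_class C E Z F \<delta> = push C E Z (SOME a. a \<in> F) \<delta>"

text \<open>The higher extension functors, for \<open>i \<ge> 1\<close>.\<close>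

definition higher_ext ::
  "('o, 'm) category \<Rightarrow> ('o, 'm, 'e) bifunctor \<Rightarrow> ('o, 'm, 'e) correspondence
     \<Rightarrow> ('o \<Rightarrow> 'o) \<Rightarrow> ('o \<Rightarrow> 'e) \<Rightarrow> nat \<Rightarrow> ('o, 'm, 'e) bifunctor" where
  "higher_ext C E s \<Sigma> \<iota> i =
     \<lparr>Ext = (\<lambda>Z A. Ext E Z ((\<Sigma> ^^ (i - 1)) A)),
      Emap = (\<lambda>c a \<delta>. push_class C E (src C c)
        ((susp_class C E s \<Sigma> \<iota> ^^ (i - 1)) (ideal_class C (injectives C E s) a))
        (pull C E ((\<Sigma> ^^ (i - 1)) (src C a)) c \<delta>))\<rparr>"

text \<open>For \<open>\<delta>\<close> in the \<open>i\<close>-th extension group of \<open>X\<close> by \<open>A\<close>, its class of morphisms \<open>X \<rightarrow> \<Sigma>\<^sup>i A\<close>.\<close>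

definition classifying ::
  "('o, 'm) category \<Rightarrow> ('o, 'm, 'e) bifunctor \<Rightarrow> ('o, 'm, 'e) correspondence
     \<Rightarrow> ('o \<Rightarrow> 'o) \<Rightarrow> ('o \<Rightarrow> 'e) \<Rightarrow> nat \<Rightarrow> 'o \<Rightarrow> 'o \<Rightarrow> 'e \<Rightarrow> 'm set" where
  "classifying C E s \<Sigma> \<iota> i X A \<delta> = ideal_class C (injectives C E s)
     (SOME d. d \<in> arr C X ((\<Sigma> ^^ i) A) \<and>
        pull C E ((\<Sigma> ^^ (i - 1)) A) d (\<iota> ((\<Sigma> ^^ (i - 1)) A)) = \<delta>)"

text \<open>\<open>\<delta> \<union> \<theta>\<close> for \<open>\<delta>\<close> of degree \<open>i\<close> on \<open>(X, A)\<close> and \<open>\<theta>\<close> of degree \<open>j\<close> on \<open>(Z, X)\<close>.\<close>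

definition cup ::
  "('o, 'm) category \<Rightarrow> ('o, 'm, 'e) bifunctor \<Rightarrow> ('o, 'm, 'e) correspondence
     \<Rightarrow> ('o \<Rightarrow> 'o) \<Rightarrow> ('o \<Rightarrow> 'e) \<Rightarrow> nat \<Rightarrow> nat \<Rightarrow> 'o \<Rightarrow> 'o \<Rightarrow> 'o \<Rightarrow> 'e \<Rightarrow> 'e \<Rightarrow> 'e" where
  "cup C E s \<Sigma> \<iota> i j Z X A \<delta> \<theta> =
     push_class C E Z ((susp_class C E s \<Sigma> \<iota> ^^ (j - 1)) (classifying C E s \<Sigma> \<iota> i X A \<delta>)) \<theta>"

text \<open>
  For \<open>d i\<close> in \<open>Ext E (M i) (M (i - 1))\<close>, \<open>cup_chain \<dots> M d k\<close> is the product
  \<open>d 1 \<union> \<dots> \<union> d (k + 1)\<close>, bracketed from the left.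
\<close>

primrec cup_chain ::
  "('o, 'm) category \<Rightarrow> ('o, 'm, 'e) bifunctor \<Rightarrow> ('o, 'm, 'e) correspondence
     \<Rightarrow> ('o \<Rightarrow> 'o) \<Rightarrow> ('o \<Rightarrow> 'e) \<Rightarrow> (nat \<Rightarrow> 'o) \<Rightarrow> (nat \<Rightarrow> 'e) \<Rightarrow> nat \<Rightarrow> 'e" where
  "cup_chain C E s \<Sigma> \<iota> M d 0 = d 1"
| "cup_chain C E s \<Sigma> \<iota> M d (Suc k) =
     cup C E s \<Sigma> \<iota> (k + 1) 1 (M (k + 2)) (M (k + 1)) (M 0) (cup_chain C E s \<Sigma> \<iota> M d k) (d (k + 2))"

section \<open>n-cluster tilting subcategories\<close>

definition functorially_finite :: "('o, 'm) category \<Rightarrow> 'o set \<Rightarrow> bool" where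
  "functorially_finite C \<T> \<longleftrightarrow>
     (\<forall>X\<in>Ob C.
        (\<exists>T\<in>\<T>. \<exists>r\<in>arr C T X. \<forall>T'\<in>\<T>. \<forall>f\<in>arr C T' X. \<exists>g\<in>arr C T' T. f = r \<cdot>\<^bsub>C\<^esub> g) \<and>
        (\<exists>T\<in>\<T>. \<exists>l\<in>arr C X T. \<forall>T'\<in>\<T>. \<forall>f\<in>arr C X T'. \<exists>g\<in>arr C T T'. f = g \<cdot>\<^bsub>C\<^esub> l))"

definition cluster_tilting ::
  "('o, 'm) category \<Rightarrow> ('o, 'm, 'e) bifunctor \<Rightarrow> ('o, 'm, 'e) correspondence
     \<Rightarrow> ('o \<Rightarrow> 'o) \<Rightarrow> ('o \<Rightarrow> 'e) \<Rightarrow> nat \<Rightarrow> 'o set \<Rightarrow> bool" where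
  "cluster_tilting C E s \<Sigma> \<iota> n \<T> \<longleftrightarrow>
     \<T> \<subseteq> Ob C \<and> additive_category (full_subcategory C \<T>) \<and>
     (\<forall>A\<in>\<T>. \<forall>B\<in>Ob C. isomorphic C A B \<longrightarrow> B \<in> \<T>) \<and>
     (\<forall>A B S i\<^sub>1 i\<^sub>2 p\<^sub>1 p\<^sub>2. biproduct C A B S i\<^sub>1 i\<^sub>2 p\<^sub>1 p\<^sub>2 \<and> S \<in> \<T> \<longrightarrow> A \<in> \<T>) \<and>
     functorially_finite C \<T> \<and>
     (\<forall>X\<in>Ob C.
        (X \<in> \<T> \<longleftrightarrow> (\<forall>i\<in>{1..n - 1}. \<forall>T\<in>\<T>.
           exts (higher_ext C E s \<Sigma> \<iota> i) X T = {zero_ext (higher_ext C E s \<Sigma> \<iota> i) X T})) \<and>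
        (X \<in> \<T> \<longleftrightarrow> (\<forall>i\<in>{1..n - 1}. \<forall>T\<in>\<T>.
           exts (higher_ext C E s \<Sigma> \<iota> i) T X = {zero_ext (higher_ext C E s \<Sigma> \<iota> i) T X})))"

text \<open>
  In the decomposition, \<open>M 0\<close> and \<open>M n\<close> are the end terms of \<open>X\<close>, so that all \<open>n\<close> triangles have the
  form \<open>M i \<rightarrow> X\<^sup>i\<^sup>+\<^sup>1 \<rightarrow> M (i + 1)\<close> with maps \<open>m i\<close> and \<open>e (i + 1)\<close>.
\<close>

definition s_decomposable ::
  "('o, 'm) category \<Rightarrow> ('o, 'm, 'e) bifunctor \<Rightarrow> ('o, 'm, 'e) correspondence
     \<Rightarrow> ('o \<Rightarrow> 'o) \<Rightarrow> ('o \<Rightarrow> 'e) \<Rightarrow> nat \<Rightarrow> 'o set \<Rightarrow> ('o, 'm) cpx \<Rightarrow> 'e \<Rightarrow> bool" where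
  "s_decomposable C E s \<Sigma> \<iota> n \<T> X \<delta> \<longleftrightarrow>
     attached_complex (full_subcategory C \<T>) (higher_ext C E s \<Sigma> \<iota> n) n X \<delta> \<and>
     (\<exists>M m e d.
        M 0 = obj X 0 \<and> M n = obj X (n + 1) \<and> m 0 = diff X 0 \<and> e n = diff X n \<and>
        (\<forall>i<n. s_triangle C E s (M i) (m i) (obj X (i + 1)) (e (i + 1)) (M (i + 1)) (d (i + 1))) \<and>
        (\<forall>i\<in>{1..<n}. diff X i = m i \<cdot>\<^bsub>C\<^esub> e i) \<and>
        \<delta> = cup_chain C E s \<Sigma> \<iota> M d (n - 1))"

text \<open>The classes in the full subcategory on \<open>\<T>\<close> of the decomposable complexes for \<open>\<delta>\<close>.\<close>

definition decomposable_classes ::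
  "('o, 'm) category \<Rightarrow> ('o, 'm, 'e) bifunctor \<Rightarrow> ('o, 'm, 'e) correspondence
     \<Rightarrow> ('o \<Rightarrow> 'o) \<Rightarrow> ('o \<Rightarrow> 'e) \<Rightarrow> nat \<Rightarrow> 'o set \<Rightarrow> 'o \<Rightarrow> 'o \<Rightarrow> 'e \<Rightarrow> ('o, 'm) cpx set set" where
  "decomposable_classes C E s \<Sigma> \<iota> n \<T> Z A \<delta> =
     {homotopy_class (full_subcategory C \<T>) n X | X.
        obj X 0 = A \<and> obj X (n + 1) = Z \<and> s_decomposable C E s \<Sigma> \<iota> n \<T> X \<delta>}"

definition higher_realization ::
  "('o, 'm) category \<Rightarrow> ('o, 'm, 'e) bifunctor \<Rightarrow> ('o, 'm, 'e) correspondence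
     \<Rightarrow> ('o \<Rightarrow> 'o) \<Rightarrow> ('o \<Rightarrow> 'e) \<Rightarrow> nat \<Rightarrow> 'o set \<Rightarrow> ('o, 'm, 'e) correspondence" where
  "higher_realization C E s \<Sigma> \<iota> n \<T> =
     (\<lambda>Z A \<delta>. THE K. K \<in> decomposable_classes C E s \<Sigma> \<iota> n \<T> Z A \<delta>)"

end

theory Submission
  imports Defs
begin

text \<open>
  Let the morphisms be the elements of degree 0 and the elements of \<open>E\<^sup>i(Z, A)\<close> those of degree \<open>i\<close>, composed
  by the cup product. In this graded category every triangle induces long exact sequences in both
  variables, and the whole situation is self-dual.

  A decomposition writes \<open>\<delta>\<close> as a product \<open>\<epsilon>\<^sub>1 \<dots> \<epsilon>\<^sub>n\<close> of extensions of the triangles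
  \<open>M i \<rightarrow> X\<^sup>i\<^sup>+\<^sup>1 \<rightarrow> M (i + 1)\<close>. Since \<open>\<T>\<close> has no self-extensions in degrees \<open>1, \<dots>, n - 1\<close>, dimension shifting
  makes almost all extensions between \<open>\<T>\<close> and the \<open>M i\<close> vanish, and the two extra conditions on \<open>\<T>\<close> make the
  maps \<open>M i \<rightarrow> X\<^sup>i\<^sup>+\<^sup>1\<close> monic for maps from \<open>\<T>\<close>, and dually. This gives exactness, and it allows to lift an
  equation \<open>a \<delta> = \<rho> c\<close> first to the \<open>M i\<close>, then to the complexes. A chain endomorphism that vanishes at the ends
  has a null-homotopic square, so lifts of the identity are homotopy equivalences.

  Decompositions exist: write \<open>\<delta> = d \<omega>\<close> with \<open>\<omega>\<close> an iterated syzygy extension and resolve by left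
  approximations, which are inflations by the weak idempotent completeness (W). The syzygies of a
  mapping cone are extensions of those of the two complexes, found one after the other by the octahedron.
\<close>

section \<open>Graded categories\<close>

text \<open>The triangle axioms give exact sequences for morphisms only. Degree 1 has to be
  recovered from mapping cones (\<open>exact_ext_left\<close>, \<open>exact_ext_mid\<close>); higher
  degrees follow by representing extension groups through suspensions and by resolving with
  projectives.

  No five lemma is at hand, so isomorphisms are always found in the same way: two comparison maps
  are inverse up to a map of square zero, and 1 + \<nu> is invertible when \<nu> has square zero.

  The obstacle behind the second half is that a realization is a whole homotopy class, while a
  complex merely equivalent to a decomposable one comes without triangles. The axioms speak about
  all members of the class, so \<open>dec_closed\<close> has to rebuild the triangles of such a
  complex. After that, distinguished and decomposable mean the same and homotopies disappear from
  the argument.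

  All graded pieces lie in one ring with a total product, so duality is reversal of the product. Its
  unit \<open>u\<close> is not attached to any object; it serves as the empty product.\<close>

locale graded_precategory =
  fixes mul :: "'r::ab_group_add \<Rightarrow> 'r \<Rightarrow> 'r" (infixl "\<odot>" 70)
    and u :: 'r and Obj :: "'o set" and H :: "nat \<Rightarrow> 'o \<Rightarrow> 'o \<Rightarrow> 'r set" and I :: "'o \<Rightarrow> 'r"
  assumes mul_assoc: "(a \<odot> b) \<odot> c = a \<odot> (b \<odot> c)"
    and mul_add_right: "a \<odot> (b + c) = a \<odot> b + a \<odot> c"
    and mul_add_left: "(a + b) \<odot> c = a \<odot> c + b \<odot> c"
    and unit_left [simp]: "u \<odot> a = a"
    and unit_right [simp]: "a \<odot> u = a"
    and H_Obj: "f \<in> H i A B \<Longrightarrow> A \<in> Obj \<and> B \<in> Obj"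
    and H_zero: "\<lbrakk>A \<in> Obj; B \<in> Obj\<rbrakk> \<Longrightarrow> 0 \<in> H i A B"
    and H_add: "\<lbrakk>f \<in> H i A B; g \<in> H i A B\<rbrakk> \<Longrightarrow> f + g \<in> H i A B"
    and H_neg: "f \<in> H i A B \<Longrightarrow> - f \<in> H i A B"
    and H_mul: "\<lbrakk>g \<in> H j B D; f \<in> H i A B\<rbrakk> \<Longrightarrow> g \<odot> f \<in> H (i + j) A D"
    and H_id: "A \<in> Obj \<Longrightarrow> I A \<in> H 0 A A"
    and id_left: "f \<in> H i A B \<Longrightarrow> I B \<odot> f = f"
    and id_right: "f \<in> H i A B \<Longrightarrow> f \<odot> I A = f"
begin

definition bip where
  "bip A B S i1 i2 p1 p2 \<longleftrightarrow> i1 \<in> H 0 A S \<and> i2 \<in> H 0 B S \<and> p1 \<in> H 0 S A \<and> p2 \<in> H 0 S B \<and>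
     p1 \<odot> i1 = I A \<and> p2 \<odot> i2 = I B \<and> p1 \<odot> i2 = 0 \<and> p2 \<odot> i1 = 0 \<and> i1 \<odot> p1 + i2 \<odot> p2 = I S"

lemma mul_zero_right [simp]: "a \<odot> 0 = 0"
  using mul_add_right[of a 0 0] by simp

lemma mul_zero_left [simp]: "0 \<odot> a = 0"
  using mul_add_left[of 0 0 a] by simp

lemma mul_minus_right: "a \<odot> (- b) = - (a \<odot> b)"
  using mul_add_right[of a b "- b"] by (simp add: eq_neg_iff_add_eq_0 add.commute)

lemma mul_minus_left: "(- a) \<odot> b = - (a \<odot> b)"
  using mul_add_left[of a "- a" b] by (simp add: eq_neg_iff_add_eq_0 add.commute)

lemma mul_diff_right: "a \<odot> (b - c) = a \<odot> b - a \<odot> c"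
  using mul_add_right[of a b "- c"] by (simp add: mul_minus_right)

lemma mul_diff_left: "(a - b) \<odot> c = a \<odot> c - b \<odot> c"
  using mul_add_left[of a "- b" c] by (simp add: mul_minus_left)

lemmas mul_simps = mul_assoc mul_add_right mul_add_left mul_minus_right mul_minus_left
  mul_diff_right mul_diff_left

lemma mul_ext: "a \<odot> b = c \<Longrightarrow> a \<odot> (b \<odot> z) = c \<odot> z"
  by (simp add: mul_assoc[symmetric])

lemma mul_ext2: "a \<odot> (b \<odot> c) = d \<Longrightarrow> a \<odot> (b \<odot> (c \<odot> z)) = d \<odot> z"
  by (simp add: mul_assoc[symmetric])

lemma H_diff: "\<lbrakk>f \<in> H i A B; g \<in> H i A B\<rbrakk> \<Longrightarrow> f - g \<in> H i A B"
  using H_add[of f i A B "- g"] H_neg by simp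

lemma H_src: "f \<in> H i A B \<Longrightarrow> A \<in> Obj" and H_trg: "f \<in> H i A B \<Longrightarrow> B \<in> Obj"
  using H_Obj by blast+

lemma H_mul0: "\<lbrakk>g \<in> H 0 B D; f \<in> H i A B\<rbrakk> \<Longrightarrow> g \<odot> f \<in> H i A D"
  and H_mul0': "\<lbrakk>g \<in> H i B D; f \<in> H 0 A B\<rbrakk> \<Longrightarrow> g \<odot> f \<in> H i A D"
  and H_mul1: "\<lbrakk>g \<in> H (Suc 0) B D; f \<in> H i A B\<rbrakk> \<Longrightarrow> g \<odot> f \<in> H (Suc i) A D"
  and H_mul1': "\<lbrakk>g \<in> H i B D; f \<in> H (Suc 0) A B\<rbrakk> \<Longrightarrow> g \<odot> f \<in> H (Suc i) A D"
  using H_mul[of g _ B D f _ A] by fastforce+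

lemmas H_intros = H_mul0 H_mul0' H_add H_diff H_neg

lemma bip_D:
  assumes "bip A B S i1 i2 p1 p2"
  shows "A \<in> Obj" "B \<in> Obj" "S \<in> Obj" "i1 \<in> H 0 A S" "i2 \<in> H 0 B S" "p1 \<in> H 0 S A" "p2 \<in> H 0 S B"
    "p1 \<odot> i1 = I A" "p2 \<odot> i2 = I B" "p1 \<odot> i2 = 0" "p2 \<odot> i1 = 0" "i1 \<odot> p1 + i2 \<odot> p2 = I S"
  using assms H_Obj unfolding bip_def by blast+

lemma bip_swap: "bip A B S i1 i2 p1 p2 \<Longrightarrow> bip B A S i2 i1 p2 p1"
  unfolding bip_def by (auto simp: add.commute)

lemma bip_mul:
  assumes "bip A B S i1 i2 p1 p2"
  shows "p1 \<odot> i2 = 0" "p2 \<odot> i1 = 0" "p1 \<odot> (i2 \<odot> z) = 0" "p2 \<odot> (i1 \<odot> z) = 0"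
    "f \<in> H i X A \<Longrightarrow> p1 \<odot> (i1 \<odot> f) = f" "f \<in> H i X B \<Longrightarrow> p2 \<odot> (i2 \<odot> f) = f"
    "g \<in> H i A X \<Longrightarrow> g \<odot> (p1 \<odot> i1) = g" "g \<in> H i B X \<Longrightarrow> g \<odot> (p2 \<odot> i2) = g"
    "p1 \<odot> i1 = I A" "p2 \<odot> i2 = I B"
  using bip_D[OF assms] by (simp_all add: mul_assoc[symmetric] id_left id_right)

text \<open>Writing \<open>\<phi>\<close> as 1 + \<nu> with \<nu> of square zero, the inverse is 1 -
  \<nu>, which is 2 - \<open>\<phi>\<close>.\<close>

lemma square_zero_iso:
  assumes "\<phi> \<in> H 0 B B" "(\<phi> - I B) \<odot> (\<phi> - I B) = 0"
  shows "\<exists>\<psi>\<in>H 0 B B. \<psi> \<odot> \<phi> = I B \<and> \<phi> \<odot> \<psi> = I B"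
proof -
  have B: "B \<in> Obj" using assms(1) H_Obj by blast
  have II: "I B \<odot> I B = I B" by (rule id_left[OF H_id[OF B]])
  let ?\<psi> = "I B + I B - \<phi>"
  have "\<phi> \<odot> \<phi> = \<phi> + \<phi> - I B"
    using assms(2) by (simp add: mul_simps id_left[OF assms(1)] id_right[OF assms(1)] II algebra_simps)
  then have "?\<psi> \<odot> \<phi> = I B \<and> \<phi> \<odot> ?\<psi> = I B"
    by (simp add: mul_simps id_left[OF assms(1)] id_right[OF assms(1)])
  then show ?thesis using assms(1) H_id[OF B] H_add H_diff by blast
qed

lemma inverse_unique:
  assumes "b \<in> H 0 A B" "l \<in> H 0 B A" "r \<in> H 0 B A" "l \<odot> b = I A" "b \<odot> r = I B"
  shows "l = r"
proof -
  have "l = l \<odot> (b \<odot> r)" by (simp only: assms(5) id_right[OF assms(2)])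
  also have "\<dots> = r" by (simp only: mul_assoc[symmetric] assms(4) id_left[OF assms(3)])
  finally show ?thesis .
qed

text \<open>Inverting \<open>c \<odot> b\<close> and \<open>b \<odot> c\<close> gives a left and a
  right inverse of \<open>b\<close>, and these agree. This stands in for the five lemma: maps back
  and forth between triangles that are mutually inverse on the outer terms satisfy both square
  conditions.\<close>

lemma iso_of_square_zero:
  assumes b: "b \<in> H 0 A B" and c: "c \<in> H 0 B A"
    and "(c \<odot> b - I A) \<odot> (c \<odot> b - I A) = 0" "(b \<odot> c - I B) \<odot> (b \<odot> c - I B) = 0"
  shows "\<exists>b'\<in>H 0 B A. b' \<odot> b = I A \<and> b \<odot> b' = I B"
proof -
  obtain \<psi> where 1: "\<psi> \<in> H 0 A A" "\<psi> \<odot> (c \<odot> b) = I A"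
    using square_zero_iso[OF H_mul0[OF c b] assms(3)] by blast
  obtain \<chi> where 2: "\<chi> \<in> H 0 B B" "(b \<odot> c) \<odot> \<chi> = I B"
    using square_zero_iso[OF H_mul0[OF b c] assms(4)] by blast
  have "\<psi> \<odot> c = c \<odot> \<chi>"
    using inverse_unique[OF b, of "\<psi> \<odot> c" "c \<odot> \<chi>"] 1 2 c by (simp add: mul_assoc H_mul0)
  then have "b \<odot> (\<psi> \<odot> c) = I B" using 2(2) by (simp add: mul_assoc)
  then show ?thesis using 1 c by (intro bexI[of _ "\<psi> \<odot> c"]) (simp_all add: mul_assoc H_mul0)
qed

text \<open>Reversing the product and the end terms keeps every axiom; degrees simply add up in the
  other order. Interpretations of this kind make the results below available for the opposite
  category.\<close>

lemma dual_precategory: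
  "graded_precategory (\<lambda>x y. y \<odot> x) u Obj (\<lambda>i A B. H i B A) I"
  by unfold_locales
    (auto simp: mul_simps H_Obj H_zero H_add H_neg H_id id_left id_right add.commute intro: H_mul[of _ _ _ _ _ _ , simplified add.commute])

lemma dual_bip:
  "graded_precategory.bip (\<lambda>x y. y \<odot> x) (\<lambda>i A B. H i B A) I A B S i1 i2 p1 p2 = bip A B S p1 p2 i1 i2"
  unfolding graded_precategory.bip_def[OF dual_precategory] bip_def by auto

end

section \<open>Triangles\<close>

text \<open>The extriangulated axioms in ring form, stated for degrees 0 and 1 only.
  \<open>tri_mid_iso\<close> reflects that a realization is a class of complexes;
  \<open>cone\<close> and \<open>cocone\<close> are (EA2) and its dual for n = 1. The list is closed
  under reversal: in \<open>cocone\<close> the summand \<open>A'\<close> precedes \<open>B\<close>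
  so that it is literally the reversed \<open>cone\<close>.\<close>

locale triangle_category = graded_precategory +
  fixes Tri :: "'b \<Rightarrow> 'a \<Rightarrow> 'b \<Rightarrow> 'a \<Rightarrow> 'b \<Rightarrow> 'a \<Rightarrow> bool"
  assumes zero_obj: "\<exists>Z\<in>Obj. I Z = 0"
    and bip_exists: "\<lbrakk>A \<in> Obj; B \<in> Obj\<rbrakk> \<Longrightarrow> \<exists>S i1 i2 p1 p2. bip A B S i1 i2 p1 p2"
    and tri_H: "Tri A x B y C \<delta> \<Longrightarrow> x \<in> H 0 A B \<and> y \<in> H 0 B C \<and> \<delta> \<in> H (Suc 0) C A"
    and tri_zero: "Tri A x B y C \<delta> \<Longrightarrow> y \<odot> x = 0 \<and> \<delta> \<odot> y = 0 \<and> x \<odot> \<delta> = 0"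
    and tri_cov_mid: "\<lbrakk>Tri A x B y C \<delta>; f \<in> H 0 T B; y \<odot> f = 0\<rbrakk> \<Longrightarrow> \<exists>g\<in>H 0 T A. f = x \<odot> g"
    and tri_cov_right: "\<lbrakk>Tri A x B y C \<delta>; f \<in> H 0 T C; \<delta> \<odot> f = 0\<rbrakk> \<Longrightarrow> \<exists>g\<in>H 0 T B. f = y \<odot> g"
    and tri_con_mid: "\<lbrakk>Tri A x B y C \<delta>; f \<in> H 0 B T; f \<odot> x = 0\<rbrakk> \<Longrightarrow> \<exists>g\<in>H 0 C T. f = g \<odot> y"
    and tri_con_left: "\<lbrakk>Tri A x B y C \<delta>; f \<in> H 0 A T; f \<odot> \<delta> = 0\<rbrakk> \<Longrightarrow> \<exists>g\<in>H 0 B T. f = g \<odot> x"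
    and realize: "\<delta> \<in> H (Suc 0) C A \<Longrightarrow> \<exists>x B y. Tri A x B y C \<delta>"
    and tri_lift: "\<lbrakk>Tri A x B y C \<delta>; Tri A' x' B' y' C' \<delta>'; a \<in> H 0 A A'; c \<in> H 0 C C'; a \<odot> \<delta> = \<delta>' \<odot> c\<rbrakk>
      \<Longrightarrow> \<exists>b\<in>H 0 B B'. b \<odot> x = x' \<odot> a \<and> y' \<odot> b = c \<odot> y"
    and tri_mid_iso: "\<lbrakk>Tri A x B y C \<delta>; b \<in> H 0 B B'; b' \<in> H 0 B' B; b' \<odot> b = I B; b \<odot> b' = I B'\<rbrakk>
      \<Longrightarrow> Tri A (b \<odot> x) B' (y \<odot> b') C \<delta>"
    and infl_comp: "\<lbrakk>Tri A f B y C \<delta>; Tri B g D y' C' \<delta>'\<rbrakk> \<Longrightarrow> \<exists>F h \<phi>. Tri A (g \<odot> f) D h F \<phi>"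
    and defl_comp: "\<lbrakk>Tri A x B f C \<delta>; Tri A' x' C g D \<delta>'\<rbrakk> \<Longrightarrow> \<exists>F h \<phi>. Tri F h B (g \<odot> f) D \<phi>"
    and cone: "\<lbrakk>Tri A x B y C (\<rho> \<odot> c); Tri A x' B' y' C' \<rho>; c \<in> H 0 C C'\<rbrakk>
      \<Longrightarrow> \<exists>f S i1 i2 p1 p2. f \<in> H 0 B B' \<and> f \<odot> x = x' \<and> y' \<odot> f = c \<odot> y \<and> bip C B' S i1 i2 p1 p2 \<and>
            Tri B (i2 \<odot> f - i1 \<odot> y) S (c \<odot> p1 + y' \<odot> p2) C' (x \<odot> \<rho>)"
    and cocone: "\<lbrakk>Tri A x B y C \<delta>; Tri A' x' B' y' C (a \<odot> \<delta>); a \<in> H 0 A A'\<rbrakk>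
      \<Longrightarrow> \<exists>h S i1 i2 p1 p2. h \<in> H 0 B B' \<and> h \<odot> x = x' \<odot> a \<and> y' \<odot> h = y \<and> bip A' B S i1 i2 p1 p2 \<and>
            Tri A (i1 \<odot> a + i2 \<odot> x) S (h \<odot> p2 - x' \<odot> p1) B' (\<delta> \<odot> y')"
begin

lemma tri_D:
  assumes "Tri A x B y C \<delta>"
  shows "A \<in> Obj" "B \<in> Obj" "C \<in> Obj" "x \<in> H 0 A B" "y \<in> H 0 B C" "\<delta> \<in> H (Suc 0) C A"
    "y \<odot> x = 0" "\<delta> \<odot> y = 0" "x \<odot> \<delta> = 0"
    "y \<odot> (x \<odot> z) = 0" "\<delta> \<odot> (y \<odot> z) = 0" "x \<odot> (\<delta> \<odot> z) = 0"
    "I B \<odot> x = x" "I C \<odot> y = y" "I A \<odot> \<delta> = \<delta>" "x \<odot> I A = x" "y \<odot> I B = y" "\<delta> \<odot> I C = \<delta>"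
  using tri_H[OF assms] tri_zero[OF assms] H_Obj
  by (auto simp: mul_assoc[symmetric] intro: id_left id_right)

lemma dual_triangle_category:
  "triangle_category (\<lambda>x y. y \<odot> x) u Obj (\<lambda>i A B. H i B A) I (\<lambda>A x B y C \<delta>. Tri C y B x A \<delta>)"
proof -
  interpret d: graded_precategory "\<lambda>x y. y \<odot> x" u Obj "\<lambda>i A B. H i B A" I
    by (rule dual_precategory)
  show ?thesis
  proof (unfold_locales, goal_cases)
    case 1 show ?case by (rule zero_obj)
  next
    case (2 A B) then show ?case unfolding dual_bip using bip_exists by blast
  next
    case (3 A x B y C \<delta>) then show ?case using tri_H by blast
  next
    case (4 A x B y C \<delta>) then show ?case using tri_zero by blast
  next
    case (5 A x B y C \<delta> f T) then show ?case using tri_con_mid by blast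
  next
    case (6 A x B y C \<delta> f T) then show ?case using tri_con_left by blast
  next
    case (7 A x B y C \<delta> f T) then show ?case using tri_cov_mid by blast
  next
    case (8 A x B y C \<delta> f T) then show ?case using tri_cov_right by blast
  next
    case (9 \<delta> C A) then show ?case using realize by blast
  next
    case (10 A x B y C \<delta> A' x' B' y' C' \<delta>' a c)
    then show ?case using tri_lift[OF 10(2) 10(1) 10(4) 10(3) 10(5)[symmetric]] by metis
  next
    case (11 A x B y C \<delta> b B' b')
    then show ?case using tri_mid_iso[OF 11(1) 11(3) 11(2) 11(4) 11(5)] by blast
  next
    case (12 A f B y C \<delta> g D y' C' \<delta>') then show ?case using defl_comp[OF 12(2,1)] by blast
  next
    case (13 A x B f C \<delta> A' x' g D \<delta>') then show ?case using infl_comp[OF 13(2,1)] by blast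
  next
    case (14 A x B y C \<rho> c x' B' y' C')
    then show ?case unfolding dual_bip using cocone[OF 14(2) 14(1) 14(3)] by metis
  next
    case (15 A x B y C \<delta> A' x' B' y' a)
    then show ?case unfolding dual_bip using cone[OF 15(2) 15(1) 15(3)] by metis
  qed
qed

text \<open>Glue \<open>\<delta>\<close> and \<open>\<theta>\<close> to one extension
  \<open>\<rho>\<close> by A over the sum of C and X. In the cone triangle of \<open>i1\<close> the
  extension \<open>x \<odot> \<rho>\<close> vanishes, so \<open>i2\<close> lifts through the
  deflation of that triangle; applying \<open>\<rho>\<close> leaves only the component of the lift
  along C.\<close>

lemma exact_ext_left:
  assumes t: "Tri A x B y C \<delta>" and \<theta>: "\<theta> \<in> H (Suc 0) X A" and z: "x \<odot> \<theta> = 0"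
  shows "\<exists>g\<in>H 0 X C. \<theta> = \<delta> \<odot> g"
proof -
  have X: "X \<in> Obj" using \<theta> H_src by blast
  obtain S i1 i2 p1 p2 where b: "bip C X S i1 i2 p1 p2" using bip_exists[OF tri_D(3)[OF t] X] by blast
  note b_D = bip_D[OF b] and bS = bip_mul[OF b] and tD = tri_D[OF t]
  define \<rho> where "\<rho> = \<delta> \<odot> p1 + \<theta> \<odot> p2"
  have \<rho>H: "\<rho> \<in> H (Suc 0) S A" unfolding \<rho>_def using tD \<theta> b_D by (blast intro: H_intros)
  have r1: "\<rho> \<odot> i1 = \<delta>" and r2: "\<rho> \<odot> i2 = \<theta>"
    unfolding \<rho>_def by (simp_all add: mul_simps bS tD id_right[OF \<theta>])
  obtain x' B' y' where t': "Tri A x' B' y' S \<rho>" using realize[OF \<rho>H] by blast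
  obtain f S2 j1 j2 q1 q2 where b2: "bip C B' S2 j1 j2 q1 q2"
    and t2: "Tri B (j2 \<odot> f - j1 \<odot> y) S2 (i1 \<odot> q1 + y' \<odot> q2) S (x \<odot> \<rho>)"
    using cone[OF t[folded r1] t' b_D(4)] by blast
  have "x \<odot> \<rho> = 0" unfolding \<rho>_def by (simp add: mul_simps tD mul_ext[OF z])
  then obtain g where g: "g \<in> H 0 X S2" "i2 = (i1 \<odot> q1 + y' \<odot> q2) \<odot> g"
    using tri_cov_right[OF t2 b_D(5)] by auto
  have "\<theta> = \<rho> \<odot> ((i1 \<odot> q1 + y' \<odot> q2) \<odot> g)" using r2 g(2) by simp
  also have "\<dots> = \<delta> \<odot> (q1 \<odot> g)" by (simp add: mul_simps mul_ext[OF r1] tri_D[OF t'])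
  finally show ?thesis using g(1) bip_D(6)[OF b2] by (blast intro: H_intros)
qed

text \<open>Exactness provides some \<open>c\<close> with the right extension, but the lift
  \<open>b0\<close> belonging to it need not be \<open>b\<close>. The difference is
  \<open>k \<odot> y\<close>, and adding \<open>y' \<odot> k\<close> to \<open>c\<close> repairs the
  square without changing \<open>\<delta>' \<odot> c\<close>.\<close>

lemma tri_third_map:
  assumes t: "Tri A x B y C \<delta>" and t': "Tri A' x' B' y' C' \<delta>'" and a: "a \<in> H 0 A A'" and b: "b \<in> H 0 B B'"
    and e: "b \<odot> x = x' \<odot> a"
  shows "\<exists>c\<in>H 0 C C'. c \<odot> y = y' \<odot> b \<and> a \<odot> \<delta> = \<delta>' \<odot> c"
proof -
  note tD = tri_D[OF t] and tD' = tri_D[OF t']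
  have "x' \<odot> (a \<odot> \<delta>) = 0" using mul_ext[OF e[symmetric], of \<delta>] tD by (simp add: mul_simps)
  then obtain c where c: "c \<in> H 0 C C'" "a \<odot> \<delta> = \<delta>' \<odot> c"
    using exact_ext_left[OF t' H_mul0[OF a tD(6)]] by blast
  obtain b0 where b0: "b0 \<in> H 0 B B'" "b0 \<odot> x = x' \<odot> a" "y' \<odot> b0 = c \<odot> y"
    using tri_lift[OF t t' a c] by blast
  have "(b - b0) \<odot> x = 0" by (simp add: mul_simps e b0)
  then obtain k where k: "k \<in> H 0 C B'" "b - b0 = k \<odot> y"
    using tri_con_mid[OF t H_diff[OF b b0(1)]] by blast
  then have "y' \<odot> b - y' \<odot> b0 = y' \<odot> (k \<odot> y)" by (metis mul_diff_right)
  then have "(c + y' \<odot> k) \<odot> y = y' \<odot> b" by (simp add: mul_simps b0(3) algebra_simps)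
  moreover have "a \<odot> \<delta> = \<delta>' \<odot> (c + y' \<odot> k)" by (simp add: mul_simps tD' c)
  moreover have "c + y' \<odot> k \<in> H 0 C C'" using c(1) k(1) tD'(5) by (blast intro: H_intros)
  ultimately show ?thesis by blast
qed

text \<open>Triangles are only assumed closed under changing the middle term, so transport along an
  isomorphism of the third term goes through a realization of
  \<open>\<delta> \<odot> \<theta>\<close>. Lifts in both directions are inverse up to maps that
  factor through the deflation and are killed by it, hence have square zero.\<close>

lemma tri_end_iso:
  assumes t: "Tri A x B y C \<delta>" and th: "\<theta> \<in> H 0 C' C" "\<theta>' \<in> H 0 C C'" "\<theta> \<odot> \<theta>' = I C" "\<theta>' \<odot> \<theta> = I C'"
  shows "Tri A x B (\<theta>' \<odot> y) C' (\<delta> \<odot> \<theta>)"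
proof -
  note tD = tri_D[OF t]
  obtain x1 B1 y1 where t1: "Tri A x1 B1 y1 C' (\<delta> \<odot> \<theta>)" using realize[OF H_mul0'[OF tD(6) th(1)]] by blast
  note tD1 = tri_D[OF t1]
  obtain b where b: "b \<in> H 0 B1 B" "b \<odot> x1 = x" "y \<odot> b = \<theta> \<odot> y1"
    using tri_lift[OF t1 t H_id[OF tD(1)] th(1)] tD by (auto simp: mul_ext[OF tD(15)])
  obtain c where c: "c \<in> H 0 B B1" "c \<odot> x = x1" "y1 \<odot> c = \<theta>' \<odot> y"
    using tri_lift[OF t t1 H_id[OF tD(1)] th(2)] tD tD1 by (auto simp: mul_assoc th)
  have y1: "y1 = \<theta>' \<odot> (y \<odot> b)" by (simp add: b mul_ext[OF th(4)] tD1)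
  have sq1: "(c \<odot> b - I B1) \<odot> (c \<odot> b - I B1) = 0"
  proof -
    have cb: "c \<odot> b \<in> H 0 B1 B1" by (rule H_mul0[OF c(1) b(1)])
    have "y1 \<odot> (c \<odot> b) = y1" by (metis c(3) mul_assoc y1)
    then have z: "y1 \<odot> (c \<odot> b - I B1) = 0" by (simp add: mul_simps tD1)
    have "(c \<odot> b - I B1) \<odot> x1 = 0" by (simp add: mul_simps b c tD1)
    then obtain k where k: "c \<odot> b - I B1 = k \<odot> y1"
      using tri_con_mid[OF t1 H_diff[OF cb H_id[OF tD1(2)]]] by blast
    have "(k \<odot> y1) \<odot> (c \<odot> b - I B1) = 0" by (simp only: mul_assoc z mul_zero_right)
    then show ?thesis using k by simp
  qed
  have sq2: "(b \<odot> c - I B) \<odot> (b \<odot> c - I B) = 0"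
  proof -
    have bc: "b \<odot> c \<in> H 0 B B" by (rule H_mul0[OF b(1) c(1)])
    have "y \<odot> (b \<odot> c) = y" by (simp add: mul_ext[OF b(3)] mul_assoc c mul_ext[OF th(3)] tD)
    then have z: "y \<odot> (b \<odot> c - I B) = 0" by (simp add: mul_simps tD)
    have "(b \<odot> c - I B) \<odot> x = 0" by (simp add: mul_simps b c tD)
    then obtain k where k: "b \<odot> c - I B = k \<odot> y"
      using tri_con_mid[OF t H_diff[OF bc H_id[OF tD(2)]]] by blast
    have "(k \<odot> y) \<odot> (b \<odot> c - I B) = 0" by (simp only: mul_assoc z mul_zero_right)
    then show ?thesis using k by simp
  qed
  obtain d where d: "d \<in> H 0 B B1" "d \<odot> b = I B1" "b \<odot> d = I B"
    using iso_of_square_zero[OF b(1) c(1) sq1 sq2] by blast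
  have "Tri A (b \<odot> x1) B (y1 \<odot> d) C' (\<delta> \<odot> \<theta>)" using tri_mid_iso[OF t1 b(1) d] .
  moreover have "y1 \<odot> d = \<theta>' \<odot> y" by (simp add: y1 mul_assoc d tD)
  ultimately show ?thesis by (simp add: b)
qed

text \<open>Use \<open>tri_third_map\<close> in both directions. The resulting endomorphisms of a
  third term fix deflation and extension; they differ from 1 by some \<open>q \<odot> k\<close> that
  in turn kills \<open>q\<close>, so the difference has square zero.\<close>

lemma tri_recognition:
  assumes t: "Tri A x B y C \<delta>" and t': "Tri A x B y' C' \<delta>'"
  shows "\<exists>\<theta>\<in>H 0 C C'. \<exists>\<theta>'\<in>H 0 C' C. \<theta>' \<odot> \<theta> = I C \<and> \<theta> \<odot> \<theta>' = I C' \<and> \<theta> \<odot> y = y' \<and> \<delta> = \<delta>' \<odot> \<theta>"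
proof -
  note tD = tri_D[OF t] and tD' = tri_D[OF t']
  have e: "I B \<odot> x = x \<odot> I A" by (simp add: tD)
  obtain c where c: "c \<in> H 0 C C'" "c \<odot> y = y'" "\<delta> = \<delta>' \<odot> c"
    using tri_third_map[OF t t' H_id[OF tD(1)] H_id[OF tD(2)] e] tD tD' by auto
  obtain c' where c': "c' \<in> H 0 C' C" "c' \<odot> y' = y" "\<delta>' = \<delta> \<odot> c'"
    using tri_third_map[OF t' t H_id[OF tD(1)] H_id[OF tD(2)] e] tD tD' by auto
  have sq: "(\<phi> - I Q) \<odot> (\<phi> - I Q) = 0"
    if T: "Tri A x B q Q \<epsilon>" and \<phi>: "\<phi> \<in> H 0 Q Q" "\<phi> \<odot> q = q" "\<epsilon> \<odot> \<phi> = \<epsilon>" for Q q \<phi> \<epsilon>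
  proof -
    note TD = tri_D[OF T]
    have z: "(\<phi> - I Q) \<odot> q = 0" and "\<epsilon> \<odot> (\<phi> - I Q) = 0" by (simp_all add: mul_simps \<phi> TD)
    then obtain k where k: "\<phi> - I Q = q \<odot> k"
      using tri_cov_right[OF T H_diff[OF \<phi>(1) H_id[OF TD(3)]]] by blast
    have "(\<phi> - I Q) \<odot> (q \<odot> k) = 0" by (simp only: mul_assoc[symmetric] z mul_zero_left)
    then show ?thesis using k by simp
  qed
  have "\<exists>b'\<in>H 0 C' C. b' \<odot> c = I C \<and> c \<odot> b' = I C'"
  proof (rule iso_of_square_zero[OF c(1) c'(1)])
    show "(c' \<odot> c - I C) \<odot> (c' \<odot> c - I C) = 0"
      by (rule sq[OF t]) (simp_all add: H_mul0[OF c'(1) c(1)] mul_assoc c(2) c'(2) mul_ext[OF c'(3)[symmetric]] c(3)[symmetric])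
    show "(c \<odot> c' - I C') \<odot> (c \<odot> c' - I C') = 0"
      by (rule sq[OF t']) (simp_all add: H_mul0[OF c(1) c'(1)] mul_assoc c(2) c'(2) mul_ext[OF c(3)[symmetric]] c'(3)[symmetric])
  qed
  then show ?thesis using c by metis
qed

text \<open>Here the middle map is prescribed to be \<open>g\<close>, while \<open>cone\<close> only
  promises some lift \<open>\<phi>\<close>. As \<open>\<phi> - g = k \<odot> f'\<close>, a shear by
  \<open>k\<close>, combined with the passage to the given sum S, turns \<open>\<phi>\<close> into
  \<open>g\<close> and \<open>d0\<close> into \<open>d0 - h \<odot> k\<close>.\<close>

lemma tri_pushout:
  assumes t: "Tri A f B f' D \<delta>f" and t': "Tri A (g \<odot> f) C h E \<delta>h" and g: "g \<in> H 0 B C"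
    and b: "bip D C S i1 i2 p1 p2"
  shows "\<exists>d\<in>H 0 D E. d \<odot> f' = h \<odot> g \<and> \<delta>h \<odot> d = \<delta>f \<and>
    Tri B (i2 \<odot> g - i1 \<odot> f') S (d \<odot> p1 + h \<odot> p2) E (f \<odot> \<delta>h)"
proof -
  note tD = tri_D[OF t] and tD' = tri_D[OF t'] and bD = bip_D[OF b] and bS = bip_mul[OF b]
  obtain d0 where d0: "d0 \<in> H 0 D E" "d0 \<odot> f' = h \<odot> g" "\<delta>f = \<delta>h \<odot> d0"
    using tri_third_map[OF t t' H_id[OF tD(1)] g] tD tD' by (auto simp: mul_assoc)
  obtain \<phi> S' j1 j2 q1 q2 where \<phi>: "\<phi> \<in> H 0 B C" "\<phi> \<odot> f = g \<odot> f" "h \<odot> \<phi> = d0 \<odot> f'"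
    and b': "bip D C S' j1 j2 q1 q2" and T: "Tri B (j2 \<odot> \<phi> - j1 \<odot> f') S' (d0 \<odot> q1 + h \<odot> q2) E (f \<odot> \<delta>h)"
    using cone[OF t[unfolded d0(3)] t' d0(1)] by blast
  note bD' = bip_D[OF b'] and bS' = bip_mul[OF b']
  have "(\<phi> - g) \<odot> f = 0" by (simp add: mul_simps \<phi>)
  then obtain k where k: "k \<in> H 0 D C" "\<phi> - g = k \<odot> f'" using tri_con_mid[OF t H_diff[OF \<phi>(1) g]] by blast
  then have \<phi>g: "\<phi> = g + k \<odot> f'" by (simp add: algebra_simps)
  have kq: "k \<odot> q1 \<in> H 0 S' C" and kp: "k \<odot> p1 \<in> H 0 S C" using H_mul0[OF k(1)] bD bD' by blast+
  let ?b = "i1 \<odot> q1 + i2 \<odot> q2 + i2 \<odot> (k \<odot> q1)" and ?b' = "j1 \<odot> p1 + j2 \<odot> p2 - j2 \<odot> (k \<odot> p1)"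
  have bH: "?b \<in> H 0 S' S" "?b' \<in> H 0 S S'" using bD bD' k(1) by (blast intro: H_intros)+
  have e1: "?b' \<odot> ?b = I S'" using bD'(12)
    by (simp add: mul_simps bS bS' bS(5)[OF bD'(6)] bS(6)[OF bD'(7)] bS(6)[OF kq])
  have e2: "?b \<odot> ?b' = I S" using bD(12)
    by (simp add: mul_simps bS bS' bS'(5)[OF bD(6)] bS'(6)[OF bD(7)] bS'(6)[OF kp])
  have "?b \<odot> (j2 \<odot> \<phi> - j1 \<odot> f') = i2 \<odot> \<phi> - i1 \<odot> f' - i2 \<odot> (k \<odot> f')"
    by (simp add: mul_simps bS' bS'(5)[OF tD(5)] bS'(6)[OF \<phi>(1)])
  also have "\<dots> = i2 \<odot> g - i1 \<odot> f'" by (simp add: \<phi>g mul_simps)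
  finally have E1: "?b \<odot> (j2 \<odot> \<phi> - j1 \<odot> f') = i2 \<odot> g - i1 \<odot> f'" .
  have E2: "(d0 \<odot> q1 + h \<odot> q2) \<odot> ?b' = (d0 - h \<odot> k) \<odot> p1 + h \<odot> p2"
    by (simp add: mul_simps bS' bS'(5)[OF bD(6)] bS'(6)[OF bD(7)] bS'(6)[OF kp])
  have "Tri B (i2 \<odot> g - i1 \<odot> f') S ((d0 - h \<odot> k) \<odot> p1 + h \<odot> p2) E (f \<odot> \<delta>h)"
    using tri_mid_iso[OF T bH e1 e2] unfolding E1 E2 .
  moreover have "(d0 - h \<odot> k) \<odot> f' = h \<odot> g" using \<phi>(3) d0(2) unfolding \<phi>g by (simp add: mul_simps)
  moreover have "\<delta>h \<odot> (d0 - h \<odot> k) = \<delta>f" by (simp add: mul_simps d0(3) tD')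
  moreover have "d0 - h \<odot> k \<in> H 0 D E" using d0(1) k(1) tD' by (blast intro: H_intros)
  ultimately show ?thesis by blast
qed

lemma tri_neg_mid:
  assumes t: "Tri A (i2 \<odot> g - i1 \<odot> f) S (d \<odot> p1 + h \<odot> p2) E \<epsilon>" and b: "bip D C S i1 i2 p1 p2"
    and g: "g \<in> H 0 A C" and f: "f \<in> H 0 A D"
  shows "Tri A (i2 \<odot> g + i1 \<odot> f) S (h \<odot> p2 - d \<odot> p1) E \<epsilon>"
proof -
  note bD = bip_D[OF b] and bS = bip_mul[OF b]
  let ?s = "i2 \<odot> p2 - i1 \<odot> p1"
  have s: "?s \<in> H 0 S S" using bD by (blast intro: H_intros)
  have ss: "?s \<odot> ?s = I S" using bD(12)
    by (simp add: mul_simps bS bS(5)[OF bD(6)] bS(6)[OF bD(7)] add.commute)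
  have "?s \<odot> (i2 \<odot> g - i1 \<odot> f) = i2 \<odot> g + i1 \<odot> f"
    by (simp add: mul_simps bS(1-4) bS(5)[OF f] bS(6)[OF g])
  moreover have "(d \<odot> p1 + h \<odot> p2) \<odot> ?s = h \<odot> p2 - d \<odot> p1"
    by (simp add: mul_simps bS(1-4) bS(5)[OF bD(6)] bS(6)[OF bD(7)])
  ultimately show ?thesis using tri_mid_iso[OF t s s ss ss] by simp
qed

text \<open>There are two candidates for the third term over the composite: \<open>E\<close>, from a
  realization of \<open>f' \<odot> \<delta>g\<close>, and \<open>E2\<close>, supplied by
  \<open>infl_comp\<close>. Both are third terms of triangles on the same map from B to the sum of D
  and C, by \<open>cocone\<close> and, after a sign change, by \<open>tri_pushout\<close>. So
  \<open>tri_recognition\<close> identifies them compatibly with all maps.\<close>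

lemma octahedron:
  assumes t: "Tri A f B f' D \<delta>f" and t': "Tri B g C g' F \<delta>g"
  shows "\<exists>E h d e \<delta>h. Tri A (g \<odot> f) C h E \<delta>h \<and> Tri D d E e F (f' \<odot> \<delta>g) \<and>
    h \<odot> g = d \<odot> f' \<and> e \<odot> h = g' \<and> \<delta>h \<odot> d = \<delta>f \<and> f \<odot> \<delta>h = \<delta>g \<odot> e"
proof -
  note tD = tri_D[OF t] and tD' = tri_D[OF t']
  obtain d E e where t3: "Tri D d E e F (f' \<odot> \<delta>g)" using realize[OF H_mul0[OF tD(5) tD'(6)]] by blast
  note tD3 = tri_D[OF t3]
  obtain h S i1 i2 p1 p2 where h: "h \<in> H 0 C E" "h \<odot> g = d \<odot> f'" "e \<odot> h = g'" and b: "bip D C S i1 i2 p1 p2"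
    and t4: "Tri B (i1 \<odot> f' + i2 \<odot> g) S (h \<odot> p2 - d \<odot> p1) E (\<delta>g \<odot> e)"
    using cocone[OF t' t3 tD(5)] by blast
  note bS = bip_mul[OF b]
  obtain E2 h2 \<delta>2 where t5: "Tri A (g \<odot> f) C h2 E2 \<delta>2" using infl_comp[OF t t'] by blast
  note tD5 = tri_D[OF t5]
  obtain d2 where d2: "d2 \<in> H 0 D E2" "d2 \<odot> f' = h2 \<odot> g" "\<delta>2 \<odot> d2 = \<delta>f"
    and t6: "Tri B (i2 \<odot> g - i1 \<odot> f') S (d2 \<odot> p1 + h2 \<odot> p2) E2 (f \<odot> \<delta>2)"
    using tri_pushout[OF t t5 tD'(4) b] by blast
  obtain \<theta> \<theta>' where th: "\<theta> \<in> H 0 E E2" "\<theta>' \<in> H 0 E2 E" "\<theta>' \<odot> \<theta> = I E" "\<theta> \<odot> \<theta>' = I E2"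
    "\<theta> \<odot> (h \<odot> p2 - d \<odot> p1) = h2 \<odot> p2 - d2 \<odot> p1" "\<delta>g \<odot> e = (f \<odot> \<delta>2) \<odot> \<theta>"
    using tri_recognition[OF t4[unfolded add.commute[of "i1 \<odot> f'"]] tri_neg_mid[OF t6 b tD'(4) tD(5)]] by blast
  have "(\<theta> \<odot> (h \<odot> p2 - d \<odot> p1)) \<odot> i2 = (h2 \<odot> p2 - d2 \<odot> p1) \<odot> i2" using th(5) by simp
  then have th2: "\<theta> \<odot> h = h2"
    by (simp add: mul_simps bS(1-4) bS(8)[OF h(1)] bS(8)[OF tD5(5)])
  have "(\<theta> \<odot> (h \<odot> p2 - d \<odot> p1)) \<odot> i1 = (h2 \<odot> p2 - d2 \<odot> p1) \<odot> i1" using th(5) by simp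
  then have thd: "\<theta> \<odot> d = d2"
    by (simp add: mul_simps bS(1-4) bS(7)[OF tD3(4)] bS(7)[OF d2(1)])
  have "\<theta>' \<odot> h2 = h" by (simp add: th2[symmetric] mul_ext[OF th(3)] id_left[OF h(1)])
  then have "Tri A (g \<odot> f) C h E (\<delta>2 \<odot> \<theta>)" using tri_end_iso[OF t5 th(1,2,4,3)] by simp
  moreover have "(\<delta>2 \<odot> \<theta>) \<odot> d = \<delta>f" by (simp add: mul_assoc thd d2)
  ultimately show ?thesis using t3 h th(6) by (metis mul_assoc)
qed

text \<open>The map from B to the sum of C and D with components \<open>y\<close> (up to sign) and
  \<open>v\<close> kills \<open>\<theta>\<close>. By \<open>tri_pushout\<close> it starts a triangle
  with extension \<open>x \<odot> \<phi>\<close>, and \<open>exact_ext_left\<close> for that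
  triangle gives the factorization.\<close>

lemma exact_ext_mid:
  assumes t: "Tri A x B y C \<delta>" and th: "\<theta> \<in> H (Suc 0) Z B" and z: "y \<odot> \<theta> = 0"
  shows "\<exists>\<theta>'\<in>H (Suc 0) Z A. \<theta> = x \<odot> \<theta>'"
proof -
  note tD = tri_D[OF t]
  obtain v D w where t1: "Tri B v D w Z \<theta>" using realize[OF th] by blast
  note tD1 = tri_D[OF t1]
  obtain F h \<phi> where t2: "Tri A (v \<odot> x) D h F \<phi>" using infl_comp[OF t t1] by blast
  obtain S i1 i2 p1 p2 where b: "bip C D S i1 i2 p1 p2" using bip_exists[OF tD(3) tD1(2)] by blast
  obtain d where d: "d \<in> H 0 C F" and t3: "Tri B (i2 \<odot> v - i1 \<odot> y) S (d \<odot> p1 + h \<odot> p2) F (x \<odot> \<phi>)"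
    using tri_pushout[OF t t2 tD1(4) b] by blast
  have "(i2 \<odot> v - i1 \<odot> y) \<odot> \<theta> = 0" by (simp add: mul_simps z tD1)
  then obtain k where k: "k \<in> H 0 Z F" "\<theta> = (x \<odot> \<phi>) \<odot> k" using exact_ext_left[OF t3 th] by blast
  then show ?thesis using H_mul0'[OF tri_D(6)[OF t2]] by (metis mul_assoc)
qed

text \<open>A realization of \<open>i1 \<odot> \<epsilon>\<close> has an unknown middle term Q, to
  be identified with the sum of X and Y. Lifting gives maps between X and Q in both directions, and
  \<open>p2\<close> extends to Q because it kills the extension.\<close>

lemma tri_add_id:
  assumes t: "Tri M m X e M' \<epsilon>" and b: "bip M Y S i1 i2 p1 p2" and b': "bip X Y S' j1 j2 q1 q2"
  shows "Tri S (j1 \<odot> (m \<odot> p1) + j2 \<odot> p2) S' (e \<odot> q1) M' (i1 \<odot> \<epsilon>)"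
proof -
  note tD = tri_D[OF t] and bD = bip_D[OF b] and bS = bip_mul[OF b] and bD' = bip_D[OF b'] and bS' = bip_mul[OF b']
  obtain s Q r where T: "Tri S s Q r M' (i1 \<odot> \<epsilon>)" using realize[OF H_mul0[OF bD(4) tD(6)]] by blast
  note TD = tri_D[OF T]
  obtain f where f: "f \<in> H 0 X Q" "f \<odot> m = s \<odot> i1" "r \<odot> f = e"
    using tri_lift[OF t T bD(4) H_id[OF tD(3)]] tD TD by (auto simp: mul_assoc)
  have pe: "p1 \<odot> (i1 \<odot> \<epsilon>) = \<epsilon>" by (rule bS(5)[OF tD(6)])
  obtain c where c: "c \<in> H 0 Q X" "c \<odot> s = m \<odot> p1" "e \<odot> c = r"
    using tri_lift[OF T t bD(6) H_id[OF tD(3)]] tD TD pe by auto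
  obtain l0 where l0: "l0 \<in> H 0 Q Y" "p2 = l0 \<odot> s"
    using tri_con_left[OF T bD(7)] by (auto simp: bS)
  have "(l0 \<odot> f) \<odot> m = 0" by (simp add: mul_assoc f(2)) (simp add: mul_ext[OF l0(2)[symmetric]] bS)
  then obtain k0 where k0: "k0 \<in> H 0 M' Y" "l0 \<odot> f = k0 \<odot> e"
    using tri_con_mid[OF t H_mul0[OF l0(1) f(1)]] by blast
  \<comment> \<open>Subtracting \<open>k0 \<odot> r\<close> keeps the restriction along
    \<open>s\<close> and makes the map vanish on the image of \<open>f\<close>.\<close>
  define l where "l = l0 - k0 \<odot> r"
  have l: "l \<in> H 0 Q Y" "l \<odot> s = p2" "l \<odot> f = 0"
    unfolding l_def using H_diff[OF l0(1) H_mul0[OF k0(1) TD(5)]]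
    by (simp_all add: mul_simps TD f l0(2)[symmetric] k0(2))
  let ?f = "f \<odot> q1 + s \<odot> (i2 \<odot> q2)" and ?g = "j1 \<odot> c + j2 \<odot> l"
  have fH: "?f \<in> H 0 S' Q" and gH: "?g \<in> H 0 Q S'"
    using f(1) c(1) l(1) bD bD' TD by (blast intro: H_intros)+
  have "?f \<odot> ?g = f \<odot> c + s \<odot> (i2 \<odot> l)"
    by (simp add: mul_simps bS'(1-4) bS'(5)[OF c(1)] bS'(6)[OF l(1)])
  then have fgs: "(?f \<odot> ?g) \<odot> s = s" and rfg: "r \<odot> (?f \<odot> ?g) = r"
    using bD(12) by (simp_all add: mul_simps c l f mul_ext[OF f(2)] mul_ext[OF f(3)] TD mul_add_right[symmetric])
  have sq1: "(?f \<odot> ?g - I Q) \<odot> (?f \<odot> ?g - I Q) = 0"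
  proof -
    have "(?f \<odot> ?g - I Q) \<odot> s = 0" and z: "r \<odot> (?f \<odot> ?g - I Q) = 0"
      using fgs rfg by (simp_all add: mul_diff_left mul_diff_right TD)
    then obtain k where k: "?f \<odot> ?g - I Q = k \<odot> r"
      using tri_con_mid[OF T H_diff[OF H_mul0[OF fH gH] H_id[OF TD(2)]]] by blast
    have "(k \<odot> r) \<odot> (?f \<odot> ?g - I Q) = 0" by (simp only: mul_assoc z mul_zero_right)
    then show ?thesis using k by simp
  qed
  have cf: "c \<odot> f \<in> H 0 X X" using H_mul0[OF c(1) f(1)] .
  have "(c \<odot> f - I X) \<odot> m = 0" by (simp add: mul_simps f tD) (simp add: mul_ext[OF c(2)] mul_assoc bS tD)
  then obtain k where k: "k \<in> H 0 M' X" "c \<odot> f - I X = k \<odot> e"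
    using tri_con_mid[OF t H_diff[OF cf H_id[OF tD(2)]]] by blast
  have ek: "e \<odot> (k \<odot> e) = 0" unfolding k(2)[symmetric] by (simp add: mul_simps mul_ext[OF c(3)] f tD)
  have "?g \<odot> ?f = j1 \<odot> ((c \<odot> f) \<odot> q1) + j2 \<odot> q2"
    by (simp add: mul_simps l mul_ext[OF l(2)] mul_ext[OF l(3)] mul_ext[OF c(2)] mul_assoc bS bS(6)[OF bD'(7)])
  also have "c \<odot> f = k \<odot> e + I X" using k(2) by (simp add: algebra_simps)
  finally have gf: "?g \<odot> ?f - I S' = j1 \<odot> (k \<odot> (e \<odot> q1))"
    using bD'(12) by (simp add: mul_simps id_left[OF bD'(6)] algebra_simps)
  have "(j1 \<odot> (k \<odot> (e \<odot> q1))) \<odot> (j1 \<odot> (k \<odot> (e \<odot> q1))) = 0"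
    by (simp add: mul_assoc bS'(5)[OF H_mul0[OF k(1) H_mul0[OF tD(5) bD'(6)]]] mul_ext2[OF ek])
  then have sq2: "(?g \<odot> ?f - I S') \<odot> (?g \<odot> ?f - I S') = 0" unfolding gf .
  obtain g' where g': "g' \<in> H 0 S' Q" "g' \<odot> ?g = I Q" "?g \<odot> g' = I S'"
    using iso_of_square_zero[OF gH fH sq1 sq2] by blast
  have "Tri S (?g \<odot> s) S' (r \<odot> g') M' (i1 \<odot> \<epsilon>)" by (rule tri_mid_iso[OF T gH g'])
  moreover have "?g \<odot> s = j1 \<odot> (m \<odot> p1) + j2 \<odot> p2" by (simp add: mul_simps c l)
  moreover have "(e \<odot> q1) \<odot> ?g = r" by (simp add: mul_simps bS'(1-4) bS'(5)[OF c(1)] c(3))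
  then have "r \<odot> g' = e \<odot> q1" using g'(3) id_right[OF H_mul0[OF tD(5) bD'(6)]] by (metis mul_assoc)
  ultimately show ?thesis by simp
qed

lemma tri_id_left:
  assumes A: "A \<in> Obj" and Z: "Z \<in> Obj" "I Z = 0"
  shows "Tri A (I A) A 0 Z 0"
proof -
  obtain x B y where t: "Tri A x B y Z 0" using realize[OF H_zero[OF Z(1) A]] by blast
  note tD = tri_D[OF t]
  have y: "y = 0" using tD(14) Z by simp
  obtain g where g: "g \<in> H 0 B A" "I A = g \<odot> x" using tri_con_left[OF t H_id[OF A]] by auto
  obtain g' where g': "g' \<in> H 0 B A" "I B = x \<odot> g'" using tri_cov_mid[OF t H_id[OF tD(2)]] y by auto
  have "g = g'" using inverse_unique[OF tD(4) g(1) g'(1)] g g' by simp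
  then show ?thesis using tri_mid_iso[OF t g(1) tD(4)] g g' y by simp
qed

end

context triangle_category begin

interpretation dual: triangle_category "\<lambda>x y. y \<odot> x" u Obj "\<lambda>i A B. H i B A" I "\<lambda>A x B y C \<delta>. Tri C y B x A \<delta>"
  by (rule dual_triangle_category)

lemmas exact_ext_right = dual.exact_ext_left
lemmas exact_ext_mid' = dual.exact_ext_mid
lemmas tri_id_right = dual.tri_id_left

end

section \<open>Long exact sequences\<close>

text \<open>In the application S is the (i+1)-fold suspension of A. Its canonical element
  \<open>j\<close> of degree i + 1 carries degrees 0 and 1 onto degrees i + 1 and i + 2, injectively
  in degree 1. This reduces the contravariant sequences to degrees 0 and 1; the covariant ones are
  treated by syzygies.\<close>

locale suspended_category = triangle_category +
  assumes shift: "A \<in> Obj \<Longrightarrow> \<exists>S\<in>Obj. \<exists>j\<in>H (Suc i) S A.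
        (\<forall>X. \<forall>f\<in>H (Suc i) X A. \<exists>g\<in>H 0 X S. f = j \<odot> g) \<and>
        (\<forall>X. \<forall>f\<in>H (Suc (Suc i)) X A. \<exists>g\<in>H (Suc 0) X S. f = j \<odot> g) \<and>
        (\<forall>X. \<forall>g\<in>H (Suc 0) X S. j \<odot> g = 0 \<longrightarrow> g = 0)"
    and proj1: "C \<in> Obj \<Longrightarrow> \<exists>K q P p \<omega>. Tri K q P p C \<omega> \<and> (\<forall>X. H (Suc 0) P X \<subseteq> {0})"
    and inj1: "A \<in> Obj \<Longrightarrow> \<exists>x J y S \<omega>. Tri A x J y S \<omega> \<and> (\<forall>X. H (Suc 0) X J \<subseteq> {0})"
begin

lemma proj_vanish: 
  assumes "\<And>X. H (Suc 0) P X \<subseteq> {0}" "f \<in> H (Suc i) P A"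
  shows "f = 0"
proof (cases i)
  case 0 then show ?thesis using assms by blast
next
  case (Suc k)
  then show ?thesis using shift[OF H_trg[OF assms(2)], of k] assms by fastforce
qed

lemma long_con_left:
  assumes t: "Tri A x B y C \<delta>" and f: "f \<in> H i A T" "f \<odot> \<delta> = 0"
  shows "\<exists>g\<in>H i B T. f = g \<odot> x"
proof (cases i)
  case 0 then show ?thesis using tri_con_left[OF t] f by blast
next
  case (Suc k)
  obtain S j where j: "j \<in> H (Suc k) S T" and j1: "\<And>X f. f \<in> H (Suc k) X T \<Longrightarrow> \<exists>g\<in>H 0 X S. f = j \<odot> g"
    and j2: "\<And>X g. g \<in> H (Suc 0) X S \<Longrightarrow> j \<odot> g = 0 \<Longrightarrow> g = 0"
    using shift[OF H_trg[OF f(1)], of k] by metis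
  obtain d where d: "d \<in> H 0 A S" "f = j \<odot> d" using j1 f(1) Suc by blast
  have "d \<odot> \<delta> = 0" using j2[OF H_mul0[OF d(1) tri_D(6)[OF t]]] f(2) d(2) by (simp add: mul_assoc)
  then obtain g where "g \<in> H 0 B S" "d = g \<odot> x" using tri_con_left[OF t d(1)] by blast
  then show ?thesis using H_mul0'[OF j] d(2) Suc by (metis mul_assoc)
qed

lemma long_con_mid:
  assumes t: "Tri A x B y C \<delta>" and f: "f \<in> H i B T" "f \<odot> x = 0"
  shows "\<exists>g\<in>H i C T. f = g \<odot> y"
proof -
  consider "i = 0" | "i = Suc 0" | k where "i = Suc (Suc k)" by (metis nat.exhaust)
  then show ?thesis
  proof cases
    case 1 then show ?thesis using tri_con_mid[OF t] f by blast
  next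
    case 2 then show ?thesis using exact_ext_mid'[OF t] f by blast
  next
    case (3 k)
    obtain S j where j: "j \<in> H (Suc k) S T"
      and j1: "\<And>X f. f \<in> H (Suc (Suc k)) X T \<Longrightarrow> \<exists>g\<in>H (Suc 0) X S. f = j \<odot> g"
      and j2: "\<And>X g. g \<in> H (Suc 0) X S \<Longrightarrow> j \<odot> g = 0 \<Longrightarrow> g = 0"
      using shift[OF H_trg[OF f(1)], of k] by metis
    obtain d where d: "d \<in> H (Suc 0) B S" "f = j \<odot> d" using j1 f(1) 3 by blast
    have "d \<odot> x = 0" using j2[OF H_mul0'[OF d(1) tri_D(4)[OF t]]] f(2) d(2) by (simp add: mul_assoc)
    then obtain g where "g \<in> H (Suc 0) C S" "d = g \<odot> y" using exact_ext_mid'[OF t d(1)] by blast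
    then show ?thesis using H_mul1'[OF j] d(2) 3 by (metis mul_assoc)
  qed
qed

lemma long_con_right:
  assumes t: "Tri A x B y C \<delta>" and f: "f \<in> H (Suc i) C T" "f \<odot> y = 0"
  shows "\<exists>g\<in>H i A T. f = g \<odot> \<delta>"
proof (cases i)
  case 0 then show ?thesis using exact_ext_right[OF t] f by blast
next
  case (Suc k)
  obtain S j where j: "j \<in> H (Suc k) S T"
    and j1: "\<And>X f. f \<in> H (Suc (Suc k)) X T \<Longrightarrow> \<exists>g\<in>H (Suc 0) X S. f = j \<odot> g"
    and j2: "\<And>X g. g \<in> H (Suc 0) X S \<Longrightarrow> j \<odot> g = 0 \<Longrightarrow> g = 0"
    using shift[OF H_trg[OF f(1)], of k] by metis
  obtain d where d: "d \<in> H (Suc 0) C S" "f = j \<odot> d" using j1 f(1) Suc by blast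
  have "d \<odot> y = 0" using j2[OF H_mul0'[OF d(1) tri_D(5)[OF t]]] f(2) d(2) by (simp add: mul_assoc)
  then obtain g where "g \<in> H 0 A S" "d = g \<odot> \<delta>" using exact_ext_right[OF t d(1)] by blast
  then show ?thesis using H_mul0'[OF j] d(2) Suc by (metis mul_assoc)
qed

text \<open>Dimension shifting along a projective presentation. Together with
  \<open>syzygy_zero\<close> it lowers the degree by one and drives the inductions for the covariant
  sequences.\<close>

lemma syzygy_factor:
  assumes t: "Tri K q P p X \<omega>" and P: "\<And>X. H (Suc 0) P X \<subseteq> {0}" and f: "f \<in> H (Suc i) X A"
  shows "\<exists>g\<in>H i K A. f = g \<odot> \<omega>"
  using long_con_right[OF t f] proj_vanish[OF P H_mul0'[OF f tri_D(5)[OF t]]] by blast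

lemma syzygy_zero:
  assumes t: "Tri K q P p X \<omega>" and P: "\<And>X. H (Suc 0) P X \<subseteq> {0}" and f: "f \<in> H (Suc i) K A" "f \<odot> \<omega> = 0"
  shows "f = 0"
proof -
  obtain k where "k \<in> H (Suc i) P A" "f = k \<odot> q" using long_con_left[OF t f] by blast
  then show ?thesis using proj_vanish[OF P] by fastforce
qed

lemma inj_vanish:
  assumes J: "\<And>X. H (Suc 0) X J \<subseteq> {0}" and f: "f \<in> H (Suc i) X J"
  shows "f = 0"
  using f
proof (induction i arbitrary: X f)
  case 0 then show ?case using J by blast
next
  case (Suc i)
  obtain K q P p \<omega> where t: "Tri K q P p X \<omega>" and P: "\<And>X. H (Suc 0) P X \<subseteq> {0}"
    using proj1[OF H_src[OF Suc.prems]] by blast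
  then show ?case using syzygy_factor[OF t P Suc.prems] Suc.IH by fastforce
qed

lemma long_cov_mid:
  assumes t: "Tri A x B y C \<delta>" and f: "f \<in> H i T B" "y \<odot> f = 0"
  shows "\<exists>g\<in>H i T A. f = x \<odot> g"
proof (cases i)
  case 0 then show ?thesis using tri_cov_mid[OF t] f by blast
next
  case (Suc k)
  have "f \<in> H (Suc k) T B \<Longrightarrow> y \<odot> f = 0 \<Longrightarrow> \<exists>g\<in>H (Suc k) T A. f = x \<odot> g" for f T
  proof (induction k arbitrary: f T)
    case 0 then show ?case using exact_ext_mid[OF t] by blast
  next
    case (Suc k)
    obtain K q P p \<omega> where r: "Tri K q P p T \<omega>" and P: "\<And>X. H (Suc 0) P X \<subseteq> {0}"
      using proj1[OF H_src[OF Suc.prems(1)]] by blast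
    obtain g where g: "g \<in> H (Suc k) K B" "f = g \<odot> \<omega>" using syzygy_factor[OF r P Suc.prems(1)] by blast
    have "y \<odot> g = 0"
      using syzygy_zero[OF r P H_mul0[OF tri_D(5)[OF t] g(1)]] Suc.prems(2) g(2) by (simp add: mul_assoc)
    then obtain h where "h \<in> H (Suc k) K A" "g = x \<odot> h" using Suc.IH[OF g(1)] by blast
    then show ?case using H_mul1'[OF _ tri_D(6)[OF r]] g(2) by (metis mul_assoc)
  qed
  then show ?thesis using f Suc by blast
qed

lemma long_cov_right:
  assumes t: "Tri A x B y C \<delta>" and f: "f \<in> H i T C" "\<delta> \<odot> f = 0"
  shows "\<exists>g\<in>H i T B. f = y \<odot> g"
  using f
proof (induction i arbitrary: f T)
  case 0 then show ?case using tri_cov_right[OF t] by blast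
next
  case (Suc k)
  obtain K q P p \<omega> where r: "Tri K q P p T \<omega>" and P: "\<And>X. H (Suc 0) P X \<subseteq> {0}"
    using proj1[OF H_src[OF Suc.prems(1)]] by blast
  obtain g where g: "g \<in> H k K C" "f = g \<odot> \<omega>" using syzygy_factor[OF r P Suc.prems(1)] by blast
  have "\<delta> \<odot> g = 0"
    using syzygy_zero[OF r P H_mul1[OF tri_D(6)[OF t] g(1)]] Suc.prems(2) g(2) by (simp add: mul_assoc)
  then obtain h where "h \<in> H k K B" "g = y \<odot> h" using Suc.IH[OF g(1)] by blast
  then show ?case using H_mul1'[OF _ tri_D(6)[OF r]] g(2) by (metis mul_assoc)
qed

lemma long_cov_left:
  assumes t: "Tri A x B y C \<delta>" and f: "f \<in> H (Suc i) T A" "x \<odot> f = 0"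
  shows "\<exists>g\<in>H i T C. f = \<delta> \<odot> g"
  using f
proof (induction i arbitrary: f T)
  case 0 then show ?case using exact_ext_left[OF t] by blast
next
  case (Suc k)
  obtain K q P p \<omega> where r: "Tri K q P p T \<omega>" and P: "\<And>X. H (Suc 0) P X \<subseteq> {0}"
    using proj1[OF H_src[OF Suc.prems(1)]] by blast
  obtain g where g: "g \<in> H (Suc k) K A" "f = g \<odot> \<omega>" using syzygy_factor[OF r P Suc.prems(1)] by blast
  have "x \<odot> g = 0"
    using syzygy_zero[OF r P H_mul0[OF tri_D(4)[OF t] g(1)]] Suc.prems(2) g(2) by (simp add: mul_assoc)
  then obtain h where "h \<in> H k K C" "g = \<delta> \<odot> h" using Suc.IH[OF g(1)] by blast
  then show ?case using H_mul1'[OF _ tri_D(6)[OF r]] g(2) by (metis mul_assoc)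
qed

end

text \<open>This interface forgets how the long exact sequences arose. Unlike
  \<open>suspended_category\<close> it is symmetric, so it can be dualised.\<close>

locale long_exact_category = triangle_category +
  assumes cov_mid: "\<lbrakk>Tri A x B y C \<delta>; f \<in> H i T B; y \<odot> f = 0\<rbrakk> \<Longrightarrow> \<exists>g\<in>H i T A. f = x \<odot> g"
    and cov_right: "\<lbrakk>Tri A x B y C \<delta>; f \<in> H i T C; \<delta> \<odot> f = 0\<rbrakk> \<Longrightarrow> \<exists>g\<in>H i T B. f = y \<odot> g"
    and cov_left: "\<lbrakk>Tri A x B y C \<delta>; f \<in> H (Suc i) T A; x \<odot> f = 0\<rbrakk> \<Longrightarrow> \<exists>g\<in>H i T C. f = \<delta> \<odot> g"
    and con_mid: "\<lbrakk>Tri A x B y C \<delta>; f \<in> H i B T; f \<odot> x = 0\<rbrakk> \<Longrightarrow> \<exists>g\<in>H i C T. f = g \<odot> y"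
    and con_left: "\<lbrakk>Tri A x B y C \<delta>; f \<in> H i A T; f \<odot> \<delta> = 0\<rbrakk> \<Longrightarrow> \<exists>g\<in>H i B T. f = g \<odot> x"
    and con_right: "\<lbrakk>Tri A x B y C \<delta>; f \<in> H (Suc i) C T; f \<odot> y = 0\<rbrakk> \<Longrightarrow> \<exists>g\<in>H i A T. f = g \<odot> \<delta>"
    and enough_proj: "C \<in> Obj \<Longrightarrow> \<exists>K q P p \<omega>. Tri K q P p C \<omega> \<and> (\<forall>i X. H (Suc i) P X \<subseteq> {0})"
    and enough_inj: "A \<in> Obj \<Longrightarrow> \<exists>x J y S \<omega>. Tri A x J y S \<omega> \<and> (\<forall>i X. H (Suc i) X J \<subseteq> {0})"
begin

lemma dual_long_exact:
  "long_exact_category (\<lambda>x y. y \<odot> x) u Obj (\<lambda>i A B. H i B A) I (\<lambda>A x B y C \<delta>. Tri C y B x A \<delta>)"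
proof -
  interpret d: triangle_category "\<lambda>x y. y \<odot> x" u Obj "\<lambda>i A B. H i B A" I "\<lambda>A x B y C \<delta>. Tri C y B x A \<delta>"
    by (rule dual_triangle_category)
  show ?thesis
  proof (unfold_locales, goal_cases)
    case (1 A x B y C \<delta> f i T) then show ?case by (rule con_mid)
  next
    case (2 A x B y C \<delta> f i T) then show ?case by (rule con_left)
  next
    case (3 A x B y C \<delta> f i T) then show ?case by (rule con_right)
  next
    case (4 A x B y C \<delta> f i T) then show ?case by (rule cov_mid)
  next
    case (5 A x B y C \<delta> f i T) then show ?case by (rule cov_right)
  next
    case (6 A x B y C \<delta> f i T) then show ?case by (rule cov_left)
  next
    case (7 A) then show ?case using enough_inj[OF 7] by metis
  next
    case (8 A) then show ?case using enough_proj[OF 8] by metis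
  qed
qed

end

sublocale suspended_category \<subseteq> long_exact_category
proof
  fix C assume "C \<in> Obj"
  then obtain K q P p \<omega> where "Tri K q P p C \<omega>" "\<And>X. H (Suc 0) P X \<subseteq> {0}" using proj1 by blast
  then show "\<exists>K q P p \<omega>. Tri K q P p C \<omega> \<and> (\<forall>i X. H (Suc i) P X \<subseteq> {0})" using proj_vanish by blast
next
  fix A assume "A \<in> Obj"
  then obtain x J y S \<omega> where "Tri A x J y S \<omega>" "\<And>X. H (Suc 0) X J \<subseteq> {0}" using inj1 by blast
  then show "\<exists>x J y S \<omega>. Tri A x J y S \<omega> \<and> (\<forall>i X. H (Suc i) X J \<subseteq> {0})" using inj_vanish by blast
qed (rule long_cov_mid long_cov_right long_cov_left long_con_mid long_con_left long_con_right; assumption)+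

section \<open>Decompositions over a cluster tilting subcategory\<close>

text \<open>Projectivity and injectivity enter (c1) and (c2) through the vanishing of all positive
  degrees, and injectivity of a composition map through its kernel. These shapes are preserved by
  reversal of the product.\<close>

locale tilting_category = long_exact_category +
  fixes T :: "'b set" and n :: nat
  assumes n_pos: "1 \<le> n"
    and W_infl: "\<lbrakk>Tri A (g \<odot> f) D y C \<delta>; f \<in> H 0 A B; g \<in> H 0 B D\<rbrakk> \<Longrightarrow> \<exists>y C \<delta>. Tri A f B y C \<delta>"
    and W_defl: "\<lbrakk>Tri K x A (g \<odot> f) D \<delta>; f \<in> H 0 A B; g \<in> H 0 B D\<rbrakk> \<Longrightarrow> \<exists>K x \<delta>. Tri K x B g D \<delta>"
    and T_Obj: "X \<in> T \<Longrightarrow> X \<in> Obj"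
    and T_vanish: "\<lbrakk>X \<in> T; Y \<in> T; 1 \<le> i; i < n; f \<in> H i X Y\<rbrakk> \<Longrightarrow> f = 0"
    and T_memI: "\<lbrakk>X \<in> Obj; \<And>i Y f. \<lbrakk>1 \<le> i; i < n; Y \<in> T; f \<in> H i X Y\<rbrakk> \<Longrightarrow> f = 0\<rbrakk> \<Longrightarrow> X \<in> T"
    and T_memI': "\<lbrakk>X \<in> Obj; \<And>i Y f. \<lbrakk>1 \<le> i; i < n; Y \<in> T; f \<in> H i Y X\<rbrakk> \<Longrightarrow> f = 0\<rbrakk> \<Longrightarrow> X \<in> T"
    and right_approx: "X \<in> Obj \<Longrightarrow> \<exists>Y\<in>T. \<exists>r\<in>H 0 Y X. \<forall>Y'\<in>T. \<forall>f\<in>H 0 Y' X. \<exists>g\<in>H 0 Y' Y. f = r \<odot> g"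
    and left_approx: "X \<in> Obj \<Longrightarrow> \<exists>Y\<in>T. \<exists>l\<in>H 0 X Y. \<forall>Y'\<in>T. \<forall>f\<in>H 0 X Y'. \<exists>g\<in>H 0 Y Y'. f = g \<odot> l"
    and c1: "\<lbrakk>2 \<le> n; Z \<in> Obj; \<forall>X\<in>T. \<forall>f\<in>H (n - 1) X Z. f = 0\<rbrakk> \<Longrightarrow>
       \<exists>D q P p \<delta>. Tri D q P p Z \<delta> \<and> (\<forall>i X. H (Suc i) P X \<subseteq> {0}) \<and> (\<forall>X\<in>T. \<forall>f\<in>H 0 X D. q \<odot> f = 0 \<longrightarrow> f = 0)"
    and c2: "\<lbrakk>2 \<le> n; A \<in> Obj; \<forall>X\<in>T. \<forall>f\<in>H (n - 1) A X. f = 0\<rbrakk> \<Longrightarrow>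
       \<exists>x J j S \<delta>. Tri A x J j S \<delta> \<and> (\<forall>i X. H (Suc i) X J \<subseteq> {0}) \<and> (\<forall>X\<in>T. \<forall>f\<in>H 0 S X. f \<odot> j = 0 \<longrightarrow> f = 0)"
begin

lemma dual_tilting:
  "tilting_category (\<lambda>x y. y \<odot> x) u Obj (\<lambda>i A B. H i B A) I (\<lambda>A x B y C \<delta>. Tri C y B x A \<delta>) T n"
proof -
  interpret d: long_exact_category "\<lambda>x y. y \<odot> x" u Obj "\<lambda>i A B. H i B A" I "\<lambda>A x B y C \<delta>. Tri C y B x A \<delta>"
    by (rule dual_long_exact)
  show ?thesis
  proof (unfold_locales, goal_cases)
    case 1 show ?case by (rule n_pos)
  next
    case (2 A g f D y C \<delta> B) then show ?case using W_defl by blast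
  next
    case (3 K x A g f D \<delta> B) then show ?case using W_infl by blast
  next
    case 4 then show ?case by (rule T_Obj)
  next
    case (5 X Y i f) then show ?case using T_vanish by blast
  next
    case (6 X) then show ?case using T_memI' by blast
  next
    case (7 X) then show ?case using T_memI by blast
  next
    case (8 X) then show ?case using left_approx by blast
  next
    case (9 X) then show ?case using right_approx by blast
  next
    case (10 Z) then show ?case using c2[of Z] by blast
  next
    case (11 Z) then show ?case using c1[of Z] by blast
  qed
qed

lemma T_bip: assumes b: "bip A B S i1 i2 p1 p2" and "A \<in> T" "B \<in> T" shows "S \<in> T"
proof (rule T_memI)
  note bD = bip_D[OF b]
  show "S \<in> Obj" by (rule bD)
  fix i Y f assume *: "1 \<le> i" "i < n" "Y \<in> T" "f \<in> H i S Y"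
  have "f \<odot> i1 = 0" "f \<odot> i2 = 0" using T_vanish * assms(2,3) H_mul0'[OF *(4)] bD by blast+
  then have "f \<odot> (i1 \<odot> p1 + i2 \<odot> p2) = 0" by (simp add: mul_add_right mul_ext)
  then show "f = 0" using bD id_right[OF *(4)] by simp
qed

lemma T_inj: "\<lbrakk>J \<in> Obj; \<And>i X. H (Suc i) X J \<subseteq> {0}\<rbrakk> \<Longrightarrow> J \<in> T"
  by (rule T_memI') (auto simp: Suc_le_eq gr0_conv_Suc)

text \<open>By (c1) there is a syzygy triangle of Z whose map \<open>q\<close> is monic on T. Since
  \<open>\<epsilon>\<close> dies on P, it is the push of \<open>\<delta>\<close> along some
  \<open>a\<close>, and \<open>cocone\<close> yields a triangle from D over the sum of M and P to X.
  A map \<open>f\<close> killed by \<open>m\<close> comes from D by a \<open>g\<close> with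
  \<open>q \<odot> g = 0\<close>, so it vanishes.\<close>

lemma tri_mono_of_vanish:
  assumes t: "Tri M m X e Z \<epsilon>" and n: "2 \<le> n" and v: "\<And>Y f. \<lbrakk>Y \<in> T; f \<in> H (n - 1) Y Z\<rbrakk> \<Longrightarrow> f = 0"
    and f: "f \<in> H 0 Y M" "Y \<in> T" "m \<odot> f = 0"
  shows "f = 0"
proof -
  note tD = tri_D[OF t]
  obtain D q P p \<delta> where r: "Tri D q P p Z \<delta>" and P: "\<And>i X. H (Suc i) P X \<subseteq> {0}"
    and q: "\<And>X f. \<lbrakk>X \<in> T; f \<in> H 0 X D; q \<odot> f = 0\<rbrakk> \<Longrightarrow> f = 0"
    using c1[OF n tD(3)] v by blast
  note rD = tri_D[OF r]
  have "\<epsilon> \<odot> p = 0" using P H_mul0'[OF tD(6) rD(5)] by blast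
  then obtain a where a: "a \<in> H 0 D M" "\<epsilon> = a \<odot> \<delta>" using exact_ext_right[OF r tD(6)] by blast
  obtain h S i1 i2 p1 p2 where h: "h \<in> H 0 P X" and b: "bip M P S i1 i2 p1 p2"
    and t2: "Tri D (i1 \<odot> a + i2 \<odot> q) S (h \<odot> p2 - m \<odot> p1) X (\<delta> \<odot> e)"
    using cocone[OF r t[unfolded a(2)] a(1)] by blast
  note bD = bip_D[OF b] and bS = bip_mul[OF b]
  have "(h \<odot> p2 - m \<odot> p1) \<odot> (i1 \<odot> f) = 0" by (simp add: mul_simps bS(1-4) bS(5)[OF f(1)] f(3))
  then obtain g where g: "g \<in> H 0 Y D" "i1 \<odot> f = (i1 \<odot> a + i2 \<odot> q) \<odot> g"
    using tri_cov_mid[OF t2 H_mul0[OF bD(4) f(1)]] by blast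
  have "p2 \<odot> (i1 \<odot> f) = q \<odot> g"
    unfolding g(2) by (simp add: mul_simps bS(1-4) bS(6)[OF H_mul0[OF rD(4) g(1)]])
  then have "g = 0" using q[OF f(2) g(1)] by (simp add: bS)
  then have "i1 \<odot> f = 0" using g by simp
  then show "f = 0" using bS(5)[OF f(1)] by simp
qed

end

context tilting_category begin

interpretation dual: tilting_category "\<lambda>x y. y \<odot> x" u Obj "\<lambda>i A B. H i B A" I
    "\<lambda>A x B y C \<delta>. Tri C y B x A \<delta>" T n
  by (rule dual_tilting)

lemmas tri_epi_of_vanish = dual.tri_mono_of_vanish

end

section \<open>Dimension shifting along chains of triangles\<close>

context tilting_category begin

text \<open>\<open>pr \<epsilon> i k\<close> is the product \<open>\<epsilon> (i + 1) \<odot> \<dots> \<odot> \<epsilon> (i + k)\<close>.\<close>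

primrec pr where
  "pr \<epsilon> i 0 = u"
| "pr \<epsilon> i (Suc k) = \<epsilon> (Suc i) \<odot> pr \<epsilon> (Suc i) k"

lemma pr_snoc: "pr \<epsilon> i (Suc k) = pr \<epsilon> i k \<odot> \<epsilon> (Suc (i + k))"
proof (induction k arbitrary: i)
  case (Suc k)
  have "pr \<epsilon> i (Suc (Suc k)) = \<epsilon> (Suc i) \<odot> (pr \<epsilon> (Suc i) k \<odot> \<epsilon> (Suc (Suc i + k)))"
    by (simp only: pr.simps(2)[of _ i] Suc.IH)
  then show ?case by (simp add: mul_assoc)
qed simp

lemma pr_cong: "(\<And>j. i < j \<Longrightarrow> j \<le> i + k \<Longrightarrow> \<epsilon> j = \<epsilon>' j) \<Longrightarrow> pr \<epsilon> i k = pr \<epsilon>' i k"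
  by (induction k arbitrary: i) auto

text \<open>The end \<open>b\<close> may be smaller than n, which covers decompositions still under
  construction. The middle terms lie in T, but no \<open>M i\<close> is required to.\<close>

definition chain where
  "chain a b X M m e \<epsilon> \<longleftrightarrow> (\<forall>i. a \<le> i \<and> i < b \<longrightarrow>
     Tri (M i) (m i) (X (Suc i)) (e (Suc i)) (M (Suc i)) (\<epsilon> (Suc i)) \<and> X (Suc i) \<in> T)"

lemma chain_D:
  assumes "chain a b X M m e \<epsilon>" "a \<le> i" "i < b"
  shows "Tri (M i) (m i) (X (Suc i)) (e (Suc i)) (M (Suc i)) (\<epsilon> (Suc i))" "X (Suc i) \<in> T"
  using assms unfolding chain_def by blast+

lemma pr_H:
  assumes "chain a b X M m e \<epsilon>" "a \<le> i" "i + k \<le> b" "0 < k"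
  shows "pr \<epsilon> i k \<in> H k (M (i + k)) (M i)"
  using assms
proof (induction k arbitrary: i)
  case (Suc k)
  have e: "\<epsilon> (Suc i) \<in> H (Suc 0) (M (Suc i)) (M i)"
    using tri_D(6)[OF chain_D(1)[OF Suc.prems(1), of i]] Suc.prems by simp
  show ?case
  proof (cases "k = 0")
    case True then show ?thesis using e by simp
  next
    case False
    then have "pr \<epsilon> (Suc i) k \<in> H k (M (Suc i + k)) (M (Suc i))" using Suc.prems by (intro Suc.IH) auto
    then show ?thesis using H_mul1[OF e] by simp
  qed
qed simp

lemma pr_mul_H:
  assumes "chain a b X M m e \<epsilon>" "a \<le> i" "i + k \<le> b" "f \<in> H j Y (M (i + k))"
  shows "pr \<epsilon> i k \<odot> f \<in> H (j + k) Y (M i)"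
  using assms(4) H_mul[OF pr_H[OF assms(1-3)]] by (cases "k = 0") auto

lemma mul_pr_H:
  assumes "chain a b X M m e \<epsilon>" "a \<le> i" "i + k \<le> b" "f \<in> H j (M i) Y"
  shows "f \<odot> pr \<epsilon> i k \<in> H (k + j) (M (i + k)) Y"
  using assms(4) H_mul[OF assms(4) pr_H[OF assms(1-3)]] by (cases "k = 0") auto

text \<open>An element killed by one \<open>\<epsilon>\<close> lifts to the middle term of its
  triangle, where degrees 1 to n - 1 vanish on T. The bound \<open>j + k \<le> n\<close> keeps every
  degree at which this is used inside that range.\<close>

lemma chain_push_zero:
  assumes "chain a b X M m e \<epsilon>" "a \<le> i" "i + k \<le> b" "Y \<in> T" "1 \<le> j" "j + k \<le> n"
    "f \<in> H j Y (M (i + k))" "pr \<epsilon> i k \<odot> f = 0"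
  shows "f = 0"
  using assms(3,5-8)
proof (induction k arbitrary: j f)
  case (Suc k)
  note t = chain_D[OF assms(1), of "i + k"]
  have t: "Tri (M (i + k)) (m (i + k)) (X (Suc (i + k))) (e (Suc (i + k))) (M (i + Suc k)) (\<epsilon> (Suc (i + k)))"
    "X (Suc (i + k)) \<in> T" using t assms(2) Suc.prems by auto
  have "\<epsilon> (Suc (i + k)) \<odot> f = 0"
  proof (rule Suc.IH)
    show "\<epsilon> (Suc (i + k)) \<odot> f \<in> H (Suc j) Y (M (i + k))" by (rule H_mul1[OF tri_D(6)[OF t(1)] Suc.prems(4)])
    show "pr \<epsilon> i k \<odot> (\<epsilon> (Suc (i + k)) \<odot> f) = 0" using Suc.prems(5) by (simp only: pr_snoc mul_assoc)
  qed (use Suc.prems in auto)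
  then obtain g where g: "g \<in> H j Y (X (Suc (i + k)))" "f = e (Suc (i + k)) \<odot> g"
    using cov_right[OF t(1) Suc.prems(4)] by blast
  then show ?case using T_vanish[OF assms(4) t(2) _ _ g(1)] Suc.prems by auto
qed simp

lemma chain_pull_zero:
  assumes "chain a b X M m e \<epsilon>" "a \<le> i" "i + k \<le> b" "Y \<in> T" "1 \<le> j" "j + k \<le> n"
    "f \<in> H j (M i) Y" "f \<odot> pr \<epsilon> i k = 0"
  shows "f = 0"
  using assms(2,3,5-8)
proof (induction k arbitrary: i j f)
  case (Suc k)
  have t: "Tri (M i) (m i) (X (Suc i)) (e (Suc i)) (M (Suc i)) (\<epsilon> (Suc i))" "X (Suc i) \<in> T"
    using chain_D[OF assms(1), of i] Suc.prems by auto
  have "f \<odot> \<epsilon> (Suc i) = 0"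
  proof (rule Suc.IH)
    show "f \<odot> \<epsilon> (Suc i) \<in> H (Suc j) (M (Suc i)) Y" by (rule H_mul1'[OF Suc.prems(5) tri_D(6)[OF t(1)]])
    show "(f \<odot> \<epsilon> (Suc i)) \<odot> pr \<epsilon> (Suc i) k = 0" using Suc.prems(6) by (simp add: mul_assoc)
  qed (use Suc.prems in auto)
  then obtain g where g: "g \<in> H j (X (Suc i)) Y" "f = g \<odot> m i"
    using con_left[OF t(1) Suc.prems(5)] by blast
  then show ?case using T_vanish[OF t(2) assms(4) _ _ g(1)] Suc.prems by auto
qed simp

text \<open>In the covariant variable, shifting towards \<open>M 0\<close> raises the degree by i
  and shifting towards \<open>M n\<close> lowers it by n - i; in the contravariant variable it is
  the other way round. For a full chain with both ends in T, the four lemmas from here on say: for 0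
  < j < n and Y in T, \<open>H j Y (M i)\<close> vanishes unless i + j = n, and
  \<open>H j (M i) Y\<close> vanishes unless i = j.\<close>

lemma chain_vanish_cov_initial:
  assumes "chain 0 b X M m e \<epsilon>" "M 0 \<in> T" "Y \<in> T" "i \<le> b" "1 \<le> j" "i + j < n" "f \<in> H j Y (M i)"
  shows "f = 0"
  using assms(4-7)
proof (induction i arbitrary: j f)
  case 0 then show ?case using T_vanish[OF assms(3,2), of j f] by auto
next
  case (Suc i)
  note t = chain_D[OF assms(1), of i]
  have "\<epsilon> (Suc i) \<odot> f = 0"
    using Suc.IH[of "Suc j"] H_mul1[OF tri_D(6)[OF t(1)] Suc.prems(4)] Suc.prems by simp
  then obtain g where "g \<in> H j Y (X (Suc i))" "f = e (Suc i) \<odot> g"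
    using cov_right[OF t(1) Suc.prems(4)] Suc.prems by auto
  then show ?case using T_vanish[OF assms(3) t(2), of j g] Suc.prems by auto
qed

lemma chain_vanish_cov_final:
  assumes "chain a n X M m e \<epsilon>" "M n \<in> T" "Y \<in> T" "a \<le> i" "i \<le> n" "1 \<le> j" "j < n" "n < i + j" "f \<in> H j Y (M i)"
  shows "f = 0"
  using assms(5,4,6-9)
proof (induction i arbitrary: j f rule: inc_induct)
  case base then show ?case using T_vanish[OF assms(3,2), of j f] by auto
next
  case (step i)
  note t = chain_D[OF assms(1), of i]
  obtain j' where j: "j = Suc j'" "1 \<le> j'" using step.prems step.hyps by (cases j) auto
  have "m i \<odot> f = 0"
    using T_vanish[OF assms(3) t(2) _ _ H_mul0[OF tri_D(4)[OF t(1)] step.prems(5)]] step by simp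
  then obtain g where "g \<in> H j' Y (M (Suc i))" "f = \<epsilon> (Suc i) \<odot> g"
    using cov_left[OF t(1), of f j' Y] step j by auto
  then show ?case using step.IH[of j' g] step.prems j by auto
qed

lemma chain_vanish_con_final:
  assumes "chain a n X M m e \<epsilon>" "M n \<in> T" "Y \<in> T" "a \<le> i" "i \<le> n" "1 \<le> j" "j < i" "f \<in> H j (M i) Y"
  shows "f = 0"
  using assms(5,4,6-8)
proof (induction i arbitrary: j f rule: inc_induct)
  case base then show ?case using T_vanish[OF assms(2,3), of j f] by auto
next
  case (step i)
  note t = chain_D[OF assms(1), of i]
  have "f \<odot> \<epsilon> (Suc i) = 0"
    using step.IH[of "Suc j"] H_mul1'[OF step.prems(4) tri_D(6)[OF t(1)]] step by simp
  then obtain g where "g \<in> H j (X (Suc i)) Y" "f = g \<odot> m i"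
    using con_left[OF t(1) step.prems(4)] step by auto
  then show ?case using T_vanish[OF t(2) assms(3), of j g] step by auto
qed

lemma chain_vanish_con_initial:
  assumes "chain 0 b X M m e \<epsilon>" "M 0 \<in> T" "Y \<in> T" "i \<le> b" "i < j" "j < n" "f \<in> H j (M i) Y"
  shows "f = 0"
  using assms(4-7)
proof (induction i arbitrary: j f)
  case 0 then show ?case using T_vanish[OF assms(2,3), of j f] by auto
next
  case (Suc i)
  note t = chain_D[OF assms(1), of i]
  obtain j' where j: "j = Suc j'" "1 \<le> j'" using Suc.prems by (cases j) auto
  have "f \<odot> e (Suc i) = 0"
    using T_vanish[OF t(2) assms(3) _ _ H_mul0'[OF Suc.prems(4) tri_D(5)[OF t(1)]]] Suc.prems by simp
  then obtain g where "g \<in> H j' (M i) Y" "f = g \<odot> \<epsilon> (Suc i)"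
    using con_right[OF t(1), of f j' Y] Suc.prems j by auto
  then show ?case using Suc.IH[of j' g] Suc.prems j by auto
qed

text \<open>\<open>tri_epi_of_vanish\<close> applies because degree n - 1 vanishes on
  \<open>M (i - 1)\<close>, an instance of \<open>chain_vanish_con_initial\<close>. Only the
  beginning of a chain enters, so the lemma is available while a decomposition is still being
  built.\<close>

lemma chain_epi:
  assumes "chain 0 b X M m e \<epsilon>" "M 0 \<in> T" "e 0 = I (M 0)" "i \<le> b" "i < n" "Y \<in> T" "f \<in> H 0 (M i) Y" "f \<odot> e i = 0"
  shows "f = 0"
proof (cases i)
  case 0 then show ?thesis using assms id_right by simp
next
  case (Suc k)
  have t: "Tri (M k) (m k) (X (Suc k)) (e (Suc k)) (M (Suc k)) (\<epsilon> (Suc k))"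
    using chain_D[OF assms(1), of k] Suc assms by auto
  show ?thesis
  proof (rule tri_epi_of_vanish[OF t _ _ _ assms(6)])
    show "2 \<le> n" using assms Suc by simp
    fix Y f assume "Y \<in> T" "f \<in> H (n - 1) (M k) Y"
    then show "f = 0" using chain_vanish_con_initial[OF assms(1,2), of Y k "n - 1" f] assms Suc by auto
  qed (use assms Suc in auto)
qed

section \<open>Decomposed complexes and their exactness\<close>

text \<open>With the conventions \<open>e 0 = 1\<close> and \<open>m n = 1\<close> the equation \<open>d i = m i \<odot> e i\<close> holds in all degrees,
  the ends included.\<close>

definition dec where
  "dec X d \<delta> M m e \<epsilon> \<longleftrightarrow> chain 0 n X M m e \<epsilon> \<and> X 0 \<in> T \<and> X (Suc n) \<in> T \<and> M 0 = X 0 \<and> M n = X (Suc n) \<and>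
     e 0 = I (X 0) \<and> m n = I (X (Suc n)) \<and> (\<forall>i\<le>n. d i = m i \<odot> e i) \<and> \<delta> = pr \<epsilon> 0 n"

lemma dec_D:
  assumes "dec X d \<delta> M m e \<epsilon>"
  shows "chain 0 n X M m e \<epsilon>" "X 0 \<in> T" "X (Suc n) \<in> T" "M 0 = X 0" "M n = X (Suc n)"
    "e 0 = I (X 0)" "m n = I (X (Suc n))" "\<And>i. i \<le> n \<Longrightarrow> d i = m i \<odot> e i" "\<delta> = pr \<epsilon> 0 n"
    "i < n \<Longrightarrow> Tri (M i) (m i) (X (Suc i)) (e (Suc i)) (M (Suc i)) (\<epsilon> (Suc i))"
  using assms unfolding dec_def chain_def by auto

text \<open>The needed vanishing of \<open>H (n - 1) Y (M (Suc i))\<close> comes from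
  \<open>chain_vanish_cov_final\<close>, which asks that i + 1 plus n - 1 exceed n. This is the
  origin of the condition \<open>1 \<le> i\<close>.\<close>

lemma dec_mono:
  assumes D: "dec X d \<delta> M m e \<epsilon>" and "1 \<le> i" "i \<le> n" "Y \<in> T" "f \<in> H 0 Y (M i)" "m i \<odot> f = 0"
  shows "f = 0"
proof (cases "i = n")
  case True then show ?thesis using assms dec_D[OF D] id_left by metis
next
  case False
  have t: "Tri (M i) (m i) (X (Suc i)) (e (Suc i)) (M (Suc i)) (\<epsilon> (Suc i))"
    using dec_D(10)[OF D] False assms(3) by auto
  show ?thesis
  proof (rule tri_mono_of_vanish[OF t _ _ _ assms(4)])
    show "2 \<le> n" using assms False by simp
    fix Y f assume "Y \<in> T" "f \<in> H (n - 1) Y (M (Suc i))"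
    then show "f = 0" using chain_vanish_cov_final[OF dec_D(1)[OF D], of Y "Suc i" "n - 1" f] dec_D(3,5)[OF D] assms False by auto
  qed (use assms in auto)
qed

lemma dec_epi:
  assumes D: "dec X d \<delta> M m e \<epsilon>" and "i < n" "Y \<in> T" "f \<in> H 0 (M i) Y" "f \<odot> e i = 0"
  shows "f = 0"
  using chain_epi[OF dec_D(1)[OF D]] dec_D[OF D] assms by auto

lemma dec_m: assumes D: "dec X d \<delta> M m e \<epsilon>" shows "i \<le> n \<Longrightarrow> m i \<in> H 0 (M i) (X (Suc i))"
    and "i \<le> n \<Longrightarrow> e i \<in> H 0 (X i) (M i)" and "i \<le> n \<Longrightarrow> d i \<in> H 0 (X i) (X (Suc i))"
    and "i \<le> Suc n \<Longrightarrow> X i \<in> T" and "1 \<le> i \<Longrightarrow> i \<le> n \<Longrightarrow> \<epsilon> i \<in> H (Suc 0) (M i) (M (i - 1))"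
    and "i \<le> n \<Longrightarrow> M i \<in> Obj"
proof -
  note DD = dec_D[OF D]
  show m: "m i \<in> H 0 (M i) (X (Suc i))" if "i \<le> n" for i
    using tri_D(4)[OF DD(10)] DD(5,7) H_id[OF T_Obj[OF DD(3)]] that by (cases "i = n") auto
  show e: "e i \<in> H 0 (X i) (M i)" if "i \<le> n" for i
    using tri_D(5)[OF DD(10)] DD(4,6) H_id[OF T_Obj[OF DD(2)]] that by (cases i) auto
  show "i \<le> n \<Longrightarrow> d i \<in> H 0 (X i) (X (Suc i))" using H_mul0[OF m e] DD(8) by simp
  show "i \<le> Suc n \<Longrightarrow> X i \<in> T" using chain_D(2)[OF DD(1), of "i - 1"] DD(2,3) by (cases "i = 0"; cases "i = Suc n") auto
  show "1 \<le> i \<Longrightarrow> i \<le> n \<Longrightarrow> \<epsilon> i \<in> H (Suc 0) (M i) (M (i - 1))"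
    using tri_D(6)[OF DD(10), of "i - 1"] by simp
  show "i \<le> n \<Longrightarrow> M i \<in> Obj" using e H_trg by blast
qed

text \<open>As \<open>m (Suc i)\<close> is monic on T, \<open>f\<close> already dies under
  \<open>e (Suc i)\<close> and comes from \<open>M i\<close>. The obstruction to lifting it further
  along \<open>e i\<close> lies in degree 1 from Y to \<open>M (i - 1)\<close>, where everything
  vanishes.\<close>

lemma dec_exact_cov:
  assumes D: "dec X d \<delta> M m e \<epsilon>" and i: "i < n" and Y: "Y \<in> T" and f: "f \<in> H 0 Y (X (Suc i))" "d (Suc i) \<odot> f = 0"
  shows "\<exists>g\<in>H 0 Y (X i). f = d i \<odot> g"
proof -
  note DD = dec_D[OF D] and t = dec_D(10)[OF D i]
  have "e (Suc i) \<odot> f = 0"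
    by (rule dec_mono[OF D, of "Suc i" Y]) (use i Y f DD(8)[of "Suc i"] H_mul0[OF tri_D(5)[OF t] f(1)] in \<open>auto simp: mul_assoc\<close>)
  then obtain g where g: "g \<in> H 0 Y (M i)" "f = m i \<odot> g" using tri_cov_mid[OF t f(1)] by blast
  show ?thesis
  proof (cases i)
    case 0
    have gX: "g \<in> H 0 Y (X 0)" using g(1) DD(4) 0 by simp
    then show ?thesis using g(2) DD(6) DD(8)[of 0] id_left[OF gX] 0 by (intro bexI[of _ g]) (auto simp: mul_assoc)
  next
    case (Suc k)
    note t' = dec_D(10)[OF D, of k]
    have t': "Tri (M k) (m k) (X i) (e i) (M i) (\<epsilon> i)" using t' Suc i by simp
    have "\<epsilon> i \<odot> g = 0"
      using chain_vanish_cov_initial[OF DD(1) _ Y, of k "Suc 0"] DD(2,4) H_mul1[OF tri_D(6)[OF t'] g(1)] i Suc by auto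
    then obtain h where "h \<in> H 0 Y (X i)" "g = e i \<odot> h" using tri_cov_right[OF t' g(1)] by blast
    then show ?thesis using g DD(8)[of i] i by (auto simp: mul_assoc)
  qed
qed

lemma dec_exact_con:
  assumes D: "dec X d \<delta> M m e \<epsilon>" and i: "i < n" and Y: "Y \<in> T" and f: "f \<in> H 0 (X (Suc i)) Y" "f \<odot> d i = 0"
  shows "\<exists>g\<in>H 0 (X (Suc (Suc i))) Y. f = g \<odot> d (Suc i)"
proof -
  note DD = dec_D[OF D] and t = dec_D(10)[OF D i]
  have "f \<odot> m i = 0"
    by (rule dec_epi[OF D i Y]) (use i Y f DD(8)[of i] H_mul0[OF f(1) tri_D(4)[OF t]] in \<open>auto simp: mul_assoc\<close>)
  then obtain g where g: "g \<in> H 0 (M (Suc i)) Y" "f = g \<odot> e (Suc i)" using tri_con_mid[OF t f(1)] by blast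
  show ?thesis
  proof (cases "Suc i = n")
    case True
    have "g \<odot> m (Suc i) = g" using True DD(5,7) id_right[OF g(1)] by simp
    then show ?thesis using g DD(5) DD(8)[of "Suc i"] True by (intro bexI[of _ g]) (auto simp: mul_ext)
  next
    case False
    then have t': "Tri (M (Suc i)) (m (Suc i)) (X (Suc (Suc i))) (e (Suc (Suc i))) (M (Suc (Suc i))) (\<epsilon> (Suc (Suc i)))"
      using dec_D(10)[OF D, of "Suc i"] i by simp
    have "g \<odot> \<epsilon> (Suc (Suc i)) = 0"
      using chain_vanish_con_final[OF DD(1) _ Y, of "Suc (Suc i)" "Suc 0"] DD(3,5) H_mul1'[OF g(1) tri_D(6)[OF t']] i False by auto
    then obtain h where "h \<in> H 0 (X (Suc (Suc i))) Y" "g = h \<odot> m (Suc i)" using tri_con_left[OF t' g(1)] by blast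
    then show ?thesis using g DD(8)[of "Suc i"] i by (auto simp: mul_assoc)
  qed
qed

text \<open>All factors of \<open>\<delta>\<close> but the last can be cancelled on T by
  \<open>chain_push_zero\<close>, which leaves exactness of the last triangle.\<close>

lemma dec_exact_cov_end:
  assumes D: "dec X d \<delta> M m e \<epsilon>" and Y: "Y \<in> T" and f: "f \<in> H 0 Y (X (Suc n))" "\<delta> \<odot> f = 0"
  shows "\<exists>g\<in>H 0 Y (X n). f = d n \<odot> g"
proof -
  note DD = dec_D[OF D]
  obtain k where k: "n = Suc k" using n_pos by (cases n) auto
  have t: "Tri (M k) (m k) (X n) (e n) (X (Suc n)) (\<epsilon> n)" using DD(5) DD(10)[of k] k by simp
  have "\<epsilon> n \<odot> f = 0"
    using chain_push_zero[OF DD(1), of 0 k Y "Suc 0"] Y H_mul1[OF tri_D(6)[OF t] f(1)] f(2) k DD(9)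
    by (auto simp: pr_snoc mul_assoc simp del: pr.simps)
  then obtain g where "g \<in> H 0 Y (X n)" "f = e n \<odot> g" using tri_cov_right[OF t f(1)] by blast
  moreover have "d n = e n" using DD(7) DD(8)[of n] tri_D(14)[OF t] by simp
  ultimately show ?thesis by auto
qed

lemma dec_exact_con_end:
  assumes D: "dec X d \<delta> M m e \<epsilon>" and Y: "Y \<in> T" and f: "f \<in> H 0 (X 0) Y" "f \<odot> \<delta> = 0"
  shows "\<exists>g\<in>H 0 (X (Suc 0)) Y. f = g \<odot> d 0"
proof -
  note DD = dec_D[OF D]
  obtain k where k: "n = Suc k" using n_pos by (cases n) auto
  have t: "Tri (X 0) (m 0) (X (Suc 0)) (e (Suc 0)) (M (Suc 0)) (\<epsilon> (Suc 0))"
    using DD(4) DD(10)[of 0] k by simp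
  have "f \<odot> \<epsilon> (Suc 0) = 0"
    using chain_pull_zero[OF DD(1), of "Suc 0" k Y "Suc 0"] Y H_mul1'[OF f(1) tri_D(6)[OF t]] f(2) k DD(9)
    by (auto simp: mul_assoc)
  then obtain g where "g \<in> H 0 (X (Suc 0)) Y" "f = g \<odot> m 0" using tri_con_left[OF t f(1)] by blast
  moreover have "d 0 = m 0" using DD(6) DD(8)[of 0] tri_D(16)[OF t] by simp
  ultimately show ?thesis by auto
qed

lemma dec_zero:
  assumes D: "dec X d \<delta> M m e \<epsilon>"
  shows "i < n \<Longrightarrow> d (Suc i) \<odot> d i = 0" "d 0 \<odot> \<delta> = 0" "\<delta> \<odot> d n = 0" "\<delta> \<in> H n (X (Suc n)) (X 0)"
    "d 0 = m 0" "d n = e n"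
proof -
  note DD = dec_D[OF D]
  obtain k where k: "n = Suc k" using n_pos by (cases n) auto
  show "i < n \<Longrightarrow> d (Suc i) \<odot> d i = 0" using DD(8)[of i] DD(8)[of "Suc i"] tri_D(10)[OF DD(10)]
    by (simp add: mul_assoc)
  show 1: "d 0 = m 0" using DD(6) DD(8)[of 0] tri_D(16)[OF DD(10)[of 0]] DD(4) n_pos by simp
  show 2: "d n = e n" using DD(7) DD(8)[of n] tri_D(14)[OF DD(10)[of k]] DD(5) k by simp
  show "d 0 \<odot> \<delta> = 0" using DD(9) 1 tri_D(12)[OF DD(10)[of 0]] k by simp
  show "\<delta> \<odot> d n = 0" using DD(9) 2 tri_D(8)[OF DD(10)[of k]] k by (simp add: pr_snoc mul_assoc del: pr.simps)
  show "\<delta> \<in> H n (X (Suc n)) (X 0)" using pr_H[OF DD(1), of 0 n] DD(4,5,9) n_pos by simp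
qed

end

section \<open>Lifts and homotopies\<close>

context tilting_category begin

definition cmap where
  "cmap X d Y d' f \<longleftrightarrow> (\<forall>i\<le>Suc n. f i \<in> H 0 (X i) (Y i)) \<and> (\<forall>i\<le>n. f (Suc i) \<odot> d i = d' i \<odot> f i)"

definition cpl where
  "cpl X d \<longleftrightarrow> (\<forall>i\<le>Suc n. X i \<in> T) \<and> (\<forall>i\<le>n. d i \<in> H 0 (X i) (X (Suc i))) \<and> (\<forall>i<n. d (Suc i) \<odot> d i = 0)"

text \<open>Contravariant exactness in the degrees 1 to n, tested against T only. Null-homotopies
  are built from this alone.\<close>

definition con_exact where
  "con_exact X d \<longleftrightarrow> (\<forall>i<n. \<forall>Y\<in>T. \<forall>f\<in>H 0 (X (Suc i)) Y. f \<odot> d i = 0 \<longrightarrow>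
     (\<exists>g\<in>H 0 (X (Suc (Suc i))) Y. f = g \<odot> d (Suc i)))"

text \<open>The component of the homotopy out of degree i + 1 is called \<open>h i\<close>; in
  \<open>homotopic\<close> the index is one higher.\<close>

definition null where
  "null X d Y d' p \<longleftrightarrow> (\<exists>h. (\<forall>i\<le>n. h i \<in> H 0 (X (Suc i)) (Y i)) \<and> p 0 = h 0 \<odot> d 0 \<and>
     (\<forall>i<n. p (Suc i) = h (Suc i) \<odot> d (Suc i) + d' i \<odot> h i) \<and> p (Suc n) = d' n \<odot> h n)"

lemma dec_cpl: assumes D: "dec X d \<delta> M m e \<epsilon>" shows "cpl X d"
  unfolding cpl_def using dec_m(3,4)[OF D] dec_zero(1)[OF D] by blast

lemma dec_con_exact: "dec X d \<delta> M m e \<epsilon> \<Longrightarrow> con_exact X d"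
  unfolding con_exact_def using dec_exact_con by blast

lemma con_exact_D:
  "\<lbrakk>con_exact X d; i < n; Y \<in> T; f \<in> H 0 (X (Suc i)) Y; f \<odot> d i = 0\<rbrakk>
    \<Longrightarrow> \<exists>g\<in>H 0 (X (Suc (Suc i))) Y. f = g \<odot> d (Suc i)"
  unfolding con_exact_def by blast

lemma cpl_D:
  assumes "cpl X d"
  shows "i \<le> Suc n \<Longrightarrow> X i \<in> T" "i \<le> n \<Longrightarrow> d i \<in> H 0 (X i) (X (Suc i))" "i < n \<Longrightarrow> d (Suc i) \<odot> d i = 0"
  using assms unfolding cpl_def by blast+

lemma cmap_D:
  assumes "cmap X d Y d' f"
  shows "i \<le> Suc n \<Longrightarrow> f i \<in> H 0 (X i) (Y i)" "i \<le> n \<Longrightarrow> f (Suc i) \<odot> d i = d' i \<odot> f i"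
  using assms unfolding cmap_def by blast+

lemma cmap_comp:
  assumes f: "cmap X d Y d' f" and g: "cmap Y d' Z d'' g"
  shows "cmap X d Z d'' (\<lambda>i. g i \<odot> f i)"
  unfolding cmap_def
proof (intro conjI allI impI)
  fix i assume i: "i \<le> n"
  have "(g (Suc i) \<odot> f (Suc i)) \<odot> d i = g (Suc i) \<odot> (d' i \<odot> f i)"
    by (simp add: mul_assoc cmap_D(2)[OF f i])
  also have "\<dots> = d'' i \<odot> (g i \<odot> f i)" using mul_ext[OF cmap_D(2)[OF g i]] by (simp add: mul_assoc)
  finally show "(g (Suc i) \<odot> f (Suc i)) \<odot> d i = d'' i \<odot> (g i \<odot> f i)" .
qed (use cmap_D(1)[OF f] cmap_D(1)[OF g] H_mul0 in blast)

lemma cmap_add: "cmap X d Y d' f \<Longrightarrow> cmap X d Y d' g \<Longrightarrow> cmap X d Y d' (\<lambda>i. f i + g i)"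
  unfolding cmap_def by (simp add: H_add mul_simps)

lemma cmap_diff: "cmap X d Y d' f \<Longrightarrow> cmap X d Y d' g \<Longrightarrow> cmap X d Y d' (\<lambda>i. f i - g i)"
  unfolding cmap_def by (simp add: H_diff mul_simps)

lemma cmap_id: "cpl X d \<Longrightarrow> cmap X d X d (\<lambda>i. I (X i))"
  unfolding cmap_def using cpl_D T_Obj H_id id_left id_right by (metis le_Suc_eq)

lemma pr_comm:
  assumes "\<And>i. i < k \<Longrightarrow> \<phi> i \<odot> \<epsilon> (Suc i) = \<eta> (Suc i) \<odot> \<phi> (Suc i)"
  shows "\<phi> 0 \<odot> pr \<epsilon> 0 k = pr \<eta> 0 k \<odot> \<phi> k"
  using assms
proof (induction k)
  case (Suc k)
  have "\<phi> 0 \<odot> pr \<epsilon> 0 (Suc k) = (\<phi> 0 \<odot> pr \<epsilon> 0 k) \<odot> \<epsilon> (Suc k)"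
    by (simp add: pr_snoc mul_assoc del: pr.simps)
  also have "\<dots> = pr \<eta> 0 k \<odot> (\<phi> k \<odot> \<epsilon> (Suc k))" using Suc by (simp add: mul_assoc)
  also have "\<dots> = pr \<eta> 0 (Suc k) \<odot> \<phi> (Suc k)" using Suc.prems[of k]
    by (simp add: pr_snoc mul_assoc del: pr.simps)
  finally show ?case .
qed simp

text \<open>The maps are constructed from the left. The invariant is that \<open>g k\<close> times
  the remaining product of the \<open>\<epsilon>\<close> equals the remaining product of the
  \<open>\<eta>\<close> times \<open>c\<close>. For k = 0 this is the assumption; when one factor
  remains it says that \<open>c\<close> itself can serve as the last map.\<close>

lemma dec_syzygy_lift:
  assumes D: "dec X d \<delta> M m e \<epsilon>" and D': "dec Y d' \<rho> N m' e' \<eta>"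
    and a: "a \<in> H 0 (X 0) (Y 0)" and c: "c \<in> H 0 (X (Suc n)) (Y (Suc n))" and ac: "a \<odot> \<delta> = \<rho> \<odot> c"
  shows "\<exists>g. g 0 = a \<and> g n = c \<and> (\<forall>i\<le>n. g i \<in> H 0 (M i) (N i)) \<and>
    (\<forall>i<n. g i \<odot> \<epsilon> (Suc i) = \<eta> (Suc i) \<odot> g (Suc i))"
proof -
  note DD = dec_D[OF D] and DD' = dec_D[OF D']
  have cN: "c \<in> H 0 (M n) (N n)" using c DD(5) DD'(5) by simp
  have ex: "\<exists>g. g 0 = a \<and> (\<forall>i\<le>k. g i \<in> H 0 (M i) (N i)) \<and> (\<forall>i<k. g i \<odot> \<epsilon> (Suc i) = \<eta> (Suc i) \<odot> g (Suc i)) \<and>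
      g k \<odot> pr \<epsilon> k (n - k) = pr \<eta> k (n - k) \<odot> c" if "k < n" for k
    using that
  proof (induction k)
    case 0
    show ?case by (rule exI[of _ "\<lambda>_. a"]) (use a ac DD(4,9) DD'(4,9) in auto)
  next
    case (Suc k)
    then obtain g where g: "g 0 = a" "\<And>i. i \<le> k \<Longrightarrow> g i \<in> H 0 (M i) (N i)"
      "\<And>i. i < k \<Longrightarrow> g i \<odot> \<epsilon> (Suc i) = \<eta> (Suc i) \<odot> g (Suc i)"
      "g k \<odot> pr \<epsilon> k (n - k) = pr \<eta> k (n - k) \<odot> c" by auto
    have nk: "n - k = Suc (n - Suc k)" using Suc.prems by simp
    have k: "k < n" "k \<le> n" "Suc k \<le> n" "Suc k + (n - Suc k) = n" using Suc.prems by auto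
    note t = dec_D(10)[OF D k(1)] and t' = dec_D(10)[OF D' k(1)]
    note tD = tri_D[OF t] and tD' = tri_D[OF t']
    have ge: "g k \<odot> \<epsilon> (Suc k) \<in> H (Suc 0) (M (Suc k)) (N k)" using H_mul0[OF g(2) tD(6)] by simp
    \<comment> \<open>This obstruction dies after multiplication by the remaining factors: the
      invariant turns them into a product beginning with \<open>\<eta> (Suc k)\<close>, which
      \<open>m' k\<close> kills. On T the factors can be cancelled.\<close>
    have "m' k \<odot> (g k \<odot> \<epsilon> (Suc k)) = 0"
    proof (rule chain_pull_zero[OF DD(1), of "Suc k" "n - Suc k" "Y (Suc k)" "Suc 0"])
      show "m' k \<odot> (g k \<odot> \<epsilon> (Suc k)) \<in> H (Suc 0) (M (Suc k)) (Y (Suc k))" by (rule H_mul0[OF tD'(4) ge])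
      have "(m' k \<odot> (g k \<odot> \<epsilon> (Suc k))) \<odot> pr \<epsilon> (Suc k) (n - Suc k) = m' k \<odot> (g k \<odot> pr \<epsilon> k (n - k))"
        unfolding nk by (simp add: mul_assoc)
      also have "\<dots> = 0" unfolding g(4) unfolding nk by (simp add: mul_assoc tD'(12))
      finally show "(m' k \<odot> (g k \<odot> \<epsilon> (Suc k))) \<odot> pr \<epsilon> (Suc k) (n - Suc k) = 0" .
      show "Y (Suc k) \<in> T" using dec_m(4)[OF D'] k by simp
    qed (use k in auto)
    then obtain h where h: "h \<in> H 0 (M (Suc k)) (N (Suc k))" "g k \<odot> \<epsilon> (Suc k) = \<eta> (Suc k) \<odot> h"
      using exact_ext_left[OF t' ge] by blast
    let ?L = "h \<odot> pr \<epsilon> (Suc k) (n - Suc k)" and ?R = "pr \<eta> (Suc k) (n - Suc k) \<odot> c"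
    have L: "?L \<in> H (n - Suc k) (M n) (N (Suc k))"
      using mul_pr_H[OF DD(1), of "Suc k" "n - Suc k" h 0] h(1) k by simp
    have R: "?R \<in> H (n - Suc k) (M n) (N (Suc k))"
      using pr_mul_H[OF DD'(1), of "Suc k" "n - Suc k" c 0] cN k by simp
    have "\<eta> (Suc k) \<odot> (?L - ?R) = 0"
      using g(4) unfolding nk by (simp add: mul_simps mul_ext[OF h(2)[symmetric]])
    then obtain \<kappa> where \<kappa>: "\<kappa> \<in> H (n - Suc k) (M n) (Y (Suc k))" "?L - ?R = e' (Suc k) \<odot> \<kappa>"
      using cov_right[OF t' H_diff[OF L R]] by blast
    \<comment> \<open>Both ends of \<open>\<kappa>\<close> lie in T and its degree is between 1 and
      n - 1. Hence the invariant holds for \<open>h\<close> without any further correction.\<close>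
    have "\<kappa> = 0" by (rule T_vanish[OF _ _ _ _ \<kappa>(1)]) (use DD(3,5) dec_m(4)[OF D', of "Suc k"] Suc.prems in auto)
    then have LR: "?L = ?R" using \<kappa>(2) by simp
    show ?case
    proof (rule exI[of _ "g(Suc k := h)"], intro conjI allI impI)
      show "(g(Suc k := h)) i \<odot> \<epsilon> (Suc i) = \<eta> (Suc i) \<odot> (g(Suc k := h)) (Suc i)" if "i < Suc k" for i
        using that g(3) h(2) by (cases "i = k") auto
    qed (use g h LR in \<open>auto simp: le_Suc_eq\<close>)
  qed
  obtain k where k: "n = Suc k" using n_pos by (cases n) auto
  then obtain g where g: "g 0 = a" "\<And>i. i \<le> k \<Longrightarrow> g i \<in> H 0 (M i) (N i)"
      "\<And>i. i < k \<Longrightarrow> g i \<odot> \<epsilon> (Suc i) = \<eta> (Suc i) \<odot> g (Suc i)"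
      "g k \<odot> pr \<epsilon> k (n - k) = pr \<eta> k (n - k) \<odot> c" using ex[of k] by blast
  then have gk: "g k \<odot> \<epsilon> (Suc k) = \<eta> (Suc k) \<odot> c" using k by simp
  show ?thesis
    by (rule exI[of _ "g(n := c)"]) (use g(1-3) gk cN k in \<open>auto simp: le_Suc_eq less_Suc_eq\<close>)
qed

lemma dec_lift:
  assumes D: "dec X d \<delta> M m e \<epsilon>" and D': "dec Y d' \<rho> N m' e' \<eta>"
    and a: "a \<in> H 0 (X 0) (Y 0)" and c: "c \<in> H 0 (X (Suc n)) (Y (Suc n))" and ac: "a \<odot> \<delta> = \<rho> \<odot> c"
  shows "\<exists>f. cmap X d Y d' f \<and> f 0 = a \<and> f (Suc n) = c"
proof -
  note DD = dec_D[OF D] and DD' = dec_D[OF D']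
  obtain g where g: "g 0 = a" "g n = c" "\<And>i. i \<le> n \<Longrightarrow> g i \<in> H 0 (M i) (N i)"
    "\<And>i. i < n \<Longrightarrow> g i \<odot> \<epsilon> (Suc i) = \<eta> (Suc i) \<odot> g (Suc i)"
    using dec_syzygy_lift[OF assms] by blast
  have "\<forall>i. i < n \<longrightarrow> (\<exists>b\<in>H 0 (X (Suc i)) (Y (Suc i)). b \<odot> m i = m' i \<odot> g i \<and> e' (Suc i) \<odot> b = g (Suc i) \<odot> e (Suc i))"
    using tri_lift[OF dec_D(10)[OF D] dec_D(10)[OF D'] g(3) g(3) g(4)] by auto
  then obtain b where b: "\<And>i. i < n \<Longrightarrow> b i \<in> H 0 (X (Suc i)) (Y (Suc i))"
    "\<And>i. i < n \<Longrightarrow> b i \<odot> m i = m' i \<odot> g i" "\<And>i. i < n \<Longrightarrow> e' (Suc i) \<odot> b i = g (Suc i) \<odot> e (Suc i)"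
    by metis
  define f where "f i = (if i = 0 then a else if i = Suc n then c else b (i - 1))" for i
  have fH: "f i \<in> H 0 (X i) (Y i)" if "i \<le> Suc n" for i
    using that a c b(1)[of "i - 1"] unfolding f_def by auto
  have fm: "f (Suc i) \<odot> m i = m' i \<odot> g i" if "i \<le> n" for i
    using that b(2)[of i] g(2) DD(7) DD'(7) id_left[OF c] id_right[OF c] unfolding f_def by auto
  have fe: "e' i \<odot> f i = g i \<odot> e i" if "i \<le> n" for i
    using that b(3)[of "i - 1"] g(1) DD(6) DD'(6) id_left[OF a] id_right[OF a] n_pos unfolding f_def
    by (cases i) auto
  have "cmap X d Y d' f" unfolding cmap_def
  proof (intro conjI allI impI fH)
    fix i assume i: "i \<le> n"
    show "f (Suc i) \<odot> d i = d' i \<odot> f i"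
      using DD(8)[OF i] DD'(8)[OF i] mul_ext[OF fm[OF i], of "e i"] fe[OF i] by (simp add: mul_assoc)
  qed
  then show ?thesis unfolding f_def by auto
qed

text \<open>The usual induction on degrees, started with \<open>h 0 = 0\<close> because
  \<open>p 0 = 0\<close>. Everything is truncated at \<open>k\<close> since
  \<open>correct_to_identity\<close> applies it to complexes that agree in low degrees only.\<close>

lemma partial_homotopy:
  assumes ex: "con_exact X d" and Y: "cpl Y d'"
    and XO: "\<And>i. i \<le> Suc n \<Longrightarrow> X i \<in> Obj"
    and p: "\<And>i. i \<le> k \<Longrightarrow> p i \<in> H 0 (X i) (Y i)" "\<And>i. i < k \<Longrightarrow> p (Suc i) \<odot> d i = d' i \<odot> p i" "p 0 = 0"
    and k: "k \<le> n"
  shows "\<exists>h. h 0 = 0 \<and> (\<forall>i\<le>k. h i \<in> H 0 (X (Suc i)) (Y i)) \<and>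
    (\<forall>i<k. p (Suc i) = h (Suc i) \<odot> d (Suc i) + d' i \<odot> h i)"
  using p k
proof (induction k)
  case 0
  then show ?case using H_zero XO T_Obj cpl_D(1)[OF Y] by (intro exI[of _ "\<lambda>_. 0"]) auto
next
  case (Suc k)
  then obtain h where h: "h 0 = 0" "\<And>i. i \<le> k \<Longrightarrow> h i \<in> H 0 (X (Suc i)) (Y i)"
    "\<And>i. i < k \<Longrightarrow> p (Suc i) = h (Suc i) \<odot> d (Suc i) + d' i \<odot> h i" by auto
  let ?q = "p (Suc k) - d' k \<odot> h k"
  have q: "?q \<in> H 0 (X (Suc k)) (Y (Suc k))"
    using H_diff[OF Suc.prems(1) H_mul0[OF cpl_D(2)[OF Y] h(2)]] Suc.prems(4) by simp
  have "d' k \<odot> p k = d' k \<odot> (h k \<odot> d k)"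
  proof (cases k)
    case 0 then show ?thesis using h(1) Suc.prems(3) by simp
  next
    case (Suc j)
    then have "d' k \<odot> d' j = 0" using cpl_D(3)[OF Y, of j] \<open>Suc k \<le> n\<close> by simp
    then have "d' k \<odot> (d' j \<odot> h j) = 0" using mul_ext by fastforce
    then show ?thesis using h(3)[of j] Suc by (simp add: mul_simps)
  qed
  then have "?q \<odot> d k = 0" using Suc.prems(2)[of k] by (simp add: mul_simps)
  then obtain g where g: "g \<in> H 0 (X (Suc (Suc k))) (Y (Suc k))" "?q = g \<odot> d (Suc k)"
    using con_exact_D[OF ex _ cpl_D(1)[OF Y] q] Suc.prems(4) by auto
  then have "p (Suc k) = g \<odot> d (Suc k) + d' k \<odot> h k" by (simp add: algebra_simps)
  then show ?case
    by (intro exI[of _ "h(Suc k := g)"]) (use h g in \<open>auto simp: le_Suc_eq less_Suc_eq\<close>)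
qed

text \<open>The homotopy from \<open>partial_homotopy\<close> may fail in degree n + 1, where
  \<open>d n \<odot> h n\<close> need not vanish although \<open>p\<close> does. Multiplying the
  homotopy by \<open>p\<close> repairs this end, at the cost of replacing \<open>p\<close> by its
  square.\<close>

lemma null_square:
  assumes X: "cpl X d" and ex: "con_exact X d" and p: "cmap X d X d p" and z: "p 0 = 0" "p (Suc n) = 0"
  shows "null X d X d (\<lambda>i. p i \<odot> p i)"
proof -
  note pD = cmap_D[OF p]
  obtain h where h: "h 0 = 0" "\<And>i. i \<le> n \<Longrightarrow> h i \<in> H 0 (X (Suc i)) (X i)"
    "\<And>i. i < n \<Longrightarrow> p (Suc i) = h (Suc i) \<odot> d (Suc i) + d i \<odot> h i"
    using partial_homotopy[OF ex X T_Obj[OF cpl_D(1)[OF X]], of n p] pD z by auto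
  show ?thesis unfolding null_def
  proof (rule exI[of _ "\<lambda>i. p i \<odot> h i"], intro conjI allI impI)
    fix i assume i: "i < n"
    have "p (Suc i) \<odot> p (Suc i) = p (Suc i) \<odot> (h (Suc i) \<odot> d (Suc i) + d i \<odot> h i)" using h(3)[OF i] by simp
    also have "\<dots> = (p (Suc i) \<odot> h (Suc i)) \<odot> d (Suc i) + d i \<odot> (p i \<odot> h i)"
      using mul_ext[OF pD(2)[of i], of "h i"] i by (simp add: mul_simps)
    finally show "p (Suc i) \<odot> p (Suc i) = (p (Suc i) \<odot> h (Suc i)) \<odot> d (Suc i) + d i \<odot> (p i \<odot> h i)" .
  qed (use z h(2) H_mul0[OF pD(1)] mul_ext[OF pD(2)[of n, symmetric]] in auto)
qed

lemma null_uminus: "null X d Y d' p \<Longrightarrow> null X d Y d' (\<lambda>i. - p i)"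
  unfolding null_def by (elim exE) (rule_tac x = "\<lambda>i. - h i" in exI, auto simp: H_neg mul_simps)

text \<open>The inverse is g' = 2g - gfg: then g'f - 1 and fg' - 1 are the negative squares of gf -
  1 and fg - 1, which vanish at both ends, so \<open>null_square\<close> applies.\<close>

lemma homotopy_inverse:
  assumes X: "cpl X d" "con_exact X d" and Y: "cpl Y d'" "con_exact Y d'"
    and f: "cmap X d Y d' f" and g: "cmap Y d' X d g" and XY: "X 0 = Y 0" "X (Suc n) = Y (Suc n)"
    and fe: "f 0 = I (X 0)" "f (Suc n) = I (X (Suc n))" and ge: "g 0 = I (X 0)" "g (Suc n) = I (X (Suc n))"
  shows "\<exists>g'. cmap Y d' X d g' \<and> g' 0 = I (X 0) \<and> g' (Suc n) = I (X (Suc n)) \<and>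
    null X d X d (\<lambda>i. g' i \<odot> f i - I (X i)) \<and> null Y d' Y d' (\<lambda>i. f i \<odot> g' i - I (Y i))"
proof -
  let ?g = "\<lambda>i. (g i + g i) - g i \<odot> (f i \<odot> g i)"
  have II: "I (X 0) \<odot> I (X 0) = I (X 0)" "I (X (Suc n)) \<odot> I (X (Suc n)) = I (X (Suc n))"
    using id_left H_id T_Obj cpl_D(1)[OF X(1)] by (meson le0 le_refl)+
  let ?p = "\<lambda>i. g i \<odot> f i - I (X i)" and ?q = "\<lambda>i. f i \<odot> g i - I (Y i)"
  have p: "cmap X d X d ?p" and q: "cmap Y d' Y d' ?q"
    by (intro cmap_diff cmap_comp[OF f g] cmap_comp[OF g f] cmap_id X(1) Y(1))+
  have np: "null X d X d (\<lambda>i. - (?p i \<odot> ?p i))"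
    by (rule null_uminus, rule null_square[OF X p]) (use fe ge II in auto)
  have nq: "null Y d' Y d' (\<lambda>i. - (?q i \<odot> ?q i))"
    by (rule null_uminus, rule null_square[OF Y q]) (use fe ge II XY in auto)
  have gfp: "?g i \<odot> f i - I (X i) = - (?p i \<odot> ?p i)" if "i \<le> Suc n" for i
  proof -
    note id = id_left[OF cmap_D(1)[OF f that]] id_right[OF cmap_D(1)[OF f that]] id_left[OF cmap_D(1)[OF g that]]
      id_left[OF H_id[OF T_Obj[OF cpl_D(1)[OF X(1) that]]]]
    show ?thesis by (simp add: mul_simps id mul_ext[OF id(3)])
  qed
  have fgq: "f i \<odot> ?g i - I (Y i) = - (?q i \<odot> ?q i)" if "i \<le> Suc n" for i
  proof -
    note id = id_left[OF cmap_D(1)[OF f that]] id_right[OF cmap_D(1)[OF g that]] id_left[OF cmap_D(1)[OF g that]]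
      id_left[OF H_id[OF T_Obj[OF cpl_D(1)[OF Y(1) that]]]]
    show ?thesis by (simp add: mul_simps id mul_ext[OF id(1)])
  qed
  have "null X d X d (\<lambda>i. ?g i \<odot> f i - I (X i))" using np gfp unfolding null_def by (elim exE) (rule exI, auto)
  moreover have "null Y d' Y d' (\<lambda>i. f i \<odot> ?g i - I (Y i))" using nq fgq unfolding null_def by (elim exE) (rule exI, auto)
  moreover have "cmap Y d' X d ?g" using cmap_diff[OF cmap_add[OF g g] cmap_comp[OF cmap_comp[OF g f] g]] .
  ultimately show ?thesis using fe ge II by (intro exI[of _ ?g]) auto
qed

end

section \<open>Existence of decompositions\<close>

context long_exact_category begin

text \<open>K is an r-fold syzygy of C and \<open>w\<close> the product of the extensions of the
  projective presentations. Multiplication by \<open>w\<close> shifts positive degrees by r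
  bijectively.\<close>

lemma iterated_syzygy:
  assumes "C \<in> Obj"
  shows "\<exists>K. \<exists>w\<in>H r C K. (\<forall>j A. \<forall>f\<in>H (Suc j + r) C A. \<exists>g\<in>H (Suc j) K A. f = g \<odot> w) \<and>
    (\<forall>j A. \<forall>f\<in>H (Suc j) K A. f \<odot> w = 0 \<longrightarrow> f = 0)"
proof (induction r)
  case 0
  show ?case
  proof (rule exI[of _ C], rule bexI[OF _ H_id[OF assms]], intro conjI allI ballI impI)
    fix j A f assume "f \<in> H (Suc j + 0) C A"
    then show "\<exists>g\<in>H (Suc j) C A. f = g \<odot> I C" using id_right by force
  next
    fix j A f assume "f \<in> H (Suc j) C A" "f \<odot> I C = 0"
    then show "f = 0" using id_right by metis
  qed
next
  case (Suc r)
  then obtain K w where w: "w \<in> H r C K" "\<And>j A f. f \<in> H (Suc j + r) C A \<Longrightarrow> \<exists>g\<in>H (Suc j) K A. f = g \<odot> w"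
    "\<And>j A f. f \<in> H (Suc j) K A \<Longrightarrow> f \<odot> w = 0 \<Longrightarrow> f = 0" by blast
  obtain K' q P p \<omega> where t: "Tri K' q P p K \<omega>" and P: "\<And>i X. H (Suc i) P X \<subseteq> {0}"
    using enough_proj[OF H_trg[OF w(1)]] by blast
  note tD = tri_D[OF t]
  have 1: "\<exists>g\<in>H (Suc j) K' A. f = g \<odot> (\<omega> \<odot> w)" if f: "f \<in> H (Suc j + Suc r) C A" for j A f
  proof -
    obtain g where g: "g \<in> H (Suc (Suc j)) K A" "f = g \<odot> w" using w(2)[of f "Suc j" A] f by auto
    have "g \<odot> p = 0" using P H_mul0'[OF g(1) tD(5)] by blast
    then obtain h where "h \<in> H (Suc j) K' A" "g = h \<odot> \<omega>" using con_right[OF t g(1)] by blast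
    then show ?thesis using g(2) by (auto simp: mul_assoc)
  qed
  have 2: "f = 0" if f: "f \<in> H (Suc j) K' A" "f \<odot> (\<omega> \<odot> w) = 0" for j A f
  proof -
    have "f \<odot> \<omega> = 0" using w(3)[OF H_mul1'[OF f(1) tD(6)]] f(2) by (simp add: mul_assoc)
    then obtain g where "g \<in> H (Suc j) P A" "f = g \<odot> q" using con_left[OF t f(1)] by blast
    then show ?thesis using P by fastforce
  qed
  have "\<omega> \<odot> w \<in> H (Suc r) C K'" by (rule H_mul1[OF tD(6) w(1)])
  then show ?case using 1 2 by blast
qed

end

context tilting_category begin

text \<open>A left approximation need not be an inflation. Adding an inflation into an injective,
  which lies in T, gives a map one component of which is an inflation. By (W) the map itself is one,
  and it is still an approximation.\<close>

lemma left_approx_triangle: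
  assumes Y: "Y \<in> Obj"
  shows "\<exists>m X e N \<nu>. Tri Y m X e N \<nu> \<and> X \<in> T \<and> (\<forall>Z\<in>T. \<forall>f\<in>H 0 Y Z. \<exists>g\<in>H 0 X Z. f = g \<odot> m)"
proof -
  obtain T0 l where l: "T0 \<in> T" "l \<in> H 0 Y T0" "\<And>Z f. Z \<in> T \<Longrightarrow> f \<in> H 0 Y Z \<Longrightarrow> \<exists>g\<in>H 0 T0 Z. f = g \<odot> l"
    using left_approx[OF Y] by blast
  obtain x J y S \<omega> where t: "Tri Y x J y S \<omega>" and J: "\<And>i X. H (Suc i) X J \<subseteq> {0}"
    using enough_inj[OF Y] by blast
  note tD = tri_D[OF t]
  have JT: "J \<in> T" using T_inj[OF tD(2) J] .
  obtain X i1 i2 p1 p2 where b: "bip T0 J X i1 i2 p1 p2" using bip_exists[OF T_Obj[OF l(1)] tD(2)] by blast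
  note bD = bip_D[OF b] and bS = bip_mul[OF b]
  let ?m = "i1 \<odot> l + i2 \<odot> x"
  have m: "?m \<in> H 0 Y X" using bD l(2) tD by (blast intro: H_intros)
  have "p2 \<odot> ?m = x" "p1 \<odot> ?m = l" by (simp_all add: mul_add_right bS(1-4) bS(5)[OF l(2)] bS(6)[OF tD(4)])
  then obtain e N \<nu> where "Tri Y ?m X e N \<nu>" using W_infl[of Y p2 ?m J y S \<omega>, OF _ m bD(7)] t by auto
  moreover have "\<exists>g\<in>H 0 X Z. f = g \<odot> ?m" if "Z \<in> T" "f \<in> H 0 Y Z" for Z f
  proof -
    obtain g where "g \<in> H 0 T0 Z" "f = g \<odot> l" using l(3) \<open>Z \<in> T\<close> \<open>f \<in> H 0 Y Z\<close> by blast
    then show ?thesis using bD(6) \<open>p1 \<odot> ?m = l\<close> H_mul0 mul_assoc by metis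
  qed
  moreover have "X \<in> T" using T_bip[OF b l(1) JT] .
  ultimately show ?thesis by blast
qed

text \<open>Degree 1 on N vanishes because maps from Y to T extend along \<open>m\<close>; a higher
  degree on N comes from one degree lower on Y. So each approximation enlarges the range of
  vanishing by one.\<close>

lemma approx_vanish:
  assumes t: "Tri Y m X e N \<nu>" and X: "X \<in> T" and ap: "\<forall>Z\<in>T. \<forall>f\<in>H 0 Y Z. \<exists>g\<in>H 0 X Z. f = g \<odot> m"
    and v: "\<forall>Z\<in>T. \<forall>i f. 1 \<le> i \<longrightarrow> i < k \<longrightarrow> f \<in> H i Y Z \<longrightarrow> f = 0"
    and f: "Z \<in> T" "1 \<le> j" "j < Suc k" "j < n" "f \<in> H j N Z"
  shows "f = 0"
proof -
  note tD = tri_D[OF t]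
  obtain i where i: "j = Suc i" using f(2) by (cases j) auto
  have "f \<odot> e = 0" using T_vanish[OF X f(1,2,4) H_mul0'[OF f(5) tD(5)]] .
  then obtain g where g: "g \<in> H i Y Z" "f = g \<odot> \<nu>" using con_right[OF t] f(5) i by blast
  show ?thesis
  proof (cases "i = 0")
    case True
    then obtain h where "g = h \<odot> m" using ap f(1) g(1) by blast
    then show ?thesis using g(2) tD by (simp add: mul_assoc)
  next
    case False
    then have "1 \<le> i" "i < k" using f(3) i by auto
    then have "g = 0" using v f(1) g(1) by blast
    then show ?thesis using g(2) by simp
  qed
qed

text \<open>The hypothesis \<open>v\<close> makes the connecting map injective in degrees 1 to n -
  1, which forces elements on Q to come from C.\<close>

lemma snoc_mem:
  assumes t: "Tri N x Q y C \<zeta>" and C: "C \<in> T"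
    and v: "\<And>Z j f. \<lbrakk>Z \<in> T; 1 \<le> j; j < n; f \<in> H j N Z; f \<odot> \<zeta> = 0\<rbrakk> \<Longrightarrow> f = 0"
  shows "Q \<in> T"
proof (rule T_memI)
  note tD = tri_D[OF t]
  show "Q \<in> Obj" by (rule tD)
  fix i Z f assume *: "1 \<le> i" "i < n" "Z \<in> T" "f \<in> H i Q Z"
  have "f \<odot> x = 0" by (rule v[OF *(3,1,2) H_mul0'[OF *(4) tD(4)]]) (simp add: mul_assoc tD)
  then obtain g where g: "g \<in> H i C Z" "f = g \<odot> y" using con_mid[OF t *(4)] by blast
  then show "f = 0" using T_vanish[OF C *(3,1,2) g(1)] by simp
qed

lemma chain_snoc:
  assumes "chain a k X M m e \<epsilon>" "a \<le> k" "Tri (M k) x Q y N \<zeta>" "Q \<in> T"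
  shows "chain a (Suc k) (X(Suc k := Q)) (M(Suc k := N)) (m(k := x)) (e(Suc k := y)) (\<epsilon>(Suc k := \<zeta>))"
  using assms unfolding chain_def by (auto simp: less_Suc_eq)

lemma dec_snoc:
  assumes c: "chain 0 r X M m e \<epsilon>" and n: "n = Suc r" and e: "M 0 = X 0" "e 0 = I (X 0)" "X 0 \<in> T"
    and t: "Tri (M r) x (X n) y (X (Suc n)) \<zeta>" and X: "X n \<in> T" "X (Suc n) \<in> T"
    and d: "\<And>i. i < r \<Longrightarrow> d i = m i \<odot> e i" "d r = x \<odot> e r" "d n = y"
  shows "dec X d (pr \<epsilon> 0 r \<odot> \<zeta>) (M(n := X (Suc n))) (m(r := x, n := I (X (Suc n)))) (e(n := y)) (\<epsilon>(n := \<zeta>))"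
  unfolding dec_def
proof (intro conjI allI impI)
  show "chain 0 n X (M(n := X (Suc n))) (m(r := x, n := I (X (Suc n)))) (e(n := y)) (\<epsilon>(n := \<zeta>))"
    using c t X unfolding chain_def n by (auto simp: less_Suc_eq)
  have "pr \<epsilon> 0 r = pr (\<epsilon>(n := \<zeta>)) 0 r" by (rule pr_cong) (simp add: n)
  then show "pr \<epsilon> 0 r \<odot> \<zeta> = pr (\<epsilon>(n := \<zeta>)) 0 n" by (simp add: n pr_snoc del: pr.simps)
  show "d i = (m(r := x, n := I (X (Suc n)))) i \<odot> (e(n := y)) i" if "i \<le> n" for i
    using that d tri_D(14)[OF t] unfolding n by (auto simp: le_Suc_eq)
qed (use e X n in auto)

text \<open>The invariant concerns the remaining factor \<open>E\<close> from C to
  \<open>M k\<close>: positive degrees below k vanish on \<open>M k\<close>, and in degree k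
  multiplication by \<open>E\<close> is injective for targets in T. At k = n - 1 this is what
  \<open>snoc_mem\<close> needs to place the middle term of a realization of \<open>E\<close> in T.
  For n = 1 no approximation occurs and \<open>\<delta>\<close> is realized directly.\<close>

lemma dec_exists:
  assumes A: "A \<in> T" and C: "C \<in> T" and \<delta>: "\<delta> \<in> H n C A"
  shows "\<exists>X d M m e \<epsilon>. dec X d \<delta> M m e \<epsilon> \<and> X 0 = A \<and> X (Suc n) = C"
proof -
  obtain r where r: "n = Suc r" using n_pos by (cases n) auto
  have step: "\<exists>X M m e \<epsilon> E. chain 0 k X M m e \<epsilon> \<and> M 0 = A \<and> X 0 = A \<and> e 0 = I A \<and> E \<in> H (n - k) C (M k) \<and>
      \<delta> = pr \<epsilon> 0 k \<odot> E \<and> (\<forall>Z\<in>T. \<forall>j f. 1 \<le> j \<longrightarrow> j < k \<longrightarrow> f \<in> H j (M k) Z \<longrightarrow> f = 0) \<and>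
      (\<forall>Z\<in>T. \<forall>f\<in>H k (M k) Z. f \<odot> E = 0 \<longrightarrow> f = 0)" if "1 \<le> k" "k \<le> r" for k
    using that
  proof (induction k rule: nat_induct_at_least)
    case base
    \<comment> \<open>Now \<open>\<delta> = g \<odot> w\<close> with \<open>g\<close> of degree 1.
      The middle term Y of the triangle of \<open>g\<close> need not lie in T; approximating it and
      applying the octahedron replaces K by \<open>M1\<close>, with remaining factor
      \<open>k \<odot> w\<close>.\<close>
    obtain K w where w: "w \<in> H r C K" "\<And>A f. f \<in> H (Suc 0 + r) C A \<Longrightarrow> \<exists>g\<in>H (Suc 0) K A. f = g \<odot> w"
      "\<And>A f. f \<in> H (Suc 0) K A \<Longrightarrow> f \<odot> w = 0 \<Longrightarrow> f = 0" using iterated_syzygy[OF T_Obj[OF C], of r] by blast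
    obtain g where g: "g \<in> H (Suc 0) K A" "\<delta> = g \<odot> w" using w(2)[of \<delta> A] \<delta> r by auto
    obtain a Y b where t1: "Tri A a Y b K g" using realize[OF g(1)] by blast
    note t1D = tri_D[OF t1]
    obtain l X1 c N \<nu> where t2: "Tri Y l X1 c N \<nu>" "X1 \<in> T"
      "\<forall>Z\<in>T. \<forall>f\<in>H 0 Y Z. \<exists>g\<in>H 0 X1 Z. f = g \<odot> l" using left_approx_triangle[OF t1D(2)] by blast
    obtain M1 h k k' \<epsilon>1 where t3: "Tri A (l \<odot> a) X1 h M1 \<epsilon>1" and t4: "Tri K k M1 k' N (b \<odot> \<nu>)" and ek: "\<epsilon>1 \<odot> k = g"
      using octahedron[OF t1 t2(1)] by blast
    note t4D = tri_D[OF t4]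
    have inj: "f = 0" if f: "Z \<in> T" "f \<in> H (Suc 0) M1 Z" "f \<odot> (k \<odot> w) = 0" for Z f
    proof -
      have "f \<odot> k = 0" using w(3)[OF H_mul0'[OF f(2) t4D(4)]] f(3) by (simp add: mul_assoc)
      then obtain f2 where "f2 \<in> H (Suc 0) N Z" "f = f2 \<odot> k'" using con_mid[OF t4 f(2)] by blast
      moreover have "f2 = 0" if "f2 \<in> H (Suc 0) N Z" for f2
        by (rule approx_vanish[OF t2, where k = 1 and Z = Z and j = "Suc 0"]) (use f(1) that base r in auto)
      ultimately show ?thesis by fastforce
    qed
    show ?case
      by (rule exI[of _ "(\<lambda>_. A)(1 := X1)"], rule exI[of _ "(\<lambda>_. A)(1 := M1)"], rule exI[of _ "\<lambda>_. l \<odot> a"],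
          rule exI[of _ "(\<lambda>_. I A)(1 := h)"], rule exI[of _ "\<lambda>_. \<epsilon>1"], rule exI[of _ "k \<odot> w"])
        (use t3 t2(2) inj H_mul0[OF t4D(4) w(1)] g(2) r in \<open>auto simp: chain_def mul_ext[OF ek]\<close>)
  next
    case (Suc k)
    then obtain X M m e \<epsilon> E where c: "chain 0 k X M m e \<epsilon>" and MX: "M 0 = A" "X 0 = A" "e 0 = I A"
      and E: "E \<in> H (n - k) C (M k)" "\<delta> = pr \<epsilon> 0 k \<odot> E"
      and v: "\<forall>Z\<in>T. \<forall>j f. 1 \<le> j \<longrightarrow> j < k \<longrightarrow> f \<in> H j (M k) Z \<longrightarrow> f = 0"
      and inj: "\<And>Z f. Z \<in> T \<Longrightarrow> f \<in> H k (M k) Z \<Longrightarrow> f \<odot> E = 0 \<Longrightarrow> f = 0"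
      using Suc_leD[OF Suc.prems] by blast
    obtain x Q y N \<nu> where t: "Tri (M k) x Q y N \<nu>" "Q \<in> T"
      "\<forall>Z\<in>T. \<forall>f\<in>H 0 (M k) Z. \<exists>g\<in>H 0 Q Z. f = g \<odot> x" using left_approx_triangle[OF H_trg[OF E(1)]] by blast
    note tD = tri_D[OF t(1)]
    have nk: "n - k = Suc (n - Suc k)" "1 \<le> n - k" "n - k < n" using Suc r by auto
    \<comment> \<open>The product has both ends in T and degree n - k, between 1 and n - 1. Its
      vanishing lets \<open>E\<close> split off the extension \<open>\<nu>\<close> of the
      approximation triangle.\<close>
    have "x \<odot> E = 0" by (rule T_vanish[OF C t(2) nk(2,3) H_mul0[OF tD(4) E(1)]])
    then obtain E' where E': "E' \<in> H (n - Suc k) C N" "E = \<nu> \<odot> E'" using cov_left[OF t(1)] E(1) unfolding nk(1) by blast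
    have v': "f = 0" if "Z \<in> T" "1 \<le> j" "j < Suc k" "f \<in> H j N Z" for Z j f
      by (rule approx_vanish[OF t v, where Z = Z and j = j]) (use that Suc.prems r in auto)
    have inj': "f = 0" if f: "Z \<in> T" "f \<in> H (Suc k) N Z" "f \<odot> E' = 0" for Z f
    proof -
      have "f \<odot> y = 0" by (rule T_vanish[OF t(2) f(1) _ _ H_mul0'[OF f(2) tD(5)]]) (use Suc.prems r in auto)
      then obtain g where g: "g \<in> H k (M k) Z" "f = g \<odot> \<nu>" using con_right[OF t(1) f(2)] by blast
      then have "g = 0" using inj[OF f(1) g(1)] f(3) E'(2) by (simp add: mul_assoc)
      then show ?thesis using g by simp
    qed
    have "pr \<epsilon> 0 k = pr (\<epsilon>(Suc k := \<nu>)) 0 k" by (rule pr_cong) simp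
    then have "\<delta> = pr (\<epsilon>(Suc k := \<nu>)) 0 (Suc k) \<odot> E'" using E(2) E'(2) by (simp add: pr_snoc mul_assoc del: pr.simps)
    show ?case
      by (rule exI[of _ "X(Suc k := Q)"], rule exI[of _ "M(Suc k := N)"], rule exI[of _ "m(k := x)"],
          rule exI[of _ "e(Suc k := y)"], rule exI[of _ "\<epsilon>(Suc k := \<nu>)"], rule exI[of _ E'])
        (use chain_snoc[OF c _ t(1,2)] MX E'(1) \<open>\<delta> = pr (\<epsilon>(Suc k := \<nu>)) 0 (Suc k) \<odot> E'\<close> v' inj' in \<open>auto simp: fun_upd_def\<close>)
  qed
  have "\<exists>X M m e \<epsilon> E. chain 0 r X M m e \<epsilon> \<and> M 0 = A \<and> X 0 = A \<and> e 0 = I A \<and> E \<in> H (Suc 0) C (M r) \<and>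
      \<delta> = pr \<epsilon> 0 r \<odot> E \<and> (\<forall>Z\<in>T. \<forall>j f. 1 \<le> j \<longrightarrow> j < n \<longrightarrow> f \<in> H j (M r) Z \<longrightarrow> f \<odot> E = 0 \<longrightarrow> f = 0)"
  proof (cases "r = 0")
    case True
    show ?thesis
      by (rule exI[of _ "\<lambda>_. A"], rule exI[of _ "\<lambda>_. A"], rule exI, rule exI[of _ "\<lambda>_. I A"], rule exI, rule exI[of _ \<delta>])
        (use \<delta> r True in \<open>auto simp: chain_def\<close>)
  next
    case False
    then obtain X M m e \<epsilon> E where c: "chain 0 r X M m e \<epsilon>" and MX: "M 0 = A" "X 0 = A" "e 0 = I A"
      and E: "E \<in> H (n - r) C (M r)" "\<delta> = pr \<epsilon> 0 r \<odot> E"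
      and v: "\<And>Z j f. Z \<in> T \<Longrightarrow> 1 \<le> j \<Longrightarrow> j < r \<Longrightarrow> f \<in> H j (M r) Z \<Longrightarrow> f = 0"
      and inj: "\<And>Z f. Z \<in> T \<Longrightarrow> f \<in> H r (M r) Z \<Longrightarrow> f \<odot> E = 0 \<Longrightarrow> f = 0"
      using step[of r] by fastforce
    have "f = 0" if "Z \<in> T" "1 \<le> j" "j < n" "f \<in> H j (M r) Z" "f \<odot> E = 0" for Z j f
      using that v inj r by (cases "j = r") auto
    moreover have "E \<in> H (Suc 0) C (M r)" using E r by simp
    ultimately show ?thesis using c MX E by blast
  qed
  then obtain X M m e \<epsilon> E where c: "chain 0 r X M m e \<epsilon>" and MX: "M 0 = A" "X 0 = A" "e 0 = I A"
    and E: "E \<in> H (Suc 0) C (M r)" "\<delta> = pr \<epsilon> 0 r \<odot> E"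
    and v: "\<And>Z j f. Z \<in> T \<Longrightarrow> 1 \<le> j \<Longrightarrow> j < n \<Longrightarrow> f \<in> H j (M r) Z \<Longrightarrow> f \<odot> E = 0 \<Longrightarrow> f = 0" by blast
  obtain x Q y where t: "Tri (M r) x Q y C E" using realize[OF E(1)] by blast
  have Q: "Q \<in> T" by (rule snoc_mem[OF t C v])
  let ?X = "X(n := Q, Suc n := C)"
  have c': "chain 0 r ?X M m e \<epsilon>" using c r unfolding chain_def by auto
  let ?d = "\<lambda>i. if i < r then m i \<odot> e i else if i = r then x \<odot> e r else y"
  have dd: "\<exists>M m e \<epsilon>. dec ?X ?d \<delta> M m e \<epsilon>"
    using dec_snoc[OF c' r, of x y E ?d] MX t A C Q E(2) r by auto
  show ?thesis by (rule exI[of _ ?X], rule exI[of _ ?d]) (use dd MX(2) r in auto)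
qed

text \<open>After the prescribed triangle only approximations are taken, as no extension is given in
  advance. Once k = n the range of vanishing is all of 1 to n - 1, so \<open>M n\<close> lies in T
  and serves as the end term.\<close>

lemma inflation_dec:
  assumes t0: "Tri A f B y K \<delta>0" and A: "A \<in> T" and B: "B \<in> T"
  shows "\<exists>X d \<delta> M m e \<epsilon>. dec X d \<delta> M m e \<epsilon> \<and> X 0 = A \<and> X (Suc 0) = B \<and> d 0 = f"
proof -
  have ex: "\<exists>X M m e \<epsilon>. chain 0 k X M m e \<epsilon> \<and> M 0 = A \<and> X 0 = A \<and> X (Suc 0) = B \<and> e 0 = I A \<and> m 0 = f \<and>
      M k \<in> Obj \<and> (\<forall>Z\<in>T. \<forall>j f. 1 \<le> j \<longrightarrow> j < k \<longrightarrow> f \<in> H j (M k) Z \<longrightarrow> f = 0)" if "1 \<le> k" "k \<le> n" for k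
    using that
  proof (induction k rule: nat_induct_at_least)
    case base
    show ?case
      by (rule exI[of _ "(\<lambda>_. A)(1 := B)"], rule exI[of _ "(\<lambda>_. A)(1 := K)"], rule exI[of _ "\<lambda>_. f"],
          rule exI[of _ "(\<lambda>_. I A)(1 := y)"], rule exI[of _ "\<lambda>_. \<delta>0"])
        (use tri_D(3)[OF t0] t0 B in \<open>auto simp: chain_def\<close>)
  next
    case (Suc k)
    then obtain X M m e \<epsilon> where c: "chain 0 k X M m e \<epsilon>"
      and MX: "M 0 = A" "X 0 = A" "X (Suc 0) = B" "e 0 = I A" "m 0 = f" "M k \<in> Obj"
      and v: "\<forall>Z\<in>T. \<forall>j f. 1 \<le> j \<longrightarrow> j < k \<longrightarrow> f \<in> H j (M k) Z \<longrightarrow> f = 0"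
      using Suc_leD[OF Suc.prems] by blast
    obtain x Q y N \<nu> where t: "Tri (M k) x Q y N \<nu>" "Q \<in> T"
      "\<forall>Z\<in>T. \<forall>f\<in>H 0 (M k) Z. \<exists>g\<in>H 0 Q Z. f = g \<odot> x" using left_approx_triangle[OF MX(6)] by blast
    have v': "f = 0" if "Z \<in> T" "1 \<le> j" "j < Suc k" "f \<in> H j N Z" for Z j f
      by (rule approx_vanish[OF t v, where Z = Z and j = j]) (use that Suc.prems in auto)
    have "k \<noteq> 0" using Suc.hyps by simp
    show ?case
      by (rule exI[of _ "X(Suc k := Q)"], rule exI[of _ "M(Suc k := N)"], rule exI[of _ "m(k := x)"],
          rule exI[of _ "e(Suc k := y)"], rule exI[of _ "\<epsilon>(Suc k := \<nu>)"])
        (use chain_snoc[OF c _ t(1,2)] MX v' tri_D(3)[OF t(1)] \<open>k \<noteq> 0\<close> in \<open>auto simp: fun_upd_def\<close>)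
  qed
  obtain X M m e \<epsilon> where c: "chain 0 n X M m e \<epsilon>"
    and MX: "M 0 = A" "X 0 = A" "X (Suc 0) = B" "e 0 = I A" "m 0 = f" "M n \<in> Obj"
    and v: "\<forall>Z\<in>T. \<forall>j f. 1 \<le> j \<longrightarrow> j < n \<longrightarrow> f \<in> H j (M n) Z \<longrightarrow> f = 0"
    using ex[OF n_pos order_refl] by blast
  have Mn: "M n \<in> T" by (rule T_memI[OF MX(6)]) (use v in blast)
  let ?X = "X(Suc n := M n)" and ?m = "m(n := I (M n))"
  have "dec ?X (\<lambda>i. ?m i \<odot> e i) (pr \<epsilon> 0 n) M ?m e \<epsilon>"
    unfolding dec_def chain_def using c Mn MX A n_pos by (auto simp: chain_def)
  moreover have "?X 0 = A" "?X (Suc 0) = B" "?m 0 \<odot> e 0 = f" using MX n_pos tri_D(16)[OF t0] by auto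
  ultimately show ?thesis by blast
qed

end

section \<open>Invariance under homotopy equivalence\<close>

context tilting_category begin

text \<open>Compare t with tfg: since t kills \<open>d' i\<close>, the homotopy shows that the
  difference factors through \<open>d' (Suc i)\<close>, and tf factors by exactness of X.\<close>

lemma con_exact_of_null:
  assumes ex: "con_exact X d" and f: "cmap X d Y d' f" and g: "cmap Y d' X d g"
    and nl: "null Y d' Y d' (\<lambda>i. f i \<odot> g i - I (Y i))"
  shows "con_exact Y d'"
  unfolding con_exact_def
proof (intro allI ballI impI)
  fix i Z t assume i: "i < n" and Z: "Z \<in> T" and t: "t \<in> H 0 (Y (Suc i)) Z" "t \<odot> d' i = 0"
  have i': "Suc i \<le> Suc n" "i \<le> n" "Suc i \<le> n" "Suc (Suc i) \<le> Suc n" using i by auto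
  obtain h where h: "\<And>i. i \<le> n \<Longrightarrow> h i \<in> H 0 (Y (Suc i)) (Y i)"
    "f (Suc i) \<odot> g (Suc i) - I (Y (Suc i)) = h (Suc i) \<odot> d' (Suc i) + d' i \<odot> h i"
    using nl i unfolding null_def by blast
  have tf: "t \<odot> f (Suc i) \<in> H 0 (X (Suc i)) Z" by (rule H_mul0[OF t(1) cmap_D(1)[OF f i'(1)]])
  have "(t \<odot> f (Suc i)) \<odot> d i = 0" by (simp add: mul_assoc cmap_D(2)[OF f i'(2)] mul_ext[OF t(2)])
  then obtain k where k: "k \<in> H 0 (X (Suc (Suc i))) Z" "t \<odot> f (Suc i) = k \<odot> d (Suc i)"
    using con_exact_D[OF ex i Z tf] by blast
  have "t \<odot> (f (Suc i) \<odot> g (Suc i) - I (Y (Suc i))) = (t \<odot> h (Suc i)) \<odot> d' (Suc i)"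
    unfolding h(2) by (simp add: mul_simps mul_ext[OF t(2)])
  then have "t = t \<odot> (f (Suc i) \<odot> g (Suc i)) - (t \<odot> h (Suc i)) \<odot> d' (Suc i)"
    by (simp add: mul_diff_right id_right[OF t(1)] algebra_simps)
  also have "t \<odot> (f (Suc i) \<odot> g (Suc i)) = (k \<odot> g (Suc (Suc i))) \<odot> d' (Suc i)"
    by (simp add: mul_ext[OF k(2)] mul_assoc cmap_D(2)[OF g i'(3)])
  finally have "t = (k \<odot> g (Suc (Suc i)) - t \<odot> h (Suc i)) \<odot> d' (Suc i)" by (simp add: mul_diff_left)
  moreover have "k \<odot> g (Suc (Suc i)) - t \<odot> h (Suc i) \<in> H 0 (Y (Suc (Suc i))) Z"
    using H_diff[OF H_mul0[OF k(1) cmap_D(1)[OF g i'(4)]] H_mul0[OF t(1) h(1)[OF i'(3)]]] .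
  ultimately show "\<exists>g\<in>H 0 (Y (Suc (Suc i))) Z. t = g \<odot> d' (Suc i)" by blast
qed

text \<open>A chain map between complexes that agree except in degree \<open>n = r + 1\<close>, and that is the identity
  at both ends, can be deformed to one that is the identity outside degree \<open>n\<close>.\<close>

lemma correct_to_identity:
  assumes n: "n = Suc r" and A: "cpl A dA" "con_exact A dA" and B: "cpl B dB"
    and AB: "\<And>i. i \<le> r \<Longrightarrow> A i = B i" "\<And>i. i < r \<Longrightarrow> dA i = dB i" "A (Suc n) = B (Suc n)"
    and F: "cmap A dA B dB F" and Fe: "F 0 = I (A 0)" "F (Suc n) = I (A (Suc n))"
  shows "\<exists>w\<in>H 0 (A n) (B n). w \<odot> dA r = dB r \<and> dB n \<odot> w = dA n"
proof -
  note FD = cmap_D[OF F] and AD = cpl_D[OF A(1)] and BD = cpl_D[OF B]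
  have AO: "i \<le> Suc n \<Longrightarrow> A i \<in> Obj" for i using T_Obj AD by blast
  have "\<exists>h. h 0 = 0 \<and> (\<forall>i\<le>r. h i \<in> H 0 (A (Suc i)) (B i)) \<and>
    (\<forall>i<r. F (Suc i) - I (A (Suc i)) = h (Suc i) \<odot> dA (Suc i) + dB i \<odot> h i)"
  proof (rule partial_homotopy[OF A(2) B AO, of r "\<lambda>i. F i - I (A i)"])
    fix i assume i: "i \<le> r"
    then show "F i - I (A i) \<in> H 0 (A i) (B i)" using H_diff[OF FD(1)[of i]] H_id[OF AO[of i]] AB(1)[of i] n by simp
  next
    fix i assume i: "i < r"
    then have *: "dA i = dB i" "dB i \<in> H 0 (A i) (A (Suc i))" using AB(2) AD(2)[of i] n by auto
    then show "(F (Suc i) - I (A (Suc i))) \<odot> dA i = dB i \<odot> (F i - I (A i))"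
      using FD(2)[of i] i n by (simp add: mul_simps id_left[OF *(2)] id_right[OF *(2)])
  qed (use n Fe in auto)
  then obtain h where h: "h 0 = 0" "\<And>i. i \<le> r \<Longrightarrow> h i \<in> H 0 (A (Suc i)) (B i)"
    "\<And>i. i < r \<Longrightarrow> F (Suc i) - I (A (Suc i)) = h (Suc i) \<odot> dA (Suc i) + dB i \<odot> h i" by blast
  have r: "dB r \<in> H 0 (A r) (B n)" "r \<le> n" using BD(2)[of r] AB(1)[of r] n by auto
  \<comment> \<open>Subtracting \<open>dB r \<odot> h r\<close> absorbs the homotopy in degree r,
    while the composite with \<open>dB n\<close> stays the same because \<open>dB n\<close> kills
    \<open>dB r\<close>.\<close>
  let ?w = "F n - dB r \<odot> h r"
  have "h r \<in> H 0 (A n) (A r)" using h(2)[of r] AB(1)[of r] n by simp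
  then have w: "?w \<in> H 0 (A n) (B n)" using H_diff[OF FD(1)[of n] H_mul0[OF r(1)]] n by simp
  have "dB r \<odot> F r - dB r \<odot> (h r \<odot> dA r) = dB r"
  proof (cases r)
    case 0
    then show ?thesis using h(1) Fe(1) id_right[OF r(1)] by simp
  next
    case (Suc j)
    then have z: "dB r \<odot> dB j = 0" using BD(3)[of j] n by simp
    have "dB r \<odot> (F r - I (A r)) = dB r \<odot> (h r \<odot> dA r)"
      using h(3)[of j] Suc by (simp add: mul_add_right mul_ext[OF z[unfolded Suc]])
    then show ?thesis by (simp add: mul_diff_right id_right[OF r(1)] algebra_simps)
  qed
  then have "?w \<odot> dA r = dB r" using FD(2)[of r] n by (simp add: mul_simps)
  moreover have "dB n \<odot> ?w = dA n"
  proof -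
    have z: "dB n \<odot> dB r = 0" using BD(3)[of r] n by simp
    have "dB n \<odot> F n = dA n" using FD(2)[of n] Fe(2) id_left[OF AD(2)[of n]] by simp
    then show ?thesis by (simp add: mul_diff_right mul_ext[OF z])
  qed
  ultimately show ?thesis using w by blast
qed

text \<open>The triangles of Y are rebuilt from the left, up to degree r = n - 1, out of exactness
  and (W). The last one is found by comparing Y with a decomposed complex that differs from it in
  degree n only.\<close>

lemma dec_closed:
  assumes D: "dec X d \<delta> M m e \<epsilon>" and Y: "cpl Y d'" and XY: "Y 0 = X 0" "Y (Suc n) = X (Suc n)"
    and f: "cmap X d Y d' f" and g: "cmap Y d' X d g"
    and fe: "f 0 = I (X 0)" "f (Suc n) = I (X (Suc n))" and ge: "g 0 = I (X 0)" "g (Suc n) = I (X (Suc n))"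
    and nl: "null Y d' Y d' (\<lambda>i. f i \<odot> g i - I (Y i))"
  shows "\<exists>N m e \<eta>. dec Y d' \<delta> N m e \<eta>"
proof -
  note DD = dec_D[OF D] and YD = cpl_D[OF Y] and fD = cmap_D[OF f] and gD = cmap_D[OF g]
  have exY: "con_exact Y d'" by (rule con_exact_of_null[OF dec_con_exact[OF D] f g nl])
  obtain r where r: "n = Suc r" using n_pos by (cases n) auto
  have Y0: "Y 0 \<in> T" "Y (Suc n) \<in> T" using YD by auto
  have "\<exists>N m' e' \<eta>. chain 0 k Y N m' e' \<eta> \<and> N 0 = Y 0 \<and> e' 0 = I (Y 0) \<and>
    (\<forall>i\<le>k. m' i \<in> H 0 (N i) (Y (Suc i)) \<and> e' i \<in> H 0 (Y i) (N i) \<and> d' i = m' i \<odot> e' i)" if "k \<le> r" for k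
    using that
  proof (induction k)
    case 0
    have d0: "d' 0 \<in> H 0 (Y 0) (Y (Suc 0))" using YD(2)[of 0] by simp
    show ?case
      by (rule exI[of _ "\<lambda>_. Y 0"], rule exI[of _ "\<lambda>_. d' 0"], rule exI[of _ "\<lambda>_. I (Y 0)"])
        (use d0 id_right[OF d0] H_id[OF T_Obj[OF Y0(1)]] in \<open>auto simp: chain_def\<close>)
  next
    case (Suc k)
    then obtain N m' e' \<eta> where c: "chain 0 k Y N m' e' \<eta>" and N: "N 0 = Y 0" "e' 0 = I (Y 0)"
      and m': "\<And>i. i \<le> k \<Longrightarrow> m' i \<in> H 0 (N i) (Y (Suc i))"
      and e': "\<And>i. i \<le> k \<Longrightarrow> e' i \<in> H 0 (Y i) (N i)"
      and d': "\<And>i. i \<le> k \<Longrightarrow> d' i = m' i \<odot> e' i" by auto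
    have k: "k < n" "Suc k < n" "k \<le> n" using Suc.prems r by auto
    have epi: "t = 0" if "Z \<in> T" "t \<in> H 0 (N k) Z" "t \<odot> e' k = 0" for Z t
      using chain_epi[OF c _ _ order_refl k(1) that] N Y0 by simp
    \<comment> \<open>By (W) it suffices that some composite starting with \<open>m' k\<close> is an
      inflation. For k = 0 composing with \<open>g\<close> gives \<open>m 0\<close>. For k > 0 take
      an inflation \<open>l\<close> into an injective: exactness extends
      \<open>l \<odot> e' k\<close> along \<open>d' k\<close>, and cancelling \<open>e' k\<close>,
      which is epic for maps into T, shows that \<open>l\<close> factors through
      \<open>m' k\<close>.\<close>
    have "\<exists>y C \<zeta>. Tri (N k) (m' k) (Y (Suc k)) y C \<zeta>"
    proof (cases k)
      case 0
      have "g (Suc 0) \<odot> d' 0 = m 0"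
        using gD(2)[of 0] ge(1) dec_zero(5)[OF D] id_right[OF dec_m(3)[OF D, of 0]] by simp
      moreover have "d' 0 = m' 0" using d'[of 0] N(2) id_right[OF m'[of 0]] N(1) by simp
      ultimately have "Tri (N k) (g (Suc 0) \<odot> m' k) (X (Suc 0)) (e (Suc 0)) (M (Suc 0)) (\<epsilon> (Suc 0))"
        using DD(10)[of 0] 0 N(1) XY(1) DD(4) n_pos by simp
      moreover have "g (Suc 0) \<in> H 0 (Y (Suc k)) (X (Suc 0))" using gD(1)[of "Suc 0"] 0 by simp
      ultimately show ?thesis using W_infl m'[OF order_refl] by blast
    next
      case (Suc j)
      obtain l J y S \<omega> where t: "Tri (N k) l J y S \<omega>" and J: "\<And>i X. H (Suc i) X J \<subseteq> {0}"
        using enough_inj[OF H_trg[OF e'[of k]]] by blast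
      note tD = tri_D[OF t]
      have JT: "J \<in> T" using T_inj[OF tD(2) J] .
      have em: "e' k \<odot> m' j = 0" using tri_D(7)[OF chain_D(1)[OF c, of j]] Suc by simp
      have le: "l \<odot> e' k \<in> H 0 (Y (Suc j)) J" using H_mul0[OF tD(4) e'[of k]] Suc by simp
      have "(l \<odot> e' k) \<odot> d' j = 0" using d'[of j] Suc by (simp add: mul_assoc mul_ext[OF em[unfolded Suc]])
      then obtain \<kappa> where \<kappa>: "\<kappa> \<in> H 0 (Y (Suc k)) J" "l \<odot> e' k = \<kappa> \<odot> d' k"
        using con_exact_D[OF exY _ JT le] k Suc by auto
      have "l - \<kappa> \<odot> m' k = 0"
      proof (rule epi[OF JT H_diff[OF tD(4) H_mul0[OF \<kappa>(1) m'[OF order_refl]]]])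
        show "(l - \<kappa> \<odot> m' k) \<odot> e' k = 0" using \<kappa>(2) d'[of k] by (simp add: mul_simps)
      qed
      then show ?thesis using W_infl[OF _ m'[OF order_refl] \<kappa>(1)] t by simp
    qed
    then obtain y C \<zeta> where t: "Tri (N k) (m' k) (Y (Suc k)) y C \<zeta>" by blast
    have YT: "Y (Suc k) \<in> T" "Y (Suc (Suc k)) \<in> T" using YD(1) k by auto
    have dm: "d' (Suc k) \<odot> m' k \<in> H 0 (N k) (Y (Suc (Suc k)))" using H_mul0[OF YD(2)[of "Suc k"] m'[of k]] k by simp
    have "(d' (Suc k) \<odot> m' k) \<odot> e' k = 0" using YD(3)[of k] d'[of k] k by (simp add: mul_assoc)
    then have "d' (Suc k) \<odot> m' k = 0" using epi[OF YT(2) dm] by blast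
    then obtain q where q: "q \<in> H 0 C (Y (Suc (Suc k)))" "d' (Suc k) = q \<odot> y"
      using tri_con_mid[OF t YD(2)[of "Suc k"]] k by auto
    have c': "chain 0 (Suc k) Y (N(Suc k := C)) (m'(Suc k := q)) (e'(Suc k := y)) (\<eta>(Suc k := \<zeta>))"
      using c t YT(1) unfolding chain_def by (auto simp: less_Suc_eq)
    show ?case
      by (rule exI[of _ "N(Suc k := C)"], rule exI[of _ "m'(Suc k := q)"], rule exI[of _ "e'(Suc k := y)"],
          rule exI[of _ "\<eta>(Suc k := \<zeta>)"])
        (use c' N m' e' d' q tri_D(5)[OF t] in \<open>auto simp: fun_upd_def le_Suc_eq\<close>)
  qed
  from this[OF order_refl] obtain N m' e' \<eta> where c: "chain 0 r Y N m' e' \<eta>" and N: "N 0 = Y 0" "e' 0 = I (Y 0)"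
    and m': "\<And>i. i \<le> r \<Longrightarrow> m' i \<in> H 0 (N i) (Y (Suc i))" and e': "\<And>i. i \<le> r \<Longrightarrow> e' i \<in> H 0 (Y i) (N i)"
    and d': "\<And>i. i \<le> r \<Longrightarrow> d' i = m' i \<odot> e' i" by blast
  have epi: "t = 0" if "i \<le> r" "Z \<in> T" "t \<in> H 0 (N i) Z" "t \<odot> e' i = 0" for i Z t
    by (rule chain_epi[OF c _ _ that(1) _ that(2-4)]) (use N Y0 r that in auto)

  \<comment> \<open>The chain map \<open>f\<close> induces maps from the syzygies of X to those of
    Y. They carry the last factor of the decomposition of \<open>\<delta>\<close> over to Y, giving
    \<open>\<zeta>\<close> below.\<close>
  have "\<exists>\<phi>. \<phi> 0 = I (Y 0) \<and> (\<forall>i\<le>k. \<phi> i \<in> H 0 (M i) (N i) \<and> \<phi> i \<odot> e i = e' i \<odot> f i) \<and>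
    (\<forall>i<k. \<phi> i \<odot> \<epsilon> (Suc i) = \<eta> (Suc i) \<odot> \<phi> (Suc i))" if "k \<le> r" for k
    using that
  proof (induction k)
    case 0
    show ?case
      by (rule exI[of _ "\<lambda>_. I (Y 0)"]) (use N DD(4,6) XY(1) fe(1) H_id[OF T_Obj[OF Y0(1)]] in auto)
  next
    case (Suc k)
    then obtain \<phi> where \<phi>: "\<phi> 0 = I (Y 0)" "\<And>i. i \<le> k \<Longrightarrow> \<phi> i \<in> H 0 (M i) (N i)"
      "\<And>i. i \<le> k \<Longrightarrow> \<phi> i \<odot> e i = e' i \<odot> f i" "\<And>i. i < k \<Longrightarrow> \<phi> i \<odot> \<epsilon> (Suc i) = \<eta> (Suc i) \<odot> \<phi> (Suc i)" by auto
    have k: "k < n" "k \<le> n" "k \<le> r" "k < r" "Suc k \<le> Suc n" using Suc.prems r by auto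
    note t = DD(10)[OF k(1)] and t' = chain_D(1)[OF c le0 k(4)]
    have "f (Suc k) \<odot> m k - m' k \<odot> \<phi> k = 0"
    proof (rule dec_epi[OF D k(1) YD(1)[OF k(5)]])
      show "f (Suc k) \<odot> m k - m' k \<odot> \<phi> k \<in> H 0 (M k) (Y (Suc k))"
        using H_diff[OF H_mul0[OF fD(1)[OF k(5)] tri_D(4)[OF t]] H_mul0[OF m'[OF k(3)] \<phi>(2)[OF order_refl]]] .
      show "(f (Suc k) \<odot> m k - m' k \<odot> \<phi> k) \<odot> e k = 0"
        using fD(2)[OF k(2)] DD(8)[OF k(2)] d'[OF k(3)] \<phi>(3)[OF order_refl] by (simp add: mul_simps)
    qed
    then have "f (Suc k) \<odot> m k = m' k \<odot> \<phi> k" by simp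
    then obtain q where q: "q \<in> H 0 (M (Suc k)) (N (Suc k))" "q \<odot> e (Suc k) = e' (Suc k) \<odot> f (Suc k)"
      "\<phi> k \<odot> \<epsilon> (Suc k) = \<eta> (Suc k) \<odot> q"
      using tri_third_map[OF t t' \<phi>(2)[OF order_refl] fD(1)[OF k(5)]] by blast
    show ?case
    proof (rule exI[of _ "\<phi>(Suc k := q)"], intro conjI allI impI)
      fix i assume "i < Suc k"
      then show "(\<phi>(Suc k := q)) i \<odot> \<epsilon> (Suc i) = \<eta> (Suc i) \<odot> (\<phi>(Suc k := q)) (Suc i)"
        using \<phi>(4) q(3) by (cases "i = k") auto
    qed (use \<phi> q in \<open>auto simp: le_Suc_eq\<close>)
  qed
  from this[OF order_refl] obtain \<phi> where \<phi>: "\<phi> 0 = I (Y 0)" "\<And>i. i \<le> r \<Longrightarrow> \<phi> i \<in> H 0 (M i) (N i)"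
    "\<And>i. i < r \<Longrightarrow> \<phi> i \<odot> \<epsilon> (Suc i) = \<eta> (Suc i) \<odot> \<phi> (Suc i)" by blast
  define \<zeta> where "\<zeta> = \<phi> r \<odot> \<epsilon> n"
  have tr: "Tri (M r) (m r) (X n) (e n) (X (Suc n)) (\<epsilon> n)" using DD(5) DD(10)[of r] r by simp
  have \<zeta>H: "\<zeta> \<in> H (Suc 0) (X (Suc n)) (N r)" unfolding \<zeta>_def using H_mul0[OF \<phi>(2) tri_D(6)[OF tr]] by simp
  have pr\<zeta>: "pr \<eta> 0 r \<odot> \<zeta> = \<delta>"
  proof -
    have *: "pr \<eta> 0 r \<odot> \<phi> r = \<phi> 0 \<odot> pr \<epsilon> 0 r" using pr_comm[of r \<phi> \<epsilon> \<eta>] \<phi>(3) by simp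
    have "pr \<eta> 0 r \<odot> \<zeta> = I (Y 0) \<odot> (pr \<epsilon> 0 r \<odot> \<epsilon> n)"
      unfolding \<zeta>_def mul_ext[OF *] \<phi>(1) by (rule mul_assoc)
    also have "pr \<epsilon> 0 r \<odot> \<epsilon> n = \<delta>" using DD(9) r by (simp add: pr_snoc del: pr.simps)
    finally have "pr \<eta> 0 r \<odot> \<zeta> = I (Y 0) \<odot> \<delta>" .
    then show ?thesis using id_left[OF dec_zero(4)[OF D]] XY(1) by simp
  qed
  obtain x Q y where tQ: "Tri (N r) x Q y (X (Suc n)) \<zeta>" using realize[OF \<zeta>H] by blast
  \<comment> \<open>\<open>chain_vanish_con_final\<close> is not applicable, since this chain is not
    known to end in T. In degree 1 exactness of Y takes its place: \<open>s\<close> extends along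
    \<open>m' k\<close>, so \<open>s \<odot> \<eta> i\<close> is zero.\<close>
  have vanish: "t = 0" if "1 \<le> j" "j < i" "i \<le> r" "Z \<in> T" "t \<in> H j (N i) Z" for i j Z t
    using that
  proof (induction j arbitrary: i t)
    case (Suc j)
    obtain k where k: "i = Suc k" using Suc.prems by (cases i) auto
    note ck = chain_D[OF c, of k]
    have ck: "Tri (N k) (m' k) (Y i) (e' i) (N i) (\<eta> i)" "Y i \<in> T" using ck Suc.prems k by auto
    have "t \<odot> e' i = 0" using T_vanish[OF ck(2) Suc.prems(4) _ _ H_mul0'[OF Suc.prems(5) tri_D(5)[OF ck(1)]]] Suc.prems r by simp
    then obtain s where s: "s \<in> H j (N k) Z" "t = s \<odot> \<eta> i" using con_right[OF ck(1) Suc.prems(5)] by blast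
    show ?case
    proof (cases "j = 0")
      case False
      then show ?thesis using Suc.IH[of k s] Suc.prems s k by simp
    next
      case True
      obtain l where l: "k = Suc l" using Suc.prems k True by (cases k) auto
      have kn: "l < n" "k \<le> r" using Suc.prems k l r by auto
      have em: "e' k \<odot> m' l = 0" using tri_D(7)[OF chain_D(1)[OF c, of l]] l kn by simp
      have se: "s \<odot> e' k \<in> H 0 (Y (Suc l)) Z" using H_mul0'[OF s(1) e'[OF kn(2)]] True l by simp
      have "(s \<odot> e' k) \<odot> d' l = 0" using d'[of l] kn l by (simp add: mul_assoc mul_ext[OF em[unfolded l]])
      then obtain \<kappa> where \<kappa>: "\<kappa> \<in> H 0 (Y (Suc k)) Z" "s \<odot> e' k = \<kappa> \<odot> d' k"
        using con_exact_D[OF exY kn(1) Suc.prems(4) se] l by auto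
      have s0: "s \<in> H 0 (N k) Z" using s(1) True by simp
      have "s - \<kappa> \<odot> m' k = 0"
      proof (rule epi[OF kn(2) Suc.prems(4) H_diff[OF s0 H_mul0[OF \<kappa>(1) m'[OF kn(2)]]]])
        show "(s - \<kappa> \<odot> m' k) \<odot> e' k = 0" using \<kappa>(2) d'[OF kn(2)] by (simp add: mul_simps)
      qed
      then have "s = \<kappa> \<odot> m' k" by simp
      then show ?thesis using s(2) tri_D(9)[OF ck(1)] by (simp add: mul_assoc)
    qed
  qed simp
  have factor: "\<exists>s\<in>H 0 (N 0) Z. t = s \<odot> pr \<eta> 0 k" if "k \<le> r" "Z \<in> T" "t \<in> H k (N k) Z" for k Z t
    using that
  proof (induction k arbitrary: t)
    case (Suc k)
    have ck: "Tri (N k) (m' k) (Y (Suc k)) (e' (Suc k)) (N (Suc k)) (\<eta> (Suc k))" "Y (Suc k) \<in> T"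
      using chain_D[OF c, of k] Suc.prems by auto
    have "t \<odot> e' (Suc k) = 0"
      using T_vanish[OF ck(2) Suc.prems(2) _ _ H_mul0'[OF Suc.prems(3) tri_D(5)[OF ck(1)]]] Suc.prems r by simp
    then obtain s where s: "s \<in> H k (N k) Z" "t = s \<odot> \<eta> (Suc k)" using con_right[OF ck(1) Suc.prems(3)] by blast
    then obtain s' where "s' \<in> H 0 (N 0) Z" "s = s' \<odot> pr \<eta> 0 k" using Suc.IH[of s] Suc.prems by auto
    then show ?case using s(2) by (intro bexI[of _ s']) (auto simp: pr_snoc mul_assoc simp del: pr.simps)
  qed auto
  \<comment> \<open>The critical degree is j = r, where an element is some \<open>s\<close> times
    the product of the \<open>\<eta>\<close>. If \<open>\<zeta>\<close> kills it, then
    \<open>s \<odot> \<delta> = 0\<close>; so \<open>s\<close> factors through \<open>d 0\<close>,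
    hence through \<open>m' 0\<close>, which kills \<open>\<eta> (Suc 0)\<close>.\<close>
  have QT: "Q \<in> T"
  proof (rule snoc_mem[OF tQ])
    show "X (Suc n) \<in> T" by (rule DD)
    fix Z j t assume *: "Z \<in> T" "1 \<le> j" "j < n" "t \<in> H j (N r) Z" "t \<odot> \<zeta> = 0"
    show "t = 0"
    proof (cases "j < r")
      case True then show ?thesis using vanish[of j r Z t] * by simp
    next
      case False
      then have j: "j = r" using *(3) r by simp
      then obtain s where s: "s \<in> H 0 (Y 0) Z" "t = s \<odot> pr \<eta> 0 r" using factor[of r Z t] * N(1) by auto
      have sX: "s \<in> H 0 (X 0) Z" using s(1) XY by simp
      have "s \<odot> \<delta> = 0" using *(5) s(2) pr\<zeta> by (simp add: mul_assoc)
      then obtain k where k: "k \<in> H 0 (X (Suc 0)) Z" "s = k \<odot> d 0" using dec_exact_con_end[OF D *(1) sX] by blast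
      have "d 0 = g (Suc 0) \<odot> d' 0" using gD(2)[of 0] ge(1) id_right[OF dec_m(3)[OF D, of 0]] by simp
      also have "d' 0 = m' 0" using d'[of 0] N id_right[OF m'[of 0]] by simp
      finally have "t = k \<odot> (g (Suc 0) \<odot> (m' 0 \<odot> pr \<eta> 0 r))" using s(2) k(2) by (simp add: mul_assoc)
      moreover obtain q where q: "r = Suc q" using j *(2) by (cases r) auto
      moreover have "m' 0 \<odot> (\<eta> (Suc 0) \<odot> z) = 0" for z using tri_D(12)[OF chain_D(1)[OF c, of 0]] q by simp
      ultimately show ?thesis by simp
    qed
  qed
  \<comment> \<open>The decomposed comparison complex: Y with its term in degree n replaced by
    Q.\<close>
  let ?Y = "Y(n := Q)" and ?d = "d'(r := x \<odot> e' r, n := y)"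
  have c2: "chain 0 r ?Y N m' e' \<eta>" using c r unfolding chain_def by auto
  obtain N2 m2 e2 \<eta>2 where D2: "dec ?Y ?d \<delta> N2 m2 e2 \<eta>2"
    using dec_snoc[OF c2 r, of x y \<zeta> ?d] N Y0 tQ QT DD(3) XY d' r pr\<zeta> by auto
  obtain F1 where F1: "cmap ?Y ?d X d F1" "F1 0 = I (Y 0)" "F1 (Suc n) = I (Y (Suc n))"
    using dec_lift[OF D2 D, of "I (Y 0)" "I (Y (Suc n))"] XY r H_id[OF T_Obj[OF Y0(1)]] H_id[OF T_Obj[OF Y0(2)]]
      id_left[OF dec_zero(4)[OF D]] id_right[OF dec_zero(4)[OF D]] by auto
  obtain G1 where G1: "cmap X d ?Y ?d G1" "G1 0 = I (Y 0)" "G1 (Suc n) = I (Y (Suc n))"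
    using dec_lift[OF D D2, of "I (Y 0)" "I (Y (Suc n))"] XY r H_id[OF T_Obj[OF Y0(1)]] H_id[OF T_Obj[OF Y0(2)]]
      id_left[OF dec_zero(4)[OF D]] id_right[OF dec_zero(4)[OF D]] by auto
  have II: "I (Y 0) \<odot> I (Y 0) = I (Y 0)" "I (Y (Suc n)) \<odot> I (Y (Suc n)) = I (Y (Suc n))"
    using id_left[OF H_id[OF T_Obj[OF Y0(1)]]] id_left[OF H_id[OF T_Obj[OF Y0(2)]]] by auto
  \<comment> \<open>Chain maps through X, deformed to the identity outside degree n, give maps
    between Q and \<open>Y n\<close> in both directions. They are inverse up to square-zero maps, so
    Q and \<open>Y n\<close> are isomorphic.\<close>
  obtain w where w: "w \<in> H 0 Q (Y n)" "w \<odot> (x \<odot> e' r) = d' r" "d' n \<odot> w = y"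
    using correct_to_identity[OF r dec_cpl[OF D2] dec_con_exact[OF D2] Y _ _ _ cmap_comp[OF F1(1) f]] F1 fe II XY r by auto
  obtain v where v: "v \<in> H 0 (Y n) Q" "v \<odot> d' r = x \<odot> e' r" "y \<odot> v = d' n"
    using correct_to_identity[OF r Y exY dec_cpl[OF D2] _ _ _ cmap_comp[OF g G1(1)]] G1 ge II XY r by auto
  have sq1: "(v \<odot> w - I Q) \<odot> (v \<odot> w - I Q) = 0"
  proof -
    have z: "y \<odot> (v \<odot> w - I Q) = 0" by (simp add: mul_simps mul_ext[OF v(3)] w(3) tri_D[OF tQ])
    have h: "v \<odot> w - I Q \<in> H 0 (?Y (Suc r)) Q" using H_diff[OF H_mul0[OF v(1) w(1)] H_id[OF T_Obj[OF QT]]] r by simp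
    have "(v \<odot> w - I Q) \<odot> ?d r = 0" using r by (simp add: mul_simps w(2) v(2) tri_D[OF tQ] mul_ext[OF tri_D(13)[OF tQ]])
    then obtain k where "v \<odot> w - I Q = k \<odot> y"
      using con_exact_D[OF dec_con_exact[OF D2] _ QT h] r by auto
    then show ?thesis using z by (metis mul_assoc mul_zero_right)
  qed
  have dn: "d' n \<in> H 0 (Y n) (Y (Suc n))" "d' r \<in> H 0 (Y r) (Y n)" "Y n \<in> T" using YD(1)[of n] YD(2)[of n] YD(2)[of r] r by auto
  have sq2: "(w \<odot> v - I (Y n)) \<odot> (w \<odot> v - I (Y n)) = 0"
  proof -
    have z: "d' n \<odot> (w \<odot> v - I (Y n)) = 0" by (simp add: mul_simps mul_ext[OF w(3)] v(3) id_right[OF dn(1)])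
    have h: "w \<odot> v - I (Y n) \<in> H 0 (Y (Suc r)) (Y n)" using H_diff[OF H_mul0[OF w(1) v(1)] H_id[OF T_Obj[OF dn(3)]]] r by simp
    have "(w \<odot> v - I (Y n)) \<odot> d' r = 0" by (simp add: mul_simps v(2) w(2) id_left[OF dn(2)])
    then obtain k where "w \<odot> v - I (Y n) = k \<odot> d' n"
      using con_exact_D[OF exY _ dn(3) h] r by auto
    then show ?thesis using z by (metis mul_assoc mul_zero_right)
  qed
  obtain w' where w': "w' \<in> H 0 (Y n) Q" "w' \<odot> w = I Q" "w \<odot> w' = I (Y n)"
    using iso_of_square_zero[OF w(1) v(1) sq1 sq2] by blast
  have "w \<odot> x - m' r = 0"
  proof (rule epi[OF order_refl dn(3)])
    show "w \<odot> x - m' r \<in> H 0 (N r) (Y n)" using H_diff[OF H_mul0[OF w(1) tri_D(4)[OF tQ]]] m'[of r] r by simp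
    show "(w \<odot> x - m' r) \<odot> e' r = 0" using w(2) d'[of r] by (simp add: mul_simps)
  qed
  moreover have "y \<odot> w' = d' n" using w(3) w'(3) id_right[OF dn(1)] by (metis mul_assoc)
  ultimately have "Tri (N r) (m' r) (Y n) (d' n) (Y (Suc n)) \<zeta>"
    using tri_mid_iso[OF tQ w(1) w'] XY by simp
  then have "dec Y d' (pr \<eta> 0 r \<odot> \<zeta>) (N(n := Y (Suc n))) (m'(r := m' r, n := I (Y (Suc n)))) (e'(n := d' n)) (\<eta>(n := \<zeta>))"
    by (intro dec_snoc[OF c r]) (use N Y0 dn d' in auto)
  then show ?thesis using pr\<zeta> by auto
qed

end

section \<open>Mapping cones\<close>

context tilting_category begin

text \<open>The syzygies \<open>W k\<close> of the mapping cone are extensions of \<open>M (k + 1)\<close> by \<open>N k\<close>: the step from \<open>W k\<close>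
  to \<open>W (k + 1)\<close> is the octahedron on \<open>W k \<rightarrow> M (k + 1) \<oplus> Y (k + 1) \<rightarrow> X (k + 2) \<oplus> Y (k + 1)\<close>.\<close>

lemma cone_step:
  assumes D: "dec X d \<delta> M m e \<epsilon>" and D': "dec Y d' \<rho> N m' e' \<eta>" and k: "k < n"
    and g: "\<And>i. i \<le> n \<Longrightarrow> g i \<in> H 0 (M i) (N i)" "\<And>i. i < n \<Longrightarrow> g i \<odot> \<epsilon> (Suc i) = \<eta> (Suc i) \<odot> g (Suc i)"
    and t: "Tri (N k) a W b (M (Suc k)) (\<eta> (Suc k) \<odot> g (Suc k))"
  shows "\<exists>W' a' b' \<psi> K i1 i2 p1 p2 q \<chi>.
    (Suc k < n \<longrightarrow> Tri (N (Suc k)) a' W' b' (M (Suc (Suc k))) (\<eta> (Suc (Suc k)) \<odot> g (Suc (Suc k))) \<and>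
       b' \<odot> q = e (Suc (Suc k)) \<odot> p1) \<and>
    (Suc k = n \<longrightarrow> W' = N n \<and> a' = I (N n)) \<and>
    bip (X (Suc (Suc k))) (Y (Suc k)) K i1 i2 p1 p2 \<and> \<psi> \<in> H 0 W (Y (Suc k)) \<and> \<psi> \<odot> a = m' k \<and>
    e' (Suc k) \<odot> \<psi> = g (Suc k) \<odot> b \<and> Tri W (i2 \<odot> \<psi> - i1 \<odot> (m (Suc k) \<odot> b)) K q W' \<chi> \<and>
    \<chi> \<odot> a' = a \<odot> \<eta> (Suc k) \<and> q \<odot> (i1 \<odot> m (Suc k)) = a' \<odot> g (Suc k) \<and> q \<odot> i2 = a' \<odot> e' (Suc k)"
proof -
  note DD = dec_D[OF D] and DD' = dec_D[OF D'] and tD = tri_D[OF t]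
  have k': "Suc k \<le> n" using k by simp
  note t' = DD'(10)[OF k]
  have gk: "g (Suc k) \<in> H 0 (M (Suc k)) (N (Suc k))" and e'k: "e' (Suc k) \<in> H 0 (Y (Suc k)) (N (Suc k))"
    using g(1)[OF k'] tri_D(5)[OF t'] by auto
  obtain \<psi> S j1 j2 q1 q2 where \<psi>: "\<psi> \<in> H 0 W (Y (Suc k))" "\<psi> \<odot> a = m' k" "e' (Suc k) \<odot> \<psi> = g (Suc k) \<odot> b"
    and b: "bip (M (Suc k)) (Y (Suc k)) S j1 j2 q1 q2"
    and c: "Tri W (j2 \<odot> \<psi> - j1 \<odot> b) S (g (Suc k) \<odot> q1 + e' (Suc k) \<odot> q2) (N (Suc k)) (a \<odot> \<eta> (Suc k))"
    using cone[OF t t' gk] by blast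
  note bD = bip_D[OF b] and bS = bip_mul[OF b]
  have gj1: "(g (Suc k) \<odot> q1 + e' (Suc k) \<odot> q2) \<odot> j1 = g (Suc k)"
    by (simp add: mul_simps bS(1-4) bS(7)[OF gk])
  have gj2: "(g (Suc k) \<odot> q1 + e' (Suc k) \<odot> q2) \<odot> j2 = e' (Suc k)"
    by (simp add: mul_simps bS(1-4) bS(8)[OF e'k])
  show ?thesis
  proof (cases "Suc k = n")
    \<comment> \<open>At the last step \<open>M n = X (Suc n)\<close> and \<open>m n\<close> is an
      identity, so the cone triangle is already the wanted one.\<close>
    case True
    have 1: "m (Suc k) = I (M (Suc k))" "X (Suc (Suc k)) = M (Suc k)" using DD(5,7) True by auto
    have 2: "m (Suc k) \<odot> b = b" "j1 \<odot> m (Suc k) = j1" unfolding 1 by (rule id_left[OF tD(5)], rule id_right[OF bD(4)])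
    have 3: "I (N n) \<odot> g (Suc k) = g (Suc k)" "I (N n) \<odot> e' (Suc k) = e' (Suc k)"
      using id_left[OF gk] id_left[OF e'k] True by auto
    have 4: "(a \<odot> \<eta> (Suc k)) \<odot> I (N n) = a \<odot> \<eta> (Suc k)"
      using tri_D(18)[OF t'] True by (simp add: mul_assoc)
    show ?thesis
      by (rule exI[of _ "N n"], rule exI[of _ "I (N n)"], rule exI, rule exI[of _ \<psi>], rule exI[of _ S],
          rule exI[of _ j1], rule exI[of _ j2], rule exI[of _ q1], rule exI[of _ q2],
          rule exI[of _ "g (Suc k) \<odot> q1 + e' (Suc k) \<odot> q2"], rule exI[of _ "a \<odot> \<eta> (Suc k)"], intro conjI impI)
        (use True \<psi> b c gj1 gj2 1(2) 2 3 4 in auto)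
  next
    case False
    then have kn: "Suc k < n" "Suc (Suc k) \<le> Suc n" "Suc k \<le> Suc n" using k by auto
    obtain K i1 i2 p1 p2 where b': "bip (X (Suc (Suc k))) (Y (Suc k)) K i1 i2 p1 p2"
      using bip_exists T_Obj dec_m(4)[OF D kn(2)] dec_m(4)[OF D' kn(3)] by blast
    note t2 = DD(10)[OF kn(1)]
    \<comment> \<open>Adding the identity of \<open>Y (Suc k)\<close> to the triangle of
      \<open>M (Suc k)\<close> produces an inflation that can be composed with the one of the cone
      triangle.\<close>
    note ta = tri_add_id[OF t2 b b']
    let ?s = "i1 \<odot> (m (Suc k) \<odot> q1) + i2 \<odot> q2"
    obtain W' h a' b'' \<chi> where o: "Tri W (?s \<odot> (j2 \<odot> \<psi> - j1 \<odot> b)) K h W' \<chi>"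
      "Tri (N (Suc k)) a' W' b'' (M (Suc (Suc k))) ((g (Suc k) \<odot> q1 + e' (Suc k) \<odot> q2) \<odot> (j1 \<odot> \<epsilon> (Suc (Suc k))))"
      "h \<odot> ?s = a' \<odot> (g (Suc k) \<odot> q1 + e' (Suc k) \<odot> q2)" "b'' \<odot> h = e (Suc (Suc k)) \<odot> p1" "\<chi> \<odot> a' = a \<odot> \<eta> (Suc k)"
      using octahedron[OF c ta] by blast
    have 1: "?s \<odot> (j2 \<odot> \<psi> - j1 \<odot> b) = i2 \<odot> \<psi> - i1 \<odot> (m (Suc k) \<odot> b)"
      by (simp add: mul_simps bS(1-4) bS(5)[OF tD(5)] bS(6)[OF \<psi>(1)])
    have 2: "(g (Suc k) \<odot> q1 + e' (Suc k) \<odot> q2) \<odot> (j1 \<odot> \<epsilon> (Suc (Suc k))) = \<eta> (Suc (Suc k)) \<odot> g (Suc (Suc k))"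
      using mul_ext[OF gj1] g(2)[OF kn(1)] by simp
    have sj: "?s \<odot> j1 = i1 \<odot> m (Suc k)" "?s \<odot> j2 = i2"
      by (simp_all add: mul_simps bS tri_D[OF t2] id_right[OF bip_D(5)[OF b']])
    have 3: "h \<odot> (i1 \<odot> m (Suc k)) = a' \<odot> g (Suc k)" using mul_ext[OF o(3), of j1] sj(1) gj1 by (simp add: mul_assoc)
    have 4: "h \<odot> i2 = a' \<odot> e' (Suc k)" using mul_ext[OF o(3), of j2] sj(2) gj2 by (simp add: mul_assoc)
    show ?thesis
      by (rule exI[of _ W'], rule exI[of _ a'], rule exI[of _ b''], rule exI[of _ \<psi>], rule exI[of _ K],
          rule exI[of _ i1], rule exI[of _ i2], rule exI[of _ p1], rule exI[of _ p2],
          rule exI[of _ h], rule exI[of _ \<chi>], intro conjI impI)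
        (use False \<psi> b' o[unfolded 1 2] 3 4 in auto)
  qed
qed

text \<open>Dependent choice of all data at once: \<open>P\<close> describes the triangle of one
  stage, \<open>Q\<close> the link to the next. Both leave the stages beyond n free.\<close>

lemma cone_sequence:
  assumes D: "dec X d \<delta> M m e \<epsilon>" and D': "dec Y d' \<rho> N m' e' \<eta>" and XY: "X 0 = Y 0"
    and g: "g 0 = I (X 0)" "\<And>i. i \<le> n \<Longrightarrow> g i \<in> H 0 (M i) (N i)" "\<And>i. i < n \<Longrightarrow> g i \<odot> \<epsilon> (Suc i) = \<eta> (Suc i) \<odot> g (Suc i)"
  shows "\<exists>W a b \<psi> K i1 i2 p1 p2 q \<chi>. W 0 = X (Suc 0) \<and> a 0 = m 0 \<and> b 0 = e (Suc 0) \<and> W n = N n \<and> a n = I (N n) \<and>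
    (\<forall>k<n. Tri (N k) (a k) (W k) (b k) (M (Suc k)) (\<eta> (Suc k) \<odot> g (Suc k)) \<and>
      bip (X (Suc (Suc k))) (Y (Suc k)) (K (Suc k)) (i1 (Suc k)) (i2 (Suc k)) (p1 (Suc k)) (p2 (Suc k)) \<and>
      \<psi> (Suc k) \<in> H 0 (W k) (Y (Suc k)) \<and> \<psi> (Suc k) \<odot> a k = m' k \<and> e' (Suc k) \<odot> \<psi> (Suc k) = g (Suc k) \<odot> b k \<and>
      Tri (W k) (i2 (Suc k) \<odot> \<psi> (Suc k) - i1 (Suc k) \<odot> (m (Suc k) \<odot> b k)) (K (Suc k)) (q (Suc k)) (W (Suc k)) (\<chi> (Suc k)) \<and>
      \<chi> (Suc k) \<odot> a (Suc k) = a k \<odot> \<eta> (Suc k) \<and> q (Suc k) \<odot> (i1 (Suc k) \<odot> m (Suc k)) = a (Suc k) \<odot> g (Suc k) \<and>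
      q (Suc k) \<odot> i2 (Suc k) = a (Suc k) \<odot> e' (Suc k) \<and>
      (Suc k < n \<longrightarrow> b (Suc k) \<odot> q (Suc k) = e (Suc (Suc k)) \<odot> p1 (Suc k)))"
proof -
  note DD = dec_D[OF D] and DD' = dec_D[OF D']
  define P where "P k s \<longleftrightarrow> (case s of (W, a, b, r) \<Rightarrow> (k = 0 \<longrightarrow> W = X (Suc 0) \<and> a = m 0 \<and> b = e (Suc 0)) \<and>
    (k < n \<longrightarrow> Tri (N k) a W b (M (Suc k)) (\<eta> (Suc k) \<odot> g (Suc k))) \<and> (k = n \<longrightarrow> W = N n \<and> a = I (N n)))"
    for k and s :: "'b \<times> 'a \<times> 'a \<times> 'a \<times> 'b \<times> 'a \<times> 'a \<times> 'a \<times> 'a \<times> 'a \<times> 'a"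
  define Q where "Q k s s' \<longleftrightarrow> (case s of (W, a, b, r) \<Rightarrow> case s' of (W', a', b', \<psi>, K, i1, i2, p1, p2, q, \<chi>) \<Rightarrow>
      k < n \<longrightarrow> bip (X (Suc (Suc k))) (Y (Suc k)) K i1 i2 p1 p2 \<and>
      \<psi> \<in> H 0 W (Y (Suc k)) \<and> \<psi> \<odot> a = m' k \<and> e' (Suc k) \<odot> \<psi> = g (Suc k) \<odot> b \<and>
      Tri W (i2 \<odot> \<psi> - i1 \<odot> (m (Suc k) \<odot> b)) K q W' \<chi> \<and>
      \<chi> \<odot> a' = a \<odot> \<eta> (Suc k) \<and> q \<odot> (i1 \<odot> m (Suc k)) = a' \<odot> g (Suc k) \<and> q \<odot> i2 = a' \<odot> e' (Suc k) \<and>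
      (Suc k < n \<longrightarrow> b' \<odot> q = e (Suc (Suc k)) \<odot> p1))"
    for k and s s' :: "'b \<times> 'a \<times> 'a \<times> 'a \<times> 'b \<times> 'a \<times> 'a \<times> 'a \<times> 'a \<times> 'a \<times> 'a"
  have "\<exists>f. \<forall>k. P k (f k) \<and> Q k (f k) (f (Suc k))"
  proof (rule dependent_nat_choice)
    \<comment> \<open>As \<open>g 0\<close> is an identity, the sequence can start with the first
      triangle of X itself.\<close>
    have z: "\<eta> (Suc 0) \<odot> g (Suc 0) = \<epsilon> (Suc 0)"
      using g(1) g(3)[of 0] n_pos id_left[OF dec_m(5)[OF D, of 1]] DD(4) by simp
    have "Tri (N 0) (m 0) (X (Suc 0)) (e (Suc 0)) (M (Suc 0)) (\<eta> (Suc 0) \<odot> g (Suc 0))"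
      unfolding z using DD(4) DD(10)[of 0] DD'(4) XY n_pos by simp
    then have "P 0 (X (Suc 0), m 0, e (Suc 0), r)" for r unfolding P_def using n_pos by simp
    then show "\<exists>s. P 0 s" by blast
  next
    fix s k assume s: "P k s"
    obtain W a b r where sW: "s = (W, a, b, r)" by (metis prod_cases4)
    show "\<exists>s'. P (Suc k) s' \<and> Q k s s'"
    proof (cases "k < n")
      case False then show ?thesis unfolding P_def Q_def by (auto split: prod.splits)
    next
      case True
      then have t: "Tri (N k) a W b (M (Suc k)) (\<eta> (Suc k) \<odot> g (Suc k))" using s sW unfolding P_def by simp
      from cone_step[OF D D' True g(2,3) t]
      obtain W' a' b' \<psi> K i1 i2 p1 p2 q \<chi> where
        *: "Suc k < n \<Longrightarrow> Tri (N (Suc k)) a' W' b' (M (Suc (Suc k))) (\<eta> (Suc (Suc k)) \<odot> g (Suc (Suc k)))"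
        "Suc k < n \<Longrightarrow> b' \<odot> q = e (Suc (Suc k)) \<odot> p1"
        "Suc k = n \<Longrightarrow> W' = N n \<and> a' = I (N n)"
        "bip (X (Suc (Suc k))) (Y (Suc k)) K i1 i2 p1 p2" "\<psi> \<in> H 0 W (Y (Suc k))" "\<psi> \<odot> a = m' k"
        "e' (Suc k) \<odot> \<psi> = g (Suc k) \<odot> b" "Tri W (i2 \<odot> \<psi> - i1 \<odot> (m (Suc k) \<odot> b)) K q W' \<chi>"
        "\<chi> \<odot> a' = a \<odot> \<eta> (Suc k)" "q \<odot> (i1 \<odot> m (Suc k)) = a' \<odot> g (Suc k)" "q \<odot> i2 = a' \<odot> e' (Suc k)"
        by blast
      show ?thesis
        by (rule exI[of _ "(W', a', b', \<psi>, K, i1, i2, p1, p2, q, \<chi>)"]) (use * in \<open>simp add: P_def Q_def sW\<close>)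
    qed
  qed
  then obtain f where f: "\<And>k. P k (f k)" "\<And>k. Q k (f k) (f (Suc k))" by blast
  define W where "W = (\<lambda>k. fst (f k))"
  define a where "a = (\<lambda>k. fst (snd (f k)))"
  define b where "b = (\<lambda>k. fst (snd (snd (f k))))"
  define r where "r = (\<lambda>k. snd (snd (snd (f k))))"
  define \<psi> where "\<psi> = (\<lambda>k. fst (r k))"
  define K where "K = (\<lambda>k. fst (snd (r k)))"
  define i1 where "i1 = (\<lambda>k. fst (snd (snd (r k))))"
  define i2 where "i2 = (\<lambda>k. fst (snd (snd (snd (r k)))))"
  define p1 where "p1 = (\<lambda>k. fst (snd (snd (snd (snd (r k))))))"
  define p2 where "p2 = (\<lambda>k. fst (snd (snd (snd (snd (snd (r k)))))))"
  define q where "q = (\<lambda>k. fst (snd (snd (snd (snd (snd (snd (r k))))))))"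
  define \<chi> where "\<chi> = (\<lambda>k. snd (snd (snd (snd (snd (snd (snd (r k))))))))"
  have fk: "f k = (W k, a k, b k, \<psi> k, K k, i1 k, i2 k, p1 k, p2 k, q k, \<chi> k)" for k
    unfolding W_def a_def b_def \<psi>_def K_def i1_def i2_def p1_def p2_def q_def \<chi>_def r_def by simp
  note P = f(1)[unfolded P_def fk prod.case, rule_format] and Q = f(2)[unfolded Q_def fk prod.case, rule_format]
  show ?thesis
    by (rule exI[of _ W], rule exI[of _ a], rule exI[of _ b], rule exI[of _ \<psi>], rule exI[of _ K], rule exI[of _ i1],
        rule exI[of _ i2], rule exI[of _ p1], rule exI[of _ p2], rule exI[of _ q], rule exI[of _ \<chi>], intro conjI allI impI)
      (use P[of 0] P[of n] P Q in \<open>blast+\<close>)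
qed

text \<open>The lift is not chosen beforehand but read off from the octahedra: in degree j + 1 it is
  \<open>\<psi> (Suc j)\<close> after the map from \<open>X (Suc j)\<close> through the cone to
  \<open>W j\<close>. So the complex that has been decomposed is the cone of exactly this
  lift.\<close>

lemma dec_cone:
  assumes D: "dec X d \<delta> M m e \<epsilon>" and D': "dec Y d' \<rho> N m' e' \<eta>" and XY: "X 0 = Y 0"
    and c: "c \<in> H 0 (X (Suc n)) (Y (Suc n))" and \<delta>: "\<delta> = \<rho> \<odot> c"
  shows "\<exists>f K dK i1 i2 p1 p2 W m2 e2 \<chi>. cmap X d Y d' f \<and> f 0 = I (X 0) \<and> f (Suc n) = c \<and>
    K 0 = X (Suc 0) \<and> K (Suc n) = Y (Suc n) \<and>
    (\<forall>k. 1 \<le> k \<and> k \<le> n \<longrightarrow> bip (X (Suc k)) (Y k) (K k) (i1 k) (i2 k) (p1 k) (p2 k)) \<and>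
    dK 0 = i1 1 \<odot> (- d 1) + i2 1 \<odot> f 1 \<and>
    (\<forall>k. 1 \<le> k \<and> k < n \<longrightarrow> dK k = i1 (Suc k) \<odot> (- d (Suc k) \<odot> p1 k) + i2 (Suc k) \<odot> (f (Suc k) \<odot> p1 k + d' k \<odot> p2 k)) \<and>
    dK n = f (Suc n) \<odot> p1 n + d' n \<odot> p2 n \<and> dec K dK (d 0 \<odot> \<rho>) W m2 e2 \<chi>"
proof -
  note DD = dec_D[OF D] and DD' = dec_D[OF D']
  have IX: "I (X 0) \<in> H 0 (X 0) (Y 0)" using H_id[OF T_Obj[OF DD(2)]] XY by simp
  have "I (X 0) \<odot> \<delta> = \<rho> \<odot> c" using id_left[OF dec_zero(4)[OF D]] \<delta> by simp
  then obtain g where g: "g 0 = I (X 0)" "g n = c" "\<And>i. i \<le> n \<Longrightarrow> g i \<in> H 0 (M i) (N i)"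
    "\<And>i. i < n \<Longrightarrow> g i \<odot> \<epsilon> (Suc i) = \<eta> (Suc i) \<odot> g (Suc i)"
    using dec_syzygy_lift[OF D D' IX c] by blast
  obtain W a b \<psi> K i1 i2 p1 p2 q \<chi> where W0: "W 0 = X (Suc 0)" "a 0 = m 0" "b 0 = e (Suc 0)" "W n = N n" "a n = I (N n)"
    and "\<forall>k<n. Tri (N k) (a k) (W k) (b k) (M (Suc k)) (\<eta> (Suc k) \<odot> g (Suc k)) \<and>
      bip (X (Suc (Suc k))) (Y (Suc k)) (K (Suc k)) (i1 (Suc k)) (i2 (Suc k)) (p1 (Suc k)) (p2 (Suc k)) \<and>
      \<psi> (Suc k) \<in> H 0 (W k) (Y (Suc k)) \<and> \<psi> (Suc k) \<odot> a k = m' k \<and> e' (Suc k) \<odot> \<psi> (Suc k) = g (Suc k) \<odot> b k \<and>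
      Tri (W k) (i2 (Suc k) \<odot> \<psi> (Suc k) - i1 (Suc k) \<odot> (m (Suc k) \<odot> b k)) (K (Suc k)) (q (Suc k)) (W (Suc k)) (\<chi> (Suc k)) \<and>
      \<chi> (Suc k) \<odot> a (Suc k) = a k \<odot> \<eta> (Suc k) \<and> q (Suc k) \<odot> (i1 (Suc k) \<odot> m (Suc k)) = a (Suc k) \<odot> g (Suc k) \<and>
      q (Suc k) \<odot> i2 (Suc k) = a (Suc k) \<odot> e' (Suc k) \<and>
      (Suc k < n \<longrightarrow> b (Suc k) \<odot> q (Suc k) = e (Suc (Suc k)) \<odot> p1 (Suc k))"
    using cone_sequence[OF D D' XY g(1,3,4)] by blast
  then have R: "Tri (N k) (a k) (W k) (b k) (M (Suc k)) (\<eta> (Suc k) \<odot> g (Suc k))"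
      "bip (X (Suc (Suc k))) (Y (Suc k)) (K (Suc k)) (i1 (Suc k)) (i2 (Suc k)) (p1 (Suc k)) (p2 (Suc k))"
      "\<psi> (Suc k) \<in> H 0 (W k) (Y (Suc k))" "\<psi> (Suc k) \<odot> a k = m' k" "e' (Suc k) \<odot> \<psi> (Suc k) = g (Suc k) \<odot> b k"
      "Tri (W k) (i2 (Suc k) \<odot> \<psi> (Suc k) - i1 (Suc k) \<odot> (m (Suc k) \<odot> b k)) (K (Suc k)) (q (Suc k)) (W (Suc k)) (\<chi> (Suc k))"
      "\<chi> (Suc k) \<odot> a (Suc k) = a k \<odot> \<eta> (Suc k)" "q (Suc k) \<odot> (i1 (Suc k) \<odot> m (Suc k)) = a (Suc k) \<odot> g (Suc k)"
      "q (Suc k) \<odot> i2 (Suc k) = a (Suc k) \<odot> e' (Suc k)"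
      "Suc k < n \<Longrightarrow> b (Suc k) \<odot> q (Suc k) = e (Suc (Suc k)) \<odot> p1 (Suc k)" if "k < n" for k using that by blast+
  \<comment> \<open>Degree 0 of the cone is \<open>X (Suc 0)\<close> alone and degree n + 1 is
    \<open>Y (Suc n)\<close> alone. With identities for \<open>q' 0\<close> and \<open>t 0\<close>
    the lower end obeys the general formulas.\<close>
  define K' where "K' = K(0 := X (Suc 0), Suc n := Y (Suc n))"
  define q' where "q' = q(0 := I (X (Suc 0)))"
  define t where "t = i1(0 := I (X (Suc 0)))"
  have XT: "X i \<in> T" "Y i \<in> T" if "i \<le> Suc n" for i using dec_m(4)[OF D that] dec_m(4)[OF D' that] .
  have X1: "I (X (Suc 0)) \<in> H 0 (X (Suc 0)) (X (Suc 0))" using H_id[OF T_Obj[OF XT(1)[of "Suc 0"]]] by simp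
  have tH: "t j \<in> H 0 (X (Suc j)) (K' j)" and qH: "q' j \<in> H 0 (K' j) (W j)" if "j \<le> n" for j
    using bip_D(4)[OF R(2)[of "j - 1"]] tri_D(5)[OF R(6)[of "j - 1"]] that X1 W0(1)
    unfolding t_def K'_def q'_def by (cases j; auto)+
  have bqt: "b j \<odot> (q' j \<odot> t j) = e (Suc j)" if "j < n" for j
  proof (cases j)
    case 0
    have "b 0 \<odot> I (X (Suc 0)) = e (Suc 0)" using W0 id_right[OF tri_D(5)[OF R(1)[of 0]]] n_pos by simp
    then show ?thesis using 0 id_left[OF X1] unfolding q'_def t_def by simp
  next
    case (Suc i)
    then have i: "i < n" "Suc i < n" using that by auto
    have "e (Suc (Suc i)) \<odot> (p1 (Suc i) \<odot> i1 (Suc i)) = e (Suc (Suc i))"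
      using bip_mul(7)[OF R(2)[OF i(1)] tri_D(5)[OF DD(10)[OF i(2)]]] .
    then show ?thesis using mul_ext[OF R(10)[OF i], of "i1 (Suc i)"] Suc unfolding q'_def t_def by (simp add: mul_assoc)
  qed
  define f where "f = (\<lambda>i. if i = 0 then I (X 0) else if i = Suc n then c else \<psi> i \<odot> (q' (i - 1) \<odot> t (i - 1)))"
  have fS: "f (Suc j) = \<psi> (Suc j) \<odot> (q' j \<odot> t j)" if "j < n" for j using that unfolding f_def by simp
  have f0: "f 0 = I (X 0)" "f (Suc n) = c" unfolding f_def by auto
  have fH: "f i \<in> H 0 (X i) (Y i)" if "i \<le> Suc n" for i
  proof -
    note iS = that
    consider "i = 0" | "i = Suc n" | j where "i = Suc j" "j < n" using iS by (cases "i = Suc n"; cases i) auto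
    then show ?thesis
    proof cases
      case 1 then show ?thesis using f0 IX by simp
    next
      case 2 then show ?thesis using f0 c by simp
    next
      case (3 j)
      then show ?thesis using H_mul0[OF R(3)[OF 3(2)] H_mul0[OF qH tH]] fS by simp
    qed
  qed
  have ef: "e' j \<odot> f j = g j \<odot> e j" if j: "1 \<le> j" "j \<le> n" for j
  proof -
    obtain i where i: "j = Suc i" "i < n" using j by (cases j) auto
    show ?thesis using fS[OF i(2)] mul_ext[OF R(5)[OF i(2)]] bqt[OF i(2)] i(1) by (simp add: mul_assoc)
  qed
  have cm: "cmap X d Y d' f" unfolding cmap_def
  proof (intro conjI allI impI fH)
    fix j assume j: "j \<le> n"
    consider "j = 0" | "j = n" "1 \<le> j" | i where "j = Suc i" "Suc i < n" using j n_pos by (cases "j = n"; cases j) auto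
    then show "f (Suc j) \<odot> d j = d' j \<odot> f j"
    proof cases
      case 1
      have d0: "d 0 = m 0" "d' 0 = m' 0" using dec_zero(5)[OF D] dec_zero(5)[OF D'] by auto
      have "f (Suc 0) = \<psi> (Suc 0)" using fS[of 0] n_pos id_right[OF R(3)[of 0]] id_left[OF X1] W0 unfolding q'_def t_def by simp
      moreover have "d' 0 \<odot> I (X 0) = d' 0" using id_right[OF dec_m(3)[OF D', of 0]] XY by simp
      ultimately show ?thesis using 1 R(4)[of 0] W0(2) d0 f0 n_pos by simp
    next
      case 2
      have "f (Suc n) \<odot> d n = g n \<odot> e n" using f0 g(2) dec_zero(6)[OF D] by simp
      also have "\<dots> = d' n \<odot> f n" using ef[of n] 2 dec_zero(6)[OF D'] by simp
      finally show ?thesis using 2 by simp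
    next
      case (3 i)
      have i: "i < n" using 3 by simp
      have mf: "f (Suc (Suc i)) \<odot> m (Suc i) = m' (Suc i) \<odot> g (Suc i)"
        using fS[OF 3(2)] R(8)[OF i] mul_ext[OF R(4)[OF 3(2)]] unfolding q'_def t_def by (simp add: mul_assoc)
      have "f (Suc (Suc i)) \<odot> d (Suc i) = m' (Suc i) \<odot> (g (Suc i) \<odot> e (Suc i))"
        using DD(8)[of "Suc i"] i mul_ext[OF mf] by (simp add: mul_assoc)
      then show ?thesis using ef[of "Suc i"] DD'(8)[of "Suc i"] i 3(1) by (simp add: mul_assoc)
    qed
  qed
  define m2 where "m2 = (\<lambda>k. if k = n then I (Y (Suc n)) else i2 (Suc k) \<odot> \<psi> (Suc k) - i1 (Suc k) \<odot> (m (Suc k) \<odot> b k))"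
  define dK where "dK = (\<lambda>k. m2 k \<odot> q' k)"
  have NY: "N n = Y (Suc n)" using DD'(5) .
  have m2: "m2 k = i2 (Suc k) \<odot> \<psi> (Suc k) - i1 (Suc k) \<odot> (m (Suc k) \<odot> b k)" if "k < n" for k
    using that unfolding m2_def by simp
  have KT: "K' (Suc k) \<in> T" if "k < n" for k
    using T_bip[OF R(2)[OF that] XT(1) XT(2)] that unfolding K'_def by simp
  have chK: "chain 0 n K' W m2 q' \<chi>" unfolding chain_def using R(6) m2 KT by (auto simp: K'_def q'_def)
  have pr\<chi>: "d 0 \<odot> \<rho> = pr \<chi> 0 n"
  proof -
    \<comment> \<open>The commutation relations between \<open>\<chi>\<close> and
      \<open>\<eta>\<close> telescope. The ends contribute \<open>a 0 = m 0 = d 0\<close> and the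
      identity \<open>a n\<close>.\<close>
    have "a 0 \<odot> pr \<eta> 0 n = pr \<chi> 0 n \<odot> a n" using R(7) by (intro pr_comm) simp
    then show ?thesis using W0(2,4,5) DD'(9) dec_zero(5)[OF D] id_right[OF pr_H[OF chK, of 0 n]] n_pos by simp
  qed
  have decK: "dec K' dK (d 0 \<odot> \<rho>) W m2 q' \<chi>"
    unfolding dec_def using chK XT(1)[of "Suc 0"] XT(2)[of "Suc n"] W0(1,4) NY pr\<chi> n_pos
    by (simp add: K'_def q'_def m2_def dK_def)
  have dK0: "dK 0 = i1 1 \<odot> (- d 1) + i2 1 \<odot> f 1"
  proof -
    have "m2 0 \<in> H 0 (X (Suc 0)) (K' (Suc 0))" using tri_D(4)[OF chain_D(1)[OF chK, of 0]] W0(1) n_pos by simp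
    then have "dK 0 = m2 0" unfolding dK_def q'_def using id_right by simp
    moreover have "f 1 = \<psi> 1" using fS[of 0] n_pos id_right[OF R(3)[of 0]] id_left[OF X1] W0 unfolding q'_def t_def by simp
    moreover have "d 1 = m 1 \<odot> b 0" using DD(8)[of 1] n_pos W0(3) by simp
    ultimately show ?thesis using m2[of 0] n_pos by (simp add: mul_minus_right)
  qed
  have dKk: "dK k = i1 (Suc k) \<odot> (- d (Suc k) \<odot> p1 k) + i2 (Suc k) \<odot> (f (Suc k) \<odot> p1 k + d' k \<odot> p2 k)"
    if k: "1 \<le> k" "k < n" for k
  proof -
    obtain i where i: "k = Suc i" "i < n" using k by (cases k) auto
    note bp = R(2)[OF i(2)]
    have qk: "q' k = q k" "t k = i1 k" using k unfolding q'_def t_def by auto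
    have qkH: "q k \<in> H 0 (K k) (W k)" using tri_D(5)[OF R(6)[OF i(2)]] i by simp
    have "q k = (q k \<odot> i1 k) \<odot> p1 k + (q k \<odot> i2 k) \<odot> p2 k"
      using bip_D(12)[OF bp] id_right[OF qkH] i by (simp add: mul_assoc mul_add_right[symmetric])
    then have "\<psi> (Suc k) \<odot> q k = \<psi> (Suc k) \<odot> ((q k \<odot> i1 k) \<odot> p1 k + (q k \<odot> i2 k) \<odot> p2 k)" by simp
    also have "\<dots> = f (Suc k) \<odot> p1 k + \<psi> (Suc k) \<odot> (a k \<odot> (e' k \<odot> p2 k))"
      using fS[OF k(2)] qk R(9)[OF i(2)] i(1) by (simp add: mul_simps)
    also have "\<psi> (Suc k) \<odot> (a k \<odot> (e' k \<odot> p2 k)) = d' k \<odot> p2 k"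
      using DD'(8)[of k] k mul_ext[OF R(4)[OF k(2)]] by (simp add: mul_assoc)
    finally have 1: "\<psi> (Suc k) \<odot> q k = f (Suc k) \<odot> p1 k + d' k \<odot> p2 k" .
    have 2: "m (Suc k) \<odot> (b k \<odot> q k) = d (Suc k) \<odot> p1 k"
      using R(10)[OF i(2)] DD(8)[of "Suc k"] k i by (simp add: mul_assoc)
    show ?thesis unfolding dK_def qk m2[OF k(2)] by (simp add: mul_diff_left mul_assoc 1 2 mul_minus_left mul_minus_right)
  qed
  have dKn: "dK n = f (Suc n) \<odot> p1 n + d' n \<odot> p2 n"
  proof -
    obtain i where i: "n = Suc i" "i < n" using n_pos by (cases n) auto
    note bp = R(2)[OF i(2)]
    have qnH: "q n \<in> H 0 (K n) (Y (Suc n))" using tri_D(5)[OF R(6)[OF i(2)]] i W0(4) NY by simp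
    have qn: "dK n = q n" using id_left[OF qnH] n_pos unfolding dK_def m2_def q'_def by simp
    have "q n \<odot> (i1 n \<odot> m n) = I (N n) \<odot> g n" "q n \<odot> i2 n = I (N n) \<odot> e' n" using R(8,9)[OF i(2)] W0(5) i(1) by auto
    moreover have "I (N n) \<odot> g n = c" "I (N n) \<odot> e' n = d' n"
      using id_left[OF g(3)[of n]] id_left[OF dec_m(2)[OF D', of n]] g(2) dec_zero(6)[OF D'] by auto
    moreover have "i1 n \<odot> m n = i1 n" using id_right[OF bip_D(4)[OF bp]] DD(7) i by simp
    moreover have "q n = (q n \<odot> i1 n) \<odot> p1 n + (q n \<odot> i2 n) \<odot> p2 n"
      using bip_D(12)[OF bp] id_right[OF qnH] i by (simp add: mul_assoc mul_add_right[symmetric])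
    ultimately show ?thesis using qn f0 by simp
  qed
  have bips: "bip (X (Suc k)) (Y k) (K' k) (i1 k) (i2 k) (p1 k) (p2 k)" if "1 \<le> k" "k \<le> n" for k
    using R(2)[of "k - 1"] that unfolding K'_def by (cases k) auto
  show ?thesis
    by (rule exI[of _ f], rule exI[of _ K'], rule exI[of _ dK], rule exI[of _ i1], rule exI[of _ i2],
        rule exI[of _ p1], rule exI[of _ p2], rule exI[of _ W], rule exI[of _ m2], rule exI[of _ q'], rule exI[of _ \<chi>])
      (use cm f0 bips dK0 dKk dKn decK in \<open>simp add: K'_def\<close>)
qed

end

section \<open>Duality\<close>

context tilting_category begin

interpretation dual: tilting_category "\<lambda>x y. y \<odot> x" u Obj "\<lambda>i A B. H i B A" I
    "\<lambda>A x B y C \<delta>. Tri C y B x A \<delta>" T n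
  by (rule dual_tilting)

lemma pr_rev: "i + k \<le> n \<Longrightarrow> dual.pr (\<lambda>j. \<epsilon> (Suc n - j)) i k = pr \<epsilon> (n - (i + k)) k"
proof (induction k arbitrary: i)
  case (Suc k)
  have "n - (Suc i + k) = n - (i + Suc k)" "Suc (n - (i + Suc k) + k) = Suc n - Suc i" using Suc.prems by auto
  then show ?case using Suc.IH[of "Suc i"] Suc.prems by (simp add: pr_snoc del: pr.simps(2))
qed simp

text \<open>Read backwards, degree i becomes n + 1 - i and syzygy i becomes n - i, while the
  families \<open>m\<close> and \<open>e\<close> exchange roles.\<close>

lemma dec_rev:
  assumes D: "dec X d \<delta> M m e \<epsilon>"
  shows "dual.dec (\<lambda>i. X (Suc n - i)) (\<lambda>i. d (n - i)) \<delta> (\<lambda>i. M (n - i)) (\<lambda>i. e (n - i)) (\<lambda>i. m (n - i))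
    (\<lambda>i. \<epsilon> (Suc n - i))"
proof -
  note DD = dec_D[OF D]
  have "dual.chain 0 n (\<lambda>i. X (Suc n - i)) (\<lambda>i. M (n - i)) (\<lambda>i. e (n - i)) (\<lambda>i. m (n - i)) (\<lambda>i. \<epsilon> (Suc n - i))"
    unfolding dual.chain_def
  proof (intro allI impI)
    fix i assume i: "0 \<le> i \<and> i < n"
    then have k: "Suc (n - Suc i) = n - i" "n - Suc i < n" by auto
    show "Tri (M (n - Suc i)) (m (n - Suc i)) (X (Suc n - Suc i)) (e (n - i)) (M (n - i)) (\<epsilon> (Suc n - Suc i)) \<and> X (Suc n - Suc i) \<in> T"
      using chain_D[OF DD(1) _ k(2)] k by simp
  qed
  then show ?thesis unfolding dual.dec_def using DD pr_rev[of 0 n \<epsilon>] by simp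
qed

end

context tilting_category begin

interpretation dual: tilting_category "\<lambda>x y. y \<odot> x" u Obj "\<lambda>i A B. H i B A" I
    "\<lambda>A x B y C \<delta>. Tri C y B x A \<delta>" T n
  by (rule dual_tilting)

lemma deflation_dec:
  assumes t0: "Tri K x B f C \<delta>0" and B: "B \<in> T" and C: "C \<in> T"
  shows "\<exists>X d \<delta> M m e \<epsilon>. dec X d \<delta> M m e \<epsilon> \<and> X (Suc n) = C \<and> X n = B \<and> d n = f"
proof -
  obtain X d \<delta> M m e \<epsilon> where "dual.dec X d \<delta> M m e \<epsilon>" "X 0 = C" "X (Suc 0) = B" "d 0 = f"
    using dual.inflation_dec[OF t0 C B] by blast
  then show ?thesis using dual.dec_rev[of X d \<delta> M m e \<epsilon>] by fastforce
qed

text \<open>This is \<open>dec_cone\<close> in the opposite category for the reversed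
  decompositions, with Y in the role of X. There the summand from Y comes first, so the two summands
  are swapped when the result is read back.\<close>

lemma dec_cocone:
  assumes D: "dec X d \<delta> M m e \<epsilon>" and D': "dec Y d' \<rho> N m' e' \<eta>" and XY: "X (Suc n) = Y (Suc n)"
    and a: "a \<in> H 0 (X 0) (Y 0)" and \<rho>: "\<rho> = a \<odot> \<delta>"
  shows "\<exists>h K dK i1 i2 p1 p2 W m2 e2 \<chi>. cmap X d Y d' h \<and> h 0 = a \<and> h (Suc n) = I (X (Suc n)) \<and>
    K 0 = X 0 \<and> K (Suc n) = Y n \<and>
    (\<forall>k. 1 \<le> k \<and> k \<le> n \<longrightarrow> bip (X k) (Y (k - 1)) (K k) (i1 k) (i2 k) (p1 k) (p2 k)) \<and>
    dK 0 = i1 1 \<odot> d 0 + i2 1 \<odot> h 0 \<and>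
    (\<forall>k. 1 \<le> k \<and> k < n \<longrightarrow> dK k = i1 (Suc k) \<odot> (d k \<odot> p1 k) + i2 (Suc k) \<odot> (h k \<odot> p1 k - d' (k - 1) \<odot> p2 k)) \<and>
    dK n = h n \<odot> p1 n - d' (n - 1) \<odot> p2 n \<and> dec K dK (\<delta> \<odot> d' n) W m2 e2 \<chi>"
proof -
  have XY': "Y (Suc n - 0) = X (Suc n - 0)" using XY by simp
  have a': "a \<in> H 0 (X (Suc n - Suc n)) (Y (Suc n - Suc n))" using a by simp
  from dual.dec_cone[OF dec_rev[OF D'] dec_rev[OF D] XY' a' \<rho>]
  obtain f K dK i1 i2 p1 p2 W m2 e2 \<chi> where
    f: "dual.cmap (\<lambda>i. Y (Suc n - i)) (\<lambda>i. d' (n - i)) (\<lambda>i. X (Suc n - i)) (\<lambda>i. d (n - i)) f"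
      "f 0 = I (Y (Suc n - 0))" "f (Suc n) = a"
    and K: "K 0 = Y (Suc n - Suc 0)" "K (Suc n) = X (Suc n - Suc n)"
    and b: "\<And>k. 1 \<le> k \<and> k \<le> n \<Longrightarrow> dual.bip (Y (Suc n - Suc k)) (X (Suc n - k)) (K k) (i1 k) (i2 k) (p1 k) (p2 k)"
    and dK: "dK 0 = - d' (n - 1) \<odot> i1 1 + f 1 \<odot> i2 1"
      "\<And>k. 1 \<le> k \<and> k < n \<Longrightarrow> dK k = (p1 k \<odot> - d' (n - Suc k)) \<odot> i1 (Suc k) + (p1 k \<odot> f (Suc k) + p2 k \<odot> d (n - k)) \<odot> i2 (Suc k)"
      "dK n = p1 n \<odot> f (Suc n) + p2 n \<odot> d (n - n)"
    and dec: "dual.dec K dK (\<delta> \<odot> d' (n - 0)) W m2 e2 \<chi>"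
    by blast
  define h where "h = (\<lambda>i. f (Suc n - i))"
  define L where "L = (\<lambda>i. K (Suc n - i))"
  define dL where "dL = (\<lambda>i. dK (n - i))"
  define j1 where "j1 = (\<lambda>i. p2 (Suc n - i))"
  define j2 where "j2 = (\<lambda>i. p1 (Suc n - i))"
  define q1 where "q1 = (\<lambda>i. i2 (Suc n - i))"
  define q2 where "q2 = (\<lambda>i. i1 (Suc n - i))"
  have cm: "cmap X d Y d' h" unfolding cmap_def
  proof (intro conjI allI impI)
    fix i assume i: "i \<le> Suc n"
    show "h i \<in> H 0 (X i) (Y i)" using dual.cmap_D(1)[OF f(1), of "Suc n - i"] i unfolding h_def by simp
  next
    fix i assume i: "i \<le> n"
    show "h (Suc i) \<odot> d i = d' i \<odot> h i"
      using dual.cmap_D(2)[OF f(1), of "n - i"] i unfolding h_def by (simp add: Suc_diff_le)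
  qed
  have bips: "bip (X k) (Y (k - 1)) (L k) (j1 k) (j2 k) (q1 k) (q2 k)" if k: "1 \<le> k \<and> k \<le> n" for k
  proof -
    have "1 \<le> Suc n - k \<and> Suc n - k \<le> n" "Suc n - Suc (Suc n - k) = k - 1" "Suc n - (Suc n - k) = k" using k by auto
    then have "bip (Y (k - 1)) (X k) (K (Suc n - k)) (p1 (Suc n - k)) (p2 (Suc n - k)) (i1 (Suc n - k)) (i2 (Suc n - k))"
      using b[of "Suc n - k"] unfolding dual_bip by simp
    then show ?thesis unfolding L_def j1_def j2_def q1_def q2_def by (rule bip_swap)
  qed
  have dk: "dL k = j1 (Suc k) \<odot> (d k \<odot> q1 k) + j2 (Suc k) \<odot> (h k \<odot> q1 k - d' (k - 1) \<odot> q2 k)" if k: "1 \<le> k \<and> k < n" for k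
  proof -
    have "1 \<le> n - k \<and> n - k < n" "Suc (n - k) = Suc n - k" "n - Suc (n - k) = k - 1" "n - (n - k) = k" "Suc n - Suc k = n - k"
      using k by auto
    then show ?thesis using dK(2)[of "n - k"] unfolding dL_def j1_def j2_def q1_def q2_def h_def
      by (simp add: mul_simps algebra_simps)
  qed
  have d0: "dL 0 = j1 1 \<odot> d 0 + j2 1 \<odot> h 0" using dK(3) unfolding dL_def j1_def j2_def h_def by (simp add: add.commute)
  have dn: "dL n = h n \<odot> q1 n - d' (n - 1) \<odot> q2 n" using dK(1) unfolding dL_def q1_def q2_def h_def
    by (simp add: mul_minus_left)
  have de: "dec L dL (\<delta> \<odot> d' n) (\<lambda>i. W (n - i)) (\<lambda>i. e2 (n - i)) (\<lambda>i. m2 (n - i)) (\<lambda>i. \<chi> (Suc n - i))"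
    using dual.dec_rev[OF dec] unfolding L_def dL_def by simp
  show ?thesis
    by (rule exI[of _ h], rule exI[of _ L], rule exI[of _ dL], rule exI[of _ j1], rule exI[of _ j2],
        rule exI[of _ q1], rule exI[of _ q2], rule exI[of _ "\<lambda>i. W (n - i)"], rule exI[of _ "\<lambda>i. e2 (n - i)"],
        rule exI[of _ "\<lambda>i. m2 (n - i)"], rule exI[of _ "\<lambda>i. \<chi> (Suc n - i)"])
      (use cm bips dk d0 dn de f K XY in \<open>simp add: h_def L_def\<close>)
qed

end

section \<open>Graded categories inside an endomorphism ring\<close>

text \<open>The product over all commutative groups \<open>G\<close> on a type, each taken once for every index: a type
  class group that contains every family of groups given on carriers.\<close>

typedef ('k, 'v) group_family =
  "{f :: 'v monoid \<times> 'k \<Rightarrow> 'v. \<forall>G k. (comm_group G \<longrightarrow> f (G, k) \<in> carrier G) \<and> (\<not> comm_group G \<longrightarrow> f (G, k) = undefined)}"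
  by (rule exI[of _ "\<lambda>(G, k). if comm_group G then \<one>\<^bsub>G\<^esub> else undefined"])
    (auto simp: comm_group_def group_def monoid.one_closed)

setup_lifting type_definition_group_family

lemma comm_group_simps:
  assumes "comm_group G"
  shows "x \<in> carrier G \<Longrightarrow> y \<in> carrier G \<Longrightarrow> x \<otimes>\<^bsub>G\<^esub> y \<in> carrier G" "\<one>\<^bsub>G\<^esub> \<in> carrier G"
    "x \<in> carrier G \<Longrightarrow> inv\<^bsub>G\<^esub> x \<in> carrier G"
    "x \<in> carrier G \<Longrightarrow> y \<in> carrier G \<Longrightarrow> z \<in> carrier G \<Longrightarrow> x \<otimes>\<^bsub>G\<^esub> y \<otimes>\<^bsub>G\<^esub> z = x \<otimes>\<^bsub>G\<^esub> (y \<otimes>\<^bsub>G\<^esub> z)"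
    "x \<in> carrier G \<Longrightarrow> \<one>\<^bsub>G\<^esub> \<otimes>\<^bsub>G\<^esub> x = x" "x \<in> carrier G \<Longrightarrow> inv\<^bsub>G\<^esub> x \<otimes>\<^bsub>G\<^esub> x = \<one>\<^bsub>G\<^esub>" "x \<in> carrier G \<Longrightarrow> x \<otimes>\<^bsub>G\<^esub> \<one>\<^bsub>G\<^esub> = x"
proof -
  interpret comm_group G by fact
  show "x \<in> carrier G \<Longrightarrow> y \<in> carrier G \<Longrightarrow> x \<otimes>\<^bsub>G\<^esub> y \<in> carrier G" "\<one>\<^bsub>G\<^esub> \<in> carrier G"
    "x \<in> carrier G \<Longrightarrow> inv\<^bsub>G\<^esub> x \<in> carrier G"
    "x \<in> carrier G \<Longrightarrow> y \<in> carrier G \<Longrightarrow> z \<in> carrier G \<Longrightarrow> x \<otimes>\<^bsub>G\<^esub> y \<otimes>\<^bsub>G\<^esub> z = x \<otimes>\<^bsub>G\<^esub> (y \<otimes>\<^bsub>G\<^esub> z)"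
    "x \<in> carrier G \<Longrightarrow> \<one>\<^bsub>G\<^esub> \<otimes>\<^bsub>G\<^esub> x = x" "x \<in> carrier G \<Longrightarrow> inv\<^bsub>G\<^esub> x \<otimes>\<^bsub>G\<^esub> x = \<one>\<^bsub>G\<^esub>" "x \<in> carrier G \<Longrightarrow> x \<otimes>\<^bsub>G\<^esub> \<one>\<^bsub>G\<^esub> = x"
    by (simp_all add: m_assoc)
qed

lemma comm_group_commute:
  assumes "comm_group G" shows "x \<in> carrier G \<Longrightarrow> y \<in> carrier G \<Longrightarrow> x \<otimes>\<^bsub>G\<^esub> y = y \<otimes>\<^bsub>G\<^esub> x"
  using assms by (rule comm_monoid.m_comm[OF comm_group.axioms(1)])

instantiation group_family :: (type, type) ab_group_add
begin

lift_definition zero_group_family :: "('a, 'b) group_family"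
  is "\<lambda>(G, k). if comm_group G then \<one>\<^bsub>G\<^esub> else undefined"
  by (simp add: comm_group_simps)

lift_definition plus_group_family :: "('a, 'b) group_family \<Rightarrow> ('a, 'b) group_family \<Rightarrow> ('a, 'b) group_family"
  is "\<lambda>f g (G, k). if comm_group G then f (G, k) \<otimes>\<^bsub>G\<^esub> g (G, k) else undefined"
  by (simp add: comm_group_simps)

lift_definition uminus_group_family :: "('a, 'b) group_family \<Rightarrow> ('a, 'b) group_family"
  is "\<lambda>f (G, k). if comm_group G then inv\<^bsub>G\<^esub> f (G, k) else undefined"
  by (simp add: comm_group_simps)

definition minus_group_family :: "('a, 'b) group_family \<Rightarrow> ('a, 'b) group_family \<Rightarrow> ('a, 'b) group_family" where
  "minus_group_family f g = f + (- g)"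

instance
proof
  fix a b c :: "('a, 'b) group_family"
  show "a + b + c = a + (b + c)" by transfer (auto simp: comm_group_simps fun_eq_iff)
  show "a + b = b + a" by transfer (auto simp: fun_eq_iff intro: comm_group_commute)
  show "0 + a = a" by transfer (auto simp: comm_group_simps fun_eq_iff)
  show "- a + a = 0" by transfer (auto simp: comm_group_simps fun_eq_iff)
  show "a - b = a + - b" by (rule minus_group_family_def)
qed

end

text \<open>A homogeneous element acts on the product of all homogeneous components by composition on the left.
  This embeds the whole graded category into one associative ring, so that computations in it need
  no carrier conditions.\<close>

typedef (overloaded) 'a endo = "{f :: 'a::ab_group_add \<Rightarrow> 'a. \<forall>x y. f (x + y) = f x + f y}"
  by (rule exI[of _ "\<lambda>x. x"]) simp

setup_lifting type_definition_endo

instantiation endo :: (ab_group_add) ab_group_add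
begin
lift_definition zero_endo :: "'a endo" is "\<lambda>_. 0" by simp
lift_definition plus_endo :: "'a endo \<Rightarrow> 'a endo \<Rightarrow> 'a endo" is "\<lambda>f g x. f x + g x" by (simp add: algebra_simps)
lift_definition minus_endo :: "'a endo \<Rightarrow> 'a endo \<Rightarrow> 'a endo" is "\<lambda>f g x. f x - g x" by (simp add: algebra_simps)
lift_definition uminus_endo :: "'a endo \<Rightarrow> 'a endo" is "\<lambda>f x. - f x" by simp
instance by (standard; transfer; simp add: algebra_simps)
end

lift_definition endo_mul :: "'a::ab_group_add endo \<Rightarrow> 'a endo \<Rightarrow> 'a endo" is "\<lambda>f g x. f (g x)" by simp
lift_definition endo_one :: "'a::ab_group_add endo" is "\<lambda>x. x" by simp

lemma endo_mul:
  "endo_mul (endo_mul a b) c = endo_mul a (endo_mul b c)" "endo_mul a (b + c) = endo_mul a b + endo_mul a c"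
  "endo_mul (a + b) c = endo_mul a c + endo_mul b c" "endo_mul endo_one a = a" "endo_mul a endo_one = a"
  by (transfer; simp)+

text \<open>The raw form in which the concrete category is supplied: composition takes degrees and
  end terms as arguments, and its laws hold on carriers only.\<close>

locale graded_data =
  fixes Obj :: "'o set" and G :: "nat \<Rightarrow> 'o \<Rightarrow> 'o \<Rightarrow> 'v monoid"
    and gc :: "nat \<Rightarrow> nat \<Rightarrow> 'o \<Rightarrow> 'o \<Rightarrow> 'o \<Rightarrow> 'v \<Rightarrow> 'v \<Rightarrow> 'v" and gid :: "'o \<Rightarrow> 'v"
  assumes G_group: "\<lbrakk>A \<in> Obj; B \<in> Obj\<rbrakk> \<Longrightarrow> comm_group (G i A B)"
    and gid_closed: "A \<in> Obj \<Longrightarrow> gid A \<in> carrier (G 0 A A)"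
    and gc_closed: "\<lbrakk>A \<in> Obj; B \<in> Obj; D \<in> Obj; f \<in> carrier (G i A B); g \<in> carrier (G j B D)\<rbrakk>
      \<Longrightarrow> gc j i A B D g f \<in> carrier (G (i + j) A D)"
    and gc_add_right: "\<lbrakk>A \<in> Obj; B \<in> Obj; D \<in> Obj; f \<in> carrier (G i A B); f' \<in> carrier (G i A B); g \<in> carrier (G j B D)\<rbrakk>
      \<Longrightarrow> gc j i A B D g (f \<otimes>\<^bsub>G i A B\<^esub> f') = gc j i A B D g f \<otimes>\<^bsub>G (i + j) A D\<^esub> gc j i A B D g f'"
    and gc_add_left: "\<lbrakk>A \<in> Obj; B \<in> Obj; D \<in> Obj; f \<in> carrier (G i A B); g \<in> carrier (G j B D); g' \<in> carrier (G j B D)\<rbrakk>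
      \<Longrightarrow> gc j i A B D (g \<otimes>\<^bsub>G j B D\<^esub> g') f = gc j i A B D g f \<otimes>\<^bsub>G (i + j) A D\<^esub> gc j i A B D g' f"
    and gc_assoc: "\<lbrakk>A \<in> Obj; B \<in> Obj; D \<in> Obj; F \<in> Obj; f \<in> carrier (G i A B); g \<in> carrier (G j B D); h \<in> carrier (G k D F)\<rbrakk>
      \<Longrightarrow> gc (j + k) i A B F (gc k j B D F h g) f = gc k (i + j) A D F h (gc j i A B D g f)"
    and gid_left: "\<lbrakk>A \<in> Obj; B \<in> Obj; f \<in> carrier (G i A B)\<rbrakk> \<Longrightarrow> gc 0 i A B B (gid B) f = f"
    and gid_right: "\<lbrakk>A \<in> Obj; B \<in> Obj; f \<in> carrier (G i A B)\<rbrakk> \<Longrightarrow> gc i 0 A A B f (gid A) = f"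
begin

definition at :: "(nat \<times> 'o \<times> 'o, 'v) group_family \<Rightarrow> nat \<Rightarrow> 'o \<Rightarrow> 'o \<Rightarrow> 'v" where
  "at m i A B = Rep_group_family m (G i A B, i, A, B)"

definition valid where
  "valid \<phi> \<longleftrightarrow> (\<forall>i. \<forall>A\<in>Obj. \<forall>B\<in>Obj. \<phi> i A B \<in> carrier (G i A B))"

text \<open>A group sitting at an index to which it does not belong receives its unit, so that
  \<open>mk\<close> respects sums and \<open>at\<close> recovers the family.\<close>

definition mk :: "(nat \<Rightarrow> 'o \<Rightarrow> 'o \<Rightarrow> 'v) \<Rightarrow> (nat \<times> 'o \<times> 'o, 'v) group_family" where
  "mk \<phi> = Abs_group_family (\<lambda>(K, i, A, B). if comm_group K
     then (if A \<in> Obj \<and> B \<in> Obj \<and> K = G i A B then \<phi> i A B else \<one>\<^bsub>K\<^esub>) else undefined)"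

lemma Rep_mk:
  assumes "valid \<phi>"
  shows "Rep_group_family (mk \<phi>) = (\<lambda>(K, i, A, B). if comm_group K
     then (if A \<in> Obj \<and> B \<in> Obj \<and> K = G i A B then \<phi> i A B else \<one>\<^bsub>K\<^esub>) else undefined)"
  unfolding mk_def
  by (rule Abs_group_family_inverse) (use assms in \<open>auto simp: valid_def comm_group_simps\<close>)

lemma at_mk: "valid \<phi> \<Longrightarrow> A \<in> Obj \<Longrightarrow> B \<in> Obj \<Longrightarrow> at (mk \<phi>) i A B = \<phi> i A B"
  unfolding at_def by (simp add: Rep_mk G_group)

lemma at_closed: "A \<in> Obj \<Longrightarrow> B \<in> Obj \<Longrightarrow> at m i A B \<in> carrier (G i A B)"
  using Rep_group_family[of m] G_group[of A B i] unfolding at_def by blast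

lemma at_add: "A \<in> Obj \<Longrightarrow> B \<in> Obj \<Longrightarrow> at (m + m') i A B = at m i A B \<otimes>\<^bsub>G i A B\<^esub> at m' i A B"
  unfolding at_def by (simp add: plus_group_family.rep_eq G_group)

lemma mk_cong: "(\<And>i A B. A \<in> Obj \<Longrightarrow> B \<in> Obj \<Longrightarrow> \<phi> i A B = \<psi> i A B) \<Longrightarrow> mk \<phi> = mk \<psi>"
  unfolding mk_def by (rule arg_cong[where f = Abs_group_family]) (auto simp: fun_eq_iff)

lemma mk_add:
  assumes "valid \<phi>" "valid \<psi>"
  shows "mk (\<lambda>i A B. \<phi> i A B \<otimes>\<^bsub>G i A B\<^esub> \<psi> i A B) = mk \<phi> + mk \<psi>"
proof -
  have v: "valid (\<lambda>i A B. \<phi> i A B \<otimes>\<^bsub>G i A B\<^esub> \<psi> i A B)"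
    using assms G_group unfolding valid_def by (simp add: comm_group_simps)
  show ?thesis
    by (rule Rep_group_family_inject[THEN iffD1])
      (auto simp: plus_group_family.rep_eq Rep_mk v assms fun_eq_iff comm_group_simps)
qed

definition act :: "nat \<Rightarrow> 'o \<Rightarrow> 'o \<Rightarrow> 'v \<Rightarrow> (nat \<times> 'o \<times> 'o, 'v) group_family \<Rightarrow> nat \<Rightarrow> 'o \<Rightarrow> 'o \<Rightarrow> 'v" where
  "act i A B f m = (\<lambda>k X Y. if Y = B \<and> i \<le> k then gc i (k - i) X A B f (at m (k - i) X A) else \<one>\<^bsub>G k X Y\<^esub>)"

definition emb :: "nat \<Rightarrow> 'o \<Rightarrow> 'o \<Rightarrow> 'v \<Rightarrow> (nat \<times> 'o \<times> 'o, 'v) group_family endo" where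
  "emb i A B f = Abs_endo (\<lambda>m. mk (act i A B f m))"

context
  fixes i A B f assumes A: "A \<in> Obj" and B: "B \<in> Obj" and f: "f \<in> carrier (G i A B)"
begin

lemma act_valid: "valid (act i A B f m)"
  unfolding valid_def
proof (intro allI ballI)
  fix k X Y assume X: "X \<in> Obj" and Y: "Y \<in> Obj"
  have "gc i (k - i) X A B f (at m (k - i) X A) \<in> carrier (G (k - i + i) X B)"
    by (rule gc_closed[OF X A B at_closed[OF X A] f])
  then show "act i A B f m k X Y \<in> carrier (G k X Y)"
    using G_group[OF X Y] unfolding act_def by (auto simp: comm_group_simps)
qed

lemma act_add:
  assumes X: "X \<in> Obj" and Y: "Y \<in> Obj"
  shows "act i A B f (m + m') k X Y = act i A B f m k X Y \<otimes>\<^bsub>G k X Y\<^esub> act i A B f m' k X Y"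
proof -
  have "gc i (k - i) X A B f (at m (k - i) X A \<otimes>\<^bsub>G (k - i) X A\<^esub> at m' (k - i) X A) =
    gc i (k - i) X A B f (at m (k - i) X A) \<otimes>\<^bsub>G (k - i + i) X B\<^esub> gc i (k - i) X A B f (at m' (k - i) X A)"
    by (rule gc_add_right[OF X A B at_closed[OF X A] at_closed[OF X A] f])
  then show ?thesis using G_group[OF X Y] unfolding act_def by (auto simp: at_add[OF X A] comm_group_simps)
qed

lemma Rep_emb: "Rep_endo (emb i A B f) = (\<lambda>m. mk (act i A B f m))"
  unfolding emb_def
proof (rule Abs_endo_inverse, clarify)
  fix m m'
  have "mk (act i A B f (m + m')) = mk (\<lambda>k X Y. act i A B f m k X Y \<otimes>\<^bsub>G k X Y\<^esub> act i A B f m' k X Y)"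
    by (rule mk_cong) (rule act_add)
  then show "mk (act i A B f (m + m')) = mk (act i A B f m) + mk (act i A B f m')" by (simp add: mk_add act_valid)
qed

end

lemma emb_add:
  assumes A: "A \<in> Obj" and B: "B \<in> Obj" and f: "f \<in> carrier (G i A B)" "g \<in> carrier (G i A B)"
  shows "emb i A B (f \<otimes>\<^bsub>G i A B\<^esub> g) = emb i A B f + emb i A B g"
proof -
  have fg: "f \<otimes>\<^bsub>G i A B\<^esub> g \<in> carrier (G i A B)" using f G_group[OF A B] by (simp add: comm_group_simps)
  have "mk (act i A B (f \<otimes>\<^bsub>G i A B\<^esub> g) m) = mk (act i A B f m) + mk (act i A B g m)" for m
  proof -
    have "mk (act i A B (f \<otimes>\<^bsub>G i A B\<^esub> g) m) = mk (\<lambda>k X Y. act i A B f m k X Y \<otimes>\<^bsub>G k X Y\<^esub> act i A B g m k X Y)"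
    proof (rule mk_cong)
      fix k X Y assume X: "X \<in> Obj" and Y: "Y \<in> Obj"
      show "act i A B (f \<otimes>\<^bsub>G i A B\<^esub> g) m k X Y = act i A B f m k X Y \<otimes>\<^bsub>G k X Y\<^esub> act i A B g m k X Y"
      proof -
        have "gc i (k - i) X A B (f \<otimes>\<^bsub>G i A B\<^esub> g) (at m (k - i) X A) =
          gc i (k - i) X A B f (at m (k - i) X A) \<otimes>\<^bsub>G (k - i + i) X B\<^esub> gc i (k - i) X A B g (at m (k - i) X A)"
          by (rule gc_add_left[OF X A B at_closed[OF X A] f])
        then show ?thesis using G_group[OF X Y] unfolding act_def by (auto simp: comm_group_simps)
      qed
    qed
    then show ?thesis by (simp add: mk_add act_valid[OF A B] f)
  qed
  then show ?thesis
    by (intro Rep_endo_inject[THEN iffD1]) (simp add: Rep_emb[OF A B] f fg plus_endo.rep_eq)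
qed

text \<open>On components of degree at least i + j this is associativity of \<open>gc\<close>; all
  other components are units on both sides.\<close>

lemma emb_comp:
  assumes A: "A \<in> Obj" and B: "B \<in> Obj" and D: "D \<in> Obj" and f: "f \<in> carrier (G i A B)" and g: "g \<in> carrier (G j B D)"
  shows "endo_mul (emb j B D g) (emb i A B f) = emb (i + j) A D (gc j i A B D g f)"
proof -
  note gf = gc_closed[OF A B D f g]
  have "mk (act j B D g (mk (act i A B f m))) = mk (act (i + j) A D (gc j i A B D g f) m)" for m
  proof (rule mk_cong)
    fix k X Y assume X: "X \<in> Obj" and Y: "Y \<in> Obj"
    have one: "gc j l X B D g \<one>\<^bsub>G l X B\<^esub> = \<one>\<^bsub>G (l + j) X D\<^esub>" for l
    proof -
      interpret a: comm_group "G l X B" by (rule G_group[OF X B])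
      interpret b: comm_group "G (l + j) X D" by (rule G_group[OF X D])
      have c: "gc j l X B D g \<one>\<^bsub>G l X B\<^esub> \<in> carrier (G (l + j) X D)" by (rule gc_closed[OF X B D a.one_closed g])
      have "gc j l X B D g \<one>\<^bsub>G l X B\<^esub> \<otimes>\<^bsub>G (l + j) X D\<^esub> gc j l X B D g \<one>\<^bsub>G l X B\<^esub> = gc j l X B D g \<one>\<^bsub>G l X B\<^esub>"
        using gc_add_right[OF X B D a.one_closed a.one_closed g] by simp
      then show ?thesis using c b.l_cancel_one' by metis
    qed
    consider "Y \<noteq> D" | "Y = D" "k < j" | "Y = D" "j \<le> k" "k < i + j" | "Y = D" "i + j \<le> k" by linarith
    then show "act j B D g (mk (act i A B f m)) k X Y = act (i + j) A D (gc j i A B D g f) m k X Y"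
    proof cases
      case 3
      then have *: "\<not> i \<le> k - j" "k - j + j = k" by auto
      then show ?thesis using 3 one[of "k - j"] unfolding act_def[of j] act_def[of "i + j"]
        by (simp add: at_mk[OF act_valid[OF A B f]] X B) (simp add: act_def *)
    next
      case 4
      then have *: "i \<le> k - j" "k - j - i = k - (i + j)" "k - (i + j) + i = k - j" by auto
      have "gc (i + j) (k - (i + j)) X A D (gc j i A B D g f) (at m (k - (i + j)) X A) =
          gc j (k - (i + j) + i) X B D g (gc i (k - (i + j)) X A B f (at m (k - (i + j)) X A))"
        by (rule gc_assoc[OF X A B D at_closed[OF X A] f g])
      then show ?thesis using 4 *
        unfolding act_def[of j] act_def[of "i + j"]
        by (simp add: at_mk[OF act_valid[OF A B f]] X B) (simp add: act_def *)
    qed (auto simp: act_def)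
  qed
  then show ?thesis
    by (intro Rep_endo_inject[THEN iffD1]) (simp add: Rep_emb[OF A B f] Rep_emb[OF B D g] Rep_emb[OF A D gf] endo_mul.rep_eq)
qed

text \<open>An element is recovered from its action on the family that is the identity of A in
  degree 0 and trivial elsewhere.\<close>

lemma emb_inj:
  assumes A: "A \<in> Obj" and B: "B \<in> Obj" and f: "f \<in> carrier (G i A B)" "g \<in> carrier (G i A B)"
    and eq: "emb i A B f = emb i A B g"
  shows "f = g"
proof -
  let ?\<phi> = "\<lambda>k X Y. if k = 0 \<and> X = A \<and> Y = A then gid A else \<one>\<^bsub>G k X Y\<^esub>"
  have v: "valid ?\<phi>" unfolding valid_def using gid_closed[OF A] G_group by (auto simp: comm_group_simps)
  have "at (Rep_endo (emb i A B h) (mk ?\<phi>)) i A B = h" if h: "h \<in> carrier (G i A B)" for h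
    unfolding Rep_emb[OF A B h] at_mk[OF act_valid[OF A B h] A B] unfolding act_def
    by (simp add: at_mk[OF v A A] gid_right[OF A B h])
  from this[OF f(1)] this[OF f(2)] show ?thesis unfolding eq by simp
qed

definition H where "H i A B = (if A \<in> Obj \<and> B \<in> Obj then emb i A B ` carrier (G i A B) else {})"
definition I where "I A = emb 0 A A (gid A)"

lemma emb_H: "\<lbrakk>A \<in> Obj; B \<in> Obj; f \<in> carrier (G i A B)\<rbrakk> \<Longrightarrow> emb i A B f \<in> H i A B"
  unfolding H_def by simp

lemma H_E: assumes "x \<in> H i A B" obtains f where "A \<in> Obj" "B \<in> Obj" "f \<in> carrier (G i A B)" "x = emb i A B f"
  using assms unfolding H_def by (auto split: if_splits)

lemma emb_one: assumes A: "A \<in> Obj" and B: "B \<in> Obj" shows "emb i A B \<one>\<^bsub>G i A B\<^esub> = 0"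
proof -
  have c: "comm_group (G i A B)" by (rule G_group[OF A B])
  have "emb i A B \<one>\<^bsub>G i A B\<^esub> = emb i A B \<one>\<^bsub>G i A B\<^esub> + emb i A B \<one>\<^bsub>G i A B\<^esub>"
    using emb_add[OF A B, of "\<one>\<^bsub>G i A B\<^esub>" i "\<one>\<^bsub>G i A B\<^esub>"] by (simp add: comm_group_simps[OF c])
  then show ?thesis by simp
qed

lemma emb_inv: assumes A: "A \<in> Obj" and B: "B \<in> Obj" and f: "f \<in> carrier (G i A B)"
  shows "emb i A B (inv\<^bsub>G i A B\<^esub> f) = - emb i A B f"
proof -
  have c: "comm_group (G i A B)" by (rule G_group[OF A B])
  have "emb i A B (inv\<^bsub>G i A B\<^esub> f) + emb i A B f = 0"
    using emb_add[OF A B comm_group_simps(3)[OF c f] f] unfolding comm_group_simps(6)[OF c f] emb_one[OF A B] by simp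
  then show ?thesis by (simp add: eq_neg_iff_add_eq_0)
qed

sublocale graded_precategory endo_mul endo_one Obj H I
proof (unfold_locales, goal_cases)
  case (6 f i A B) then show ?case by (auto elim: H_E)
next
  case (7 A B i)
  then show ?case using emb_H[OF 7, of "\<one>\<^bsub>G i A B\<^esub>" i] emb_one[OF 7] G_group[OF 7] by (simp add: comm_group_simps)
next
  case (8 f i A B g)
  obtain f' where f: "A \<in> Obj" "B \<in> Obj" "f' \<in> carrier (G i A B)" "f = emb i A B f'" using 8(1) by (rule H_E)
  obtain g' where g: "g' \<in> carrier (G i A B)" "g = emb i A B g'" using 8(2) by (rule H_E)
  then show ?case using emb_add[OF f(1,2,3) g(1)] emb_H[OF f(1,2)] f G_group[OF f(1,2)] comm_group_simps(1) by metis
next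
  case (9 f i A B)
  obtain f' where f: "A \<in> Obj" "B \<in> Obj" "f' \<in> carrier (G i A B)" "f = emb i A B f'" using 9 by (rule H_E)
  then show ?case using emb_inv[OF f(1-3)] emb_H[OF f(1,2)] G_group[OF f(1,2)] comm_group_simps(3) by metis
next
  case (10 g j B D f i A)
  obtain g' where g: "B \<in> Obj" "D \<in> Obj" "g' \<in> carrier (G j B D)" "g = emb j B D g'" using 10(1) by (rule H_E)
  obtain f' where f: "A \<in> Obj" "f' \<in> carrier (G i A B)" "f = emb i A B f'" using 10(2) by (rule H_E)
  show ?case using emb_comp[OF f(1) g(1,2) f(2) g(3)] emb_H[OF f(1) g(2) gc_closed[OF f(1) g(1,2) f(2) g(3)]] f g by simp
next
  case (11 A) then show ?case unfolding I_def using emb_H gid_closed by blast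
next
  case (12 f i A B)
  obtain f' where f: "A \<in> Obj" "B \<in> Obj" "f' \<in> carrier (G i A B)" "f = emb i A B f'" using 12 by (rule H_E)
  show ?case unfolding I_def f(4) using emb_comp[OF f(1,2,2,3) gid_closed[OF f(2)]] gid_left[OF f(1-3)] by simp
next
  case (13 f i A B)
  obtain f' where f: "A \<in> Obj" "B \<in> Obj" "f' \<in> carrier (G i A B)" "f = emb i A B f'" using 13 by (rule H_E)
  show ?case unfolding I_def f(4) using emb_comp[OF f(1,1,2) gid_closed[OF f(1)] f(3)] gid_right[OF f(1-3)] by simp
qed (simp_all add: endo_mul)

end

section \<open>Extriangulated categories\<close>

context preadditive_category begin

lemma arr_closed:
  assumes "A \<in> Ob C" "B \<in> Ob C"
  shows "zero_arr C A B \<in> arr C A B" "f \<in> arr C A B \<Longrightarrow> g \<in> arr C A B \<Longrightarrow> f \<boxplus>\<^bsub>C\<^esub> g \<in> arr C A B"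
    "f \<in> arr C A B \<Longrightarrow> g \<in> arr C A B \<Longrightarrow> f \<boxminus>\<^bsub>C\<^esub> g \<in> arr C A B" "f \<in> arr C A B \<Longrightarrow> neg_arr C f \<in> arr C A B"
proof -
  interpret comm_group "Hom C A B" using hom_group assms .
  show "zero_arr C A B \<in> arr C A B" "f \<in> arr C A B \<Longrightarrow> g \<in> arr C A B \<Longrightarrow> f \<boxplus>\<^bsub>C\<^esub> g \<in> arr C A B"
    "f \<in> arr C A B \<Longrightarrow> g \<in> arr C A B \<Longrightarrow> f \<boxminus>\<^bsub>C\<^esub> g \<in> arr C A B" "f \<in> arr C A B \<Longrightarrow> neg_arr C f \<in> arr C A B"
    using src_trg[OF assms] by (auto simp: add_arr_def minus_arr_def neg_arr_def)
qed

lemma minus_add: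
  assumes "A \<in> Ob C" "B \<in> Ob C" "f \<in> arr C A B" "g \<in> arr C A B"
  shows "(f \<boxminus>\<^bsub>C\<^esub> g) \<boxplus>\<^bsub>C\<^esub> g = f" "f \<boxminus>\<^bsub>C\<^esub> f = zero_arr C A B"
proof -
  interpret comm_group "Hom C A B" using hom_group assms by blast
  show "(f \<boxminus>\<^bsub>C\<^esub> g) \<boxplus>\<^bsub>C\<^esub> g = f" "f \<boxminus>\<^bsub>C\<^esub> f = zero_arr C A B"
    using src_trg[OF assms(1,2)] assms(3,4) arr_closed(3)[OF assms]
    by (auto simp: add_arr_def minus_arr_def m_assoc)
qed

lemma comp_zero_left:
  assumes "A \<in> Ob C" "B \<in> Ob C" "D \<in> Ob C" "f \<in> arr C A B"
  shows "zero_arr C B D \<cdot>\<^bsub>C\<^esub> f = zero_arr C A D"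
proof -
  interpret a: comm_group "Hom C A D" using hom_group assms by blast
  interpret b: comm_group "Hom C B D" using hom_group assms by blast
  have z: "zero_arr C B D \<in> arr C B D" by simp
  have c: "zero_arr C B D \<cdot>\<^bsub>C\<^esub> f \<in> arr C A D" using comp_arr assms z by blast
  have "zero_arr C B D \<boxplus>\<^bsub>C\<^esub> zero_arr C B D = zero_arr C B D" using src_trg[OF assms(2,3) z] by (simp add: add_arr_def)
  then show ?thesis using comp_add_left[OF assms z z] src_trg[OF assms(1,3) c] c a.l_cancel_one'
    by (metis add_arr_def)
qed

end

context biadditive_functor begin

lemma exts_one: "Z \<in> Ob C \<Longrightarrow> A \<in> Ob C \<Longrightarrow> zero_ext E Z A \<in> exts E Z A"
  using ext_group comm_group_simps(2) by blast

lemma push_closed: "\<lbrakk>Z \<in> Ob C; A \<in> Ob C; A' \<in> Ob C; a \<in> arr C A A'; \<delta> \<in> exts E Z A\<rbrakk> \<Longrightarrow> push C E Z a \<delta> \<in> exts E Z A'"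
  unfolding push_def using Emap_hom[of Z Z A A' "idn C Z" a] idn_arr by (auto simp: hom_def)

lemma pull_closed: "\<lbrakk>Z \<in> Ob C; Z' \<in> Ob C; A \<in> Ob C; c \<in> arr C Z' Z; \<delta> \<in> exts E Z A\<rbrakk> \<Longrightarrow> pull C E A c \<delta> \<in> exts E Z' A"
  unfolding pull_def using Emap_hom[of Z Z' A A c "idn C A"] idn_arr by (auto simp: hom_def)

lemma push_mult: "\<lbrakk>Z \<in> Ob C; A \<in> Ob C; A' \<in> Ob C; a \<in> arr C A A'; \<delta> \<in> exts E Z A; \<rho> \<in> exts E Z A\<rbrakk> \<Longrightarrow>
    push C E Z a (\<delta> \<otimes>\<^bsub>Ext E Z A\<^esub> \<rho>) = push C E Z a \<delta> \<otimes>\<^bsub>Ext E Z A'\<^esub> push C E Z a \<rho>"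
  unfolding push_def using Emap_hom[of Z Z A A' "idn C Z" a] idn_arr by (auto simp: hom_def)

lemma pull_mult: "\<lbrakk>Z \<in> Ob C; Z' \<in> Ob C; A \<in> Ob C; c \<in> arr C Z' Z; \<delta> \<in> exts E Z A; \<rho> \<in> exts E Z A\<rbrakk> \<Longrightarrow>
    pull C E A c (\<delta> \<otimes>\<^bsub>Ext E Z A\<^esub> \<rho>) = pull C E A c \<delta> \<otimes>\<^bsub>Ext E Z' A\<^esub> pull C E A c \<rho>"
  unfolding pull_def using Emap_hom[of Z Z' A A c "idn C A"] idn_arr by (auto simp: hom_def)

lemma push_comp: "\<lbrakk>Z \<in> Ob C; A \<in> Ob C; A' \<in> Ob C; A'' \<in> Ob C; a \<in> arr C A A'; a' \<in> arr C A' A''; \<delta> \<in> exts E Z A\<rbrakk> \<Longrightarrow>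
    push C E Z (a' \<cdot>\<^bsub>C\<^esub> a) \<delta> = push C E Z a' (push C E Z a \<delta>)"
  unfolding push_def using Emap_comp[of Z Z Z A A' A'' "idn C Z" "idn C Z" a a' \<delta>] idn_arr comp_idn by metis

lemma pull_comp: "\<lbrakk>Z \<in> Ob C; Z' \<in> Ob C; Z'' \<in> Ob C; A \<in> Ob C; c \<in> arr C Z' Z; c' \<in> arr C Z'' Z'; \<delta> \<in> exts E Z A\<rbrakk> \<Longrightarrow>
    pull C E A (c \<cdot>\<^bsub>C\<^esub> c') \<delta> = pull C E A c' (pull C E A c \<delta>)"
  unfolding pull_def using Emap_comp[of Z Z' Z'' A A A c c' "idn C A" "idn C A" \<delta>] idn_arr comp_idn by metis

lemma push_pull: "\<lbrakk>Z \<in> Ob C; Z' \<in> Ob C; A \<in> Ob C; A' \<in> Ob C; c \<in> arr C Z' Z; a \<in> arr C A A'; \<delta> \<in> exts E Z A\<rbrakk> \<Longrightarrow>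
    push C E Z' a (pull C E A c \<delta>) = pull C E A' c (push C E Z a \<delta>)"
  unfolding push_def pull_def
  using Emap_comp[of Z Z' Z' A A A' c "idn C Z'" "idn C A" a \<delta>] Emap_comp[of Z Z Z' A A' A' "idn C Z" c a "idn C A'" \<delta>]
    idn_arr comp_idn by metis

lemma push_idn: "\<lbrakk>Z \<in> Ob C; A \<in> Ob C; \<delta> \<in> exts E Z A\<rbrakk> \<Longrightarrow> push C E Z (idn C A) \<delta> = \<delta>"
  and pull_idn: "\<lbrakk>Z \<in> Ob C; A \<in> Ob C; \<delta> \<in> exts E Z A\<rbrakk> \<Longrightarrow> pull C E A (idn C Z) \<delta> = \<delta>"
  unfolding push_def pull_def by (auto simp: Emap_idn)

lemma push_add: "\<lbrakk>Z \<in> Ob C; A \<in> Ob C; A' \<in> Ob C; a \<in> arr C A A'; a' \<in> arr C A A'; \<delta> \<in> exts E Z A\<rbrakk> \<Longrightarrow>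
    push C E Z (a \<boxplus>\<^bsub>C\<^esub> a') \<delta> = push C E Z a \<delta> \<otimes>\<^bsub>Ext E Z A'\<^esub> push C E Z a' \<delta>"
  unfolding push_def using Emap_add_right[of Z Z A A' "idn C Z" a a' \<delta>] idn_arr by blast

lemma pull_add: "\<lbrakk>Z \<in> Ob C; Z' \<in> Ob C; A \<in> Ob C; c \<in> arr C Z' Z; c' \<in> arr C Z' Z; \<delta> \<in> exts E Z A\<rbrakk> \<Longrightarrow>
    pull C E A (c \<boxplus>\<^bsub>C\<^esub> c') \<delta> = pull C E A c \<delta> \<otimes>\<^bsub>Ext E Z' A\<^esub> pull C E A c' \<delta>"
  unfolding pull_def using Emap_add_left[of Z Z' A A c c' "idn C A" \<delta>] idn_arr by blast

lemma push_one: assumes "Z \<in> Ob C" "A \<in> Ob C" "A' \<in> Ob C" "a \<in> arr C A A'"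
  shows "push C E Z a (zero_ext E Z A) = zero_ext E Z A'"
proof -
  interpret a: comm_group "Ext E Z A" using ext_group assms by blast
  interpret b: comm_group "Ext E Z A'" using ext_group assms by blast
  show ?thesis using push_mult[OF assms a.one_closed a.one_closed] push_closed[OF assms a.one_closed] b.l_cancel_one'
    by (metis a.one_closed a.l_one)
qed

lemma pull_one: assumes "Z \<in> Ob C" "Z' \<in> Ob C" "A \<in> Ob C" "c \<in> arr C Z' Z"
  shows "pull C E A c (zero_ext E Z A) = zero_ext E Z' A"
proof -
  interpret a: comm_group "Ext E Z A" using ext_group assms by blast
  interpret b: comm_group "Ext E Z' A" using ext_group assms by blast
  show ?thesis using pull_mult[OF assms a.one_closed a.one_closed] pull_closed[OF assms a.one_closed] b.l_cancel_one'
    by (metis a.one_closed a.l_one)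
qed

lemma ext_cancel: assumes "Z \<in> Ob C" "A \<in> Ob C" "x \<in> exts E Z A" "y \<in> exts E Z A" "x \<otimes>\<^bsub>Ext E Z A\<^esub> y = y"
  shows "x = zero_ext E Z A"
proof -
  interpret comm_group "Ext E Z A" using ext_group assms by blast
  show ?thesis using assms(3-5) r_cancel_one' by metis
qed

lemma pull_zero: assumes "Z \<in> Ob C" "Z' \<in> Ob C" "A \<in> Ob C" "\<delta> \<in> exts E Z A"
  shows "pull C E A (zero_arr C Z' Z) \<delta> = zero_ext E Z' A"
proof -
  note z = arr_closed(1)[OF assms(2,1)]
  have "zero_arr C Z' Z \<boxplus>\<^bsub>C\<^esub> zero_arr C Z' Z = zero_arr C Z' Z"
    using src_trg[OF assms(2,1) z] comm_group_simps(5)[OF hom_group[OF assms(2,1)] z] by (simp add: add_arr_def)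
  then show ?thesis
    using pull_add[OF assms(1-3) z z assms(4)] ext_cancel[OF assms(2,3)] pull_closed[OF assms(1-3) z assms(4)] by metis
qed

end

lemma is_complex_cong:
  assumes "\<And>i. i \<le> n + 1 \<Longrightarrow> obj X i = obj Y i" "\<And>i. i \<le> n \<Longrightarrow> diff X i = diff Y i" "is_complex C n X"
  shows "is_complex C n Y"
  using assms unfolding is_complex_def by auto

lemma homotopy_class_cong:
  assumes o: "\<And>i. i \<le> n + 1 \<Longrightarrow> obj X i = obj Y i" and d: "\<And>i. i \<le> n \<Longrightarrow> diff X i = diff Y i"
    and X: "X \<in> homotopy_class C n W"
  shows "Y \<in> homotopy_class C n W"
proof -
  have cm: "chain_map C n W X f = chain_map C n W Y f" "chain_map C n X W f = chain_map C n Y W f" for f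
    unfolding chain_map_def using o d by auto
  have ef: "end_fixing_map C n W X f = end_fixing_map C n W Y f" "end_fixing_map C n X W f = end_fixing_map C n Y W f" for f
    unfolding end_fixing_map_def cm using o by auto
  have "homotopic C n Y Y (\<lambda>i. f i \<cdot>\<^bsub>C\<^esub> g i) (\<lambda>i. idn C (obj Y i))" 
    if h: "homotopic C n X X (\<lambda>i. f i \<cdot>\<^bsub>C\<^esub> g i) (\<lambda>i. idn C (obj X i))" for f g
    using h unfolding homotopic_def
  proof (elim exE conjE, intro exI conjI)
    fix h assume a: "\<forall>i\<in>{1..n + 1}. h i \<in> arr C (obj X i) (obj X (i - 1))"
      "f 0 \<cdot>\<^bsub>C\<^esub> g 0 = idn C (obj X 0) \<boxplus>\<^bsub>C\<^esub> h 1 \<cdot>\<^bsub>C\<^esub> diff X 0"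
      "\<forall>i\<in>{1..n}. f i \<cdot>\<^bsub>C\<^esub> g i = idn C (obj X i) \<boxplus>\<^bsub>C\<^esub> (h (i + 1) \<cdot>\<^bsub>C\<^esub> diff X i \<boxplus>\<^bsub>C\<^esub> diff X (i - 1) \<cdot>\<^bsub>C\<^esub> h i)"
      "f (n + 1) \<cdot>\<^bsub>C\<^esub> g (n + 1) = idn C (obj X (n + 1)) \<boxplus>\<^bsub>C\<^esub> diff X n \<cdot>\<^bsub>C\<^esub> h (n + 1)"
    show "\<forall>i\<in>{1..n + 1}. h i \<in> arr C (obj Y i) (obj Y (i - 1))"
    proof
      fix i assume "i \<in> {1..n + 1}"
      then have "h i \<in> arr C (obj X i) (obj X (i - 1))" "i \<le> n + 1" "i - 1 \<le> n + 1" using a(1) by auto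
      then show "h i \<in> arr C (obj Y i) (obj Y (i - 1))" using o by metis
    qed
    show "f 0 \<cdot>\<^bsub>C\<^esub> g 0 = idn C (obj Y 0) \<boxplus>\<^bsub>C\<^esub> h 1 \<cdot>\<^bsub>C\<^esub> diff Y 0" using a(2) o d by simp
    show "\<forall>i\<in>{1..n}. f i \<cdot>\<^bsub>C\<^esub> g i = idn C (obj Y i) \<boxplus>\<^bsub>C\<^esub> (h (i + 1) \<cdot>\<^bsub>C\<^esub> diff Y i \<boxplus>\<^bsub>C\<^esub> diff Y (i - 1) \<cdot>\<^bsub>C\<^esub> h i)"
      using a(3) o d by auto
    show "f (n + 1) \<cdot>\<^bsub>C\<^esub> g (n + 1) = idn C (obj Y (n + 1)) \<boxplus>\<^bsub>C\<^esub> diff Y n \<cdot>\<^bsub>C\<^esub> h (n + 1)" using a(4) o d by simp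
  qed
  note ho = this
  obtain f g where "end_fixing_map C n W X f" "end_fixing_map C n X W g"
    "homotopic C n W W (\<lambda>i. g i \<cdot>\<^bsub>C\<^esub> f i) (\<lambda>i. idn C (obj W i))"
    "homotopic C n X X (\<lambda>i. f i \<cdot>\<^bsub>C\<^esub> g i) (\<lambda>i. idn C (obj X i))"
    using X unfolding homotopy_class_def homotopy_equivalent_def by blast
  then have "homotopy_equivalent C n W Y" unfolding homotopy_equivalent_def ef using ho by blast
  moreover have "is_complex C n X" "obj X 0 = obj W 0" "obj X (n + 1) = obj W (n + 1)"
    using X unfolding homotopy_class_def complexes_between_def by auto
  moreover from calculation(2) have "is_complex C n Y" by (rule is_complex_cong[where X = X, rotated 2]) (use o d in auto)
  ultimately show ?thesis using o[of 0] o[of "n + 1"] unfolding homotopy_class_def complexes_between_def by simp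
qed

section \<open>An extriangulated category in terms of its triangles\<close>

locale extriangulated_category = n_exangulated_category C E s 1
  for C :: "('o, 'm) category" and E :: "('o, 'm, 'e) bifunctor" and s :: "('o, 'm, 'e) correspondence"
begin

abbreviation cpx3 where
  "cpx3 A x B y Z \<equiv> \<lparr>obj = (\<lambda>i. if i = 0 then A else if i = 1 then B else Z), diff = (\<lambda>i. if i = 0 then x else y)\<rparr>"

text \<open>A complex has arbitrary values outside its degrees, while \<open>s_triangle\<close>
  fixes one particular filling. By \<open>homotopy_class_cong\<close> the classes do not see the
  difference.\<close>

lemma distinguished_triangle:
  assumes D: "distinguished C E s 1 X \<delta>"
  shows "s_triangle C E s (obj X 0) (diff X 0) (obj X 1) (diff X 1) (obj X 2) \<delta>"
proof -
  let ?Y = "cpx3 (obj X 0) (diff X 0) (obj X 1) (diff X 1) (obj X 2)"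
  have XD: "obj X 0 \<in> Ob C" "obj X 2 \<in> Ob C" "\<delta> \<in> exts E (obj X 2) (obj X 0)" "X \<in> s (obj X 2) (obj X 0) \<delta>"
    using D unfolding distinguished_def by (simp_all add: numeral_2_eq_2)
  obtain W where W: "s (obj X 2) (obj X 0) \<delta> = homotopy_class C 1 W"
    using realization_class[OF XD(1-3)] by blast
  have two: "Suc (Suc 0) = 2" by simp
  have "?Y \<in> homotopy_class C 1 W"
  proof (rule homotopy_class_cong[of 1 X])
    fix i :: nat assume "i \<le> 1 + 1"
    then consider "i = 0" | "i = 1" | "i = 2" by linarith
    then show "obj X i = obj ?Y i" by cases auto
  next
    fix i :: nat assume "i \<le> 1"
    then consider "i = 0" | "i = 1" by linarith
    then show "diff X i = diff ?Y i" by cases auto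
  next
    show "X \<in> homotopy_class C 1 W" using XD(4) W by simp
  qed
  then show ?thesis using XD(1-3) W unfolding s_triangle_def distinguished_def by (simp add: two)
qed

lemma s_triangle_D:
  assumes t: "s_triangle C E s A x B y Z \<delta>"
  shows "A \<in> Ob C" "B \<in> Ob C" "Z \<in> Ob C" "x \<in> arr C A B" "y \<in> arr C B Z" "\<delta> \<in> exts E Z A"
    "y \<cdot>\<^bsub>C\<^esub> x = zero_arr C A Z" "push C E Z x \<delta> = zero_ext E Z B" "pull C E A y \<delta> = zero_ext E B A"
    "\<lbrakk>T \<in> Ob C; f \<in> arr C T B; y \<cdot>\<^bsub>C\<^esub> f = zero_arr C T Z\<rbrakk> \<Longrightarrow> \<exists>g\<in>arr C T A. f = x \<cdot>\<^bsub>C\<^esub> g"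
    "\<lbrakk>T \<in> Ob C; f \<in> arr C T Z; pull C E A f \<delta> = zero_ext E T A\<rbrakk> \<Longrightarrow> \<exists>g\<in>arr C T B. f = y \<cdot>\<^bsub>C\<^esub> g"
    "\<lbrakk>T \<in> Ob C; f \<in> arr C B T; f \<cdot>\<^bsub>C\<^esub> x = zero_arr C A T\<rbrakk> \<Longrightarrow> \<exists>g\<in>arr C Z T. f = g \<cdot>\<^bsub>C\<^esub> y"
    "\<lbrakk>T \<in> Ob C; f \<in> arr C A T; push C E Z f \<delta> = zero_ext E Z T\<rbrakk> \<Longrightarrow> \<exists>g\<in>arr C B T. f = g \<cdot>\<^bsub>C\<^esub> x"
proof -
  have ex: "exangle C E 1 (cpx3 A x B y Z) \<delta>" using R1 t unfolding s_triangle_def by blast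
  have at: "attached_complex C E 1 (cpx3 A x B y Z) \<delta>" using ex unfolding exangle_def by blast
  then have c: "is_complex C 1 (cpx3 A x B y Z)" unfolding attached_complex_def by blast
  have o: "obj (cpx3 A x B y Z) i \<in> Ob C" if "i \<le> 1 + 1" for i using c that unfolding is_complex_def by blast
  have d: "diff (cpx3 A x B y Z) i \<in> arr C (obj (cpx3 A x B y Z) i) (obj (cpx3 A x B y Z) (i + 1))" if "i \<le> 1" for i
    using c that unfolding is_complex_def by blast
  have dd: "diff (cpx3 A x B y Z) (i + 1) \<cdot>\<^bsub>C\<^esub> diff (cpx3 A x B y Z) i = zero_arr C (obj (cpx3 A x B y Z) i) (obj (cpx3 A x B y Z) (i + 2))"
    if "i < 1" for i using c that unfolding is_complex_def by blast
  show "A \<in> Ob C" "B \<in> Ob C" "Z \<in> Ob C" using o[of 0] o[of 1] o[of 2] by auto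
  show "x \<in> arr C A B" "y \<in> arr C B Z" using d[of 0] d[of 1] by auto
  show "y \<cdot>\<^bsub>C\<^esub> x = zero_arr C A Z" using dd[of 0] by simp
  show "\<delta> \<in> exts E Z A" "push C E Z x \<delta> = zero_ext E Z B" "pull C E A y \<delta> = zero_ext E B A"
    using at unfolding attached_complex_def by auto
  have k: "kernel (Hom C T B) (Hom C T Z) (\<lambda>f. y \<cdot>\<^bsub>C\<^esub> f) = (\<lambda>f. x \<cdot>\<^bsub>C\<^esub> f) ` arr C T A"
    "kernel (Hom C T Z) (Ext E T A) (\<lambda>f. pull C E A f \<delta>) = (\<lambda>f. y \<cdot>\<^bsub>C\<^esub> f) ` arr C T B"
    "kernel (Hom C B T) (Hom C A T) (\<lambda>f. f \<cdot>\<^bsub>C\<^esub> x) = (\<lambda>f. f \<cdot>\<^bsub>C\<^esub> y) ` arr C Z T"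
    "kernel (Hom C A T) (Ext E Z T) (\<lambda>f. push C E Z f \<delta>) = (\<lambda>f. f \<cdot>\<^bsub>C\<^esub> x) ` arr C B T" if "T \<in> Ob C" for T
    using ex that unfolding exangle_def by auto
  show "\<lbrakk>T \<in> Ob C; f \<in> arr C T B; y \<cdot>\<^bsub>C\<^esub> f = zero_arr C T Z\<rbrakk> \<Longrightarrow> \<exists>g\<in>arr C T A. f = x \<cdot>\<^bsub>C\<^esub> g" for T f
    using k(1)[of T] unfolding kernel_def by blast
  show "\<lbrakk>T \<in> Ob C; f \<in> arr C T Z; pull C E A f \<delta> = zero_ext E T A\<rbrakk> \<Longrightarrow> \<exists>g\<in>arr C T B. f = y \<cdot>\<^bsub>C\<^esub> g" for T f
    using k(2)[of T] unfolding kernel_def by blast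
  show "\<lbrakk>T \<in> Ob C; f \<in> arr C B T; f \<cdot>\<^bsub>C\<^esub> x = zero_arr C A T\<rbrakk> \<Longrightarrow> \<exists>g\<in>arr C Z T. f = g \<cdot>\<^bsub>C\<^esub> y" for T f
    using k(3)[of T] unfolding kernel_def by blast
  show "\<lbrakk>T \<in> Ob C; f \<in> arr C A T; push C E Z f \<delta> = zero_ext E Z T\<rbrakk> \<Longrightarrow> \<exists>g\<in>arr C B T. f = g \<cdot>\<^bsub>C\<^esub> x" for T f
    using k(4)[of T] unfolding kernel_def by blast
qed

lemma homotopy_class_self:
  assumes "X \<in> complexes_between C n A Z"
  shows "X \<in> homotopy_class C n X"
proof -
  have c: "is_complex C n X" using assms unfolding complexes_between_def by blast
  have o: "\<And>i. i \<le> n + 1 \<Longrightarrow> obj X i \<in> Ob C" and d: "\<And>i. i \<le> n \<Longrightarrow> diff X i \<in> arr C (obj X i) (obj X (i + 1))"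
    using c unfolding is_complex_def by blast+
  have ef: "end_fixing_map C n X X (\<lambda>i. idn C (obj X i))"
    unfolding end_fixing_map_def chain_map_def using o d idn_arr comp_idn[OF o o d] by auto
  have z: "zero_arr C A B \<boxplus>\<^bsub>C\<^esub> zero_arr C A B = zero_arr C A B" "f \<in> arr C A B \<Longrightarrow> f \<boxplus>\<^bsub>C\<^esub> zero_arr C A B = f"
    if "A \<in> Ob C" "B \<in> Ob C" for A B f
  proof -
    interpret comm_group "Hom C A B" using hom_group that .
    show "zero_arr C A B \<boxplus>\<^bsub>C\<^esub> zero_arr C A B = zero_arr C A B" "f \<in> arr C A B \<Longrightarrow> f \<boxplus>\<^bsub>C\<^esub> zero_arr C A B = f"
      using src_trg[OF that] by (auto simp: add_arr_def)
  qed
  have zc: "diff X i \<cdot>\<^bsub>C\<^esub> zero_arr C T (obj X i) = zero_arr C T (obj X (i + 1))" if "i \<le> n" "T \<in> Ob C" for i T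
  proof -
    have oi: "obj X i \<in> Ob C" "obj X (i + 1) \<in> Ob C" using o that by auto
    interpret a: comm_group "Hom C T (obj X (i + 1))" using hom_group that oi by blast
    note zz = arr_closed(1)[OF that(2) oi(1)]
    have cc: "diff X i \<cdot>\<^bsub>C\<^esub> zero_arr C T (obj X i) \<in> arr C T (obj X (i + 1))" using comp_arr[OF that(2) oi zz d[OF that(1)]] .
    show ?thesis using comp_add_right[OF that(2) oi zz zz d[OF that(1)]] z(1)[OF that(2) oi(1)] cc
      src_trg[OF that(2) oi(2) cc] a.l_cancel_one' by (metis add_arr_def)
  qed
  have "homotopic C n X X (\<lambda>i. idn C (obj X i) \<cdot>\<^bsub>C\<^esub> idn C (obj X i)) (\<lambda>i. idn C (obj X i))"
    unfolding homotopic_def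
  proof (intro exI[of _ "\<lambda>i. zero_arr C (obj X i) (obj X (i - 1))"] conjI ballI)
    have ii: "idn C (obj X i) \<cdot>\<^bsub>C\<^esub> idn C (obj X i) = idn C (obj X i)" if "i \<le> n + 1" for i
      using comp_idn[OF o[OF that] o[OF that] idn_arr[OF o[OF that]]] by blast
    have l: "zero_arr C (obj X (i + 1)) (obj X i) \<cdot>\<^bsub>C\<^esub> diff X i = zero_arr C (obj X i) (obj X i)" if "i \<le> n" for i
      using comp_zero_left[OF o o o d] that by simp
    show "idn C (obj X 0) \<cdot>\<^bsub>C\<^esub> idn C (obj X 0) = idn C (obj X 0) \<boxplus>\<^bsub>C\<^esub> zero_arr C (obj X 1) (obj X (1 - 1)) \<cdot>\<^bsub>C\<^esub> diff X 0"
      using ii[of 0] l[of 0] z(2)[OF o o idn_arr[OF o]] by simp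
    show "zero_arr C (obj X i) (obj X (i - 1)) \<in> arr C (obj X i) (obj X (i - 1))" if "i \<in> {1..n + 1}" for i
      proof -
      have "i \<le> n + 1" "i - 1 \<le> n + 1" using that by auto
      then show ?thesis using arr_closed(1)[OF o o] by blast
    qed
    show "idn C (obj X (n + 1)) \<cdot>\<^bsub>C\<^esub> idn C (obj X (n + 1)) =
        idn C (obj X (n + 1)) \<boxplus>\<^bsub>C\<^esub> diff X n \<cdot>\<^bsub>C\<^esub> zero_arr C (obj X (n + 1)) (obj X (n + 1 - 1))"
      using ii[of "n + 1"] zc[of n "obj X (n + 1)"] z(2)[OF o o idn_arr[OF o]] o by simp
    fix i assume i: "i \<in> {1..n}"
    have "diff X (i - 1) \<cdot>\<^bsub>C\<^esub> zero_arr C (obj X i) (obj X (i - 1)) = zero_arr C (obj X i) (obj X i)"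
    proof -
      have "i - 1 \<le> n" "obj X i \<in> Ob C" "i - 1 + 1 = i" using i o by auto
      then show ?thesis using zc by metis
    qed
    then show "idn C (obj X i) \<cdot>\<^bsub>C\<^esub> idn C (obj X i) = idn C (obj X i) \<boxplus>\<^bsub>C\<^esub>
        (zero_arr C (obj X (i + 1)) (obj X (i + 1 - 1)) \<cdot>\<^bsub>C\<^esub> diff X i \<boxplus>\<^bsub>C\<^esub> diff X (i - 1) \<cdot>\<^bsub>C\<^esub> zero_arr C (obj X i) (obj X (i - 1)))"
      using ii[of i] l[of i] z(1)[OF o o] z(2)[OF o o idn_arr[OF o]] i by simp
  qed
  then show ?thesis using ef assms unfolding homotopy_class_def complexes_between_def homotopy_equivalent_def by auto
qed

lemma realization_exists:
  assumes "A \<in> Ob C" "Z \<in> Ob C" "\<delta> \<in> exts E Z A"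
  shows "\<exists>X. distinguished C E s 1 X \<delta> \<and> obj X 0 = A \<and> obj X 2 = Z"
proof -
  obtain X where X: "X \<in> complexes_between C 1 A Z" "s Z A \<delta> = homotopy_class C 1 X"
    using realization_class assms by blast
  then have "X \<in> s Z A \<delta>" "obj X 0 = A" "obj X (1 + 1) = Z" using homotopy_class_self[OF X(1)] unfolding complexes_between_def by auto
  then show ?thesis using assms unfolding distinguished_def by (intro exI[of _ X]) (simp add: numeral_2_eq_2)
qed

text \<open>The argument of \<open>exact_ext_left\<close>, carried out on carriers. Classifying
  extensions by maps into suspensions depends on it, so it comes before the graded category
  exists.\<close>

lemma push_kernel:
  assumes t: "s_triangle C E s A x B y Z \<delta>" and X: "X \<in> Ob C" and \<theta>: "\<theta> \<in> exts E X A"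
    and z: "push C E X x \<theta> = zero_ext E X B"
  shows "\<exists>g\<in>arr C X Z. pull C E A g \<delta> = \<theta>"
proof -
  note tD = s_triangle_D[OF t]
  obtain S i1 i2 p1 p2 where b: "biproduct C Z X S i1 i2 p1 p2" using biproduct_exists[OF tD(3) X] by blast
  then have bD: "S \<in> Ob C" "i1 \<in> arr C Z S" "i2 \<in> arr C X S" "p1 \<in> arr C S Z" "p2 \<in> arr C S X"
    "p1 \<cdot>\<^bsub>C\<^esub> i1 = idn C Z" "p2 \<cdot>\<^bsub>C\<^esub> i2 = idn C X" "p1 \<cdot>\<^bsub>C\<^esub> i2 = zero_arr C X Z" "p2 \<cdot>\<^bsub>C\<^esub> i1 = zero_arr C Z X"
    unfolding biproduct_def by auto
  let ?\<rho> = "pull C E A p1 \<delta> \<otimes>\<^bsub>Ext E S A\<^esub> pull C E A p2 \<theta>"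
  note c1 = pull_closed[OF tD(3) bD(1) tD(1) bD(4) tD(6)] and c2 = pull_closed[OF X bD(1) tD(1) bD(5) \<theta>]
  have \<rho>: "?\<rho> \<in> exts E S A" using comm_group_simps(1)[OF ext_group[OF bD(1) tD(1)] c1 c2] .
  have r1: "pull C E A i1 ?\<rho> = \<delta>"
    using pull_mult[OF bD(1) tD(3,1) bD(2) c1 c2] pull_comp[OF tD(3) bD(1) tD(3,1) bD(4,2) tD(6)]
      pull_comp[OF X bD(1) tD(3,1) bD(5,2) \<theta>] bD(6,9) pull_idn[OF tD(3,1,6)] pull_zero[OF X tD(3,1) \<theta>]
      comm_group_simps(7)[OF ext_group[OF tD(3,1)] tD(6)] by simp
  have r2: "pull C E A i2 ?\<rho> = \<theta>"
    using pull_mult[OF bD(1) X tD(1) bD(3) c1 c2] pull_comp[OF tD(3) bD(1) X tD(1) bD(4,3) tD(6)]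
      pull_comp[OF X bD(1) X tD(1) bD(5,3) \<theta>] bD(7,8) pull_idn[OF X tD(1) \<theta>] pull_zero[OF tD(3) X tD(1,6)]
      comm_group_simps(5)[OF ext_group[OF X tD(1)] \<theta>] by simp
  obtain Y where Y: "distinguished C E s 1 Y ?\<rho>" "obj Y 0 = A" "obj Y 2 = S" using realization_exists[OF tD(1) bD(1) \<rho>] by blast
  note YD = s_triangle_D[OF distinguished_triangle[OF Y(1)], unfolded Y(2,3)]
  have two: "Suc (Suc 0) = 2" "Suc 1 = 2" "1 + 1 = (2::nat)" by auto
  have "\<exists>f M. lift_of C 1 (cpx3 A x B y Z) Y (idn C (obj (cpx3 A x B y Z) 0)) i1 f \<and> mapping_cone C 1 (cpx3 A x B y Z) Y f M \<and>
    distinguished C E s 1 M (push C E (obj Y (1 + 1)) (diff (cpx3 A x B y Z) 0) ?\<rho>)"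
    by (rule EA2[OF Y(1)]) (use t bD(2) Y r1 in \<open>simp_all add: s_triangle_def numeral_2_eq_2\<close>)
  then obtain f M where f: "lift_of C 1 (cpx3 A x B y Z) Y (idn C A) i1 f" and M: "mapping_cone C 1 (cpx3 A x B y Z) Y f M"
    and dM: "distinguished C E s 1 M (push C E S x ?\<rho>)" using Y(3) two by auto
  have f2: "f 2 = i1" using f two unfolding lift_of_def by simp
  obtain j1 j2 q1 q2 where bM: "biproduct C Z (obj Y 1) (obj M 1) j1 j2 q1 q2"
    and d1: "diff M 1 = (i1 \<cdot>\<^bsub>C\<^esub> q1) \<boxplus>\<^bsub>C\<^esub> (diff Y 1 \<cdot>\<^bsub>C\<^esub> q2)" and M0: "obj M 0 = B" "obj M 2 = S"
    using M f2 two Y(3) unfolding mapping_cone_def by auto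
  then have bMD: "obj M 1 \<in> Ob C" "q1 \<in> arr C (obj M 1) Z" "q2 \<in> arr C (obj M 1) (obj Y 1)" unfolding biproduct_def by auto
  note MD = s_triangle_D[OF distinguished_triangle[OF dM], unfolded M0]
  have "pull C E B i2 (push C E S x ?\<rho>) = zero_ext E X B"
    using push_pull[OF bD(1) X tD(1,2) bD(3) tD(4) \<rho>] r2 z by simp
  then obtain k where k: "k \<in> arr C X (obj M 1)" "i2 = diff M 1 \<cdot>\<^bsub>C\<^esub> k" using MD(11)[OF X bD(3)] by blast
  have qk: "q1 \<cdot>\<^bsub>C\<^esub> k \<in> arr C X Z" "q2 \<cdot>\<^bsub>C\<^esub> k \<in> arr C X (obj Y 1)" using comp_arr X bMD k tD(3) YD(2) by blast+
  have iq: "i1 \<cdot>\<^bsub>C\<^esub> q1 \<in> arr C (obj M 1) S" "diff Y 1 \<cdot>\<^bsub>C\<^esub> q2 \<in> arr C (obj M 1) S"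
    using comp_arr bMD bD tD(3) YD(2,5) by blast+
  have "i2 = (i1 \<cdot>\<^bsub>C\<^esub> (q1 \<cdot>\<^bsub>C\<^esub> k)) \<boxplus>\<^bsub>C\<^esub> (diff Y 1 \<cdot>\<^bsub>C\<^esub> (q2 \<cdot>\<^bsub>C\<^esub> k))"
    using k(2) d1 comp_add_left[OF X bMD(1) bD(1) k(1) iq] comp_assoc[OF X bMD(1) tD(3) bD(1) k(1) bMD(2) bD(2)]
      comp_assoc[OF X bMD(1) YD(2) bD(1) k(1) bMD(3) YD(5)] by simp
  then have "\<theta> = pull C E A ((i1 \<cdot>\<^bsub>C\<^esub> (q1 \<cdot>\<^bsub>C\<^esub> k)) \<boxplus>\<^bsub>C\<^esub> (diff Y 1 \<cdot>\<^bsub>C\<^esub> (q2 \<cdot>\<^bsub>C\<^esub> k))) ?\<rho>" using r2 by simp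
  also have "\<dots> = pull C E A (q1 \<cdot>\<^bsub>C\<^esub> k) \<delta> \<otimes>\<^bsub>Ext E X A\<^esub> pull C E A (q2 \<cdot>\<^bsub>C\<^esub> k) (zero_ext E (obj Y 1) A)"
    using pull_add[OF bD(1) X tD(1) comp_arr[OF X tD(3) bD(1) qk(1) bD(2)] comp_arr[OF X YD(2) bD(1) qk(2) YD(5)] \<rho>]
      pull_comp[OF bD(1) tD(3) X tD(1) bD(2) qk(1) \<rho>] pull_comp[OF bD(1) YD(2) X tD(1) YD(5) qk(2) \<rho>] r1 YD(9) by simp
  also have "\<dots> = pull C E A (q1 \<cdot>\<^bsub>C\<^esub> k) \<delta>"
    using pull_one[OF YD(2) X tD(1) qk(2)] comm_group_simps(7)[OF ext_group[OF X tD(1)]]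
      pull_closed[OF tD(3) X tD(1) qk(1) tD(6)] by simp
  finally show ?thesis using qk(1) by auto
qed

lemma injective_ext_zero:
  assumes I: "I \<in> injectives C E s" and X: "X \<in> Ob C" and \<delta>: "\<delta> \<in> exts E X I"
  shows "\<delta> = zero_ext E X I"
proof -
  have IO: "I \<in> Ob C" using I unfolding injectives_def by blast
  obtain Y where Y: "distinguished C E s 1 Y \<delta>" "obj Y 0 = I" "obj Y 2 = X" using realization_exists[OF IO X \<delta>] by blast
  note t = distinguished_triangle[OF Y(1), unfolded Y(2,3)]
  note tD = s_triangle_D[OF t]
  obtain g where g: "g \<in> arr C (obj Y 1) I" "idn C I = g \<cdot>\<^bsub>C\<^esub> diff Y 0"
    using I t idn_arr[OF IO] unfolding injectives_def by blast
  have "\<delta> = push C E X (g \<cdot>\<^bsub>C\<^esub> diff Y 0) \<delta>" using push_idn[OF X IO \<delta>] g by simp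
  also have "\<dots> = push C E X g (push C E X (diff Y 0) \<delta>)" by (rule push_comp[OF X IO tD(2) IO tD(4) g(1) \<delta>])
  also have "\<dots> = zero_ext E X I" using tD(8) push_one[OF X tD(2) IO g(1)] by simp
  finally show ?thesis .
qed

end

section \<open>The graded category of higher extensions\<close>

locale suspended_exangulated = extriangulated_category +
  fixes \<Sigma> :: "'a \<Rightarrow> 'a" and \<iota> :: "'a \<Rightarrow> 'c"
  assumes suspension: "suspension_data C E s \<Sigma> \<iota>"
begin

lemma suspension_triangle:
  assumes "A \<in> Ob C" obtains x J y where "J \<in> injectives C E s" "s_triangle C E s A x J y (\<Sigma> A) (\<iota> A)"
  using suspension assms unfolding suspension_data_def by blast

lemma \<Sigma>_Ob: "A \<in> Ob C \<Longrightarrow> \<Sigma> A \<in> Ob C" and \<iota>_ext: "A \<in> Ob C \<Longrightarrow> \<iota> A \<in> exts E (\<Sigma> A) A"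
  by (erule suspension_triangle, erule s_triangle_D)+

lemma \<Sigma>k_Ob: "A \<in> Ob C \<Longrightarrow> (\<Sigma> ^^ k) A \<in> Ob C"
  by (induction k) (auto intro: \<Sigma>_Ob)

text \<open>An extension dies when pushed into an injective, so \<open>push_kernel\<close> makes it
  a pullback of \<open>\<iota> A\<close>.\<close>

lemma classify:
  assumes X: "X \<in> Ob C" and A: "A \<in> Ob C" and \<delta>: "\<delta> \<in> exts E X A"
  shows "\<exists>d. d \<in> arr C X (\<Sigma> A) \<and> pull C E A d (\<iota> A) = \<delta>"
proof -
  obtain x J y where J: "J \<in> injectives C E s" and t: "s_triangle C E s A x J y (\<Sigma> A) (\<iota> A)"
    using suspension_triangle[OF A] .
  note tD = s_triangle_D[OF t]
  have "push C E X x \<delta> = zero_ext E X J" by (rule injective_ext_zero[OF J X push_closed[OF X tD(1,2,4) \<delta>]])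
  then show ?thesis using push_kernel[OF t X \<delta>] by blast
qed

text \<open>Morphisms that induce the same map on all extension groups. Morphisms congruent modulo the
  injectives are related, and this coarser relation is still respected by the suspension.\<close>

definition eqp where
  "eqp A B f g \<longleftrightarrow> A \<in> Ob C \<and> B \<in> Ob C \<and> f \<in> arr C A B \<and> g \<in> arr C A B \<and>
     (\<forall>X\<in>Ob C. \<forall>\<delta>\<in>exts E X A. push C E X f \<delta> = push C E X g \<delta>)"

lemma eqp_D:
  assumes "eqp A B f g"
  shows "A \<in> Ob C" "B \<in> Ob C" "f \<in> arr C A B" "g \<in> arr C A B"
    "X \<in> Ob C \<Longrightarrow> \<delta> \<in> exts E X A \<Longrightarrow> push C E X f \<delta> = push C E X g \<delta>"
  using assms unfolding eqp_def by auto

lemma eqp_refl: "A \<in> Ob C \<Longrightarrow> B \<in> Ob C \<Longrightarrow> f \<in> arr C A B \<Longrightarrow> eqp A B f f"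
  unfolding eqp_def by auto

lemma eqp_trans: "eqp A B f g \<Longrightarrow> eqp A B g h \<Longrightarrow> eqp A B f h"
  unfolding eqp_def by auto

lemma eqp_sym: "eqp A B f g \<Longrightarrow> eqp A B g f"
  unfolding eqp_def by auto

lemma eqp_of_diff_injective:
  assumes A: "A \<in> Ob C" and B: "B \<in> Ob C" and f: "f \<in> arr C A B" and g: "g \<in> arr C A B"
    and J: "J \<in> injectives C E s" and hk: "h \<in> arr C A J" "k \<in> arr C J B" "f \<boxminus>\<^bsub>C\<^esub> g = k \<cdot>\<^bsub>C\<^esub> h"
  shows "eqp A B f g"
proof -
  have JO: "J \<in> Ob C" using J unfolding injectives_def by blast
  have "push C E X f \<delta> = push C E X g \<delta>" if X: "X \<in> Ob C" and \<delta>: "\<delta> \<in> exts E X A" for X \<delta>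
  proof -
    have "push C E X (k \<cdot>\<^bsub>C\<^esub> h) \<delta> = push C E X k (push C E X h \<delta>)" by (rule push_comp[OF X A JO B hk(1,2) \<delta>])
    also have "push C E X h \<delta> = zero_ext E X J" by (rule injective_ext_zero[OF J X push_closed[OF X A JO hk(1) \<delta>]])
    also have "push C E X k (zero_ext E X J) = zero_ext E X B" by (rule push_one[OF X JO B hk(2)])
    finally have z: "push C E X (f \<boxminus>\<^bsub>C\<^esub> g) \<delta> = zero_ext E X B" using hk(3) by simp
    have "push C E X f \<delta> = push C E X ((f \<boxminus>\<^bsub>C\<^esub> g) \<boxplus>\<^bsub>C\<^esub> g) \<delta>" using minus_add(1)[OF A B f g] by simp
    also have "\<dots> = zero_ext E X B \<otimes>\<^bsub>Ext E X B\<^esub> push C E X g \<delta>"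
      using push_add[OF X A B arr_closed(3)[OF A B f g] g \<delta>] z by simp
    also have "\<dots> = push C E X g \<delta>" by (rule comm_group_simps(5)[OF ext_group[OF X B] push_closed[OF X A B g \<delta>]])
    finally show ?thesis .
  qed
  then show ?thesis using A B f g unfolding eqp_def by blast
qed

text \<open>The difference of two classifying maps pulls \<open>\<iota> A\<close> back to zero,
  hence factors through the injective middle term of the suspension triangle.\<close>

lemma classify_unique:
  assumes X: "X \<in> Ob C" and A: "A \<in> Ob C" and d: "d \<in> arr C X (\<Sigma> A)" and d': "d' \<in> arr C X (\<Sigma> A)"
    and eq: "pull C E A d (\<iota> A) = pull C E A d' (\<iota> A)"
  shows "eqp X (\<Sigma> A) d d'"
proof -
  obtain x J y where J: "J \<in> injectives C E s" and t: "s_triangle C E s A x J y (\<Sigma> A) (\<iota> A)"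
    using suspension_triangle[OF A] .
  note tD = s_triangle_D[OF t]
  note k = arr_closed(3)[OF X tD(3) d d']
  have "pull C E A (d \<boxminus>\<^bsub>C\<^esub> d') (\<iota> A) \<otimes>\<^bsub>Ext E X A\<^esub> pull C E A d' (\<iota> A) = pull C E A d' (\<iota> A)"
    using pull_add[OF tD(3) X A k d' tD(6)] minus_add(1)[OF X tD(3) d d'] eq by simp
  then have "pull C E A (d \<boxminus>\<^bsub>C\<^esub> d') (\<iota> A) = zero_ext E X A"
    using ext_cancel[OF X A] pull_closed[OF tD(3) X A _ tD(6)] k d' by blast
  then obtain g where "g \<in> arr C X J" "d \<boxminus>\<^bsub>C\<^esub> d' = y \<cdot>\<^bsub>C\<^esub> g" using tD(11)[OF X k] by blast
  then show ?thesis using eqp_of_diff_injective[OF X tD(3) d d' J] tD(5) by blast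
qed

text \<open>\<open>sg A B t\<close> and \<open>sgk A B k t\<close> represent \<open>\<Sigma> t\<close> and \<open>\<Sigma>\<^sup>k t\<close>, well defined up to \<open>eqp\<close>.\<close>

definition sg where
  "sg A B t = (SOME r. r \<in> arr C (\<Sigma> A) (\<Sigma> B) \<and> pull C E B r (\<iota> B) = push C E (\<Sigma> A) t (\<iota> A))"

lemma sg:
  assumes A: "A \<in> Ob C" and B: "B \<in> Ob C" and t: "t \<in> arr C A B"
  shows "sg A B t \<in> arr C (\<Sigma> A) (\<Sigma> B)" "pull C E B (sg A B t) (\<iota> B) = push C E (\<Sigma> A) t (\<iota> A)"
  using someI_ex[OF classify[OF \<Sigma>_Ob[OF A] B push_closed[OF \<Sigma>_Ob[OF A] A B t \<iota>_ext[OF A]]]] unfolding sg_def by auto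

lemma sg_unique:
  assumes A: "A \<in> Ob C" and B: "B \<in> Ob C" and t: "t \<in> arr C A B" and r: "r \<in> arr C (\<Sigma> A) (\<Sigma> B)"
    and e: "pull C E B r (\<iota> B) = push C E (\<Sigma> A) t (\<iota> A)"
  shows "eqp (\<Sigma> A) (\<Sigma> B) (sg A B t) r"
  using classify_unique[OF \<Sigma>_Ob[OF A] B sg(1)[OF A B t] r] sg(2)[OF A B t] e by simp

lemma sg_cong: assumes "eqp A B a b" shows "eqp (\<Sigma> A) (\<Sigma> B) (sg A B a) (sg A B b)"
proof -
  note D = eqp_D[OF assms]
  show ?thesis by (rule sg_unique[OF D(1-3) sg(1)[OF D(1,2,4)]])
    (simp add: sg(2)[OF D(1,2,4)] D(5)[OF \<Sigma>_Ob[OF D(1)] \<iota>_ext[OF D(1)]])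
qed

lemma sg_comp:
  assumes A: "A \<in> Ob C" and B: "B \<in> Ob C" and D: "D \<in> Ob C" and a: "a \<in> arr C A B" and b: "b \<in> arr C B D"
  shows "eqp (\<Sigma> A) (\<Sigma> D) (sg A D (b \<cdot>\<^bsub>C\<^esub> a)) (sg B D b \<cdot>\<^bsub>C\<^esub> sg A B a)"
proof (rule sg_unique[OF A D comp_arr[OF A B D a b]])
  note S = \<Sigma>_Ob[OF A] \<Sigma>_Ob[OF B] \<Sigma>_Ob[OF D] and sa = sg[OF A B a] and sb = sg[OF B D b]
  show "sg B D b \<cdot>\<^bsub>C\<^esub> sg A B a \<in> arr C (\<Sigma> A) (\<Sigma> D)" by (rule comp_arr[OF S sa(1) sb(1)])
  show "pull C E D (sg B D b \<cdot>\<^bsub>C\<^esub> sg A B a) (\<iota> D) = push C E (\<Sigma> A) (b \<cdot>\<^bsub>C\<^esub> a) (\<iota> A)"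
    using pull_comp[OF S(3,2,1) D sb(1) sa(1) \<iota>_ext[OF D]] sb(2) push_pull[OF S(2,1) B D sa(1) b \<iota>_ext[OF B]] sa(2)
      push_comp[OF S(1) A B D a b \<iota>_ext[OF A]] by simp
qed

lemma sg_add:
  assumes A: "A \<in> Ob C" and B: "B \<in> Ob C" and a: "a \<in> arr C A B" and b: "b \<in> arr C A B"
  shows "eqp (\<Sigma> A) (\<Sigma> B) (sg A B (a \<boxplus>\<^bsub>C\<^esub> b)) (sg A B a \<boxplus>\<^bsub>C\<^esub> sg A B b)"
proof (rule sg_unique[OF A B arr_closed(2)[OF A B a b]])
  note S = \<Sigma>_Ob[OF A] \<Sigma>_Ob[OF B] and sa = sg[OF A B a] and sb = sg[OF A B b]
  show "sg A B a \<boxplus>\<^bsub>C\<^esub> sg A B b \<in> arr C (\<Sigma> A) (\<Sigma> B)" by (rule arr_closed(2)[OF S sa(1) sb(1)])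
  show "pull C E B (sg A B a \<boxplus>\<^bsub>C\<^esub> sg A B b) (\<iota> B) = push C E (\<Sigma> A) (a \<boxplus>\<^bsub>C\<^esub> b) (\<iota> A)"
    using pull_add[OF S(2,1) B sa(1) sb(1) \<iota>_ext[OF B]] sa(2) sb(2) push_add[OF S(1) A B a b \<iota>_ext[OF A]] by simp
qed

lemma sg_idn: assumes A: "A \<in> Ob C" shows "eqp (\<Sigma> A) (\<Sigma> A) (sg A A (idn C A)) (idn C (\<Sigma> A))"
  by (rule sg_unique[OF A A idn_arr[OF A] idn_arr[OF \<Sigma>_Ob[OF A]]])
    (simp add: pull_idn push_idn \<Sigma>_Ob A \<iota>_ext)

primrec sgk where
  "sgk A B 0 t = t"
| "sgk A B (Suc k) t = sg ((\<Sigma> ^^ k) A) ((\<Sigma> ^^ k) B) (sgk A B k t)"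

lemma sgk_arr: "A \<in> Ob C \<Longrightarrow> B \<in> Ob C \<Longrightarrow> t \<in> arr C A B \<Longrightarrow> sgk A B k t \<in> arr C ((\<Sigma> ^^ k) A) ((\<Sigma> ^^ k) B)"
  by (induction k) (auto intro: sg(1) \<Sigma>k_Ob)

lemma sgk_cong: "eqp A B a b \<Longrightarrow> eqp ((\<Sigma> ^^ k) A) ((\<Sigma> ^^ k) B) (sgk A B k a) (sgk A B k b)"
  by (induction k) (auto intro: sg_cong)

lemma sgk_comp:
  assumes "A \<in> Ob C" "B \<in> Ob C" "D \<in> Ob C" "a \<in> arr C A B" "b \<in> arr C B D"
  shows "eqp ((\<Sigma> ^^ k) A) ((\<Sigma> ^^ k) D) (sgk A D k (b \<cdot>\<^bsub>C\<^esub> a)) (sgk B D k b \<cdot>\<^bsub>C\<^esub> sgk A B k a)"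
proof (induction k)
  case 0 then show ?case using eqp_refl comp_arr assms by simp
next
  case (Suc k)
  then show ?case using eqp_trans[OF sg_cong[OF Suc] sg_comp[OF \<Sigma>k_Ob \<Sigma>k_Ob \<Sigma>k_Ob sgk_arr sgk_arr]] assms by simp
qed

lemma sgk_add:
  assumes "A \<in> Ob C" "B \<in> Ob C" "a \<in> arr C A B" "b \<in> arr C A B"
  shows "eqp ((\<Sigma> ^^ k) A) ((\<Sigma> ^^ k) B) (sgk A B k (a \<boxplus>\<^bsub>C\<^esub> b)) (sgk A B k a \<boxplus>\<^bsub>C\<^esub> sgk A B k b)"
proof (induction k)
  case 0 then show ?case using eqp_refl arr_closed(2) assms by simp
next
  case (Suc k)
  then show ?case using eqp_trans[OF sg_cong[OF Suc] sg_add[OF \<Sigma>k_Ob \<Sigma>k_Ob sgk_arr sgk_arr]] assms by simp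
qed

lemma sgk_idn: "A \<in> Ob C \<Longrightarrow> eqp ((\<Sigma> ^^ k) A) ((\<Sigma> ^^ k) A) (sgk A A k (idn C A)) (idn C ((\<Sigma> ^^ k) A))"
proof (induction k)
  case 0 then show ?case using eqp_refl idn_arr by simp
next
  case (Suc k)
  then show ?case using eqp_trans[OF sg_cong sg_idn[OF \<Sigma>k_Ob]] by simp
qed

lemma sgk_sgk: "sgk ((\<Sigma> ^^ j) A) ((\<Sigma> ^^ j) B) k (sgk A B j t) = sgk A B (k + j) t"
  by (induction k) (simp_all add: funpow_add)

end

text \<open>Degree 0 carries the morphisms and degree \<open>k + 1\<close> the extensions of \<open>\<Sigma>\<^sup>k B\<close>.\<close>

definition image_group :: "('a \<Rightarrow> 'b) \<Rightarrow> 'a monoid \<Rightarrow> 'b monoid" where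
  "image_group h G = \<lparr>carrier = h ` carrier G, monoid.mult = (\<lambda>x y. h (the_inv h x \<otimes>\<^bsub>G\<^esub> the_inv h y)), one = h \<one>\<^bsub>G\<^esub>\<rparr>"

lemma image_group_simps [simp]:
  "carrier (image_group h G) = h ` carrier G" "\<one>\<^bsub>image_group h G\<^esub> = h \<one>\<^bsub>G\<^esub>"
  "inj h \<Longrightarrow> h x \<otimes>\<^bsub>image_group h G\<^esub> h y = h (x \<otimes>\<^bsub>G\<^esub> y)"
  by (simp_all add: image_group_def the_inv_f_f)

lemma comm_group_image_group:
  assumes G: "comm_group G" and h: "inj h" shows "comm_group (image_group h G)"
proof (rule comm_groupI)
  fix x assume "x \<in> carrier (image_group h G)"
  then obtain a where a: "a \<in> carrier G" "x = h a" by auto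
  then show "\<exists>y\<in>carrier (image_group h G). y \<otimes>\<^bsub>image_group h G\<^esub> x = \<one>\<^bsub>image_group h G\<^esub>"
    by (intro bexI[of _ "h (inv\<^bsub>G\<^esub> a)"]) (simp_all add: h comm_group_simps[OF G])
qed (auto simp: h comm_group_simps[OF G] intro!: arg_cong[where f = h] comm_group_commute[OF G])

section \<open>Composition of morphisms and higher extensions\<close>

context suspended_exangulated begin

text \<open>\<open>Inl\<close> and \<open>Inr\<close> bring morphisms and extensions into one value
  type, as \<open>graded_data\<close> requires.\<close>

definition GG :: "nat \<Rightarrow> 'a \<Rightarrow> 'a \<Rightarrow> ('b + 'c) monoid" where
  "GG i A B = (case i of 0 \<Rightarrow> image_group Inl (Hom C A B) | Suc k \<Rightarrow> image_group Inr (Ext E A ((\<Sigma> ^^ k) B)))"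

text \<open>\<open>cm i A B g\<close> is a morphism \<open>A \<rightarrow> \<Sigma>\<^sup>i B\<close> classifying the element \<open>g\<close> of degree \<open>i\<close>; composition
  with an extension on the right is the cup product, and with a morphism on the right the pullback.\<close>

definition cm :: "nat \<Rightarrow> 'a \<Rightarrow> 'a \<Rightarrow> 'b + 'c \<Rightarrow> 'b" where
  "cm i A B g = (case i of 0 \<Rightarrow> projl g | Suc k \<Rightarrow>
     (SOME d. d \<in> arr C A ((\<Sigma> ^^ Suc k) B) \<and> pull C E ((\<Sigma> ^^ k) B) d (\<iota> ((\<Sigma> ^^ k) B)) = projr g))"

definition gcomp :: "nat \<Rightarrow> nat \<Rightarrow> 'a \<Rightarrow> 'a \<Rightarrow> 'a \<Rightarrow> 'b + 'c \<Rightarrow> 'b + 'c \<Rightarrow> 'b + 'c" where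
  "gcomp j i A B D g f = (case i of
     0 \<Rightarrow> (case j of 0 \<Rightarrow> Inl (projl g \<cdot>\<^bsub>C\<^esub> projl f) | Suc l \<Rightarrow> Inr (pull C E ((\<Sigma> ^^ l) D) (projl f) (projr g)))
   | Suc k \<Rightarrow> Inr (push C E A (sgk B ((\<Sigma> ^^ j) D) k (cm j B D g)) (projr f)))"

lemma GG_simps [simp]:
  "GG 0 A B = image_group Inl (Hom C A B)" "GG (Suc k) A B = image_group Inr (Ext E A ((\<Sigma> ^^ k) B))"
  by (simp_all add: GG_def)

lemma cm_0 [simp]: "cm 0 A B (Inl f) = f"
  by (simp add: cm_def)

lemma gcomp_simps [simp]:
  "gcomp 0 0 A B D (Inl g) (Inl f) = Inl (g \<cdot>\<^bsub>C\<^esub> f)"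
  "gcomp (Suc l) 0 A B D (Inr \<delta>) (Inl f) = Inr (pull C E ((\<Sigma> ^^ l) D) f \<delta>)"
  "gcomp j (Suc k) A B D w (Inr \<theta>) = Inr (push C E A (sgk B ((\<Sigma> ^^ j) D) k (cm j B D w)) \<theta>)"
  by (simp_all add: gcomp_def)

lemma GG_cases:
  assumes "f \<in> carrier (GG i A B)"
  obtains a where "i = 0" "f = Inl a" "a \<in> arr C A B"
  | k \<delta> where "i = Suc k" "f = Inr \<delta>" "\<delta> \<in> exts E A ((\<Sigma> ^^ k) B)"
  using assms by (cases i) auto

lemma cm_Suc:
  assumes A: "A \<in> Ob C" and B: "B \<in> Ob C" and \<delta>: "\<delta> \<in> exts E A ((\<Sigma> ^^ k) B)"
  shows "cm (Suc k) A B (Inr \<delta>) \<in> arr C A ((\<Sigma> ^^ Suc k) B)"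
    "pull C E ((\<Sigma> ^^ k) B) (cm (Suc k) A B (Inr \<delta>)) (\<iota> ((\<Sigma> ^^ k) B)) = \<delta>"
  using someI_ex[OF classify[OF A \<Sigma>k_Ob[OF B] \<delta>]] unfolding cm_def by auto

lemma cm_arr:
  assumes A: "A \<in> Ob C" and B: "B \<in> Ob C" and f: "f \<in> carrier (GG i A B)"
  shows "cm i A B f \<in> arr C A ((\<Sigma> ^^ i) B)"
  using f by (cases rule: GG_cases) (use cm_Suc[OF A B] in auto)

lemma cm_unique:
  assumes A: "A \<in> Ob C" and B: "B \<in> Ob C" and \<delta>: "\<delta> \<in> exts E A ((\<Sigma> ^^ k) B)"
    and d: "d \<in> arr C A ((\<Sigma> ^^ Suc k) B)" "pull C E ((\<Sigma> ^^ k) B) d (\<iota> ((\<Sigma> ^^ k) B)) = \<delta>"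
  shows "eqp A ((\<Sigma> ^^ Suc k) B) (cm (Suc k) A B (Inr \<delta>)) d"
  using classify_unique[OF A \<Sigma>k_Ob[OF B], of _ k d] cm_Suc[OF A B \<delta>] d by simp

lemma cm_add:
  assumes A: "A \<in> Ob C" and B: "B \<in> Ob C" and f: "f \<in> carrier (GG i A B)" and g: "g \<in> carrier (GG i A B)"
  shows "eqp A ((\<Sigma> ^^ i) B) (cm i A B (f \<otimes>\<^bsub>GG i A B\<^esub> g)) (cm i A B f \<boxplus>\<^bsub>C\<^esub> cm i A B g)"
  using f
proof (cases rule: GG_cases)
  case (1 a)
  then obtain b where b: "g = Inl b" "b \<in> arr C A B" using g by auto
  then show ?thesis using 1 eqp_refl[OF A B] arr_closed(2)[OF A B 1(3) b(2)] src_trg[OF A B 1(3)] by (simp add: add_arr_def)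
next
  case (2 k \<delta>)
  then obtain \<rho> where r: "g = Inr \<rho>" "\<rho> \<in> exts E A ((\<Sigma> ^^ k) B)" using g by auto
  note S = \<Sigma>k_Ob[OF B, of k] \<Sigma>k_Ob[OF B, of "Suc k"]
  note c = cm_Suc[OF A B 2(3)] cm_Suc[OF A B r(2)]
  have i: "\<iota> ((\<Sigma> ^^ k) B) \<in> exts E ((\<Sigma> ^^ Suc k) B) ((\<Sigma> ^^ k) B)" using \<iota>_ext[OF S(1)] by simp
  have "eqp A ((\<Sigma> ^^ Suc k) B) (cm (Suc k) A B (Inr (\<delta> \<otimes>\<^bsub>Ext E A ((\<Sigma> ^^ k) B)\<^esub> \<rho>))) (cm (Suc k) A B f \<boxplus>\<^bsub>C\<^esub> cm (Suc k) A B g)"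
    by (rule cm_unique[OF A B]) (use pull_add[OF S(2) A S(1) c(1,3) i] c arr_closed(2)[OF A S(2)] 2 r
        comm_group_simps(1)[OF ext_group[OF A S(1)]] in auto)
  then show ?thesis using 2 r by simp
qed

lemma gcomp_closed:
  assumes A: "A \<in> Ob C" and B: "B \<in> Ob C" and D: "D \<in> Ob C" and f: "f \<in> carrier (GG i A B)" and g: "g \<in> carrier (GG j B D)"
  shows "gcomp j i A B D g f \<in> carrier (GG (i + j) A D)"
  using f
proof (cases rule: GG_cases)
  case (1 a)
  show ?thesis using g
  proof (cases rule: GG_cases)
    case (1 b) with \<open>i = 0\<close> \<open>f = Inl a\<close> \<open>a \<in> arr C A B\<close> show ?thesis using comp_arr[OF A B D] by auto
  next
    case (2 l \<delta>) with \<open>i = 0\<close> \<open>f = Inl a\<close> \<open>a \<in> arr C A B\<close> show ?thesis using pull_closed[OF B A \<Sigma>k_Ob[OF D]] by auto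
  qed
next
  case (2 k \<delta>)
  have "sgk B ((\<Sigma> ^^ j) D) k (cm j B D g) \<in> arr C ((\<Sigma> ^^ k) B) ((\<Sigma> ^^ (k + j)) D)"
    using sgk_arr[OF B \<Sigma>k_Ob[OF D] cm_arr[OF B D g]] by (simp add: funpow_add)
  then show ?thesis using 2 push_closed[OF A \<Sigma>k_Ob[OF B] \<Sigma>k_Ob[OF D]] by auto
qed

text \<open>The composite on the right classifies the product, by the defining property of
  \<open>sg\<close>, and classifying maps are unique up to \<open>eqp\<close>. Associativity of the
  cup product rests on this.\<close>

lemma cm_gcomp:
  assumes A: "A \<in> Ob C" and B: "B \<in> Ob C" and D: "D \<in> Ob C" and f: "f \<in> carrier (GG i A B)" and g: "g \<in> carrier (GG j B D)"
  shows "eqp A ((\<Sigma> ^^ (i + j)) D) (cm (i + j) A D (gcomp j i A B D g f)) (sgk B ((\<Sigma> ^^ j) D) i (cm j B D g) \<cdot>\<^bsub>C\<^esub> cm i A B f)"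
proof -
  note gf = gcomp_closed[OF A B D f g]
  show ?thesis using f
  proof (cases rule: GG_cases)
    case (1 a)
    show ?thesis using g
    proof (cases rule: GG_cases)
      case (1 b)
      with \<open>i = 0\<close> \<open>f = Inl a\<close> \<open>a \<in> arr C A B\<close> show ?thesis using eqp_refl[OF A D] comp_arr[OF A B D] by simp
    next
      case (2 l \<delta>)
      note S = \<Sigma>k_Ob[OF D, of l] \<Sigma>k_Ob[OF D, of "Suc l"] and c = cm_Suc[OF B D 2(3)]
      have i: "\<iota> ((\<Sigma> ^^ l) D) \<in> exts E ((\<Sigma> ^^ Suc l) D) ((\<Sigma> ^^ l) D)" using \<iota>_ext[OF S(1)] by simp
      have "eqp A ((\<Sigma> ^^ Suc l) D) (cm (Suc l) A D (Inr (pull C E ((\<Sigma> ^^ l) D) a \<delta>))) (cm (Suc l) B D (Inr \<delta>) \<cdot>\<^bsub>C\<^esub> a)"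
        using gf 2 1 pull_comp[OF S(2) B A S(1) c(1) 1(3) i] c(2) comp_arr[OF A B S(2) 1(3) c(1)] by (intro cm_unique[OF A D]) auto
      then show ?thesis using 1 2 by simp
    qed
  next
    case (2 k \<delta>)
    note S = \<Sigma>k_Ob[OF B, of k] \<Sigma>k_Ob[OF B, of "Suc k"] \<Sigma>k_Ob[OF D, of "k + j"] \<Sigma>k_Ob[OF D, of "Suc k + j"]
    note c = cm_Suc[OF A B 2(3)]
    let ?t = "sgk B ((\<Sigma> ^^ j) D) k (cm j B D g)"
    have t: "?t \<in> arr C ((\<Sigma> ^^ k) B) ((\<Sigma> ^^ (k + j)) D)"
      using sgk_arr[OF B \<Sigma>k_Ob[OF D] cm_arr[OF B D g]] by (simp add: funpow_add)
    let ?s = "sgk B ((\<Sigma> ^^ j) D) (Suc k) (cm j B D g)"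
    have s_def: "?s = sg ((\<Sigma> ^^ k) B) ((\<Sigma> ^^ (k + j)) D) ?t" by (simp add: funpow_add)
    have s: "?s \<in> arr C ((\<Sigma> ^^ Suc k) B) ((\<Sigma> ^^ (Suc k + j)) D)"
      "pull C E ((\<Sigma> ^^ (k + j)) D) ?s (\<iota> ((\<Sigma> ^^ (k + j)) D)) = push C E ((\<Sigma> ^^ Suc k) B) ?t (\<iota> ((\<Sigma> ^^ k) B))"
      unfolding s_def using sg[OF S(1,3) t] by simp_all
    have i: "\<iota> ((\<Sigma> ^^ (k + j)) D) \<in> exts E ((\<Sigma> ^^ (Suc k + j)) D) ((\<Sigma> ^^ (k + j)) D)" "\<iota> ((\<Sigma> ^^ k) B) \<in> exts E ((\<Sigma> ^^ Suc k) B) ((\<Sigma> ^^ k) B)"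
      using \<iota>_ext[OF S(3)] \<iota>_ext[OF S(1)] by simp_all
    have "pull C E ((\<Sigma> ^^ (k + j)) D) (?s \<cdot>\<^bsub>C\<^esub> cm (Suc k) A B (Inr \<delta>)) (\<iota> ((\<Sigma> ^^ (k + j)) D)) = push C E A ?t \<delta>"
      using pull_comp[OF S(4,2) A S(3) s(1) c(1) i(1)] s(2) push_pull[OF S(2) A S(1,3) c(1) t i(2)] c(2) by simp
    then have "eqp A ((\<Sigma> ^^ Suc (k + j)) D) (cm (Suc (k + j)) A D (Inr (push C E A ?t \<delta>))) (?s \<cdot>\<^bsub>C\<^esub> cm (Suc k) A B (Inr \<delta>))"
      using gf 2 comp_arr[OF A S(2,4) c(1) s(1)] by (intro cm_unique[OF A D]) auto
    then show ?thesis using 2 by simp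
  qed
qed

lemma push_eqp: "eqp A B f g \<Longrightarrow> X \<in> Ob C \<Longrightarrow> \<delta> \<in> exts E X A \<Longrightarrow> push C E X f \<delta> = push C E X g \<delta>"
  by (rule eqp_D)

text \<open>Laws for representatives of suspensions hold only up to \<open>eqp\<close>. They turn
  into equalities because such a representative is used solely to push extensions, and that is what
  \<open>eqp\<close> controls.\<close>

sublocale graded_data "Ob C" GG gcomp "\<lambda>A. Inl (idn C A)"
proof (rule graded_data.intro)
  fix A B i assume "A \<in> Ob C" "B \<in> Ob C"
  then show "comm_group (GG i A B)" using hom_group ext_group \<Sigma>k_Ob by (cases i) (auto intro: comm_group_image_group)
next
  fix A assume "A \<in> Ob C" then show "Inl (idn C A) \<in> carrier (GG 0 A A)" using idn_arr by simp
next
  fix A B D f i g j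
  assume "A \<in> Ob C" "B \<in> Ob C" "D \<in> Ob C" "f \<in> carrier (GG i A B)" "g \<in> carrier (GG j B D)"
  then show "gcomp j i A B D g f \<in> carrier (GG (i + j) A D)" by (rule gcomp_closed)
next
  fix A B D f i f' g j
  assume A: "A \<in> Ob C" and B: "B \<in> Ob C" and D: "D \<in> Ob C" and f: "f \<in> carrier (GG i A B)"
    and f': "f' \<in> carrier (GG i A B)" and g: "g \<in> carrier (GG j B D)"
  show "gcomp j i A B D g (f \<otimes>\<^bsub>GG i A B\<^esub> f') = gcomp j i A B D g f \<otimes>\<^bsub>GG (i + j) A D\<^esub> gcomp j i A B D g f'"
    using f
  proof (cases rule: GG_cases)
    case (1 a)
    then obtain a' where a': "f' = Inl a'" "a' \<in> arr C A B" using f' by auto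
    have ad: "a \<otimes>\<^bsub>Hom C A B\<^esub> a' = a \<boxplus>\<^bsub>C\<^esub> a'" using src_trg[OF A B 1(3)] by (simp add: add_arr_def)
    show ?thesis using g
    proof (cases rule: GG_cases)
      case (1 b)
      have "src C (b \<cdot>\<^bsub>C\<^esub> a) = A \<and> trg C (b \<cdot>\<^bsub>C\<^esub> a) = D" using src_trg[OF A D comp_arr[OF A B D \<open>a \<in> arr C A B\<close> 1(3)]] .
      then show ?thesis using \<open>i = 0\<close> \<open>f = Inl a\<close> 1 a' ad comp_add_right[OF A B D \<open>a \<in> arr C A B\<close> a'(2) 1(3)] by (simp add: add_arr_def)
    next
      case (2 l \<delta>)
      then show ?thesis using \<open>i = 0\<close> \<open>f = Inl a\<close> a' ad pull_add[OF B A \<Sigma>k_Ob[OF D] \<open>a \<in> arr C A B\<close> a'(2) 2(3)] by simp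
    qed
  next
    case (2 k \<delta>)
    then obtain \<delta>' where d': "f' = Inr \<delta>'" "\<delta>' \<in> exts E A ((\<Sigma> ^^ k) B)" using f' by auto
    have "sgk B ((\<Sigma> ^^ j) D) k (cm j B D g) \<in> arr C ((\<Sigma> ^^ k) B) ((\<Sigma> ^^ (k + j)) D)"
      using sgk_arr[OF B \<Sigma>k_Ob[OF D] cm_arr[OF B D g]] by (simp add: funpow_add)
    then show ?thesis using 2 d' push_mult[OF A \<Sigma>k_Ob[OF B] \<Sigma>k_Ob[OF D] _ 2(3) d'(2)] by simp
  qed
next
  fix A B D f i g j g'
  assume A: "A \<in> Ob C" and B: "B \<in> Ob C" and D: "D \<in> Ob C" and f: "f \<in> carrier (GG i A B)"
    and g: "g \<in> carrier (GG j B D)" and g': "g' \<in> carrier (GG j B D)"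
  show "gcomp j i A B D (g \<otimes>\<^bsub>GG j B D\<^esub> g') f = gcomp j i A B D g f \<otimes>\<^bsub>GG (i + j) A D\<^esub> gcomp j i A B D g' f"
    using f
  proof (cases rule: GG_cases)
    case (1 a)
    show ?thesis using g
    proof (cases rule: GG_cases)
      case (1 b)
      then obtain b' where b': "g' = Inl b'" "b' \<in> arr C B D" using g' by auto
      have "src C (b \<cdot>\<^bsub>C\<^esub> a) = A \<and> trg C (b \<cdot>\<^bsub>C\<^esub> a) = D" using src_trg[OF A D comp_arr[OF A B D \<open>a \<in> arr C A B\<close> 1(3)]] .
      then show ?thesis using \<open>i = 0\<close> \<open>f = Inl a\<close> 1 b' src_trg[OF B D 1(3)] comp_add_left[OF A B D \<open>a \<in> arr C A B\<close> 1(3) b'(2)]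
        by (simp add: add_arr_def)
    next
      case (2 l \<delta>)
      then obtain \<delta>' where d': "g' = Inr \<delta>'" "\<delta>' \<in> exts E B ((\<Sigma> ^^ l) D)" using g' by auto
      then show ?thesis using \<open>i = 0\<close> \<open>f = Inl a\<close> 2 pull_mult[OF B A \<Sigma>k_Ob[OF D] \<open>a \<in> arr C A B\<close> 2(3) d'(2)] by simp
    qed
  next
    case (2 k \<delta>)
    note SD = \<Sigma>k_Ob[OF D, of j] and SB = \<Sigma>k_Ob[OF B, of k]
    have SD': "(\<Sigma> ^^ k) ((\<Sigma> ^^ j) D) \<in> Ob C" by (rule \<Sigma>k_Ob[OF SD])
    note c = cm_arr[OF B D g] cm_arr[OF B D g']
    have "push C E A (sgk B ((\<Sigma> ^^ j) D) k (cm j B D (g \<otimes>\<^bsub>GG j B D\<^esub> g'))) \<delta> =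
      push C E A (sgk B ((\<Sigma> ^^ j) D) k (cm j B D g) \<boxplus>\<^bsub>C\<^esub> sgk B ((\<Sigma> ^^ j) D) k (cm j B D g')) \<delta>"
      by (rule push_eqp[OF eqp_trans[OF sgk_cong[OF cm_add[OF B D g g']] sgk_add[OF B SD c]] A 2(3)])
    also have "\<dots> = push C E A (sgk B ((\<Sigma> ^^ j) D) k (cm j B D g)) \<delta> \<otimes>\<^bsub>Ext E A ((\<Sigma> ^^ k) ((\<Sigma> ^^ j) D))\<^esub> push C E A (sgk B ((\<Sigma> ^^ j) D) k (cm j B D g')) \<delta>"
      by (rule push_add[OF A SB SD' sgk_arr[OF B SD c(1)] sgk_arr[OF B SD c(2)] 2(3)])
    finally show ?thesis using 2 by (simp add: funpow_add)
  qed
next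
  fix A B D F f i g j h k
  assume A: "A \<in> Ob C" and B: "B \<in> Ob C" and D: "D \<in> Ob C" and F: "F \<in> Ob C" and f: "f \<in> carrier (GG i A B)"
    and g: "g \<in> carrier (GG j B D)" and h: "h \<in> carrier (GG k D F)"
  show "gcomp (j + k) i A B F (gcomp k j B D F h g) f = gcomp k (i + j) A D F h (gcomp j i A B D g f)"
    using f
  proof (cases rule: GG_cases)
    case (1 a)
    show ?thesis using g
    proof (cases rule: GG_cases)
      case (1 b)
      show ?thesis using h
      proof (cases rule: GG_cases)
        case (1 c)
        then show ?thesis using \<open>i = 0\<close> \<open>f = Inl a\<close> \<open>j = 0\<close> \<open>g = Inl b\<close>
            comp_assoc[OF A B D F \<open>a \<in> arr C A B\<close> \<open>b \<in> arr C B D\<close> 1(3)] by simp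
      next
        case (2 l \<delta>)
        then show ?thesis using \<open>i = 0\<close> \<open>f = Inl a\<close> \<open>j = 0\<close> \<open>g = Inl b\<close>
            pull_comp[OF D B A \<Sigma>k_Ob[OF F] \<open>b \<in> arr C B D\<close> \<open>a \<in> arr C A B\<close> 2(3)] by simp
      qed
    next
      case (2 l \<delta>)
      have "sgk D ((\<Sigma> ^^ k) F) l (cm k D F h) \<in> arr C ((\<Sigma> ^^ l) D) ((\<Sigma> ^^ (l + k)) F)"
        using sgk_arr[OF D \<Sigma>k_Ob[OF F] cm_arr[OF D F h]] by (simp add: funpow_add)
      then show ?thesis using \<open>i = 0\<close> \<open>f = Inl a\<close> 2
          push_pull[OF B A \<Sigma>k_Ob[OF D] \<Sigma>k_Ob[OF F] \<open>a \<in> arr C A B\<close> _ 2(3)] by simp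
    qed
  next
    case (2 l \<delta>)
    note SF = \<Sigma>k_Ob[OF F, of k] and SD = \<Sigma>k_Ob[OF D, of j]
    note ch = cm_arr[OF D F h] and cg = cm_arr[OF B D g]
    let ?h = "sgk D ((\<Sigma> ^^ k) F) j (cm k D F h)"
    have h1: "?h \<in> arr C ((\<Sigma> ^^ j) D) ((\<Sigma> ^^ j) ((\<Sigma> ^^ k) F))" by (rule sgk_arr[OF D SF ch])
    note SjF = \<Sigma>k_Ob[OF SF, of j]
    have e1: "eqp B ((\<Sigma> ^^ (j + k)) F) (cm (j + k) B F (gcomp k j B D F h g)) (?h \<cdot>\<^bsub>C\<^esub> cm j B D g)"
      by (rule cm_gcomp[OF B D F g h])
    have fp: "(\<Sigma> ^^ (j + k)) F = (\<Sigma> ^^ j) ((\<Sigma> ^^ k) F)" by (simp add: funpow_add)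
    have "push C E A (sgk B ((\<Sigma> ^^ (j + k)) F) l (cm (j + k) B F (gcomp k j B D F h g))) \<delta> =
      push C E A (sgk ((\<Sigma> ^^ j) D) ((\<Sigma> ^^ j) ((\<Sigma> ^^ k) F)) l ?h \<cdot>\<^bsub>C\<^esub> sgk B ((\<Sigma> ^^ j) D) l (cm j B D g)) \<delta>"
      using push_eqp[OF eqp_trans[OF sgk_cong[OF e1] sgk_comp[OF B SD SjF cg h1, folded fp]] A 2(3)] by (simp add: fp)
    also have "\<dots> = push C E A (sgk ((\<Sigma> ^^ j) D) ((\<Sigma> ^^ j) ((\<Sigma> ^^ k) F)) l ?h) (push C E A (sgk B ((\<Sigma> ^^ j) D) l (cm j B D g)) \<delta>)"
      by (rule push_comp[OF A \<Sigma>k_Ob[OF B] \<Sigma>k_Ob[OF SD] \<Sigma>k_Ob[OF SjF] sgk_arr[OF B SD cg] sgk_arr[OF SD SjF h1] 2(3)])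
    also have "sgk ((\<Sigma> ^^ j) D) ((\<Sigma> ^^ j) ((\<Sigma> ^^ k) F)) l ?h = sgk D ((\<Sigma> ^^ k) F) (l + j) (cm k D F h)" by (rule sgk_sgk)
    finally show ?thesis using 2 by simp
  qed
next
  fix A B f i assume A: "A \<in> Ob C" and B: "B \<in> Ob C" and f: "f \<in> carrier (GG i A B)"
  show "gcomp 0 i A B B (Inl (idn C B)) f = f" using f
  proof (cases rule: GG_cases)
    case (1 a) then show ?thesis using comp_idn[OF A B] by simp
  next
    case (2 k \<delta>)
    then show ?thesis using push_eqp[OF sgk_idn[OF B] A 2(3)] push_idn[OF A \<Sigma>k_Ob[OF B] 2(3)] by simp
  qed
next
  fix A B f i assume A: "A \<in> Ob C" and B: "B \<in> Ob C" and f: "f \<in> carrier (GG i A B)"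
  show "gcomp i 0 A A B f (Inl (idn C A)) = f" using f
  proof (cases rule: GG_cases)
    case (1 a) then show ?thesis using comp_idn[OF A B] by simp
  next
    case (2 k \<delta>) then show ?thesis using pull_idn[OF A \<Sigma>k_Ob[OF B] 2(3)] by simp
  qed
qed

end

section \<open>Passage from arrows and extensions to ring elements\<close>

context suspended_exangulated begin

notation endo_mul (infixl "\<odot>" 70)

definition em :: "'b \<Rightarrow> (nat \<times> 'a \<times> 'a, 'b + 'c) group_family endo" where
  "em f = emb 0 (src C f) (trg C f) (Inl f)"

text \<open>The index is one less than the degree: \<open>ex 0\<close> embeds plain extensions,
  \<open>ex k\<close> elements of degree k + 1.\<close>

definition ex :: "nat \<Rightarrow> 'a \<Rightarrow> 'a \<Rightarrow> 'c \<Rightarrow> (nat \<times> 'a \<times> 'a, 'b + 'c) group_family endo" where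
  "ex k Z A \<delta> = emb (Suc k) Z A (Inr \<delta>)"

lemma em_eq: "\<lbrakk>A \<in> Ob C; B \<in> Ob C; f \<in> arr C A B\<rbrakk> \<Longrightarrow> em f = emb 0 A B (Inl f)"
  using src_trg unfolding em_def by metis

lemma em_H: "\<lbrakk>A \<in> Ob C; B \<in> Ob C; f \<in> arr C A B\<rbrakk> \<Longrightarrow> em f \<in> H 0 A B"
  by (simp add: em_eq emb_H)

lemma H0_E: assumes "x \<in> H 0 A B" obtains f where "A \<in> Ob C" "B \<in> Ob C" "f \<in> arr C A B" "x = em f"
proof -
  obtain f where f: "A \<in> Ob C" "B \<in> Ob C" "f \<in> carrier (GG 0 A B)" "x = emb 0 A B f" using assms by (rule H_E)
  then obtain g where g: "g \<in> arr C A B" "f = Inl g" by auto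
  show ?thesis by (rule that[of g]) (use f g em_eq in auto)
qed

lemma em_inj: "\<lbrakk>A \<in> Ob C; B \<in> Ob C; f \<in> arr C A B; g \<in> arr C A B; em f = em g\<rbrakk> \<Longrightarrow> f = g"
  using emb_inj[of A B "Inl f" 0 "Inl g"] by (simp add: em_eq)

lemma em_comp: "\<lbrakk>A \<in> Ob C; B \<in> Ob C; D \<in> Ob C; f \<in> arr C A B; g \<in> arr C B D\<rbrakk> \<Longrightarrow> em (g \<cdot>\<^bsub>C\<^esub> f) = em g \<odot> em f"
  using emb_comp[of A B D "Inl f" 0 "Inl g" 0] comp_arr[of A B D f g] by (simp add: em_eq[of A B] em_eq[of B D] em_eq[of A D])

lemma em_add: "\<lbrakk>A \<in> Ob C; B \<in> Ob C; f \<in> arr C A B; g \<in> arr C A B\<rbrakk> \<Longrightarrow> em (f \<boxplus>\<^bsub>C\<^esub> g) = em f + em g"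
  using emb_add[of A B "Inl f" 0 "Inl g"] arr_closed(2)[of A B f g] src_trg[of A B f]
  by (simp add: em_eq[of A B]) (simp add: add_arr_def)

lemma em_zero: "\<lbrakk>A \<in> Ob C; B \<in> Ob C\<rbrakk> \<Longrightarrow> em (zero_arr C A B) = 0"
  using emb_one[of A B 0] arr_closed(1)[of A B] by (simp add: em_eq)

lemma em_idn: "A \<in> Ob C \<Longrightarrow> em (idn C A) = I A"
  using idn_arr[of A] by (simp add: em_eq[of A A] I_def)

lemma em_minus:
  assumes "A \<in> Ob C" "B \<in> Ob C" "f \<in> arr C A B" "g \<in> arr C A B" shows "em (f \<boxminus>\<^bsub>C\<^esub> g) = em f - em g"
  using em_add[OF assms(1,2) arr_closed(3)[OF assms(1,2,3,4)] assms(4)] minus_add(1)[OF assms] by (simp add: eq_diff_eq)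

lemma em_neg:
  assumes "A \<in> Ob C" "B \<in> Ob C" "f \<in> arr C A B" shows "em (neg_arr C f) = - em f"
proof -
  have "neg_arr C f \<boxplus>\<^bsub>C\<^esub> f = zero_arr C A B"
    using src_trg[OF assms] src_trg[OF assms(1,2) arr_closed(4)[OF assms]] comm_group_simps(6)[OF hom_group[OF assms(1,2)] assms(3)]
    by (simp add: add_arr_def neg_arr_def)
  then show ?thesis using em_add[OF assms(1,2) arr_closed(4)[OF assms] assms(3)] em_zero[OF assms(1,2)]
    by (simp add: eq_neg_iff_add_eq_0)
qed

lemma em_eq_0: "\<lbrakk>A \<in> Ob C; B \<in> Ob C; f \<in> arr C A B\<rbrakk> \<Longrightarrow> em f = 0 \<longleftrightarrow> f = zero_arr C A B"
  using em_inj[of A B f "zero_arr C A B"] em_zero arr_closed(1) by auto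

lemma ex_H: "\<lbrakk>Z \<in> Ob C; A \<in> Ob C; \<delta> \<in> exts E Z ((\<Sigma> ^^ k) A)\<rbrakk> \<Longrightarrow> ex k Z A \<delta> \<in> H (Suc k) Z A"
  by (simp add: ex_def emb_H)

lemma HSuc_E:
  assumes "x \<in> H (Suc k) Z A" obtains \<delta> where "Z \<in> Ob C" "A \<in> Ob C" "\<delta> \<in> exts E Z ((\<Sigma> ^^ k) A)" "x = ex k Z A \<delta>"
proof -
  obtain f where f: "Z \<in> Ob C" "A \<in> Ob C" "f \<in> carrier (GG (Suc k) Z A)" "x = emb (Suc k) Z A f" using assms by (rule H_E)
  then obtain g where g: "g \<in> exts E Z ((\<Sigma> ^^ k) A)" "f = Inr g" by auto
  show ?thesis by (rule that[of g]) (use f g ex_def in auto)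
qed

lemma ex_inj: "\<lbrakk>Z \<in> Ob C; A \<in> Ob C; \<delta> \<in> exts E Z ((\<Sigma> ^^ k) A); \<rho> \<in> exts E Z ((\<Sigma> ^^ k) A); ex k Z A \<delta> = ex k Z A \<rho>\<rbrakk> \<Longrightarrow> \<delta> = \<rho>"
  using emb_inj[of Z A "Inr \<delta>" "Suc k" "Inr \<rho>"] by (simp add: ex_def)

lemma ex_add: "\<lbrakk>Z \<in> Ob C; A \<in> Ob C; \<delta> \<in> exts E Z ((\<Sigma> ^^ k) A); \<rho> \<in> exts E Z ((\<Sigma> ^^ k) A)\<rbrakk> \<Longrightarrow>
    ex k Z A (\<delta> \<otimes>\<^bsub>Ext E Z ((\<Sigma> ^^ k) A)\<^esub> \<rho>) = ex k Z A \<delta> + ex k Z A \<rho>"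
  using emb_add[of Z A "Inr \<delta>" "Suc k" "Inr \<rho>"] by (simp add: ex_def)

lemma ex_zero: "\<lbrakk>Z \<in> Ob C; A \<in> Ob C\<rbrakk> \<Longrightarrow> ex k Z A (zero_ext E Z ((\<Sigma> ^^ k) A)) = 0"
  using emb_one[of Z A "Suc k"] by (simp add: ex_def)

lemma ex_eq_0: "\<lbrakk>Z \<in> Ob C; A \<in> Ob C; \<delta> \<in> exts E Z ((\<Sigma> ^^ k) A)\<rbrakk> \<Longrightarrow> ex k Z A \<delta> = 0 \<longleftrightarrow> \<delta> = zero_ext E Z ((\<Sigma> ^^ k) A)"
  using ex_inj[of Z A \<delta> k "zero_ext E Z ((\<Sigma> ^^ k) A)"] ex_zero exts_one \<Sigma>k_Ob by auto

lemma ex_pull: "\<lbrakk>Z \<in> Ob C; Z' \<in> Ob C; A \<in> Ob C; c \<in> arr C Z' Z; \<delta> \<in> exts E Z ((\<Sigma> ^^ k) A)\<rbrakk> \<Longrightarrow>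
    ex k Z A \<delta> \<odot> em c = ex k Z' A (pull C E ((\<Sigma> ^^ k) A) c \<delta>)"
  using emb_comp[of Z' Z A "Inl c" 0 "Inr \<delta>" "Suc k"] by (simp add: ex_def em_eq[of Z' Z])

lemma ex_push: "\<lbrakk>Z \<in> Ob C; A \<in> Ob C; A' \<in> Ob C; a \<in> arr C A A'; \<delta> \<in> exts E Z ((\<Sigma> ^^ k) A)\<rbrakk> \<Longrightarrow>
    em a \<odot> ex k Z A \<delta> = ex k Z A' (push C E Z (sgk A A' k a) \<delta>)"
  using emb_comp[of Z A A' "Inr \<delta>" "Suc k" "Inl a" 0] by (simp add: ex_def em_eq[of A A'])

lemma ex_push0: "\<lbrakk>Z \<in> Ob C; A \<in> Ob C; A' \<in> Ob C; a \<in> arr C A A'; \<delta> \<in> exts E Z A\<rbrakk> \<Longrightarrow>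
    em a \<odot> ex 0 Z A \<delta> = ex 0 Z A' (push C E Z a \<delta>)"
  using ex_push[of Z A A' a \<delta> 0] by simp

lemma ex_pull0: "\<lbrakk>Z \<in> Ob C; Z' \<in> Ob C; A \<in> Ob C; c \<in> arr C Z' Z; \<delta> \<in> exts E Z A\<rbrakk> \<Longrightarrow>
    ex 0 Z A \<delta> \<odot> em c = ex 0 Z' A (pull C E A c \<delta>)"
  using ex_pull[of Z Z' A c \<delta> 0] by simp

lemma ex_mul: "\<lbrakk>A \<in> Ob C; B \<in> Ob C; D \<in> Ob C; \<theta> \<in> exts E A ((\<Sigma> ^^ l) B); \<delta> \<in> exts E B ((\<Sigma> ^^ k) D)\<rbrakk> \<Longrightarrow>
    ex k B D \<delta> \<odot> ex l A B \<theta> = ex (l + Suc k) A D (push C E A (sgk B ((\<Sigma> ^^ Suc k) D) l (cm (Suc k) B D (Inr \<delta>))) \<theta>)"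
  using emb_comp[of A B D "Inr \<theta>" "Suc l" "Inr \<delta>" "Suc k"] by (simp add: ex_def)

lemma bip_em:
  assumes "biproduct C A B S i1 i2 p1 p2" shows "bip A B S (em i1) (em i2) (em p1) (em p2)"
proof -
  have O: "A \<in> Ob C" "B \<in> Ob C" "S \<in> Ob C" and a: "i1 \<in> arr C A S" "i2 \<in> arr C B S" "p1 \<in> arr C S A" "p2 \<in> arr C S B"
    and e: "p1 \<cdot>\<^bsub>C\<^esub> i1 = idn C A" "p2 \<cdot>\<^bsub>C\<^esub> i2 = idn C B" "p1 \<cdot>\<^bsub>C\<^esub> i2 = zero_arr C B A" "p2 \<cdot>\<^bsub>C\<^esub> i1 = zero_arr C A B"
      "(i1 \<cdot>\<^bsub>C\<^esub> p1) \<boxplus>\<^bsub>C\<^esub> (i2 \<cdot>\<^bsub>C\<^esub> p2) = idn C S"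
    using assms unfolding biproduct_def by auto
  have c: "i1 \<cdot>\<^bsub>C\<^esub> p1 \<in> arr C S S" "i2 \<cdot>\<^bsub>C\<^esub> p2 \<in> arr C S S" using comp_arr O a by blast+
  show ?thesis unfolding bip_def
    using em_H[OF O(1,3) a(1)] em_H[OF O(2,3) a(2)] em_H[OF O(3,1) a(3)] em_H[OF O(3,2) a(4)]
      em_comp[OF O(1,3,1) a(1,3)] em_comp[OF O(2,3,2) a(2,4)] em_comp[OF O(2,3,1) a(2,3)] em_comp[OF O(1,3,2) a(1,4)]
      em_add[OF O(3,3) c] em_comp[OF O(3,1,3) a(3,1)] em_comp[OF O(3,2,3) a(4,2)] O
    by (simp add: e em_idn em_zero)
qed

lemma bip_em_iff:
  assumes O: "A \<in> Ob C" "B \<in> Ob C" "S \<in> Ob C" and a: "i1 \<in> arr C A S" "i2 \<in> arr C B S" "p1 \<in> arr C S A" "p2 \<in> arr C S B"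
    and b: "bip A B S (em i1) (em i2) (em p1) (em p2)"
  shows "biproduct C A B S i1 i2 p1 p2"
proof -
  note bD = bip_D[OF b]
  have "p1 \<cdot>\<^bsub>C\<^esub> i1 = idn C A" by (rule em_inj[OF O(1,1)]) (use O a comp_arr idn_arr bD in \<open>auto simp: em_comp em_idn\<close>)
  moreover have "p2 \<cdot>\<^bsub>C\<^esub> i2 = idn C B" by (rule em_inj[OF O(2,2)]) (use O a comp_arr idn_arr bD in \<open>auto simp: em_comp em_idn\<close>)
  moreover have "p1 \<cdot>\<^bsub>C\<^esub> i2 = zero_arr C B A"
    by (rule em_inj[OF O(2,1)]) (use O a comp_arr arr_closed(1) bD in \<open>auto simp: em_comp em_zero\<close>)
  moreover have "p2 \<cdot>\<^bsub>C\<^esub> i1 = zero_arr C A B"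
    by (rule em_inj[OF O(1,2)]) (use O a comp_arr arr_closed(1) bD in \<open>auto simp: em_comp em_zero\<close>)
  moreover have "(i1 \<cdot>\<^bsub>C\<^esub> p1) \<boxplus>\<^bsub>C\<^esub> (i2 \<cdot>\<^bsub>C\<^esub> p2) = idn C S"
  proof -
    have c: "i1 \<cdot>\<^bsub>C\<^esub> p1 \<in> arr C S S" "i2 \<cdot>\<^bsub>C\<^esub> p2 \<in> arr C S S" using comp_arr O a by blast+
    show ?thesis by (rule em_inj[OF O(3,3) arr_closed(2)[OF O(3,3) c] idn_arr[OF O(3)]])
      (simp add: em_add[OF O(3,3) c] em_comp[OF O(3,1,3) a(3,1)] em_comp[OF O(3,2,3) a(4,2)] em_idn O bD)
  qed
  ultimately show ?thesis using O a unfolding biproduct_def by blast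
qed

lemma full_subcategory_simps [simp]:
  "Ob (full_subcategory C T) = T" "Hom (full_subcategory C T) = Hom C" "src (full_subcategory C T) = src C"
  "trg (full_subcategory C T) = trg C" "idn (full_subcategory C T) = idn C" "comp (full_subcategory C T) = comp C"
  by (simp_all add: full_subcategory_def)

lemma full_subcategory_ops [simp]:
  "add_arr (full_subcategory C T) = add_arr C" "minus_arr (full_subcategory C T) = minus_arr C" "neg_arr (full_subcategory C T) = neg_arr C"
  by (simp_all add: add_arr_def minus_arr_def neg_arr_def fun_eq_iff)

lemma full_subcategory_Ob: "full_subcategory C (Ob C) = C"
  by (simp add: full_subcategory_def)

text \<open>With T the set of all objects, this and the next two equivalences also cover the ambient
  category.\<close>

lemma is_complex_iff:
  assumes "T \<subseteq> Ob C"
  shows "is_complex (full_subcategory C T) n X \<longleftrightarrow> (\<forall>i\<le>Suc n. obj X i \<in> T) \<and> (\<forall>i\<le>n. diff X i \<in> arr C (obj X i) (obj X (Suc i))) \<and>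
    (\<forall>i<n. em (diff X (Suc i)) \<odot> em (diff X i) = 0)"
proof -
  have "(diff X (Suc i) \<cdot>\<^bsub>C\<^esub> diff X i = zero_arr C (obj X i) (obj X (Suc (Suc i)))) \<longleftrightarrow> em (diff X (Suc i)) \<odot> em (diff X i) = 0"
    if "\<forall>i\<le>Suc n. obj X i \<in> T" "\<forall>i\<le>n. diff X i \<in> arr C (obj X i) (obj X (Suc i))" "i < n" for i
  proof -
    have o: "obj X i \<in> Ob C" "obj X (Suc i) \<in> Ob C" "obj X (Suc (Suc i)) \<in> Ob C"
      and d: "diff X i \<in> arr C (obj X i) (obj X (Suc i))" "diff X (Suc i) \<in> arr C (obj X (Suc i)) (obj X (Suc (Suc i)))"
      using that assms by auto
    show ?thesis using em_eq_0[OF o(1,3) comp_arr[OF o d]] em_comp[OF o d] by simp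
  qed
  then show ?thesis unfolding is_complex_def by auto
qed

lemma chain_map_iff:
  assumes T: "T \<subseteq> Ob C" and X: "is_complex (full_subcategory C T) n X" and Y: "is_complex (full_subcategory C T) n Y"
  shows "chain_map (full_subcategory C T) n X Y f \<longleftrightarrow> (\<forall>i\<le>Suc n. f i \<in> arr C (obj X i) (obj Y i)) \<and>
    (\<forall>i\<le>n. em (f (Suc i)) \<odot> em (diff X i) = em (diff Y i) \<odot> em (f i))"
proof -
  have "(f (Suc i) \<cdot>\<^bsub>C\<^esub> diff X i = diff Y i \<cdot>\<^bsub>C\<^esub> f i) \<longleftrightarrow> em (f (Suc i)) \<odot> em (diff X i) = em (diff Y i) \<odot> em (f i)"
    if f: "\<forall>i\<le>Suc n. f i \<in> arr C (obj X i) (obj Y i)" and i: "i \<le> n" for i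
  proof -
    have o: "obj X i \<in> Ob C" "obj X (Suc i) \<in> Ob C" "obj Y i \<in> Ob C" "obj Y (Suc i) \<in> Ob C"
      and d: "diff X i \<in> arr C (obj X i) (obj X (Suc i))" "diff Y i \<in> arr C (obj Y i) (obj Y (Suc i))"
        "f i \<in> arr C (obj X i) (obj Y i)" "f (Suc i) \<in> arr C (obj X (Suc i)) (obj Y (Suc i))"
      using X Y f i T unfolding is_complex_iff[OF T] by auto
    show ?thesis using em_comp[OF o(1,2,4) d(1,4)] em_comp[OF o(1,3,4) d(3,2)]
        em_inj[OF o(1,4) comp_arr[OF o(1,2,4) d(1,4)] comp_arr[OF o(1,3,4) d(3,2)]] by auto
  qed
  then show ?thesis unfolding chain_map_def by auto
qed

text \<open>The homotopy is reindexed: \<open>h i\<close> on the right starts in degree i + 1, as in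
  \<open>null\<close>.\<close>

lemma homotopic_iff:
  assumes T: "T \<subseteq> Ob C" and X: "is_complex (full_subcategory C T) n X" and Y: "is_complex (full_subcategory C T) n Y"
    and f: "\<And>i. i \<le> Suc n \<Longrightarrow> f i \<in> arr C (obj X i) (obj Y i)" and g: "\<And>i. i \<le> Suc n \<Longrightarrow> g i \<in> arr C (obj X i) (obj Y i)"
  shows "homotopic (full_subcategory C T) n X Y f g \<longleftrightarrow> (\<exists>h. (\<forall>i\<le>n. h i \<in> H 0 (obj X (Suc i)) (obj Y i)) \<and>
    em (f 0) - em (g 0) = h 0 \<odot> em (diff X 0) \<and>
    (\<forall>i<n. em (f (Suc i)) - em (g (Suc i)) = h (Suc i) \<odot> em (diff X (Suc i)) + em (diff Y i) \<odot> h i) \<and>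
    em (f (Suc n)) - em (g (Suc n)) = em (diff Y n) \<odot> h n)" (is "_ \<longleftrightarrow> (\<exists>h. ?R h)")
proof -
  have o: "obj X i \<in> Ob C" "obj Y i \<in> Ob C" if "i \<le> Suc n" for i using X Y T that unfolding is_complex_iff[OF T] by auto
  have dX: "diff X i \<in> arr C (obj X i) (obj X (Suc i))" and dY: "diff Y i \<in> arr C (obj Y i) (obj Y (Suc i))" if "i \<le> n" for i
    using X Y that unfolding is_complex_iff[OF T] by auto
  have eqI: "p = q \<boxplus>\<^bsub>C\<^esub> r \<longleftrightarrow> em p - em q = em r" if "A \<in> Ob C" "B \<in> Ob C" "p \<in> arr C A B" "q \<in> arr C A B" "r \<in> arr C A B" for A B p q r
  proof -
    have "p = q \<boxplus>\<^bsub>C\<^esub> r \<longleftrightarrow> em p = em q + em r"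
      using em_inj[OF that(1,2,3) arr_closed(2)[OF that(1,2,4,5)]] em_add[OF that(1,2,4,5)] by auto
    then show ?thesis by (auto simp: algebra_simps)
  qed
  let ?L = "\<lambda>h. f 0 = g 0 \<boxplus>\<^bsub>C\<^esub> (h 1 \<cdot>\<^bsub>C\<^esub> diff X 0) \<and>
      (\<forall>i\<in>{1..n}. f i = g i \<boxplus>\<^bsub>C\<^esub> ((h (i + 1) \<cdot>\<^bsub>C\<^esub> diff X i) \<boxplus>\<^bsub>C\<^esub> (diff Y (i - 1) \<cdot>\<^bsub>C\<^esub> h i))) \<and>
      f (n + 1) = g (n + 1) \<boxplus>\<^bsub>C\<^esub> (diff Y n \<cdot>\<^bsub>C\<^esub> h (n + 1))"
  have key: "?L h \<longleftrightarrow> (em (f 0) - em (g 0) = em (h 1) \<odot> em (diff X 0) \<and>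
    (\<forall>i<n. em (f (Suc i)) - em (g (Suc i)) = em (h (Suc (Suc i))) \<odot> em (diff X (Suc i)) + em (diff Y i) \<odot> em (h (Suc i))) \<and>
    em (f (Suc n)) - em (g (Suc n)) = em (diff Y n) \<odot> em (h (Suc n)))"
    if "\<forall>i\<le>n. h (Suc i) \<in> arr C (obj X (Suc i)) (obj Y i)" for h
  proof -
    note h = that[rule_format]
    have c1: "h (Suc i) \<cdot>\<^bsub>C\<^esub> diff X i \<in> arr C (obj X i) (obj Y i)" "em (h (Suc i) \<cdot>\<^bsub>C\<^esub> diff X i) = em (h (Suc i)) \<odot> em (diff X i)"
      if "i \<le> n" for i using comp_arr em_comp o dX[OF that] h[OF that] that by (meson Suc_le_mono le_SucI)+
    have c2: "diff Y i \<cdot>\<^bsub>C\<^esub> h (Suc i) \<in> arr C (obj X (Suc i)) (obj Y (Suc i))" "em (diff Y i \<cdot>\<^bsub>C\<^esub> h (Suc i)) = em (diff Y i) \<odot> em (h (Suc i))"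
      if "i \<le> n" for i using comp_arr em_comp o dY[OF that] h[OF that] that by (meson Suc_le_mono le_SucI)+
    have k1: "f 0 = g 0 \<boxplus>\<^bsub>C\<^esub> (h 1 \<cdot>\<^bsub>C\<^esub> diff X 0) \<longleftrightarrow> em (f 0) - em (g 0) = em (h 1) \<odot> em (diff X 0)"
      using eqI[OF o(1)[of 0] o(2)[of 0] f[of 0] g[of 0] c1(1)[of 0]] c1(2)[of 0] by simp
    have k2: "f (Suc i) = g (Suc i) \<boxplus>\<^bsub>C\<^esub> ((h (Suc (Suc i)) \<cdot>\<^bsub>C\<^esub> diff X (Suc i)) \<boxplus>\<^bsub>C\<^esub> (diff Y i \<cdot>\<^bsub>C\<^esub> h (Suc i))) \<longleftrightarrow>
      em (f (Suc i)) - em (g (Suc i)) = em (h (Suc (Suc i))) \<odot> em (diff X (Suc i)) + em (diff Y i) \<odot> em (h (Suc i))" if i: "i < n" for i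
    proof -
      have i': "Suc i \<le> n" "i \<le> n" "Suc i \<le> Suc n" using i by auto
      note oo = o[OF i'(3)] and a1 = c1[OF i'(1)] and a2 = c2[OF i'(2)]
      show ?thesis using eqI[OF oo f[OF i'(3)] g[OF i'(3)] arr_closed(2)[OF oo a1(1) a2(1)]] em_add[OF oo a1(1) a2(1)] a1(2) a2(2) by simp
    qed
    have k3: "f (Suc n) = g (Suc n) \<boxplus>\<^bsub>C\<^esub> (diff Y n \<cdot>\<^bsub>C\<^esub> h (Suc n)) \<longleftrightarrow> em (f (Suc n)) - em (g (Suc n)) = em (diff Y n) \<odot> em (h (Suc n))"
      using eqI[OF o(1)[of "Suc n"] o(2)[of "Suc n"] f[of "Suc n"] g[of "Suc n"] c2(1)[of n]] c2(2)[of n] by simp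
    have "(\<forall>i\<in>{1..n}. f i = g i \<boxplus>\<^bsub>C\<^esub> ((h (i + 1) \<cdot>\<^bsub>C\<^esub> diff X i) \<boxplus>\<^bsub>C\<^esub> (diff Y (i - 1) \<cdot>\<^bsub>C\<^esub> h i))) \<longleftrightarrow>
      (\<forall>i<n. f (Suc i) = g (Suc i) \<boxplus>\<^bsub>C\<^esub> ((h (Suc (Suc i)) \<cdot>\<^bsub>C\<^esub> diff X (Suc i)) \<boxplus>\<^bsub>C\<^esub> (diff Y i \<cdot>\<^bsub>C\<^esub> h (Suc i))))" (is "?A \<longleftrightarrow> ?B")
    proof
      assume a: ?A
      show ?B
      proof (intro allI impI)
        fix i assume "i < n" then have "Suc i \<in> {1..n}" by simp
        from bspec[OF a this] show "f (Suc i) = g (Suc i) \<boxplus>\<^bsub>C\<^esub> ((h (Suc (Suc i)) \<cdot>\<^bsub>C\<^esub> diff X (Suc i)) \<boxplus>\<^bsub>C\<^esub> (diff Y i \<cdot>\<^bsub>C\<^esub> h (Suc i)))" by simp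
      qed
    next
      assume b: ?B
      show ?A
      proof
        fix i assume "i \<in> {1..n}" then have "i - 1 < n" "Suc (i - 1) = i" by auto
        then show "f i = g i \<boxplus>\<^bsub>C\<^esub> ((h (i + 1) \<cdot>\<^bsub>C\<^esub> diff X i) \<boxplus>\<^bsub>C\<^esub> (diff Y (i - 1) \<cdot>\<^bsub>C\<^esub> h i))" using b by (metis Suc_eq_plus1)
      qed
    qed
    then show ?thesis using k1 k2 k3 by simp
  qed
  show ?thesis
  proof
    assume "homotopic (full_subcategory C T) n X Y f g"
    then obtain h where h: "\<forall>i\<in>{1..n + 1}. h i \<in> arr C (obj X i) (obj Y (i - 1))" and L: "?L h" unfolding homotopic_def by auto
    have h': "\<forall>i\<le>n. h (Suc i) \<in> arr C (obj X (Suc i)) (obj Y i)" using h by force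
    have hH: "em (h (Suc i)) \<in> H 0 (obj X (Suc i)) (obj Y i)" if "i \<le> n" for i
      using em_H[OF o(1)[of "Suc i"] o(2)[of i]] h' that by simp
    show "\<exists>h. ?R h"
      by (rule exI[of _ "\<lambda>i. em (h (Suc i))"]) (use key[of h, OF h', THEN iffD1, OF L] hH in simp)
  next
    assume "\<exists>h. ?R h"
    then obtain k where k: "?R k" by blast
    have "\<exists>r. r \<in> arr C (obj X (Suc i)) (obj Y i) \<and> k i = em r" if "i \<le> n" for i
    proof -
      have "k i \<in> H 0 (obj X (Suc i)) (obj Y i)" using k that by blast
      then show ?thesis by (rule H0_E) blast
    qed
    then obtain r where r: "\<And>i. i \<le> n \<Longrightarrow> r i \<in> arr C (obj X (Suc i)) (obj Y i)" "\<And>i. i \<le> n \<Longrightarrow> k i = em (r i)" by metis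
    let ?h = "\<lambda>i. r (i - 1)"
    have r': "\<forall>i\<le>n. ?h (Suc i) \<in> arr C (obj X (Suc i)) (obj Y i)" using r by simp
    have L2: "?L ?h" by (rule key[of ?h, OF r', THEN iffD2]) (use k r(2) in simp_all)
    have mem: "\<forall>i\<in>{1..n + 1}. ?h i \<in> arr C (obj X i) (obj Y (i - 1))"
    proof
      fix i assume "i \<in> {1..n + 1}"
      then have "i - 1 \<le> n" "Suc (i - 1) = i" by auto
      then show "?h i \<in> arr C (obj X i) (obj Y (i - 1))" using r(1)[of "i - 1"] by simp
    qed
    show "homotopic (full_subcategory C T) n X Y f g" unfolding homotopic_def full_subcategory_simps full_subcategory_ops
      by (rule exI[of _ ?h]) (rule conjI[OF mem L2])
  qed
qed

end

section \<open>Triangles in the graded category of higher extensions\<close>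

lemma all_le_1: "(\<forall>i\<le>Suc 0. P i) \<longleftrightarrow> P 0 \<and> P (Suc 0)"
  and all_le_2: "(\<forall>i\<le>Suc (Suc 0). P i) \<longleftrightarrow> P 0 \<and> P (Suc 0) \<and> P (Suc (Suc 0))"
  and all_less_1: "(\<forall>i<Suc 0. P i) \<longleftrightarrow> P 0"
  by (auto simp: le_Suc_eq)

context suspended_exangulated begin

definition Tri where
  "Tri A x B y Z \<delta> \<longleftrightarrow> (\<exists>x' y' \<delta>'. s_triangle C E s A x' B y' Z \<delta>' \<and> x = em x' \<and> y = em y' \<and> \<delta> = ex 0 Z A \<delta>')"

lemma TriI: "s_triangle C E s A x B y Z \<delta> \<Longrightarrow> Tri A (em x) B (em y) Z (ex 0 Z A \<delta>)"
  unfolding Tri_def by blast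

lemma Tri_E:
  assumes "Tri A x B y Z \<delta>"
  obtains x' y' \<delta>' where "s_triangle C E s A x' B y' Z \<delta>'" "x = em x'" "y = em y'" "\<delta> = ex 0 Z A \<delta>'"
  using assms unfolding Tri_def by blast

lemma s_triangle_class:
  assumes t: "s_triangle C E s A x B y Z \<delta>"
  obtains W where "is_complex C 1 W" "s Z A \<delta> = homotopy_class C 1 W" "cpx3 A x B y Z \<in> homotopy_class C 1 W"
proof -
  note tD = s_triangle_D[OF t]
  obtain W where W: "W \<in> complexes_between C 1 A Z" "s Z A \<delta> = homotopy_class C 1 W"
    using realization_class[OF tD(1,3,6)] by blast
  moreover have "cpx3 A x B y Z \<in> s Z A \<delta>" using t unfolding s_triangle_def distinguished_def by simp
  ultimately show ?thesis using that[of W] unfolding complexes_between_def by simp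
qed

text \<open>The class of \<open>\<delta>\<close> is only known through some representative W. The
  equivalence between W and the given triangle is composed with the isomorphism of middle terms, and
  the homotopies are conjugated accordingly.\<close>

lemma s_triangle_mid_iso:
  assumes t: "s_triangle C E s A x B y Z \<delta>" and b: "b \<in> arr C B B'" "b' \<in> arr C B' B" and B': "B' \<in> Ob C"
    and bb: "em b' \<odot> em b = I B" "em b \<odot> em b' = I B'"
  shows "s_triangle C E s A (b \<cdot>\<^bsub>C\<^esub> x) B' (y \<cdot>\<^bsub>C\<^esub> b') Z \<delta>"
proof -
  note tD = s_triangle_D[OF t]
  let ?X = "cpx3 A x B y Z" and ?Y = "cpx3 A (b \<cdot>\<^bsub>C\<^esub> x) B' (y \<cdot>\<^bsub>C\<^esub> b') Z"
  obtain W where W: "is_complex C 1 W" "s Z A \<delta> = homotopy_class C 1 W" "?X \<in> homotopy_class C 1 W"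
    using s_triangle_class[OF t] .
  note iff = is_complex_iff[OF subset_refl, unfolded full_subcategory_Ob, of 1, simplified, unfolded all_le_1 all_le_2]
  have bx: "b \<cdot>\<^bsub>C\<^esub> x \<in> arr C A B'" "y \<cdot>\<^bsub>C\<^esub> b' \<in> arr C B' Z" "em (b \<cdot>\<^bsub>C\<^esub> x) = em b \<odot> em x" "em (y \<cdot>\<^bsub>C\<^esub> b') = em y \<odot> em b'"
    using comp_arr[OF tD(1,2) B' tD(4) b(1)] comp_arr[OF B' tD(2,3) b(2) tD(5)]
      em_comp[OF tD(1,2) B' tD(4) b(1)] em_comp[OF B' tD(2,3) b(2) tD(5)] by auto
  have yx: "em y \<odot> em x = 0" using em_eq_0[OF tD(1,3) comp_arr[OF tD(1-3) tD(4,5)]] tD(7) em_comp[OF tD(1-3) tD(4,5)] by simp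
  have idx: "I B \<odot> em x = em x" using id_left[OF em_H[OF tD(1,2,4)]] .
  have X: "is_complex C (Suc 0) ?X" unfolding iff using tD yx by simp
  have Y: "is_complex C (Suc 0) ?Y" unfolding iff using tD bx B' yx idx by (simp add: mul_simps mul_ext[OF bb(1)])
  obtain f g where f: "end_fixing_map C 1 W ?X f" and g: "end_fixing_map C 1 ?X W g"
    and h1: "homotopic C 1 W W (\<lambda>i. g i \<cdot>\<^bsub>C\<^esub> f i) (\<lambda>i. idn C (obj W i))"
    and h2: "homotopic C 1 ?X ?X (\<lambda>i. f i \<cdot>\<^bsub>C\<^esub> g i) (\<lambda>i. idn C (obj ?X i))"
    using W(3) unfolding homotopy_class_def homotopy_equivalent_def by blast
  note cmi = chain_map_iff[OF subset_refl, unfolded full_subcategory_Ob, of 1, simplified, unfolded all_le_1 all_le_2]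
  note hi = homotopic_iff[OF subset_refl, unfolded full_subcategory_Ob, of 1, simplified, unfolded all_le_1 all_less_1]
  note W1 = W(1)[unfolded One_nat_def] and X1 = X and Y1 = Y
  have f': "chain_map C (Suc 0) W ?X f" "f 0 = idn C (obj W 0)" "f (Suc (Suc 0)) = idn C (obj W (Suc (Suc 0)))"
    and g': "chain_map C (Suc 0) ?X W g" "g 0 = idn C A" "g (Suc (Suc 0)) = idn C Z"
    using f g unfolding end_fixing_map_def by auto
  note cf = f'(1)[unfolded cmi[OF W1 X1]] and cg = g'(1)[unfolded cmi[OF X1 W1]]
  have Wo: "obj W 0 \<in> Ob C" "obj W (Suc 0) \<in> Ob C" "obj W (Suc (Suc 0)) \<in> Ob C" using W1 unfolding iff by auto
  have fa: "f 0 \<in> arr C (obj W 0) A" "f (Suc 0) \<in> arr C (obj W (Suc 0)) B" "f (Suc (Suc 0)) \<in> arr C (obj W (Suc (Suc 0))) Z"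
    and fe: "em (f (Suc 0)) \<odot> em (diff W 0) = em x \<odot> em (f 0)" "em (f (Suc (Suc 0))) \<odot> em (diff W (Suc 0)) = em y \<odot> em (f (Suc 0))"
    using cf by simp_all
  have ga: "g 0 \<in> arr C A (obj W 0)" "g (Suc 0) \<in> arr C B (obj W (Suc 0))" "g (Suc (Suc 0)) \<in> arr C Z (obj W (Suc (Suc 0)))"
    and ge: "em (g (Suc 0)) \<odot> em x = em (diff W 0) \<odot> em (g 0)" "em (g (Suc (Suc 0))) \<odot> em y = em (diff W (Suc 0)) \<odot> em (g (Suc 0))"
    using cg by simp_all
  let ?f = "f(Suc 0 := b \<cdot>\<^bsub>C\<^esub> f (Suc 0))" and ?g = "g(Suc 0 := g (Suc 0) \<cdot>\<^bsub>C\<^esub> b')"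
  have bf: "b \<cdot>\<^bsub>C\<^esub> f (Suc 0) \<in> arr C (obj W (Suc 0)) B'" "em (b \<cdot>\<^bsub>C\<^esub> f (Suc 0)) = em b \<odot> em (f (Suc 0))"
    using comp_arr[OF Wo(2) tD(2) B' fa(2) b(1)] em_comp[OF Wo(2) tD(2) B' fa(2) b(1)] by auto
  have gb: "g (Suc 0) \<cdot>\<^bsub>C\<^esub> b' \<in> arr C B' (obj W (Suc 0))" "em (g (Suc 0) \<cdot>\<^bsub>C\<^esub> b') = em (g (Suc 0)) \<odot> em b'"
    using comp_arr[OF B' tD(2) Wo(2) b(2) ga(2)] em_comp[OF B' tD(2) Wo(2) b(2) ga(2)] by auto
  have idf: "I B \<odot> em (f (Suc 0)) = em (f (Suc 0))" "em (g (Suc 0)) \<odot> I B = em (g (Suc 0))"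
    using id_left[OF em_H[OF Wo(2) tD(2) fa(2)]] id_right[OF em_H[OF tD(2) Wo(2) ga(2)]] by auto
  have F: "chain_map C (Suc 0) W ?Y ?f" unfolding cmi[OF W1 Y1]
    using fa bf bx fe idf by (simp add: mul_simps mul_ext[OF bb(1)])
  have G: "chain_map C (Suc 0) ?Y W ?g" unfolding cmi[OF Y1 W1]
    using ga gb bx ge idf idx by (simp add: mul_simps mul_ext[OF bb(1)] mul_ext[OF ge(2)])
  have FE: "end_fixing_map C 1 W ?Y ?f" "end_fixing_map C 1 ?Y W ?g"
    unfolding end_fixing_map_def using F G f' g' by simp_all
  have gf: "g 0 \<cdot>\<^bsub>C\<^esub> f 0 \<in> arr C (obj W 0) (obj W 0)" "g (Suc 0) \<cdot>\<^bsub>C\<^esub> f (Suc 0) \<in> arr C (obj W (Suc 0)) (obj W (Suc 0))"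
    "g (Suc (Suc 0)) \<cdot>\<^bsub>C\<^esub> f (Suc (Suc 0)) \<in> arr C (obj W (Suc (Suc 0))) (obj W (Suc (Suc 0)))"
    using comp_arr Wo tD fa ga by blast+
  have fg: "f 0 \<cdot>\<^bsub>C\<^esub> g 0 \<in> arr C A A" "f (Suc 0) \<cdot>\<^bsub>C\<^esub> g (Suc 0) \<in> arr C B B" "f (Suc (Suc 0)) \<cdot>\<^bsub>C\<^esub> g (Suc (Suc 0)) \<in> arr C Z Z"
    using comp_arr Wo tD fa ga by blast+
  have gf': "(b \<cdot>\<^bsub>C\<^esub> f (Suc 0)) \<cdot>\<^bsub>C\<^esub> (g (Suc 0) \<cdot>\<^bsub>C\<^esub> b') \<in> arr C B' B'" "em ((b \<cdot>\<^bsub>C\<^esub> f (Suc 0)) \<cdot>\<^bsub>C\<^esub> (g (Suc 0) \<cdot>\<^bsub>C\<^esub> b')) = em b \<odot> (em (f (Suc 0)) \<odot> (em (g (Suc 0)) \<odot> em b'))"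
    using comp_arr[OF B' Wo(2) B' gb(1) bf(1)] em_comp[OF B' Wo(2) B' gb(1) bf(1)] gb bf by (auto simp: mul_assoc)
  have eqgf: "(g (Suc 0) \<cdot>\<^bsub>C\<^esub> b') \<cdot>\<^bsub>C\<^esub> (b \<cdot>\<^bsub>C\<^esub> f (Suc 0)) = g (Suc 0) \<cdot>\<^bsub>C\<^esub> f (Suc 0)"
    by (rule em_inj[OF Wo(2,2) comp_arr[OF Wo(2) B' Wo(2) bf(1) gb(1)] gf(2)])
      (simp add: em_comp[OF Wo(2) B' Wo(2) bf(1) gb(1)] gb bf em_comp[OF Wo(2) tD(2) Wo(2) fa(2) ga(2)] mul_simps mul_ext[OF bb(1)] idf)
  have H1: "homotopic C 1 W W (\<lambda>i. ?g i \<cdot>\<^bsub>C\<^esub> ?f i) (\<lambda>i. idn C (obj W i))"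
  proof -
    have "(\<lambda>i. ?g i \<cdot>\<^bsub>C\<^esub> ?f i) = (\<lambda>i. g i \<cdot>\<^bsub>C\<^esub> f i)" using eqgf by auto
    then show ?thesis using h1 by simp
  qed
  have arr3: "i \<le> Suc (Suc 0) \<Longrightarrow> P i" if "P 0" "P (Suc 0)" "P (Suc (Suc 0))" for P and i :: nat
    using that by (auto simp: le_Suc_eq)
  have h2': "homotopic C (Suc 0) ?X ?X (\<lambda>i. f i \<cdot>\<^bsub>C\<^esub> g i) (\<lambda>i. idn C (obj ?X i))"
    using h2 unfolding One_nat_def .
  have "\<exists>k. (k 0 \<in> H 0 (obj ?X (Suc 0)) (obj ?X 0) \<and> k (Suc 0) \<in> H 0 (obj ?X (Suc (Suc 0))) (obj ?X (Suc 0))) \<and>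
      em (f 0 \<cdot>\<^bsub>C\<^esub> g 0) - em (idn C (obj ?X 0)) = k 0 \<odot> em (diff ?X 0) \<and>
      em (f (Suc 0) \<cdot>\<^bsub>C\<^esub> g (Suc 0)) - em (idn C (obj ?X (Suc 0))) = k (Suc 0) \<odot> em (diff ?X (Suc 0)) + em (diff ?X 0) \<odot> k 0 \<and>
      em (f (Suc (Suc 0)) \<cdot>\<^bsub>C\<^esub> g (Suc (Suc 0))) - em (idn C (obj ?X (Suc (Suc 0)))) = em (diff ?X (Suc 0)) \<odot> k (Suc 0)"
    by (rule iffD1[OF hi[OF X1 X1] h2']) (erule arr3[rotated 3]; use fg idn_arr tD in simp)+
  then have "\<exists>k. (k 0 \<in> H 0 B A \<and> k (Suc 0) \<in> H 0 Z B) \<and> em (f 0 \<cdot>\<^bsub>C\<^esub> g 0) - em (idn C A) = k 0 \<odot> em x \<and>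
      em (f (Suc 0) \<cdot>\<^bsub>C\<^esub> g (Suc 0)) - em (idn C B) = k (Suc 0) \<odot> em y + em x \<odot> k 0 \<and>
      em (f (Suc (Suc 0)) \<cdot>\<^bsub>C\<^esub> g (Suc (Suc 0))) - em (idn C Z) = em y \<odot> k (Suc 0)" by simp
  then obtain k where k: "k 0 \<in> H 0 B A" "k (Suc 0) \<in> H 0 Z B" "em (f 0 \<cdot>\<^bsub>C\<^esub> g 0) - em (idn C A) = k 0 \<odot> em x"
      "em (f (Suc 0) \<cdot>\<^bsub>C\<^esub> g (Suc 0)) - em (idn C B) = k (Suc 0) \<odot> em y + em x \<odot> k 0"
      "em (f (Suc (Suc 0)) \<cdot>\<^bsub>C\<^esub> g (Suc (Suc 0))) - em (idn C Z) = em y \<odot> k (Suc 0)" by blast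
  have fgB: "em (f (Suc 0)) \<odot> em (g (Suc 0)) = I B + k (Suc 0) \<odot> em y + em x \<odot> k 0"
    using k(4) em_comp[OF tD(2) Wo(2) tD(2) ga(2) fa(2)] em_idn[OF tD(2)] by (simp add: algebra_simps)
  let ?k = "(\<lambda>i. if i = 0 then k 0 \<odot> em b' else em b \<odot> k (Suc 0))"
  have idk: "I B \<odot> k (Suc 0) = k (Suc 0)" "I B \<odot> em b' = em b'" "k 0 \<odot> I B = k 0"
    using id_left[OF k(2)] id_left[OF em_H[OF B' tD(2) b(2)]] id_right[OF k(1)] by auto
  have kH: "k 0 \<odot> em b' \<in> H 0 B' A" "em b \<odot> k (Suc 0) \<in> H 0 Z B'"
    using H_mul0[OF k(1) em_H[OF B' tD(2) b(2)]] H_mul0[OF em_H[OF tD(2) B' b(1)] k(2)] by auto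
  have eB: "em b \<odot> (em (f (Suc 0)) \<odot> (em (g (Suc 0)) \<odot> em b')) - I B' = em b \<odot> (k (Suc 0) \<odot> (em y \<odot> em b')) + em b \<odot> (em x \<odot> (k 0 \<odot> em b'))"
    using mul_ext[OF fgB, of "em b'"] bb(2) idk(2) by (simp add: mul_simps)
  have H2: "homotopic C (Suc 0) ?Y ?Y (\<lambda>i. ?f i \<cdot>\<^bsub>C\<^esub> ?g i) (\<lambda>i. idn C (obj ?Y i))"
  proof (subst hi[OF Y1 Y1])
    fix i :: nat assume i: "i \<le> Suc (Suc 0)"
    show "?f i \<cdot>\<^bsub>C\<^esub> ?g i \<in> arr C (obj ?Y i) (obj ?Y i)" by (rule arr3[OF _ _ _ i]) (use fg gf' in simp_all)
  next
    fix i :: nat assume i: "i \<le> Suc (Suc 0)"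
    show "idn C (obj ?Y i) \<in> arr C (obj ?Y i) (obj ?Y i)" by (rule arr3[OF _ _ _ i]) (use idn_arr tD B' in simp_all)
  next
    show "\<exists>h. (h 0 \<in> H 0 (obj ?Y (Suc 0)) (obj ?Y 0) \<and> h (Suc 0) \<in> H 0 (obj ?Y (Suc (Suc 0))) (obj ?Y (Suc 0))) \<and>
      em (?f 0 \<cdot>\<^bsub>C\<^esub> ?g 0) - em (idn C (obj ?Y 0)) = h 0 \<odot> em (diff ?Y 0) \<and>
      em (?f (Suc 0) \<cdot>\<^bsub>C\<^esub> ?g (Suc 0)) - em (idn C (obj ?Y (Suc 0))) = h (Suc 0) \<odot> em (diff ?Y (Suc 0)) + em (diff ?Y 0) \<odot> h 0 \<and>
      em (?f (Suc (Suc 0)) \<cdot>\<^bsub>C\<^esub> ?g (Suc (Suc 0))) - em (idn C (obj ?Y (Suc (Suc 0)))) = em (diff ?Y (Suc 0)) \<odot> h (Suc 0)"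
      by (rule exI[of _ ?k]) (use k kH gf' eB bx idk idx bb in \<open>simp add: em_idn B' tD mul_assoc mul_ext[OF bb(1)]\<close>)
  qed
  have "homotopic C 1 ?Y ?Y (\<lambda>i. ?f i \<cdot>\<^bsub>C\<^esub> ?g i) (\<lambda>i. idn C (obj ?Y i))" using H2 unfolding One_nat_def .
  then have "homotopy_equivalent C 1 W ?Y" unfolding homotopy_equivalent_def using FE H1 by blast
  moreover have "obj W 0 = A" "obj W (1 + 1) = Z" using W(3) unfolding homotopy_class_def complexes_between_def by simp_all
  ultimately have "?Y \<in> homotopy_class C 1 W" using Y unfolding homotopy_class_def complexes_between_def by simp
  then show ?thesis using W(2) tD unfolding s_triangle_def distinguished_def by simp
qed

lemma inflation_triangle:
  assumes i: "inflation C E s 1 f" and f: "f \<in> arr C A B" "A \<in> Ob C" "B \<in> Ob C"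
  obtains y Z \<delta> where "s_triangle C E s A f B y Z \<delta>"
proof -
  obtain X \<delta> where X: "distinguished C E s 1 X \<delta>" "f = diff X 0" using i unfolding inflation_def by blast
  note t = distinguished_triangle[OF X(1)] and tD = s_triangle_D[OF distinguished_triangle[OF X(1)]]
  have "obj X 0 = A" "obj X 1 = B" using src_trg[OF tD(1,2,4)] src_trg[OF f(2,3,1)] X(2) by auto
  then show ?thesis using that t X(2) by simp
qed

lemma deflation_triangle:
  assumes i: "deflation C E s 1 f" and f: "f \<in> arr C B Z" "B \<in> Ob C" "Z \<in> Ob C"
  obtains A x \<delta> where "s_triangle C E s A x B f Z \<delta>"
proof -
  obtain X \<delta> where X: "distinguished C E s 1 X \<delta>" "f = diff X 1" using i unfolding deflation_def by blast
  note t = distinguished_triangle[OF X(1)] and tD = s_triangle_D[OF distinguished_triangle[OF X(1)]]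
  have "obj X 1 = B" "obj X 2 = Z" using src_trg[OF tD(2,3,5)] src_trg[OF f(2,3,1)] X(2) by auto
  then show ?thesis using that t X(2) by simp
qed

lemma triangle_inflation: "s_triangle C E s A f B y Z \<delta> \<Longrightarrow> inflation C E s 1 f"
  unfolding s_triangle_def inflation_def by (intro exI conjI) auto

lemma triangle_deflation: "s_triangle C E s A x B f Z \<delta> \<Longrightarrow> deflation C E s 1 f"
  unfolding s_triangle_def deflation_def by (intro exI conjI) auto

lemma em_mul_eq_0:
  "\<lbrakk>A \<in> Ob C; B \<in> Ob C; D \<in> Ob C; f \<in> arr C A B; g \<in> arr C B D\<rbrakk> \<Longrightarrow> em g \<odot> em f = 0 \<longleftrightarrow> g \<cdot>\<^bsub>C\<^esub> f = zero_arr C A D"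
  using em_eq_0[of A D "g \<cdot>\<^bsub>C\<^esub> f"] em_comp comp_arr by metis

lemma triangle_lift:
  assumes t: "s_triangle C E s A x B y Z \<delta>" and t': "s_triangle C E s A' x' B' y' Z' \<delta>'"
    and a: "a \<in> arr C A A'" and c: "c \<in> arr C Z Z'" and e: "push C E Z a \<delta> = pull C E A' c \<delta>'"
  shows "\<exists>b\<in>arr C B B'. em b \<odot> em x = em x' \<odot> em a \<and> em y' \<odot> em b = em c \<odot> em y"
proof -
  note tD = s_triangle_D[OF t] and tD' = s_triangle_D[OF t']
  obtain f where f: "lift_of C 1 (cpx3 A x B y Z) (cpx3 A' x' B' y' Z') a c f"
    using R0[OF t[unfolded s_triangle_def] t'[unfolded s_triangle_def], of a c] a c e by auto
  then have m: "\<And>i. i \<le> 1 + 1 \<Longrightarrow> f i \<in> arr C (obj (cpx3 A x B y Z) i) (obj (cpx3 A' x' B' y' Z') i)"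
    and d: "\<And>i. i \<le> 1 \<Longrightarrow> f (i + 1) \<cdot>\<^bsub>C\<^esub> diff (cpx3 A x B y Z) i = diff (cpx3 A' x' B' y' Z') i \<cdot>\<^bsub>C\<^esub> f i"
    and ac: "f 0 = a" "f (1 + 1) = c" unfolding lift_of_def chain_map_def by blast+
  have b: "f 1 \<in> arr C B B'" using m[of 1] by simp
  have e1: "f 1 \<cdot>\<^bsub>C\<^esub> x = x' \<cdot>\<^bsub>C\<^esub> a" using d[of 0] ac(1) by simp
  have e2: "c \<cdot>\<^bsub>C\<^esub> y = y' \<cdot>\<^bsub>C\<^esub> f 1" using d[of 1] ac(2) by simp
  have "em (f 1) \<odot> em x = em x' \<odot> em a"
    using em_comp[OF tD(1,2) tD'(2) tD(4) b] em_comp[OF tD(1) tD'(1,2) a tD'(4)] e1 by simp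
  moreover have "em y' \<odot> em (f 1) = em c \<odot> em y"
    using em_comp[OF tD(2) tD'(2,3) b tD'(5)] em_comp[OF tD(2,3) tD'(3) tD(5) c] e2 by simp
  ultimately show ?thesis using b by blast
qed

lemma triangle_cone:
  assumes t: "s_triangle C E s A x B y Z (pull C E A c \<rho>)" and t': "s_triangle C E s A x' B' y' Z' \<rho>" and c: "c \<in> arr C Z Z'"
  shows "\<exists>f S i1 i2 p1 p2. f \<in> H 0 B B' \<and> f \<odot> em x = em x' \<and> em y' \<odot> f = em c \<odot> em y \<and> bip Z B' S i1 i2 p1 p2 \<and>
    Tri B (i2 \<odot> f - i1 \<odot> em y) S (em c \<odot> p1 + em y' \<odot> p2) Z' (em x \<odot> ex 0 Z' A \<rho>)"
proof -
  note tD = s_triangle_D[OF t] and tD' = s_triangle_D[OF t']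
  let ?X = "cpx3 A x B y Z" and ?Y = "cpx3 A x' B' y' Z'"
  have "\<exists>f M. lift_of C 1 ?X ?Y (idn C (obj ?X 0)) c f \<and> mapping_cone C 1 ?X ?Y f M \<and>
    distinguished C E s 1 M (push C E (obj ?Y (1 + 1)) (diff ?X 0) \<rho>)"
    by (rule EA2[OF t'[unfolded s_triangle_def]]) (use t c in \<open>simp_all add: s_triangle_def\<close>)
  then obtain f M where f: "lift_of C 1 ?X ?Y (idn C A) c f" and M: "mapping_cone C 1 ?X ?Y f M"
    and dM: "distinguished C E s 1 M (push C E Z' x \<rho>)" by auto
  have m: "\<And>i. i \<le> 1 + 1 \<Longrightarrow> f i \<in> arr C (obj ?X i) (obj ?Y i)"
    and d: "\<And>i. i \<le> 1 \<Longrightarrow> f (i + 1) \<cdot>\<^bsub>C\<^esub> diff ?X i = diff ?Y i \<cdot>\<^bsub>C\<^esub> f i"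
    and ac: "f 0 = idn C A" "f (1 + 1) = c" using f unfolding lift_of_def chain_map_def by blast+
  have b: "f 1 \<in> arr C B B'" using m[of 1] by simp
  have e1: "f 1 \<cdot>\<^bsub>C\<^esub> x = x'" using d[of 0] ac(1) comp_idn[OF tD'(1,2,4)] by simp
  have e2: "c \<cdot>\<^bsub>C\<^esub> y = y' \<cdot>\<^bsub>C\<^esub> f 1" using d[of 1] ac(2) by simp
  obtain j1 j2 q1 q2 where bM: "biproduct C Z B' (obj M 1) j1 j2 q1 q2"
    and d0: "diff M 0 = (j1 \<cdot>\<^bsub>C\<^esub> neg_arr C y) \<boxplus>\<^bsub>C\<^esub> (j2 \<cdot>\<^bsub>C\<^esub> f 1)"
    and d1: "diff M 1 = (c \<cdot>\<^bsub>C\<^esub> q1) \<boxplus>\<^bsub>C\<^esub> (y' \<cdot>\<^bsub>C\<^esub> q2)" and M0: "obj M 0 = B" "obj M 2 = Z'"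
    using M ac(2) unfolding mapping_cone_def by (auto simp: numeral_2_eq_2)
  then have bMD: "obj M 1 \<in> Ob C" "j1 \<in> arr C Z (obj M 1)" "j2 \<in> arr C B' (obj M 1)" "q1 \<in> arr C (obj M 1) Z" "q2 \<in> arr C (obj M 1) B'"
    unfolding biproduct_def by auto
  note ny = arr_closed(4)[OF tD(2,3,5)]
  have E0: "em (diff M 0) = em j2 \<odot> em (f 1) - em j1 \<odot> em y"
    unfolding d0 using em_add[OF tD(2) bMD(1) comp_arr[OF tD(2,3) bMD(1) ny bMD(2)] comp_arr[OF tD(2) tD'(2) bMD(1) b bMD(3)]]
      em_comp[OF tD(2,3) bMD(1) ny bMD(2)] em_comp[OF tD(2) tD'(2) bMD(1) b bMD(3)] em_neg[OF tD(2,3,5)] by (simp add: mul_simps)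
  have E1: "em (diff M 1) = em c \<odot> em q1 + em y' \<odot> em q2"
    unfolding d1 using em_add[OF bMD(1) tD'(3) comp_arr[OF bMD(1) tD(3) tD'(3) bMD(4) c] comp_arr[OF bMD(1) tD'(2,3) bMD(5) tD'(5)]]
      em_comp[OF bMD(1) tD(3) tD'(3) bMD(4) c] em_comp[OF bMD(1) tD'(2,3) bMD(5) tD'(5)] by simp
  have "em x \<odot> ex 0 Z' A \<rho> = ex 0 Z' B (push C E Z' x \<rho>)" by (rule ex_push0[OF tD'(3,1) tD(2,4) tD'(6)])
  then have "Tri B (em j2 \<odot> em (f 1) - em j1 \<odot> em y) (obj M 1) (em c \<odot> em q1 + em y' \<odot> em q2) Z' (em x \<odot> ex 0 Z' A \<rho>)"
    using TriI[OF distinguished_triangle[OF dM, unfolded M0]] unfolding E0 E1 by simp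
  moreover have "em (f 1) \<odot> em x = em x'" using em_comp[OF tD(1,2) tD'(2) tD(4) b] e1 by simp
  moreover have "em y' \<odot> em (f 1) = em c \<odot> em y"
    using em_comp[OF tD(2) tD'(2,3) b tD'(5)] em_comp[OF tD(2,3) tD'(3) tD(5) c] e2 by simp
  ultimately show ?thesis using bip_em[OF bM] em_H[OF tD(2) tD'(2) b] by blast
qed

lemma triangle_cocone:
  assumes t: "s_triangle C E s A x B y Z \<delta>" and t': "s_triangle C E s A' x' B' y' Z (push C E Z a \<delta>)" and a: "a \<in> arr C A A'"
  shows "\<exists>h S i1 i2 p1 p2. h \<in> H 0 B B' \<and> h \<odot> em x = em x' \<odot> em a \<and> em y' \<odot> h = em y \<and> bip A' B S i1 i2 p1 p2 \<and>
    Tri A (i1 \<odot> em a + i2 \<odot> em x) S (h \<odot> p2 - em x' \<odot> p1) B' (ex 0 Z A \<delta> \<odot> em y')"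
proof -
  note tD = s_triangle_D[OF t] and tD' = s_triangle_D[OF t']
  let ?X = "cpx3 A x B y Z" and ?Y = "cpx3 A' x' B' y' Z"
  have "\<exists>h M. lift_of C 1 ?X ?Y a (idn C (obj ?X (1 + 1))) h \<and> mapping_cocone C 1 ?X ?Y h M \<and>
    distinguished C E s 1 M (pull C E (obj ?X 0) (diff ?Y 1) \<delta>)"
    by (rule EA2_op[OF t[unfolded s_triangle_def]]) (use t' a in \<open>simp_all add: s_triangle_def\<close>)
  then obtain f M where f: "lift_of C 1 ?X ?Y a (idn C Z) f" and M: "mapping_cocone C 1 ?X ?Y f M"
    and dM: "distinguished C E s 1 M (pull C E A y' \<delta>)" by auto
  have m: "\<And>i. i \<le> 1 + 1 \<Longrightarrow> f i \<in> arr C (obj ?X i) (obj ?Y i)"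
    and d: "\<And>i. i \<le> 1 \<Longrightarrow> f (i + 1) \<cdot>\<^bsub>C\<^esub> diff ?X i = diff ?Y i \<cdot>\<^bsub>C\<^esub> f i"
    and ac: "f 0 = a" "f (1 + 1) = idn C Z" using f unfolding lift_of_def chain_map_def by blast+
  have b: "f 1 \<in> arr C B B'" using m[of 1] by simp
  have e1: "f 1 \<cdot>\<^bsub>C\<^esub> x = x' \<cdot>\<^bsub>C\<^esub> a" using d[of 0] ac(1) by simp
  have e2: "y = y' \<cdot>\<^bsub>C\<^esub> f 1" using d[of 1] ac(2) comp_idn[OF tD(2,3,5)] by simp
  obtain j1 j2 q1 q2 where bM: "biproduct C B A' (obj M 1) j1 j2 q1 q2"
    and d0: "diff M 0 = (j1 \<cdot>\<^bsub>C\<^esub> x) \<boxplus>\<^bsub>C\<^esub> (j2 \<cdot>\<^bsub>C\<^esub> a)"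
    and d1: "diff M 1 = (f 1 \<cdot>\<^bsub>C\<^esub> q1) \<boxminus>\<^bsub>C\<^esub> (x' \<cdot>\<^bsub>C\<^esub> q2)" and M0: "obj M 0 = A" "obj M 2 = B'"
    using M ac(1) unfolding mapping_cocone_def by (auto simp: numeral_2_eq_2)
  then have bMD: "obj M 1 \<in> Ob C" "j1 \<in> arr C B (obj M 1)" "j2 \<in> arr C A' (obj M 1)" "q1 \<in> arr C (obj M 1) B" "q2 \<in> arr C (obj M 1) A'"
    unfolding biproduct_def by auto
  have E0: "em (diff M 0) = em j2 \<odot> em a + em j1 \<odot> em x"
    unfolding d0 using em_add[OF tD(1) bMD(1) comp_arr[OF tD(1,2) bMD(1) tD(4) bMD(2)] comp_arr[OF tD(1) tD'(1) bMD(1) a bMD(3)]]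
      em_comp[OF tD(1,2) bMD(1) tD(4) bMD(2)] em_comp[OF tD(1) tD'(1) bMD(1) a bMD(3)] by (simp add: add.commute)
  have E1: "em (diff M 1) = em (f 1) \<odot> em q1 - em x' \<odot> em q2"
    unfolding d1 using em_minus[OF bMD(1) tD'(2) comp_arr[OF bMD(1) tD(2) tD'(2) bMD(4) b] comp_arr[OF bMD(1) tD'(1,2) bMD(5) tD'(4)]]
      em_comp[OF bMD(1) tD(2) tD'(2) bMD(4) b] em_comp[OF bMD(1) tD'(1,2) bMD(5) tD'(4)] by simp
  have "ex 0 Z A \<delta> \<odot> em y' = ex 0 B' A (pull C E A y' \<delta>)" by (rule ex_pull0[OF tD(3) tD'(2) tD(1) tD'(5) tD(6)])
  then have "Tri A (em j2 \<odot> em a + em j1 \<odot> em x) (obj M 1) (em (f 1) \<odot> em q1 - em x' \<odot> em q2) B' (ex 0 Z A \<delta> \<odot> em y')"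
    using TriI[OF distinguished_triangle[OF dM, unfolded M0]] unfolding E0 E1 by simp
  moreover have "em (f 1) \<odot> em x = em x' \<odot> em a"
    using em_comp[OF tD(1,2) tD'(2) tD(4) b] em_comp[OF tD(1) tD'(1,2) a tD'(4)] e1 by simp
  moreover have "em y' \<odot> em (f 1) = em y" using em_comp[OF tD(2) tD'(2,3) b tD'(5)] e2 by simp
  \<comment> \<open>In \<open>mapping_cocone\<close> the summand B comes first, in the axiom
    \<open>cocone\<close> the summand \<open>A'\<close>.\<close>
  ultimately show ?thesis using bip_swap[OF bip_em[OF bM]] em_H[OF tD(2) tD'(2) b] by blast
qed

sublocale triangle_category endo_mul endo_one "Ob C" H I Tri
proof (unfold_locales, goal_cases)
  case 1
  obtain Z where Z: "zero_object C Z" using zero_object_exists by blast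
  then have ZO: "Z \<in> Ob C" and "idn C Z = zero_arr C Z Z" using idn_arr arr_closed(1) unfolding zero_object_def by blast+
  then have "I Z = 0" using em_idn[OF ZO] em_zero[OF ZO ZO] by simp
  then show ?case using ZO by blast
next
  case (2 A B) then show ?case using biproduct_exists[OF 2] bip_em by blast
next
  case (3 A x B y Z \<delta>)
  then obtain x' y' \<delta>' where t: "s_triangle C E s A x' B y' Z \<delta>'" "x = em x'" "y = em y'" "\<delta> = ex 0 Z A \<delta>'" by (rule Tri_E)
  note tD = s_triangle_D[OF t(1)]
  show ?case using em_H[OF tD(1,2,4)] em_H[OF tD(2,3,5)] ex_H[OF tD(3,1), of \<delta>' 0] tD(6) t by simp
next
  case (4 A x B y Z \<delta>)
  then obtain x' y' \<delta>' where t: "s_triangle C E s A x' B y' Z \<delta>'" "x = em x'" "y = em y'" "\<delta> = ex 0 Z A \<delta>'" by (rule Tri_E)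
  note tD = s_triangle_D[OF t(1)]
  show ?case using em_mul_eq_0[OF tD(1-5)] tD(7,8,9) ex_push0[OF tD(3,1,2,4,6)] ex_pull0[OF tD(3,2,1,5,6)]
      ex_zero[OF tD(3,2), of 0] ex_zero[OF tD(2,1), of 0] t by simp
next
  case (5 A x B y Z \<delta> f T)
  obtain x' y' \<delta>' where t: "s_triangle C E s A x' B y' Z \<delta>'" "x = em x'" "y = em y'" using 5(1) by (rule Tri_E)
  obtain f' where f: "T \<in> Ob C" "f' \<in> arr C T B" "f = em f'" using 5(2) by (rule H0_E)
  note tD = s_triangle_D[OF t(1)]
  obtain g where g: "g \<in> arr C T A" "f' = x' \<cdot>\<^bsub>C\<^esub> g"
    using tD(10)[OF f(1,2)] em_mul_eq_0[OF f(1) tD(2,3) f(2) tD(5)] 5(3) t f by auto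
  then show ?case using em_H[OF f(1) tD(1) g(1)] em_comp[OF f(1) tD(1,2) g(1) tD(4)] t f by auto
next
  case (6 A x B y Z \<delta> f T)
  obtain x' y' \<delta>' where t: "s_triangle C E s A x' B y' Z \<delta>'" "x = em x'" "y = em y'" "\<delta> = ex 0 Z A \<delta>'" using 6(1) by (rule Tri_E)
  obtain f' where f: "T \<in> Ob C" "f' \<in> arr C T Z" "f = em f'" using 6(2) by (rule H0_E)
  note tD = s_triangle_D[OF t(1)]
  have "pull C E A f' \<delta>' = zero_ext E T A"
    using ex_pull0[OF tD(3) f(1) tD(1) f(2) tD(6)] ex_eq_0[OF f(1) tD(1), of _ 0] pull_closed[OF tD(3) f(1) tD(1) f(2) tD(6)] 6(3) t f by simp
  then obtain g where g: "g \<in> arr C T B" "f' = y' \<cdot>\<^bsub>C\<^esub> g" using tD(11)[OF f(1,2)] by blast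
  then show ?case using em_H[OF f(1) tD(2) g(1)] em_comp[OF f(1) tD(2,3) g(1) tD(5)] t f by auto
next
  case (7 A x B y Z \<delta> f T)
  obtain x' y' \<delta>' where t: "s_triangle C E s A x' B y' Z \<delta>'" "x = em x'" "y = em y'" using 7(1) by (rule Tri_E)
  obtain f' where f: "T \<in> Ob C" "f' \<in> arr C B T" "f = em f'" using 7(2) by (rule H0_E)
  note tD = s_triangle_D[OF t(1)]
  obtain g where g: "g \<in> arr C Z T" "f' = g \<cdot>\<^bsub>C\<^esub> y'"
    using tD(12)[OF f(1,2)] em_mul_eq_0[OF tD(1,2) f(1) tD(4) f(2)] 7(3) t f by auto
  then show ?case using em_H[OF tD(3) f(1) g(1)] em_comp[OF tD(2,3) f(1) tD(5) g(1)] t f by auto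
next
  case (8 A x B y Z \<delta> f T)
  obtain x' y' \<delta>' where t: "s_triangle C E s A x' B y' Z \<delta>'" "x = em x'" "y = em y'" "\<delta> = ex 0 Z A \<delta>'" using 8(1) by (rule Tri_E)
  obtain f' where f: "T \<in> Ob C" "f' \<in> arr C A T" "f = em f'" using 8(2) by (rule H0_E)
  note tD = s_triangle_D[OF t(1)]
  have "push C E Z f' \<delta>' = zero_ext E Z T"
    using ex_push0[OF tD(3,1) f(1,2) tD(6)] ex_eq_0[OF tD(3) f(1), of _ 0] push_closed[OF tD(3,1) f(1,2) tD(6)] 8(3) t f by simp
  then obtain g where g: "g \<in> arr C B T" "f' = g \<cdot>\<^bsub>C\<^esub> x'" using tD(13)[OF f(1,2)] by blast
  then show ?case using em_H[OF tD(2) f(1) g(1)] em_comp[OF tD(1,2) f(1) tD(4) g(1)] t f by auto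
next
  case (9 \<delta> Z A)
  obtain \<delta>' where d: "Z \<in> Ob C" "A \<in> Ob C" "\<delta>' \<in> exts E Z ((\<Sigma> ^^ 0) A)" "\<delta> = ex 0 Z A \<delta>'" using 9 by (rule HSuc_E)
  then obtain X where X: "distinguished C E s 1 X \<delta>'" "obj X 0 = A" "obj X 2 = Z" using realization_exists[of A Z \<delta>'] by auto
  show ?case using TriI[OF distinguished_triangle[OF X(1), unfolded X(2,3)]] d(4) by blast
next
  case (10 A x B y Z \<delta> A' x' B' y' Z' \<delta>' a c)
  obtain x1 y1 \<delta>1 where t: "s_triangle C E s A x1 B y1 Z \<delta>1" "x = em x1" "y = em y1" "\<delta> = ex 0 Z A \<delta>1" using 10(1) by (rule Tri_E)
  obtain x2 y2 \<delta>2 where t': "s_triangle C E s A' x2 B' y2 Z' \<delta>2" "x' = em x2" "y' = em y2" "\<delta>' = ex 0 Z' A' \<delta>2" using 10(2) by (rule Tri_E)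
  obtain a' where a: "a' \<in> arr C A A'" "a = em a'" using 10(3) by (rule H0_E)
  obtain c' where c: "c' \<in> arr C Z Z'" "c = em c'" using 10(4) by (rule H0_E)
  note tD = s_triangle_D[OF t(1)] and tD' = s_triangle_D[OF t'(1)]
  have "push C E Z a' \<delta>1 = pull C E A' c' \<delta>2"
    using ex_inj[OF tD(3) tD'(1), of "push C E Z a' \<delta>1" 0 "pull C E A' c' \<delta>2"] push_closed[OF tD(3,1) tD'(1) a(1) tD(6)]
      pull_closed[OF tD'(3) tD(3) tD'(1) c(1) tD'(6)] ex_push0[OF tD(3,1) tD'(1) a(1) tD(6)] ex_pull0[OF tD'(3) tD(3) tD'(1) c(1) tD'(6)]
      10(5) t(4) t'(4) a c by simp
  from triangle_lift[OF t(1) t'(1) a(1) c(1) this] obtain b where "b \<in> arr C B B'" "em b \<odot> em x1 = em x2 \<odot> em a'" "em y2 \<odot> em b = em c' \<odot> em y1" by blast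
  then show ?case using em_H[OF tD(2) tD'(2)] t t' a c by auto
next
  case (11 A x B y Z \<delta> b B' b')
  obtain x1 y1 \<delta>1 where t: "s_triangle C E s A x1 B y1 Z \<delta>1" "x = em x1" "y = em y1" "\<delta> = ex 0 Z A \<delta>1" using 11(1) by (rule Tri_E)
  obtain c where c: "B' \<in> Ob C" "c \<in> arr C B B'" "b = em c" using 11(2) by (rule H0_E)
  obtain c' where c': "c' \<in> arr C B' B" "b' = em c'" using 11(3) by (rule H0_E)
  note tD = s_triangle_D[OF t(1)]
  have "s_triangle C E s A (c \<cdot>\<^bsub>C\<^esub> x1) B' (y1 \<cdot>\<^bsub>C\<^esub> c') Z \<delta>1"
    by (rule s_triangle_mid_iso[OF t(1) c(2) c'(1) c(1)]) (use 11(4,5) c c' in simp_all)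
  then show ?case using TriI em_comp[OF tD(1,2) c(1) tD(4) c(2)] em_comp[OF c(1) tD(2,3) c'(1) tD(5)] t c c' by metis
next
  case (12 A f B y Z \<delta> g D y' Z' \<delta>')
  obtain x1 y1 \<delta>1 where t: "s_triangle C E s A x1 B y1 Z \<delta>1" "f = em x1" using 12(1) by (rule Tri_E)
  obtain x2 y2 \<delta>2 where t': "s_triangle C E s B x2 D y2 Z' \<delta>2" "g = em x2" using 12(2) by (rule Tri_E)
  note tD = s_triangle_D[OF t(1)] and tD' = s_triangle_D[OF t'(1)]
  have "inflation C E s 1 (x2 \<cdot>\<^bsub>C\<^esub> x1)"
    by (rule EA1_inflation[OF tD(1,2) tD'(2) tD(4) tD'(4) triangle_inflation[OF t(1)] triangle_inflation[OF t'(1)]])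
  then obtain h F \<phi> where "s_triangle C E s A (x2 \<cdot>\<^bsub>C\<^esub> x1) D h F \<phi>"
    by (rule inflation_triangle[OF _ comp_arr[OF tD(1,2) tD'(2) tD(4) tD'(4)] tD(1) tD'(2)])
  then show ?case using TriI em_comp[OF tD(1,2) tD'(2) tD(4) tD'(4)] t t' by metis
next
  case (13 A x B f Z \<delta> A' x' g D \<delta>')
  obtain x1 y1 \<delta>1 where t: "s_triangle C E s A x1 B y1 Z \<delta>1" "f = em y1" using 13(1) by (rule Tri_E)
  obtain x2 y2 \<delta>2 where t': "s_triangle C E s A' x2 Z y2 D \<delta>2" "g = em y2" using 13(2) by (rule Tri_E)
  note tD = s_triangle_D[OF t(1)] and tD' = s_triangle_D[OF t'(1)]
  have "deflation C E s 1 (y2 \<cdot>\<^bsub>C\<^esub> y1)"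
    by (rule EA1_deflation[OF tD(2,3) tD'(3) tD(5) tD'(5) triangle_deflation[OF t(1)] triangle_deflation[OF t'(1)]])
  then obtain F h \<phi> where "s_triangle C E s F h B (y2 \<cdot>\<^bsub>C\<^esub> y1) D \<phi>"
    by (rule deflation_triangle[OF _ comp_arr[OF tD(2,3) tD'(3) tD(5) tD'(5)] tD(2) tD'(3)])
  then show ?case using TriI em_comp[OF tD(2,3) tD'(3) tD(5) tD'(5)] t t' by metis
next
  case (14 A x B y Z \<rho> c x' B' y' Z')
  obtain x1 y1 \<delta>1 where t: "s_triangle C E s A x1 B y1 Z \<delta>1" "x = em x1" "y = em y1" "\<rho> \<odot> c = ex 0 Z A \<delta>1" using 14(1) by (rule Tri_E)
  obtain x2 y2 \<delta>2 where t': "s_triangle C E s A x2 B' y2 Z' \<delta>2" "x' = em x2" "y' = em y2" "\<rho> = ex 0 Z' A \<delta>2" using 14(2) by (rule Tri_E)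
  obtain c' where c: "c' \<in> arr C Z Z'" "c = em c'" using 14(3) by (rule H0_E)
  note tD = s_triangle_D[OF t(1)] and tD' = s_triangle_D[OF t'(1)]
  have e: "ex 0 Z A \<delta>1 = ex 0 Z A (pull C E A c' \<delta>2)"
    unfolding t(4)[symmetric] t'(4) c(2) by (rule ex_pull0[OF tD'(3) tD(3,1) c(1) tD'(6)])
  have "\<delta>1 = pull C E A c' \<delta>2"
    by (rule ex_inj[OF tD(3,1) _ _ e]) (simp_all add: tD(6) pull_closed[OF tD'(3) tD(3,1) c(1) tD'(6)])
  from triangle_cone[OF t(1)[unfolded this] t'(1) c(1)] show ?case using t t' c by simp
next
  case (15 A x B y Z \<delta> A' x' B' y' a)
  obtain x1 y1 \<delta>1 where t: "s_triangle C E s A x1 B y1 Z \<delta>1" "x = em x1" "y = em y1" "\<delta> = ex 0 Z A \<delta>1" using 15(1) by (rule Tri_E)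
  obtain x2 y2 \<delta>2 where t': "s_triangle C E s A' x2 B' y2 Z \<delta>2" "x' = em x2" "y' = em y2" "a \<odot> \<delta> = ex 0 Z A' \<delta>2" using 15(2) by (rule Tri_E)
  obtain a' where a: "a' \<in> arr C A A'" "a = em a'" using 15(3) by (rule H0_E)
  note tD = s_triangle_D[OF t(1)] and tD' = s_triangle_D[OF t'(1)]
  have e: "ex 0 Z A' \<delta>2 = ex 0 Z A' (push C E Z a' \<delta>1)"
    unfolding t'(4)[symmetric] t(4) a(2) by (rule ex_push0[OF tD(3,1) tD'(1) a(1) tD(6)])
  have "\<delta>2 = push C E Z a' \<delta>1"
    by (rule ex_inj[OF tD(3) tD'(1) _ _ e]) (simp_all add: tD'(6) push_closed[OF tD(3,1) tD'(1) a(1) tD(6)])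
  from triangle_cocone[OF t(1) t'(1)[unfolded this] a(1)] show ?case using t t' a by simp
qed

lemma projective_ext_zero:
  assumes P: "P \<in> projectives C E s" and X: "X \<in> Ob C" and \<delta>: "\<delta> \<in> exts E P X"
  shows "\<delta> = zero_ext E P X"
proof -
  have PO: "P \<in> Ob C" using P unfolding projectives_def by blast
  obtain Y where Y: "distinguished C E s 1 Y \<delta>" "obj Y 0 = X" "obj Y 2 = P" using realization_exists[OF X PO \<delta>] by blast
  note t = distinguished_triangle[OF Y(1), unfolded Y(2,3)]
  note tD = s_triangle_D[OF t]
  obtain g where g: "g \<in> arr C P (obj Y 1)" "idn C P = diff Y 1 \<cdot>\<^bsub>C\<^esub> g"
    using P t idn_arr[OF PO] unfolding projectives_def by blast
  have "\<delta> = pull C E X (diff Y 1 \<cdot>\<^bsub>C\<^esub> g) \<delta>" using pull_idn[OF PO X \<delta>] g by simp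
  also have "\<dots> = pull C E X g (pull C E X (diff Y 1) \<delta>)" by (rule pull_comp[OF PO tD(2) PO X tD(5) g(1) \<delta>])
  also have "\<dots> = zero_ext E P X" using tD(9) pull_one[OF tD(2) PO X g(1)] by simp
  finally show ?thesis .
qed

lemma projective_H: assumes "P \<in> projectives C E s" shows "H (Suc i) P X \<subseteq> {0}"
proof
  fix f assume "f \<in> H (Suc i) P X"
  then obtain \<delta> where d: "P \<in> Ob C" "X \<in> Ob C" "\<delta> \<in> exts E P ((\<Sigma> ^^ i) X)" "f = ex i P X \<delta>" by (rule HSuc_E)
  show "f \<in> {0}" using projective_ext_zero[OF assms \<Sigma>k_Ob[OF d(2)] d(3)] ex_zero[OF d(1,2), of i] d(4) by simp
qed

lemma injective_H: assumes "J \<in> injectives C E s" shows "H (Suc 0) X J \<subseteq> {0}"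
proof
  fix f assume "f \<in> H (Suc 0) X J"
  then obtain \<delta> where "X \<in> Ob C" "J \<in> Ob C" "\<delta> \<in> exts E X ((\<Sigma> ^^ 0) J)" "f = ex 0 X J \<delta>" by (rule HSuc_E)
  then show "f \<in> {0}" using injective_ext_zero[OF assms, of X \<delta>] ex_zero[of X J 0] by simp
qed

end

locale enough_exangulated = suspended_exangulated +
  assumes enough_proj: "enough_projectives C E s"

text \<open>The representing object is the (i+1)-fold suspension, with \<open>\<iota>\<close> of the
  i-fold suspension read as an element of degree i + 1. Its classifying map is the identity up to
  \<open>eqp\<close>, so multiplying a plain extension by it leaves the underlying extension
  unchanged and merely raises its degree.\<close>

sublocale enough_exangulated \<subseteq> suspended_category endo_mul endo_one "Ob C" H I Tri
proof (unfold_locales, goal_cases)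
  case (1 A i)
  note S = \<Sigma>k_Ob[OF 1, of i] \<Sigma>k_Ob[OF 1, of "Suc i"]
  have i: "\<iota> ((\<Sigma> ^^ i) A) \<in> exts E ((\<Sigma> ^^ Suc i) A) ((\<Sigma> ^^ i) A)" using \<iota>_ext[OF S(1)] by simp
  let ?S = "(\<Sigma> ^^ Suc i) A" and ?j = "ex i ((\<Sigma> ^^ Suc i) A) A (\<iota> ((\<Sigma> ^^ i) A))"
  have a: "\<exists>g\<in>H 0 X ?S. f = ?j \<odot> g" if f: "f \<in> H (Suc i) X A" for X f
  proof -
    obtain \<delta> where d: "X \<in> Ob C" "\<delta> \<in> exts E X ((\<Sigma> ^^ i) A)" "f = ex i X A \<delta>" using f by (rule HSuc_E)
    obtain c where c: "c \<in> arr C X ?S" "pull C E ((\<Sigma> ^^ i) A) c (\<iota> ((\<Sigma> ^^ i) A)) = \<delta>" using classify[OF d(1) S(1) d(2)] by auto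
    then show ?thesis using em_H[OF d(1) S(2) c(1)] ex_pull[OF S(2) d(1) 1 c(1) i] d(3) by (intro bexI[of _ "em c"]) auto
  qed
  have j: "?j \<odot> ex 0 X ?S \<delta> = ex (Suc i) X A \<delta>" if X: "X \<in> Ob C" and d: "\<delta> \<in> exts E X ?S" for X \<delta>
  proof -
    have "eqp ?S ?S (cm (Suc i) ?S A (Inr (\<iota> ((\<Sigma> ^^ i) A)))) (idn C ?S)"
      by (rule cm_unique[OF S(2) 1 i idn_arr[OF S(2)] pull_idn[OF S(2,1) i]])
    then have "push C E X (cm (Suc i) ?S A (Inr (\<iota> ((\<Sigma> ^^ i) A)))) \<delta> = \<delta>" using push_eqp[OF _ X d] push_idn[OF X S(2) d] by simp
    then show ?thesis using ex_mul[OF X S(2) 1, of \<delta> 0 "\<iota> ((\<Sigma> ^^ i) A)" i] i d by simp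
  qed
  have b: "\<exists>g\<in>H (Suc 0) X ?S. f = ?j \<odot> g" if f: "f \<in> H (Suc (Suc i)) X A" for X f
  proof -
    obtain \<delta> where d: "X \<in> Ob C" "\<delta> \<in> exts E X ?S" "f = ex (Suc i) X A \<delta>" using f by (rule HSuc_E)
    show ?thesis using ex_H[OF d(1) S(2), of \<delta> 0] d j[OF d(1,2)] by (intro bexI[of _ "ex 0 X ?S \<delta>"]) auto
  qed
  have c: "g = 0" if g: "g \<in> H (Suc 0) X ?S" "?j \<odot> g = 0" for X g
  proof -
    obtain \<delta> where d: "X \<in> Ob C" "\<delta> \<in> exts E X ((\<Sigma> ^^ 0) ?S)" "g = ex 0 X ?S \<delta>" using g(1) by (rule HSuc_E)
    have d2: "\<delta> \<in> exts E X ?S" using d(2) by simp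
    have "ex (Suc i) X A \<delta> = 0" using j[OF d(1) d2] g(2) d(3) by simp
    then have "\<delta> = zero_ext E X ?S" using ex_eq_0[OF d(1) 1 d2] by simp
    then show ?thesis using d(3) ex_zero[OF d(1) S(2), of 0] by simp
  qed
  have "?j \<in> H (Suc i) ?S A" by (rule ex_H[OF S(2) 1 i])
  then show ?case using S(2) a b c by blast
next
  case (2 Z)
  then obtain A x P y \<delta> where "P \<in> projectives C E s" "s_triangle C E s A x P y Z \<delta>"
    using enough_proj unfolding enough_projectives_def by blast
  then show ?case using TriI projective_H by blast
next
  case (3 A)
  then obtain x J y where "J \<in> injectives C E s" "s_triangle C E s A x J y (\<Sigma> A) (\<iota> A)" by (rule suspension_triangle)
  then show ?case using TriI injective_H by blast
qed

section \<open>Independence of chosen representatives; higher extensions in the ring\<close>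

context suspended_exangulated begin

text \<open>This links the ideal quotient of the definitions to \<open>eqp\<close>. That the class
  contains \<open>t\<close> uses an injective through which the zero map factors, taken from the
  suspension triangle of A.\<close>

lemma ideal_class_eqp:
  assumes A: "A \<in> Ob C" and B: "B \<in> Ob C" and t: "t \<in> arr C A B"
  shows "t \<in> ideal_class C (injectives C E s) t" "a \<in> ideal_class C (injectives C E s) t \<Longrightarrow> eqp A B a t"
proof -
  obtain x J y where J: "J \<in> injectives C E s" "s_triangle C E s A x J y (\<Sigma> A) (\<iota> A)" by (rule suspension_triangle[OF A])
  note JO = s_triangle_D(2)[OF J(2)]
  have st: "src C t = A" "trg C t = B" using src_trg[OF A B t] by auto
  have sz: "src C (zero_arr C A B) = A" "trg C (zero_arr C A B) = B" using src_trg[OF A B arr_closed(1)[OF A B]] by auto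
  have "zero_arr C A B = zero_arr C J B \<cdot>\<^bsub>C\<^esub> zero_arr C A J" using comp_zero_left[OF A JO B arr_closed(1)[OF A JO]] by simp
  then have "factors_through C (injectives C E s) (t \<boxminus>\<^bsub>C\<^esub> t)"
    using J(1) arr_closed(1)[OF A JO] arr_closed(1)[OF JO B] minus_add(2)[OF A B t t] sz unfolding factors_through_def by auto
  then show "t \<in> ideal_class C (injectives C E s) t" using t st unfolding ideal_class_def by simp
  assume "a \<in> ideal_class C (injectives C E s) t"
  then have a: "a \<in> arr C A B" and "factors_through C (injectives C E s) (a \<boxminus>\<^bsub>C\<^esub> t)" using st unfolding ideal_class_def by auto
  then obtain D g h where "D \<in> injectives C E s" "g \<in> arr C A D" "h \<in> arr C D B" "a \<boxminus>\<^bsub>C\<^esub> t = h \<cdot>\<^bsub>C\<^esub> g"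
    using src_trg[OF A B arr_closed(3)[OF A B a t]] unfolding factors_through_def by auto
  then show "eqp A B a t" using eqp_of_diff_injective[OF A B a t] by blast
qed

text \<open>Whatever representative \<open>SOME\<close> picks satisfies the equation defining
  \<open>sg\<close>, so by uniqueness it is \<open>eqp\<close> to \<open>sg A B t\<close>.\<close>

lemma susp_class_eqp:
  assumes A: "A \<in> Ob C" and B: "B \<in> Ob C" and t: "t \<in> arr C A B" and F: "F \<noteq> {}" "\<And>a. a \<in> F \<Longrightarrow> eqp A B a t"
  shows "susp_class C E s \<Sigma> \<iota> F \<noteq> {}" "a \<in> susp_class C E s \<Sigma> \<iota> F \<Longrightarrow> eqp (\<Sigma> A) (\<Sigma> B) a (sg A B t)"
proof -
  let ?P = "\<lambda>w. \<exists>a\<in>F. w \<in> arr C (\<Sigma> (src C a)) (\<Sigma> (trg C a)) \<and> push C E (\<Sigma> (src C a)) a (\<iota> (src C a)) = pull C E (trg C a) w (\<iota> (trg C a))"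
  define w where "w = (SOME w. ?P w)"
  obtain b where b: "b \<in> F" using F(1) by blast
  note bD = eqp_D[OF F(2)[OF b]]
  have "?P (sg A B b)" using b sg[OF A B bD(3)] src_trg[OF A B bD(3)] by (intro bexI[of _ b]) auto
  then have "?P w" unfolding w_def by (rule someI)
  then obtain a where a: "a \<in> F" "w \<in> arr C (\<Sigma> (src C a)) (\<Sigma> (trg C a))"
    "push C E (\<Sigma> (src C a)) a (\<iota> (src C a)) = pull C E (trg C a) w (\<iota> (trg C a))" by blast
  note aD = eqp_D[OF F(2)[OF a(1)]]
  have w: "w \<in> arr C (\<Sigma> A) (\<Sigma> B)" "pull C E B w (\<iota> B) = push C E (\<Sigma> A) t (\<iota> A)"
    using a src_trg[OF A B aD(3)] aD(5)[OF \<Sigma>_Ob[OF A] \<iota>_ext[OF A]] by auto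
  have e: "eqp (\<Sigma> A) (\<Sigma> B) w (sg A B t)" by (rule eqp_sym[OF sg_unique[OF A B t w]])
  have S: "susp_class C E s \<Sigma> \<iota> F = ideal_class C (injectives C E s) w" unfolding susp_class_def w_def ..
  show "susp_class C E s \<Sigma> \<iota> F \<noteq> {}" unfolding S using ideal_class_eqp(1)[OF \<Sigma>_Ob[OF A] \<Sigma>_Ob[OF B] w(1)] by blast
  show "eqp (\<Sigma> A) (\<Sigma> B) a (sg A B t)" if "a \<in> susp_class C E s \<Sigma> \<iota> F" for a
    using eqp_trans[OF ideal_class_eqp(2)[OF \<Sigma>_Ob[OF A] \<Sigma>_Ob[OF B] w(1)] e] that unfolding S by blast
qed

lemma susp_power_eqp:
  assumes A: "A \<in> Ob C" and B: "B \<in> Ob C" and t: "t \<in> arr C A B"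
  shows "(susp_class C E s \<Sigma> \<iota> ^^ k) (ideal_class C (injectives C E s) t) \<noteq> {} \<and>
    (\<forall>a\<in>(susp_class C E s \<Sigma> \<iota> ^^ k) (ideal_class C (injectives C E s) t). eqp ((\<Sigma> ^^ k) A) ((\<Sigma> ^^ k) B) a (sgk A B k t))"
proof (induction k)
  case 0 then show ?case using ideal_class_eqp[OF A B t] by auto
next
  case (Suc k)
  let ?F = "(susp_class C E s \<Sigma> \<iota> ^^ k) (ideal_class C (injectives C E s) t)"
  have F: "?F \<noteq> {}" "\<And>a. a \<in> ?F \<Longrightarrow> eqp ((\<Sigma> ^^ k) A) ((\<Sigma> ^^ k) B) a (sgk A B k t)" using Suc by auto
  note S = susp_class_eqp[OF \<Sigma>k_Ob[OF A, of k] \<Sigma>k_Ob[OF B, of k] sgk_arr[OF A B t, of k] F]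
  show ?case unfolding funpow.simps o_apply sgk.simps using S by blast
qed

lemma push_class_power:
  assumes A: "A \<in> Ob C" and B: "B \<in> Ob C" and t: "t \<in> arr C A B" and X: "X \<in> Ob C" and \<delta>: "\<delta> \<in> exts E X ((\<Sigma> ^^ k) A)"
  shows "push_class C E X ((susp_class C E s \<Sigma> \<iota> ^^ k) (ideal_class C (injectives C E s) t)) \<delta> = push C E X (sgk A B k t) \<delta>"
proof -
  let ?F = "(susp_class C E s \<Sigma> \<iota> ^^ k) (ideal_class C (injectives C E s) t)"
  have "(SOME a. a \<in> ?F) \<in> ?F" using susp_power_eqp[OF A B t, of k] some_in_eq by blast
  then have "eqp ((\<Sigma> ^^ k) A) ((\<Sigma> ^^ k) B) (SOME a. a \<in> ?F) (sgk A B k t)" using susp_power_eqp[OF A B t, of k] by blast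
  then show ?thesis unfolding push_class_def by (rule eqp_D(5)[OF _ X \<delta>])
qed

abbreviation Eh where "Eh \<equiv> higher_ext C E s \<Sigma> \<iota>"

lemma Ext_higher [simp]: "Ext (Eh (Suc k)) Z A = Ext E Z ((\<Sigma> ^^ k) A)"
  by (simp add: higher_ext_def)

text \<open>In the ring, functoriality of higher extensions is multiplication from both sides.
  Combined with injectivity of \<open>ex\<close>, this reduces the functor laws to ring
  laws.\<close>

lemma Emap_higher:
  assumes "Z \<in> Ob C" "Z' \<in> Ob C" "A \<in> Ob C" "A' \<in> Ob C" "c \<in> arr C Z' Z" "a \<in> arr C A A'" "\<delta> \<in> exts E Z ((\<Sigma> ^^ k) A)"
  shows "Emap (Eh (Suc k)) c a \<delta> \<in> exts E Z' ((\<Sigma> ^^ k) A')"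
    "ex k Z' A' (Emap (Eh (Suc k)) c a \<delta>) = em a \<odot> (ex k Z A \<delta> \<odot> em c)"
proof -
  note p = pull_closed[OF assms(1,2) \<Sigma>k_Ob[OF assms(3)] assms(5,7)]
  have e: "Emap (Eh (Suc k)) c a \<delta> = push C E Z' (sgk A A' k a) (pull C E ((\<Sigma> ^^ k) A) c \<delta>)"
    using push_class_power[OF assms(3,4,6,2) p] src_trg[OF assms(2,1,5)] src_trg[OF assms(3,4,6)] by (simp add: higher_ext_def)
  show "Emap (Eh (Suc k)) c a \<delta> \<in> exts E Z' ((\<Sigma> ^^ k) A')"
    unfolding e by (rule push_closed[OF assms(2) \<Sigma>k_Ob[OF assms(3)] \<Sigma>k_Ob[OF assms(4)] sgk_arr[OF assms(3,4,6)] p])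
  show "ex k Z' A' (Emap (Eh (Suc k)) c a \<delta>) = em a \<odot> (ex k Z A \<delta> \<odot> em c)"
    unfolding e using ex_push[OF assms(2,3,4,6) p] ex_pull[OF assms(1,2,3,5,7)] by simp
qed

lemma ex_id: "\<lbrakk>Z \<in> Ob C; A \<in> Ob C; \<delta> \<in> exts E Z ((\<Sigma> ^^ k) A)\<rbrakk> \<Longrightarrow> I A \<odot> ex k Z A \<delta> = ex k Z A \<delta> \<and> ex k Z A \<delta> \<odot> I Z = ex k Z A \<delta>"
  using id_left id_right ex_H by blast

lemma push_higher:
  assumes "Z \<in> Ob C" "A \<in> Ob C" "A' \<in> Ob C" "a \<in> arr C A A'" "\<delta> \<in> exts E Z ((\<Sigma> ^^ k) A)"
  shows "push C (Eh (Suc k)) Z a \<delta> \<in> exts E Z ((\<Sigma> ^^ k) A')" "ex k Z A' (push C (Eh (Suc k)) Z a \<delta>) = em a \<odot> ex k Z A \<delta>"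
  unfolding push_def using Emap_higher[OF assms(1,1,2,3) idn_arr[OF assms(1)] assms(4,5)] ex_id[OF assms(1,2,5)] by (auto simp: em_idn assms)

lemma pull_higher:
  assumes "Z \<in> Ob C" "Z' \<in> Ob C" "A \<in> Ob C" "c \<in> arr C Z' Z" "\<delta> \<in> exts E Z ((\<Sigma> ^^ k) A)"
  shows "pull C (Eh (Suc k)) A c \<delta> \<in> exts E Z' ((\<Sigma> ^^ k) A)" "ex k Z' A (pull C (Eh (Suc k)) A c \<delta>) = ex k Z A \<delta> \<odot> em c"
  unfolding pull_def using Emap_higher[OF assms(1,2,3,3,4) idn_arr[OF assms(3)] assms(5)]
    id_left[OF H_mul0'[OF ex_H[OF assms(1,3,5)] em_H[OF assms(2,1,4)]]] by (auto simp: em_idn assms)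

lemma push_pull_full: "push (full_subcategory C T) F = push C F" "pull (full_subcategory C T) F = pull C F"
  by (simp_all add: push_def pull_def fun_eq_iff)

text \<open>For a second factor of degree 1 no suspension is applied, so the cup product is a push
  along the classifying map, as is the product in the ring. Products bracketed from the left need
  only this case.\<close>

lemma cup_higher:
  assumes A: "A \<in> Ob C" and X: "X \<in> Ob C" and Z: "Z \<in> Ob C" and \<delta>: "\<delta> \<in> exts E X ((\<Sigma> ^^ k) A)" and \<theta>: "\<theta> \<in> exts E Z X"
  shows "cup C E s \<Sigma> \<iota> (Suc k) 1 Z X A \<delta> \<theta> \<in> exts E Z ((\<Sigma> ^^ Suc k) A)"
    "ex (Suc k) Z A (cup C E s \<Sigma> \<iota> (Suc k) 1 Z X A \<delta> \<theta>) = ex k X A \<delta> \<odot> ex 0 Z X \<theta>"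
proof -
  note c = cm_Suc[OF X A \<delta>]
  have "classifying C E s \<Sigma> \<iota> (Suc k) X A \<delta> = ideal_class C (injectives C E s) (cm (Suc k) X A (Inr \<delta>))"
    by (simp add: classifying_def cm_def)
  then have e: "cup C E s \<Sigma> \<iota> (Suc k) 1 Z X A \<delta> \<theta> = push C E Z (cm (Suc k) X A (Inr \<delta>)) \<theta>"
    using push_class_power[OF X \<Sigma>k_Ob[OF A] c(1) Z, of \<theta> 0] \<theta> by (simp add: cup_def)
  show "cup C E s \<Sigma> \<iota> (Suc k) 1 Z X A \<delta> \<theta> \<in> exts E Z ((\<Sigma> ^^ Suc k) A)"
    unfolding e by (rule push_closed[OF Z X \<Sigma>k_Ob[OF A] c(1) \<theta>])
  show "ex (Suc k) Z A (cup C E s \<Sigma> \<iota> (Suc k) 1 Z X A \<delta> \<theta>) = ex k X A \<delta> \<odot> ex 0 Z X \<theta>"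
    unfolding e using ex_mul[OF Z X A, of \<theta> 0 \<delta> k] \<theta> \<delta> by simp
qed

lemma higher_vanish:
  assumes "X \<in> Ob C" "A \<in> Ob C"
  shows "exts (Eh (Suc k)) X A = {zero_ext (Eh (Suc k)) X A} \<longleftrightarrow> (\<forall>f\<in>H (Suc k) X A. f = 0)"
proof
  assume "exts (Eh (Suc k)) X A = {zero_ext (Eh (Suc k)) X A}"
  then have v: "\<delta> = zero_ext E X ((\<Sigma> ^^ k) A)" if "\<delta> \<in> exts E X ((\<Sigma> ^^ k) A)" for \<delta> using that by simp
  show "\<forall>f\<in>H (Suc k) X A. f = 0"
  proof
    fix f assume "f \<in> H (Suc k) X A"
    then obtain \<delta> where d: "\<delta> \<in> exts E X ((\<Sigma> ^^ k) A)" "f = ex k X A \<delta>" by (rule HSuc_E)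
    show "f = 0" using v[OF d(1)] d(2) ex_zero[OF assms, of k] by simp
  qed
next
  assume "\<forall>f\<in>H (Suc k) X A. f = 0"
  then have "\<delta> = zero_ext E X ((\<Sigma> ^^ k) A)" if "\<delta> \<in> exts E X ((\<Sigma> ^^ k) A)" for \<delta>
    using \<open>\<forall>f\<in>H (Suc k) X A. f = 0\<close> ex_H[OF assms that] ex_eq_0[OF assms that] by auto
  then show "exts (Eh (Suc k)) X A = {zero_ext (Eh (Suc k)) X A}" unfolding Ext_higher using exts_one[OF assms(1) \<Sigma>k_Ob[OF assms(2), of k]] by blast
qed

end

locale tilted_exangulated = enough_exangulated C E s \<Sigma> \<iota>
  for C :: "('o, 'm) category" and E :: "('o, 'm, 'e) bifunctor" and s :: "('o, 'm, 'e) correspondence"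
    and \<Sigma> :: "'o \<Rightarrow> 'o" and \<iota> :: "'o \<Rightarrow> 'e" +
  fixes \<T> :: "'o set" and n :: nat
  assumes n: "1 \<le> n"
    and W_inflation: "\<And>A B D f g. \<lbrakk>A \<in> Ob C; B \<in> Ob C; D \<in> Ob C; f \<in> arr C A B; g \<in> arr C B D;
          inflation C E s 1 (g \<cdot>\<^bsub>C\<^esub> f)\<rbrakk> \<Longrightarrow> inflation C E s 1 f"
    and W_deflation: "\<And>A B D f g. \<lbrakk>A \<in> Ob C; B \<in> Ob C; D \<in> Ob C; f \<in> arr C A B; g \<in> arr C B D;
          deflation C E s 1 (g \<cdot>\<^bsub>C\<^esub> f)\<rbrakk> \<Longrightarrow> deflation C E s 1 g"
    and tilting: "cluster_tilting C E s \<Sigma> \<iota> n \<T>"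
    and cond1: "\<And>Z. \<lbrakk>2 \<le> n; Z \<in> Ob C;
          \<forall>T\<in>\<T>. exts (higher_ext C E s \<Sigma> \<iota> (n - 1)) T Z
                 = {zero_ext (higher_ext C E s \<Sigma> \<iota> (n - 1)) T Z}\<rbrakk>
        \<Longrightarrow> \<exists>D q P p \<delta>. s_triangle C E s D q P p Z \<delta> \<and> P \<in> projectives C E s \<and>
              (\<forall>T\<in>\<T>. inj_on (\<lambda>f. q \<cdot>\<^bsub>C\<^esub> f) (arr C T D))"
    and cond2: "\<And>A. \<lbrakk>2 \<le> n; A \<in> Ob C;
          \<forall>T\<in>\<T>. exts (higher_ext C E s \<Sigma> \<iota> (n - 1)) A T
                 = {zero_ext (higher_ext C E s \<Sigma> \<iota> (n - 1)) A T}\<rbrakk>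
        \<Longrightarrow> \<exists>i J j S \<delta>. s_triangle C E s A i J j S \<delta> \<and> J \<in> injectives C E s \<and>
              (\<forall>T\<in>\<T>. inj_on (\<lambda>f. f \<cdot>\<^bsub>C\<^esub> j) (arr C S T))"
begin

lemma \<T>_Ob: "\<T> \<subseteq> Ob C" and \<T>_additive: "additive_category (full_subcategory C \<T>)" and \<T>_finite: "functorially_finite C \<T>"
  and \<T>_iff: "X \<in> Ob C \<Longrightarrow> X \<in> \<T> \<longleftrightarrow> (\<forall>i\<in>{1..n - 1}. \<forall>T\<in>\<T>. exts (Eh i) X T = {zero_ext (Eh i) X T})"
    "X \<in> Ob C \<Longrightarrow> X \<in> \<T> \<longleftrightarrow> (\<forall>i\<in>{1..n - 1}. \<forall>T\<in>\<T>. exts (Eh i) T X = {zero_ext (Eh i) T X})"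
  using tilting unfolding cluster_tilting_def by blast+

lemma \<T>_iff_H:
  assumes X: "X \<in> Ob C"
  shows "X \<in> \<T> \<longleftrightarrow> (\<forall>i. 1 \<le> i \<longrightarrow> i < n \<longrightarrow> (\<forall>Y\<in>\<T>. \<forall>f\<in>H i X Y. f = 0))"
    "X \<in> \<T> \<longleftrightarrow> (\<forall>i. 1 \<le> i \<longrightarrow> i < n \<longrightarrow> (\<forall>Y\<in>\<T>. \<forall>f\<in>H i Y X. f = 0))"
proof -
  have 1: "exts (Eh i) X Y = {zero_ext (Eh i) X Y} \<longleftrightarrow> (\<forall>f\<in>H i X Y. f = 0)" 
    "exts (Eh i) Y X = {zero_ext (Eh i) Y X} \<longleftrightarrow> (\<forall>f\<in>H i Y X. f = 0)" if "1 \<le> i" "Y \<in> \<T>" for i Y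
  proof -
    obtain k where k: "i = Suc k" using \<open>1 \<le> i\<close> by (cases i) auto
    have Y: "Y \<in> Ob C" using that \<T>_Ob by blast
    show "exts (Eh i) X Y = {zero_ext (Eh i) X Y} \<longleftrightarrow> (\<forall>f\<in>H i X Y. f = 0)"
      "exts (Eh i) Y X = {zero_ext (Eh i) Y X} \<longleftrightarrow> (\<forall>f\<in>H i Y X. f = 0)"
      unfolding k by (rule higher_vanish[OF X Y], rule higher_vanish[OF Y X])
  qed
  have 2: "i \<in> {1..n - 1} \<longleftrightarrow> 1 \<le> i \<and> i < n" for i using n by auto
  show "X \<in> \<T> \<longleftrightarrow> (\<forall>i. 1 \<le> i \<longrightarrow> i < n \<longrightarrow> (\<forall>Y\<in>\<T>. \<forall>f\<in>H i X Y. f = 0))"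
    unfolding \<T>_iff(1)[OF X] Ball_def 2 using 1(1) by (auto simp: Ball_def)
  show "X \<in> \<T> \<longleftrightarrow> (\<forall>i. 1 \<le> i \<longrightarrow> i < n \<longrightarrow> (\<forall>Y\<in>\<T>. \<forall>f\<in>H i Y X. f = 0))"
    unfolding \<T>_iff(2)[OF X] Ball_def 2 using 1(2) by (auto simp: Ball_def)
qed

lemma injective_H_all: "J \<in> injectives C E s \<Longrightarrow> H (Suc i) X J \<subseteq> {0}"
  using inj_vanish[of J _ i X] injective_H by blast

sublocale tilting_category endo_mul endo_one "Ob C" H I Tri \<T> n
proof (unfold_locales, goal_cases)
  case 1 show ?case by (rule n)
next
  case (2 A g f D y Z \<delta> B)
  obtain x1 y1 \<delta>1 where t: "s_triangle C E s A x1 D y1 Z \<delta>1" "g \<odot> f = em x1" using 2(1) by (rule Tri_E)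
  obtain f' where f: "A \<in> Ob C" "B \<in> Ob C" "f' \<in> arr C A B" "f = em f'" using 2(2) by (rule H0_E)
  obtain g' where g: "D \<in> Ob C" "g' \<in> arr C B D" "g = em g'" using 2(3) by (rule H0_E)
  note gf = comp_arr[OF f(1,2) g(1) f(3) g(2)]
  have "x1 = g' \<cdot>\<^bsub>C\<^esub> f'"
    using em_inj[OF f(1) g(1) s_triangle_D(4)[OF t(1)] gf] t(2) em_comp[OF f(1,2) g(1) f(3) g(2)] f(4) g(3) by simp
  then have "inflation C E s 1 (g' \<cdot>\<^bsub>C\<^esub> f')" using triangle_inflation[OF t(1)] by simp
  then have "inflation C E s 1 f'" by (rule W_inflation[OF f(1,2) g(1) f(3) g(2)])
  then obtain y W \<delta> where "s_triangle C E s A f' B y W \<delta>" by (rule inflation_triangle[OF _ f(3,1,2)])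
  then show ?case using TriI f(4) by blast
next
  case (3 K x A g f D \<delta> B)
  obtain x1 y1 \<delta>1 where t: "s_triangle C E s K x1 A y1 D \<delta>1" "g \<odot> f = em y1" using 3(1) by (rule Tri_E)
  obtain f' where f: "A \<in> Ob C" "B \<in> Ob C" "f' \<in> arr C A B" "f = em f'" using 3(2) by (rule H0_E)
  obtain g' where g: "D \<in> Ob C" "g' \<in> arr C B D" "g = em g'" using 3(3) by (rule H0_E)
  note gf = comp_arr[OF f(1,2) g(1) f(3) g(2)]
  have "y1 = g' \<cdot>\<^bsub>C\<^esub> f'"
    using em_inj[OF f(1) g(1) s_triangle_D(5)[OF t(1)] gf] t(2) em_comp[OF f(1,2) g(1) f(3) g(2)] f(4) g(3) by simp
  then have "deflation C E s 1 (g' \<cdot>\<^bsub>C\<^esub> f')" using triangle_deflation[OF t(1)] by simp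
  then have "deflation C E s 1 g'" by (rule W_deflation[OF f(1,2) g(1) f(3) g(2)])
  then obtain W y \<delta> where "s_triangle C E s W y B g' D \<delta>" by (rule deflation_triangle[OF _ g(2) f(2) g(1)])
  then show ?case using TriI g(3) by blast
next
  case (4 X) then show ?case using \<T>_Ob by blast
next
  case (5 X Y i f)
  then have "X \<in> Ob C" using \<T>_Ob by blast
  then show ?case using \<T>_iff_H(1) 5 by blast
next
  case (6 X) then show ?case using \<T>_iff_H(1)[OF 6(1)] by blast
next
  case (7 X) then show ?case using \<T>_iff_H(2)[OF 7(1)] by blast
next
  case (8 X)
  obtain Y r where r: "Y \<in> \<T>" "r \<in> arr C Y X" "\<And>Y' f. Y' \<in> \<T> \<Longrightarrow> f \<in> arr C Y' X \<Longrightarrow> \<exists>g\<in>arr C Y' Y. f = r \<cdot>\<^bsub>C\<^esub> g"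
    using \<T>_finite 8 unfolding functorially_finite_def by meson
  have Y: "Y \<in> Ob C" using r(1) \<T>_Ob by blast
  have "\<exists>g\<in>H 0 Y' Y. f = em r \<odot> g" if Y': "Y' \<in> \<T>" and f0: "f \<in> H 0 Y' X" for Y' f
  proof -
    obtain f' where f: "Y' \<in> Ob C" "f' \<in> arr C Y' X" "f = em f'" using f0 by (rule H0_E)
    obtain g where "g \<in> arr C Y' Y" "f' = r \<cdot>\<^bsub>C\<^esub> g" using r(3)[OF Y' f(2)] by blast
    then show ?thesis using em_H[OF f(1) Y] em_comp[OF f(1) Y 8 _ r(2)] f(3) by auto
  qed
  then show ?case using r(1) em_H[OF Y 8 r(2)] by blast
next
  case (9 X)
  obtain Y l where l: "Y \<in> \<T>" "l \<in> arr C X Y" "\<And>Y' f. Y' \<in> \<T> \<Longrightarrow> f \<in> arr C X Y' \<Longrightarrow> \<exists>g\<in>arr C Y Y'. f = g \<cdot>\<^bsub>C\<^esub> l"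
    using \<T>_finite 9 unfolding functorially_finite_def by meson
  have Y: "Y \<in> Ob C" using l(1) \<T>_Ob by blast
  have "\<exists>g\<in>H 0 Y Y'. f = g \<odot> em l" if Y': "Y' \<in> \<T>" and f0: "f \<in> H 0 X Y'" for Y' f
  proof -
    obtain f' where f: "Y' \<in> Ob C" "f' \<in> arr C X Y'" "f = em f'" using f0 by (rule H0_E)
    obtain g where "g \<in> arr C Y Y'" "f' = g \<cdot>\<^bsub>C\<^esub> l" using l(3)[OF Y' f(2)] by blast
    then show ?thesis using em_H[OF Y f(1)] em_comp[OF 9 Y f(1) l(2)] f(3) by auto
  qed
  then show ?case using l(1) em_H[OF 9 Y l(2)] by blast
next
  case (10 Z)
  obtain k where k: "n - 1 = Suc k" using 10(1) by (cases "n - 1") auto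
  have "\<forall>T\<in>\<T>. exts (Eh (n - 1)) T Z = {zero_ext (Eh (n - 1)) T Z}"
    using higher_vanish[OF _ 10(2), of _ k] 10(3) \<T>_Ob unfolding k by blast
  then obtain D q P p \<delta> where t: "s_triangle C E s D q P p Z \<delta>" "P \<in> projectives C E s"
    "\<And>T. T \<in> \<T> \<Longrightarrow> inj_on (\<lambda>f. q \<cdot>\<^bsub>C\<^esub> f) (arr C T D)" using cond1[OF 10(1,2)] by blast
  note tD = s_triangle_D[OF t(1)]
  have "f = 0" if X: "X \<in> \<T>" and f: "f \<in> H 0 X D" "em q \<odot> f = 0" for X f
  proof -
    obtain f' where f': "X \<in> Ob C" "f' \<in> arr C X D" "f = em f'" using f(1) by (rule H0_E)
    note z = arr_closed(1)[OF f'(1) tD(1)]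
    have "em q \<odot> em (zero_arr C X D) = 0" using em_zero[OF f'(1) tD(1)] by simp
    then have "q \<cdot>\<^bsub>C\<^esub> f' = q \<cdot>\<^bsub>C\<^esub> zero_arr C X D"
      using em_mul_eq_0[OF f'(1) tD(1,2) f'(2) tD(4)] em_mul_eq_0[OF f'(1) tD(1,2) z tD(4)] f f'(3) by simp
    then have "f' = zero_arr C X D" using inj_onD[OF t(3)[OF X]] f'(2) z by blast
    then show ?thesis using f'(3) em_zero[OF f'(1) tD(1)] by simp
  qed
  then show ?case using TriI[OF t(1)] projective_H[OF t(2)] by blast
next
  case (11 A)
  obtain k where k: "n - 1 = Suc k" using 11(1) by (cases "n - 1") auto
  have "\<forall>T\<in>\<T>. exts (Eh (n - 1)) A T = {zero_ext (Eh (n - 1)) A T}"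
    using higher_vanish[OF 11(2), of _ k] 11(3) \<T>_Ob unfolding k by blast
  then obtain i J j S \<delta> where t: "s_triangle C E s A i J j S \<delta>" "J \<in> injectives C E s"
    "\<And>T. T \<in> \<T> \<Longrightarrow> inj_on (\<lambda>f. f \<cdot>\<^bsub>C\<^esub> j) (arr C S T)" using cond2[OF 11(1,2)] by blast
  note tD = s_triangle_D[OF t(1)]
  have "f = 0" if X: "X \<in> \<T>" and f: "f \<in> H 0 S X" "f \<odot> em j = 0" for X f
  proof -
    obtain f' where f': "X \<in> Ob C" "f' \<in> arr C S X" "f = em f'" using f(1) by (rule H0_E)
    note z = arr_closed(1)[OF tD(3) f'(1)]
    have "em (zero_arr C S X) \<odot> em j = 0" using em_zero[OF tD(3) f'(1)] by simp
    then have "f' \<cdot>\<^bsub>C\<^esub> j = zero_arr C S X \<cdot>\<^bsub>C\<^esub> j"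
      using em_mul_eq_0[OF tD(2,3) f'(1) tD(5) f'(2)] em_mul_eq_0[OF tD(2,3) f'(1) tD(5) z] f f'(3) by simp
    then have "f' = zero_arr C S X" using inj_onD[OF t(3)[OF X]] f'(2) z by blast
    then show ?thesis using f'(3) em_zero[OF tD(3) f'(1)] by simp
  qed
  then show ?case using TriI[OF t(1)] injective_H_all[OF t(2)] by blast
qed

text \<open>\<open>cup_chain\<close> with parameter k has k + 1 factors and grows on the right,
  while \<open>pr\<close> is defined by growth on the left; \<open>pr_snoc\<close> mediates.\<close>

lemma cup_chain_pr:
  assumes "\<And>i. i \<le> Suc k \<Longrightarrow> M i \<in> Ob C" "\<And>i. i \<le> k \<Longrightarrow> d (Suc i) \<in> exts E (M (Suc i)) (M i)"
  shows "cup_chain C E s \<Sigma> \<iota> M d k \<in> exts E (M (Suc k)) ((\<Sigma> ^^ k) (M 0)) \<and>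
    ex k (M (Suc k)) (M 0) (cup_chain C E s \<Sigma> \<iota> M d k) = pr (\<lambda>i. ex 0 (M i) (M (i - 1)) (d i)) 0 (Suc k)"
  using assms
proof (induction k)
  case 0 then show ?case using 0(2)[of 0] by simp
next
  case (Suc k)
  let ?c = "cup_chain C E s \<Sigma> \<iota> M d k"
  have ih: "?c \<in> exts E (M (Suc k)) ((\<Sigma> ^^ k) (M 0))"
    "ex k (M (Suc k)) (M 0) ?c = pr (\<lambda>i. ex 0 (M i) (M (i - 1)) (d i)) 0 (Suc k)" using Suc by auto
  have d: "d (Suc (Suc k)) \<in> exts E (M (Suc (Suc k))) (M (Suc k))" using Suc.prems(2)[of "Suc k"] by simp
  note c = cup_higher[OF Suc.prems(1) Suc.prems(1) Suc.prems(1) ih(1) d]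
  have e: "cup_chain C E s \<Sigma> \<iota> M d (Suc k) = cup C E s \<Sigma> \<iota> (Suc k) 1 (M (Suc (Suc k))) (M (Suc k)) (M 0) ?c (d (Suc (Suc k)))"
    by (simp add: numeral_2_eq_2)
  show ?case unfolding e pr_snoc[of _ 0 "Suc k"] using c ih(2) by simp
qed

end

section \<open>The n-exangulated structure\<close>

context tilted_exangulated begin

text \<open>Degree n of the higher extensions uses the (n-1)-fold suspension. Through
  \<open>Suc r = n\<close> the lemmas stated for successors specialise to n.\<close>

definition r where "r = n - 1"

lemma Suc_r: "Suc r = n"
  using n by (simp add: r_def)

lemmas push_n = push_higher[of _ _ _ _ _ r, unfolded Suc_r]
  and pull_n = pull_higher[of _ _ _ _ _ r, unfolded Suc_r]
  and Emap_n = Emap_higher[of _ _ _ _ _ _ _ r, unfolded Suc_r]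
  and Ext_n = Ext_higher[of r, unfolded Suc_r]
  and ex_Hn = ex_H[of _ _ _ r, unfolded Suc_r]
  and Hn_E = HSuc_E[of _ r, unfolded Suc_r]


abbreviation dif where "dif X \<equiv> \<lambda>i. em (diff X i)"
abbreviation ext_of where "ext_of X \<equiv> ex r (obj X (Suc n)) (obj X 0)"

definition decomposable :: "('o, 'm) cpx \<Rightarrow> 'e \<Rightarrow> bool" where
  "decomposable X \<delta> \<longleftrightarrow> (\<forall>i\<le>n. diff X i \<in> arr C (obj X i) (obj X (Suc i))) \<and>
     \<delta> \<in> exts E (obj X (Suc n)) ((\<Sigma> ^^ r) (obj X 0)) \<and>
     (\<exists>M m e \<epsilon>. dec (obj X) (dif X) (ext_of X \<delta>) M m e \<epsilon>)"

lemma decomposable_D: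
  assumes "decomposable X \<delta>"
  shows "i \<le> n \<Longrightarrow> diff X i \<in> arr C (obj X i) (obj X (Suc i))"
    "\<delta> \<in> exts E (obj X (Suc n)) ((\<Sigma> ^^ r) (obj X 0))"
    "i \<le> Suc n \<Longrightarrow> obj X i \<in> \<T>" "i \<le> Suc n \<Longrightarrow> obj X i \<in> Ob C"
    "is_complex (full_subcategory C \<T>) n X"
proof -
  obtain M m e \<epsilon> where D: "dec (obj X) (dif X) (ext_of X \<delta>) M m e \<epsilon>"
    using assms unfolding decomposable_def by blast
  show a: "diff X i \<in> arr C (obj X i) (obj X (Suc i))" if "i \<le> n" for i
    using assms that unfolding decomposable_def by blast
  show "\<delta> \<in> exts E (obj X (Suc n)) ((\<Sigma> ^^ r) (obj X 0))" using assms unfolding decomposable_def by blast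
  show b: "obj X i \<in> \<T>" if "i \<le> Suc n" for i using dec_m(4)[OF D that] .
  show "obj X i \<in> Ob C" if "i \<le> Suc n" for i using b[OF that] \<T>_Ob by blast
  show "is_complex (full_subcategory C \<T>) n X"
    unfolding is_complex_iff[OF \<T>_Ob] using a b dec_zero(1)[OF D] by blast
qed

lemma decomposable_E:
  assumes "decomposable X \<delta>"
  obtains M m e \<epsilon> where "dec (obj X) (dif X) (ext_of X \<delta>) M m e \<epsilon>"
  using assms unfolding decomposable_def by blast

text \<open>The maps \<open>e' 0\<close> and \<open>m' n\<close>, for which the triangles provide
  nothing, are filled with identities to meet the conventions of \<open>dec\<close>.\<close>

lemma decomposable_of_s_decomposable:
  assumes "s_decomposable C E s \<Sigma> \<iota> n \<T> X \<delta>" shows "decomposable X \<delta>"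
proof -
  from assms have ac: "is_complex (full_subcategory C \<T>) n X" "\<delta> \<in> exts E (obj X (Suc n)) ((\<Sigma> ^^ r) (obj X 0))"
    unfolding s_decomposable_def attached_complex_def by (auto simp: Ext_n)
  from ac(1) have XT: "\<And>i. i \<le> Suc n \<Longrightarrow> obj X i \<in> \<T>" and dX: "\<And>i. i \<le> n \<Longrightarrow> diff X i \<in> arr C (obj X i) (obj X (Suc i))"
    unfolding is_complex_iff[OF \<T>_Ob] by blast+
  from assms obtain M m e d where A: "M 0 = obj X 0 \<and> M n = obj X (n + 1) \<and> m 0 = diff X 0 \<and> e n = diff X n \<and>
      (\<forall>i<n. s_triangle C E s (M i) (m i) (obj X (i + 1)) (e (i + 1)) (M (i + 1)) (d (i + 1))) \<and>
      (\<forall>i\<in>{1..<n}. diff X i = m i \<cdot>\<^bsub>C\<^esub> e i) \<and> \<delta> = cup_chain C E s \<Sigma> \<iota> M d (n - 1)"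
    unfolding s_decomposable_def by blast
  then have M: "M 0 = obj X 0" "M n = obj X (Suc n)" and me: "m 0 = diff X 0" "e n = diff X n"
    and t: "\<And>i. i < n \<Longrightarrow> s_triangle C E s (M i) (m i) (obj X (Suc i)) (e (Suc i)) (M (Suc i)) (d (Suc i))"
    and f: "\<And>i. 1 \<le> i \<Longrightarrow> i < n \<Longrightarrow> diff X i = m i \<cdot>\<^bsub>C\<^esub> e i" and \<delta>: "\<delta> = cup_chain C E s \<Sigma> \<iota> M d r"
    unfolding r_def by auto
  define m' where "m' i = (if i = n then I (M n) else em (m i))" for i
  define e' where "e' i = (if i = 0 then I (M 0) else em (e i))" for i
  define \<epsilon> where "\<epsilon> i = ex 0 (M i) (M (i - 1)) (d i)" for i
  have MO: "M i \<in> Ob C" if "i \<le> n" for i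
  proof (cases "i = n")
    case True then show ?thesis using M(2) XT[of "Suc n"] \<T>_Ob by auto
  next
    case False then show ?thesis using s_triangle_D(1)[OF t[of i]] that by simp
  qed
  have XO: "obj X i \<in> Ob C" if "i \<le> Suc n" for i using XT[OF that] \<T>_Ob by blast
  have tr: "Tri (M i) (m' i) (obj X (Suc i)) (e' (Suc i)) (M (Suc i)) (\<epsilon> (Suc i))" if "i < n" for i
    using TriI[OF t[OF that]] that by (simp add: m'_def e'_def \<epsilon>_def)
  have ch: "chain 0 n (obj X) M m' e' \<epsilon>" unfolding chain_def using tr XT by auto
  have dd: "em (diff X i) = m' i \<odot> e' i" if i: "i \<le> n" for i
  proof -
    note h = em_H[OF XO XO dX[OF i]]
    consider "i = 0" | "i = n" "i \<noteq> 0" | "1 \<le> i" "i < n" using i by linarith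
    then show ?thesis
    proof cases
      case 1 then show ?thesis using h id_right[of "em (diff X 0)" 0] me n M(1) by (simp add: m'_def e'_def)
    next
      case 2 then show ?thesis using h id_left[of "em (diff X n)" 0] me M(2) by (simp add: m'_def e'_def)
    next
      case 3
      obtain k where k: "i = Suc k" using 3 by (cases i) auto
      have "e i \<in> arr C (obj X i) (M i)" using s_triangle_D(5)[OF t[of k]] 3 k by simp
      moreover have "m i \<in> arr C (M i) (obj X (Suc i))" using s_triangle_D(4)[OF t[of i]] 3 by simp
      ultimately show ?thesis using em_comp[OF XO[of i] MO[of i] XO[of "Suc i"]] f 3 by (simp add: m'_def e'_def)
    qed
  qed
  have "ex r (M (Suc r)) (M 0) (cup_chain C E s \<Sigma> \<iota> M d r) = pr \<epsilon> 0 (Suc r)"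
    using cup_chain_pr[of r M d] MO s_triangle_D(6)[OF t] Suc_r unfolding \<epsilon>_def by auto
  then have "ext_of X \<delta> = pr \<epsilon> 0 n" unfolding Suc_r \<delta> M by simp
  then have "dec (obj X) (dif X) (ext_of X \<delta>) M m' e' \<epsilon>"
    unfolding dec_def using ch dd M XT n by (auto simp: m'_def e'_def)
  then show ?thesis unfolding decomposable_def using dX ac(2) by blast
qed

lemma s_decomposable_of_decomposable:
  assumes "decomposable X \<delta>" shows "s_decomposable C E s \<Sigma> \<iota> n \<T> X \<delta>"
proof -
  note XD = decomposable_D[OF assms]
  obtain M m e \<epsilon> where D: "dec (obj X) (dif X) (ext_of X \<delta>) M m e \<epsilon>"
    using assms by (rule decomposable_E)
  note DD = dec_D[OF D]
  have "\<exists>x y d. i < n \<longrightarrow> s_triangle C E s (M i) x (obj X (Suc i)) y (M (Suc i)) d \<and>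
      m i = em x \<and> e (Suc i) = em y \<and> \<epsilon> (Suc i) = ex 0 (M (Suc i)) (M i) d" for i
    using Tri_E[OF DD(10)] by metis
  then obtain x y d where t: "\<And>i. i < n \<Longrightarrow> s_triangle C E s (M i) (x i) (obj X (Suc i)) (y i) (M (Suc i)) (d i)"
    "\<And>i. i < n \<Longrightarrow> m i = em (x i)" "\<And>i. i < n \<Longrightarrow> e (Suc i) = em (y i)"
    "\<And>i. i < n \<Longrightarrow> \<epsilon> (Suc i) = ex 0 (M (Suc i)) (M i) (d i)" by metis
  have MO: "M i \<in> Ob C" if "i \<le> n" for i using dec_m(6)[OF D that] .
  have rn: "r < n" using Suc_r by simp
  have x0: "x 0 = diff X 0"
  proof (rule em_inj[OF XD(4)[of 0] XD(4)[of 1]])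
    show "x 0 \<in> arr C (obj X 0) (obj X 1)" using s_triangle_D(4)[OF t(1)[of 0]] n DD(4) by simp
    show "diff X 0 \<in> arr C (obj X 0) (obj X 1)" using XD(1)[of 0] by simp
    show "em (x 0) = em (diff X 0)" using dec_zero(5)[OF D] t(2)[of 0] n by simp
  qed simp_all
  have yr: "y r = diff X n"
  proof (rule em_inj[OF XD(4)[of n] XD(4)[of "Suc n"]])
    show "y r \<in> arr C (obj X n) (obj X (Suc n))" using s_triangle_D(5)[OF t(1)[OF rn]] DD(5) Suc_r by simp
    show "diff X n \<in> arr C (obj X n) (obj X (Suc n))" using XD(1)[of n] by simp
    show "em (y r) = em (diff X n)" using dec_zero(6)[OF D] t(3)[OF rn] Suc_r by simp
  qed simp_all
  have xy: "diff X (Suc i) = x (Suc i) \<cdot>\<^bsub>C\<^esub> y i" if i: "Suc i < n" for i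
  proof (rule em_inj[OF XD(4)[of "Suc i"] XD(4)[of "Suc (Suc i)"]])
    note a = s_triangle_D(5)[OF t(1)[of i]] s_triangle_D(4)[OF t(1)[of "Suc i"]]
    note O = XD(4)[of "Suc i"] MO[of "Suc i"] XD(4)[of "Suc (Suc i)"]
    show "x (Suc i) \<cdot>\<^bsub>C\<^esub> y i \<in> arr C (obj X (Suc i)) (obj X (Suc (Suc i)))" using comp_arr[OF O] a i by simp
    show "diff X (Suc i) \<in> arr C (obj X (Suc i)) (obj X (Suc (Suc i)))" using XD(1)[of "Suc i"] i by simp
    show "em (diff X (Suc i)) = em (x (Suc i) \<cdot>\<^bsub>C\<^esub> y i)" using em_comp[OF O] a DD(8)[of "Suc i"] t(2)[of "Suc i"] t(3)[of i] i by simp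
  qed (use i in simp_all)
  let ?d = "\<lambda>i. d (i - 1)"
  have c: "cup_chain C E s \<Sigma> \<iota> M ?d r \<in> exts E (M (Suc r)) ((\<Sigma> ^^ r) (M 0)) \<and>
    ex r (M (Suc r)) (M 0) (cup_chain C E s \<Sigma> \<iota> M ?d r) = pr (\<lambda>i. ex 0 (M i) (M (i - 1)) (?d i)) 0 (Suc r)"
    by (rule cup_chain_pr) (use MO s_triangle_D(6)[OF t(1)] Suc_r in auto)
  have "pr (\<lambda>i. ex 0 (M i) (M (i - 1)) (?d i)) 0 n = pr \<epsilon> 0 n"
  proof (rule pr_cong)
    fix j assume "0 < j" "j \<le> 0 + n"
    then show "ex 0 (M j) (M (j - 1)) (?d j) = \<epsilon> j" using t(4)[of "j - 1"] by simp
  qed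
  then have \<delta>: "\<delta> = cup_chain C E s \<Sigma> \<iota> M ?d (n - 1)"
    using c ex_inj[OF XD(4)[of "Suc n"] XD(4)[of 0] XD(2)] DD(4,5,9) unfolding Suc_r r_def[symmetric] by simp
  have f: "diff X i = x i \<cdot>\<^bsub>C\<^esub> y (i - 1)" if "i \<in> {1..<n}" for i
    using xy[of "i - 1"] that by simp
  have O: "obj X (Suc n) \<in> Ob C" "obj X 0 \<in> Ob C" "obj X (Suc 0) \<in> Ob C" "obj X n \<in> Ob C"
    using XD(4) by simp_all
  have "push C (Eh n) (obj X (Suc n)) (diff X 0) \<delta> = zero_ext E (obj X (Suc n)) ((\<Sigma> ^^ r) (obj X (Suc 0)))"
    using push_n[OF O(1,2,3) XD(1)[of 0] XD(2)] dec_zero(2)[OF D] ex_eq_0[OF O(1,3), of _ r] by simp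
  moreover have "pull C (Eh n) (obj X 0) (diff X n) \<delta> = zero_ext E (obj X n) ((\<Sigma> ^^ r) (obj X 0))"
    using pull_n[OF O(1,4,2) XD(1)[of n] XD(2)] dec_zero(3)[OF D] ex_eq_0[OF O(4,2), of _ r] by simp
  ultimately have "attached_complex (full_subcategory C \<T>) (Eh n) n X \<delta>"
    unfolding attached_complex_def push_pull_full Ext_n using XD(2,5) by simp
  moreover have "\<forall>i<n. s_triangle C E s (M i) (x i) (obj X (i + 1)) ((\<lambda>i. y (i - 1)) (i + 1)) (M (i + 1)) (?d (i + 1))"
    using t(1) by simp
  moreover have "(\<lambda>i. y (i - 1)) n = diff X n" using yr unfolding r_def .
  ultimately show ?thesis unfolding s_decomposable_def
    by (intro conjI exI[of _ M] exI[of _ x] exI[of _ "\<lambda>i. y (i - 1)"] exI[of _ ?d])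
      (use x0 DD(4,5) f \<delta> in simp_all)
qed

lemma s_decomposable_iff: "s_decomposable C E s \<Sigma> \<iota> n \<T> X \<delta> \<longleftrightarrow> decomposable X \<delta>"
  using decomposable_of_s_decomposable s_decomposable_of_decomposable by blast

lemma dec_cong: "\<lbrakk>dec X d \<delta> M m e \<epsilon>; \<And>i. i \<le> n \<Longrightarrow> d i = d' i\<rbrakk> \<Longrightarrow> dec X d' \<delta> M m e \<epsilon>"
  unfolding dec_def by auto

lemma complex_of_dec:
  assumes D: "dec X d \<delta> M m e \<epsilon>"
  obtains K \<kappa> where "obj K = X" "\<And>i. i \<le> n \<Longrightarrow> em (diff K i) = d i" "decomposable K \<kappa>"
    "ex r (X (Suc n)) (X 0) \<kappa> = \<delta>"
proof -
  have "\<exists>f. i \<le> n \<longrightarrow> f \<in> arr C (X i) (X (Suc i)) \<and> em f = d i" for i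
    using H0_E[OF dec_m(3)[OF D]] by metis
  then obtain f where f: "\<And>i. i \<le> n \<Longrightarrow> f i \<in> arr C (X i) (X (Suc i))" "\<And>i. i \<le> n \<Longrightarrow> em (f i) = d i" by metis
  obtain \<kappa> where \<kappa>: "\<kappa> \<in> exts E (X (Suc n)) ((\<Sigma> ^^ r) (X 0))" "\<delta> = ex r (X (Suc n)) (X 0) \<kappa>"
    using dec_zero(4)[OF D] by (rule Hn_E)
  have "dec X (\<lambda>i. em (f i)) (ex r (X (Suc n)) (X 0) \<kappa>) M m e \<epsilon>"
    using dec_cong[OF D, of "\<lambda>i. em (f i)"] f(2) \<kappa>(2) by simp
  then have "decomposable \<lparr>obj = X, diff = f\<rparr> \<kappa>" unfolding decomposable_def using f(1) \<kappa>(1) by auto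
  then show thesis using that[of "\<lparr>obj = X, diff = f\<rparr>" \<kappa>] f(2) \<kappa>(2) by simp
qed

abbreviation Ct where "Ct \<equiv> full_subcategory C \<T>"
abbreviation sn where "sn \<equiv> higher_realization C E s \<Sigma> \<iota> n \<T>"

lemma cpl_of_complex: "is_complex Ct n X \<Longrightarrow> cpl (obj X) (dif X)"
  unfolding is_complex_iff[OF \<T>_Ob] cpl_def using em_H \<T>_Ob by (auto simp: subset_iff)

lemma complex_D:
  assumes "is_complex Ct n X"
  shows "i \<le> Suc n \<Longrightarrow> obj X i \<in> \<T>" "i \<le> Suc n \<Longrightarrow> obj X i \<in> Ob C" "i \<le> n \<Longrightarrow> diff X i \<in> arr C (obj X i) (obj X (Suc i))"
  using assms \<T>_Ob unfolding is_complex_iff[OF \<T>_Ob] by auto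

lemma cmap_of_chain_map:
  assumes X: "is_complex Ct n X" and Y: "is_complex Ct n Y" and f: "chain_map Ct n X Y f"
  shows "cmap (obj X) (dif X) (obj Y) (dif Y) (\<lambda>i. em (f i))"
  using f em_H complex_D(2)[OF X] complex_D(2)[OF Y] unfolding chain_map_iff[OF \<T>_Ob X Y] cmap_def by auto

lemma chain_map_of_cmap:
  assumes X: "is_complex Ct n X" and Y: "is_complex Ct n Y"
    and f: "cmap (obj X) (dif X) (obj Y) (dif Y) \<phi>"
  shows "\<exists>f. chain_map Ct n X Y f \<and> (\<forall>i\<le>Suc n. f i \<in> arr C (obj X i) (obj Y i) \<and> em (f i) = \<phi> i)"
proof -
  have "\<exists>g. i \<le> Suc n \<longrightarrow> g \<in> arr C (obj X i) (obj Y i) \<and> em g = \<phi> i" for i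
    using H0_E[OF cmap_D(1)[OF f]] by metis
  then obtain g where g: "\<And>i. i \<le> Suc n \<Longrightarrow> g i \<in> arr C (obj X i) (obj Y i)" "\<And>i. i \<le> Suc n \<Longrightarrow> em (g i) = \<phi> i" by metis
  have "chain_map Ct n X Y g" unfolding chain_map_iff[OF \<T>_Ob X Y] using g cmap_D(2)[OF f] by auto
  then show ?thesis using g by blast
qed

lemma em_eq_I: "\<lbrakk>A \<in> Ob C; f \<in> arr C A A; em f = I A\<rbrakk> \<Longrightarrow> f = idn C A"
  using em_inj[of A A f "idn C A"] idn_arr em_idn by simp

lemma null_cong: "(\<And>i. i \<le> Suc n \<Longrightarrow> p i = q i) \<Longrightarrow> null X d Y d' p \<longleftrightarrow> null X d Y d' q"
  unfolding null_def by (simp add: Suc_le_eq)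

lemma homotopic_id_iff:
  assumes X: "is_complex Ct n X" and Y: "is_complex Ct n Y" 
    and f: "\<And>i. i \<le> Suc n \<Longrightarrow> f i \<in> arr C (obj X i) (obj Y i)" and g: "\<And>i. i \<le> Suc n \<Longrightarrow> g i \<in> arr C (obj Y i) (obj X i)"
  shows "homotopic Ct n X X (\<lambda>i. g i \<cdot>\<^bsub>C\<^esub> f i) (\<lambda>i. idn C (obj X i)) \<longleftrightarrow>
    null (obj X) (dif X) (obj X) (dif X) (\<lambda>i. em (g i) \<odot> em (f i) - I (obj X i))"
proof -
  have 1: "homotopic Ct n X X (\<lambda>i. g i \<cdot>\<^bsub>C\<^esub> f i) (\<lambda>i. idn C (obj X i)) \<longleftrightarrow>
    null (obj X) (dif X) (obj X) (dif X) (\<lambda>i. em (g i \<cdot>\<^bsub>C\<^esub> f i) - em (idn C (obj X i)))"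
    unfolding null_def
    by (rule homotopic_iff[OF \<T>_Ob X X]) (use comp_arr[OF complex_D(2)[OF X] complex_D(2)[OF Y] complex_D(2)[OF X] f g] 
      idn_arr[OF complex_D(2)[OF X]] in auto)
  have 2: "em (g i \<cdot>\<^bsub>C\<^esub> f i) - em (idn C (obj X i)) = em (g i) \<odot> em (f i) - I (obj X i)" if "i \<le> Suc n" for i
    using em_comp[OF complex_D(2)[OF X] complex_D(2)[OF Y] complex_D(2)[OF X] f g] em_idn[OF complex_D(2)[OF X]] that by simp
  show ?thesis unfolding 1 by (rule null_cong[OF 2])
qed

text \<open>This is where \<open>dec_closed\<close> enters: a homotopy equivalence fixing the ends
  passes decomposability on, with the same extension.\<close>

lemma homotopy_class_sub:
  assumes D: "decomposable X \<delta>" and Y: "Y \<in> homotopy_class Ct n X"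
  shows "obj Y 0 = obj X 0" "obj Y (Suc n) = obj X (Suc n)" "decomposable Y \<delta>"
proof -
  obtain M m e \<epsilon> where dX: "dec (obj X) (dif X) (ext_of X \<delta>) M m e \<epsilon>"
    using D by (rule decomposable_E)
  note X = decomposable_D[OF D]
  from Y obtain f g where YY: "is_complex Ct n Y" "obj Y 0 = obj X 0" "obj Y (Suc n) = obj X (Suc n)"
    and f: "end_fixing_map Ct n X Y f" and g: "end_fixing_map Ct n Y X g"
    and h: "homotopic Ct n Y Y (\<lambda>i. f i \<cdot>\<^bsub>C\<^esub> g i) (\<lambda>i. idn C (obj Y i))"
    unfolding homotopy_class_def complexes_between_def homotopy_equivalent_def by auto
  show "obj Y 0 = obj X 0" "obj Y (Suc n) = obj X (Suc n)" using YY by auto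
  have f': "chain_map Ct n X Y f" "f 0 = idn C (obj X 0)" "f (Suc n) = idn C (obj X (Suc n))"
    and g': "chain_map Ct n Y X g" "g 0 = idn C (obj X 0)" "g (Suc n) = idn C (obj X (Suc n))"
    using f g YY unfolding end_fixing_map_def by auto
  have fa: "\<And>i. i \<le> Suc n \<Longrightarrow> f i \<in> arr C (obj X i) (obj Y i)" using f'(1) unfolding chain_map_def by simp
  have ga: "\<And>i. i \<le> Suc n \<Longrightarrow> g i \<in> arr C (obj Y i) (obj X i)" using g'(1) unfolding chain_map_def by simp
  have nl: "null (obj Y) (dif Y) (obj Y) (dif Y) (\<lambda>i. em (f i) \<odot> em (g i) - I (obj Y i))"
    using h homotopic_id_iff[of Y X g f] YY(1) X(5) ga fa by blast
  have "\<exists>N m e \<eta>. dec (obj Y) (dif Y) (ext_of X \<delta>) N m e \<eta>"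
    by (rule dec_closed[OF dX cpl_of_complex[OF YY(1)] YY(2,3) cmap_of_chain_map[OF X(5) YY(1) f'(1)]
        cmap_of_chain_map[OF YY(1) X(5) g'(1)] _ _ _ _ nl]) (simp_all add: f' g' em_idn X(4))
  then show "decomposable Y \<delta>" unfolding decomposable_def using complex_D(3)[OF YY(1)] X(2) YY(2,3) by simp
qed

text \<open>Identities at the ends lift in both directions by \<open>dec_lift\<close>, and
  \<open>homotopy_inverse\<close> corrects one of the lifts to an inverse up to homotopy.\<close>

lemma homotopy_class_sup:
  assumes D: "decomposable X \<delta>" and DY: "decomposable Y \<delta>" and XY: "obj Y 0 = obj X 0" "obj Y (Suc n) = obj X (Suc n)"
  shows "Y \<in> homotopy_class Ct n X"
proof -
  obtain M m e \<epsilon> where dX: "dec (obj X) (dif X) (ext_of X \<delta>) M m e \<epsilon>"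
    using D by (rule decomposable_E)
  obtain M' m' e' \<epsilon>' where dY: "dec (obj Y) (dif Y) (ext_of X \<delta>) M' m' e' \<epsilon>'"
    using DY unfolding XY[symmetric] by (rule decomposable_E)
  note X = decomposable_D[OF D] and Y = decomposable_D[OF DY]
  let ?a = "I (obj X 0)" and ?c = "I (obj X (Suc n))"
  have O: "obj X 0 \<in> Ob C" "obj X (Suc n) \<in> Ob C" using X(4) by auto
  have H: "?a \<in> H 0 (obj X 0) (obj X 0)" "?c \<in> H 0 (obj X (Suc n)) (obj X (Suc n))" using H_id O by auto
  have q: "?a \<odot> ext_of X \<delta> = ext_of X \<delta> \<odot> ?c"
    using ex_id[OF O(2,1) X(2)] by simp
  obtain \<phi> where \<phi>: "cmap (obj X) (dif X) (obj Y) (dif Y) \<phi>" "\<phi> 0 = ?a" "\<phi> (Suc n) = ?c"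
    using dec_lift[OF dX dY _ _ q] H XY by auto
  obtain \<psi>0 where \<psi>0: "cmap (obj Y) (dif Y) (obj X) (dif X) \<psi>0" "\<psi>0 0 = ?a" "\<psi>0 (Suc n) = ?c"
    using dec_lift[OF dY dX _ _ q] H XY by auto
  obtain \<psi> where \<psi>: "cmap (obj Y) (dif Y) (obj X) (dif X) \<psi>" "\<psi> 0 = ?a" "\<psi> (Suc n) = ?c"
    "null (obj X) (dif X) (obj X) (dif X) (\<lambda>i. \<psi> i \<odot> \<phi> i - I (obj X i))"
    "null (obj Y) (dif Y) (obj Y) (dif Y) (\<lambda>i. \<phi> i \<odot> \<psi> i - I (obj Y i))"
    using homotopy_inverse[OF dec_cpl[OF dX] dec_con_exact[OF dX] dec_cpl[OF dY] dec_con_exact[OF dY] \<phi>(1) \<psi>0(1)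
        XY[symmetric] \<phi>(2,3) \<psi>0(2,3)] by blast
  obtain f where f: "chain_map Ct n X Y f" "\<And>i. i \<le> Suc n \<Longrightarrow> f i \<in> arr C (obj X i) (obj Y i)" "\<And>i. i \<le> Suc n \<Longrightarrow> em (f i) = \<phi> i"
    using chain_map_of_cmap[OF X(5) Y(5) \<phi>(1)] by blast
  obtain g where g: "chain_map Ct n Y X g" "\<And>i. i \<le> Suc n \<Longrightarrow> g i \<in> arr C (obj Y i) (obj X i)" "\<And>i. i \<le> Suc n \<Longrightarrow> em (g i) = \<psi> i"
    using chain_map_of_cmap[OF Y(5) X(5) \<psi>(1)] by blast
  have E: "f 0 = idn C (obj X 0)" "f (Suc n) = idn C (obj X (Suc n))" "g 0 = idn C (obj X 0)" "g (Suc n) = idn C (obj X (Suc n))"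
    using em_eq_I[OF O(1), of "f 0"] em_eq_I[OF O(2), of "f (Suc n)"] em_eq_I[OF O(1), of "g 0"] em_eq_I[OF O(2), of "g (Suc n)"]
      f(2)[of 0] f(2)[of "Suc n"] g(2)[of 0] g(2)[of "Suc n"]
      f(3)[of 0] f(3)[of "Suc n"] g(3)[of 0] g(3)[of "Suc n"] \<phi>(2,3) \<psi>(2,3) XY by simp_all
  have "null (obj X) (dif X) (obj X) (dif X) (\<lambda>i. em (g i) \<odot> em (f i) - I (obj X i))"
    using \<psi>(4) null_cong[of "\<lambda>i. em (g i) \<odot> em (f i) - I (obj X i)" "\<lambda>i. \<psi> i \<odot> \<phi> i - I (obj X i)"] f(3) g(3) by simp
  then have h1: "homotopic Ct n X X (\<lambda>i. g i \<cdot>\<^bsub>C\<^esub> f i) (\<lambda>i. idn C (obj X i))"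
    using homotopic_id_iff[of X Y f g] X(5) Y(5) f(2) g(2) by blast
  have "null (obj Y) (dif Y) (obj Y) (dif Y) (\<lambda>i. em (f i) \<odot> em (g i) - I (obj Y i))"
    using \<psi>(5) null_cong[of "\<lambda>i. em (f i) \<odot> em (g i) - I (obj Y i)" "\<lambda>i. \<phi> i \<odot> \<psi> i - I (obj Y i)"] f(3) g(3) by simp
  then have h2: "homotopic Ct n Y Y (\<lambda>i. f i \<cdot>\<^bsub>C\<^esub> g i) (\<lambda>i. idn C (obj Y i))"
    using homotopic_id_iff[of Y X g f] X(5) Y(5) f(2) g(2) by blast
  have "end_fixing_map Ct n X Y f" "end_fixing_map Ct n Y X g"
    unfolding end_fixing_map_def using f(1) g(1) E XY by auto
  then have "homotopy_equivalent Ct n X Y" unfolding homotopy_equivalent_def using h1 h2 by auto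
  then show ?thesis unfolding homotopy_class_def complexes_between_def using XY Y(5) by simp
qed

lemma homotopy_class_eq:
  assumes "decomposable X \<delta>"
  shows "homotopy_class Ct n X = {Y. obj Y 0 = obj X 0 \<and> obj Y (Suc n) = obj X (Suc n) \<and> decomposable Y \<delta>}"
  using homotopy_class_sub[OF assms] homotopy_class_sup[OF assms] by blast

lemma decomposable_exists:
  assumes A: "A \<in> \<T>" and Z: "Z \<in> \<T>" and \<delta>: "\<delta> \<in> exts E Z ((\<Sigma> ^^ r) A)"
  obtains X where "obj X 0 = A" "obj X (Suc n) = Z" "decomposable X \<delta>"
proof -
  have O: "A \<in> Ob C" "Z \<in> Ob C" using A Z \<T>_Ob by auto
  obtain X d M m e \<epsilon> where D: "dec X d (ex r Z A \<delta>) M m e \<epsilon>" "X 0 = A" "X (Suc n) = Z"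
    using dec_exists[OF A Z ex_Hn[OF O(2,1) \<delta>]] by blast
  obtain K \<kappa> where K: "obj K = X" "decomposable K \<kappa>" "ex r (X (Suc n)) (X 0) \<kappa> = ex r Z A \<delta>"
    by (rule complex_of_dec[OF D(1)])
  have "\<kappa> = \<delta>" using ex_inj[OF O(2,1) _ \<delta>] decomposable_D(2)[OF K(2)] K D by simp
  then show thesis using that[of K] K D by simp
qed

lemma decomposable_classes_eq:
  assumes "decomposable X \<delta>"
  shows "decomposable_classes C E s \<Sigma> \<iota> n \<T> (obj X (Suc n)) (obj X 0) \<delta> = {homotopy_class Ct n X}"
proof -
  have "homotopy_class Ct n Y = homotopy_class Ct n X" if "decomposable Y \<delta>" "obj Y 0 = obj X 0" "obj Y (Suc n) = obj X (Suc n)" for Y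
    unfolding homotopy_class_eq[OF assms] homotopy_class_eq[OF that(1)] using that by simp
  then show ?thesis unfolding decomposable_classes_def s_decomposable_iff Suc_eq_plus1[symmetric] using assms by blast
qed

lemma decomposable_class_unique:
  assumes "A \<in> \<T>" "Z \<in> \<T>" "\<delta> \<in> exts (Eh n) Z A"
  shows "\<exists>!K. K \<in> decomposable_classes C E s \<Sigma> \<iota> n \<T> Z A \<delta>"
proof -
  obtain X where "obj X 0 = A" "obj X (Suc n) = Z" "decomposable X \<delta>"
    by (rule decomposable_exists[OF assms(1,2)]) (use assms(3) Ext_n in auto)
  then show ?thesis using decomposable_classes_eq[of X \<delta>] by auto
qed

lemma higher_realization_eq:
  assumes "decomposable X \<delta>"
  shows "sn (obj X (Suc n)) (obj X 0) \<delta> = homotopy_class Ct n X"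
  unfolding higher_realization_def decomposable_classes_eq[OF assms] by simp

text \<open>The class of a decomposable complex consists exactly of the complexes with the same ends
  that are decomposable for the same extension. The remaining axioms can therefore be checked on
  decompositions.\<close>

lemma distinguished_iff: "distinguished Ct (Eh n) sn n X \<delta> \<longleftrightarrow> decomposable X \<delta>"
proof
  assume "distinguished Ct (Eh n) sn n X \<delta>"
  then have a: "obj X 0 \<in> \<T>" "obj X (Suc n) \<in> \<T>" "\<delta> \<in> exts E (obj X (Suc n)) ((\<Sigma> ^^ r) (obj X 0))" "X \<in> sn (obj X (Suc n)) (obj X 0) \<delta>"
    unfolding distinguished_def by (auto simp: Ext_n)
  obtain Y where Y: "obj Y 0 = obj X 0" "obj Y (Suc n) = obj X (Suc n)" "decomposable Y \<delta>" by (rule decomposable_exists[OF a(1-3)])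
  then show "decomposable X \<delta>" using a(4) higher_realization_eq[OF Y(3)] homotopy_class_eq[OF Y(3)] by simp
next
  assume D: "decomposable X \<delta>"
  show "distinguished Ct (Eh n) sn n X \<delta>"
    unfolding distinguished_def using decomposable_D[OF D] higher_realization_eq[OF D] homotopy_class_eq[OF D] D by (simp add: Ext_n)
qed

lemma biadditive_higher: "biadditive_functor Ct (Eh n)"
proof -
  have O: "\<And>A. A \<in> \<T> \<Longrightarrow> A \<in> Ob C" using \<T>_Ob by blast
  show ?thesis
  proof (rule biadditive_functor.intro[OF \<T>_additive biadditive_functor_axioms.intro], unfold full_subcategory_simps full_subcategory_ops Ext_n, goal_cases)
    case (1 Z A) then show ?case using ext_group O \<Sigma>k_Ob by simp
  next
    case (2 Z Z' A A' c a)
    note E1 = Emap_n[OF O[OF 2(1)] O[OF 2(2)] O[OF 2(3)] O[OF 2(4)] 2(5,6)]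
    have g: "comm_group (Ext E Z ((\<Sigma> ^^ r) A))" "comm_group (Ext E Z' ((\<Sigma> ^^ r) A'))" using ext_group O 2 \<Sigma>k_Ob by simp_all
    show ?case
    proof (rule homI)
      fix \<delta> \<rho> assume d: "\<delta> \<in> exts E Z ((\<Sigma> ^^ r) A)" "\<rho> \<in> exts E Z ((\<Sigma> ^^ r) A)"
      show "Emap (Eh n) c a \<delta> \<in> exts E Z' ((\<Sigma> ^^ r) A')" by (rule E1(1)[OF d(1)])
      note m = comm_group_simps(1)[OF g(1) d] comm_group_simps(1)[OF g(2) E1(1)[OF d(1)] E1(1)[OF d(2)]]
      show "Emap (Eh n) c a (\<delta> \<otimes>\<^bsub>Ext E Z ((\<Sigma> ^^ r) A)\<^esub> \<rho>) =
          Emap (Eh n) c a \<delta> \<otimes>\<^bsub>Ext E Z' ((\<Sigma> ^^ r) A')\<^esub> Emap (Eh n) c a \<rho>"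
        by (rule ex_inj[OF O[OF 2(2)] O[OF 2(4)] E1(1)[OF m(1)] m(2)])
          (simp add: E1(2)[OF m(1)] E1(2)[OF d(1)] E1(2)[OF d(2)] ex_add[OF O[OF 2(1)] O[OF 2(3)] d]
            ex_add[OF O[OF 2(2)] O[OF 2(4)] E1(1)[OF d(1)] E1(1)[OF d(2)]] mul_add_left mul_add_right)
    qed
  next
    case (3 Z A \<delta>)
    note o = O[OF 3(1)] O[OF 3(2)]
    note E1 = Emap_n[OF o(1,1,2,2) idn_arr[OF o(1)] idn_arr[OF o(2)] 3(3)]
    show ?case by (rule ex_inj[OF o E1(1) 3(3)]) (use E1(2) ex_id[OF o 3(3)] em_idn o in simp)
  next
    case (4 Z Z' Z'' A A' A'' c c' a a' \<delta>)
    note o = O[OF 4(1)] O[OF 4(2)] O[OF 4(3)] O[OF 4(4)] O[OF 4(5)] O[OF 4(6)]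
    note E1 = Emap_n[OF o(1,2,4,5) 4(7,9,11)]
    note E2 = Emap_n[OF o(2,3,5,6) 4(8,10) E1(1)]
    note E3 = Emap_n[OF o(1,3,4,6) comp_arr[OF o(3,2,1) 4(8,7)] comp_arr[OF o(4,5,6) 4(9,10)] 4(11)]
    show ?case by (rule ex_inj[OF o(3,6) E3(1) E2(1)])
      (simp add: E1(2) E2(2) E3(2) em_comp[OF o(3,2,1) 4(8,7)] em_comp[OF o(4,5,6) 4(9,10)] mul_assoc)
  next
    case (5 Z Z' A A' c c' a \<delta>)
    note o = O[OF 5(1)] O[OF 5(2)] O[OF 5(3)] O[OF 5(4)]
    note E1 = Emap_n[OF o 5(5,7,8)] and E2 = Emap_n[OF o 5(6,7,8)]
    note E3 = Emap_n[OF o arr_closed(2)[OF o(2,1) 5(5,6)] 5(7,8)]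
    have g: "comm_group (Ext E Z' ((\<Sigma> ^^ r) A'))" using ext_group o \<Sigma>k_Ob by simp
    show ?case by (rule ex_inj[OF o(2,4) E3(1) comm_group_simps(1)[OF g E1(1) E2(1)]])
      (simp add: E1(2) E2(2) E3(2) em_add[OF o(2,1) 5(5,6)] ex_add[OF o(2,4) E1(1) E2(1)] mul_add_right)
  next
    case (6 Z Z' A A' c a a' \<delta>)
    note o = O[OF 6(1)] O[OF 6(2)] O[OF 6(3)] O[OF 6(4)]
    note E1 = Emap_n[OF o 6(5,6,8)] and E2 = Emap_n[OF o 6(5,7,8)]
    note E3 = Emap_n[OF o 6(5) arr_closed(2)[OF o(3,4) 6(6,7)] 6(8)]
    have g: "comm_group (Ext E Z' ((\<Sigma> ^^ r) A'))" using ext_group o \<Sigma>k_Ob by simp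
    show ?case by (rule ex_inj[OF o(2,4) E3(1) comm_group_simps(1)[OF g E1(1) E2(1)]])
      (simp add: E1(2) E2(2) E3(2) em_add[OF o(3,4) 6(6,7)] ex_add[OF o(2,4) E1(1) E2(1)] mul_add_left)
  qed
qed

section \<open>Lifts and exactness: conditions (R0) and (R1)\<close>

lemma lift_of_cmap:
  assumes X: "is_complex Ct n X" and Y: "is_complex Ct n Y"
    and \<phi>: "cmap (obj X) (dif X) (obj Y) (dif Y) \<phi>"
    and a: "a \<in> arr C (obj X 0) (obj Y 0)" "\<phi> 0 = em a" and c: "c \<in> arr C (obj X (Suc n)) (obj Y (Suc n))" "\<phi> (Suc n) = em c"
  shows "\<exists>f. lift_of Ct n X Y a c f \<and> (\<forall>i\<le>Suc n. f i \<in> arr C (obj X i) (obj Y i) \<and> em (f i) = \<phi> i)"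
proof -
  obtain f where f: "chain_map Ct n X Y f" "\<And>i. i \<le> Suc n \<Longrightarrow> f i \<in> arr C (obj X i) (obj Y i)" "\<And>i. i \<le> Suc n \<Longrightarrow> em (f i) = \<phi> i"
    using chain_map_of_cmap[OF X Y \<phi>] by blast
  have "f 0 = a" by (rule em_inj[OF complex_D(2)[OF X] complex_D(2)[OF Y] f(2) a(1)]) (use f(3) a(2) in auto)
  moreover have "f (Suc n) = c" by (rule em_inj[OF complex_D(2)[OF X] complex_D(2)[OF Y] f(2) c(1)]) (use f(3) c(2) in auto)
  ultimately show ?thesis unfolding lift_of_def using f by auto
qed

lemma decomposable_lift:
  assumes DX: "decomposable X \<delta>" and DY: "decomposable Y \<rho>"
    and a: "a \<in> arr C (obj X 0) (obj Y 0)" and c: "c \<in> arr C (obj X (Suc n)) (obj Y (Suc n))"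
    and e: "push C (Eh n) (obj X (Suc n)) a \<delta> = pull C (Eh n) (obj Y 0) c \<rho>"
  shows "\<exists>f. lift_of Ct n X Y a c f"
proof -
  note X = decomposable_D[OF DX] and Y = decomposable_D[OF DY]
  have O: "obj X 0 \<in> Ob C" "obj X (Suc n) \<in> Ob C" "obj Y 0 \<in> Ob C" "obj Y (Suc n) \<in> Ob C" using X(4) Y(4) by auto
  obtain M m e \<epsilon> where dX: "dec (obj X) (dif X) (ext_of X \<delta>) M m e \<epsilon>"
    using DX by (rule decomposable_E)
  obtain M' m' e' \<epsilon>' where dY: "dec (obj Y) (dif Y) (ext_of Y \<rho>) M' m' e' \<epsilon>'"
    using DY by (rule decomposable_E)
  have "em a \<odot> ext_of X \<delta> = ext_of Y \<rho> \<odot> em c"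
    using push_n(2)[OF O(2,1,3) a X(2)] pull_n(2)[OF O(4,2,3) c Y(2)] e by simp
  then obtain \<phi> where "cmap (obj X) (dif X) (obj Y) (dif Y) \<phi>" "\<phi> 0 = em a" "\<phi> (Suc n) = em c"
    using dec_lift[OF dX dY em_H[OF O(1,3) a] em_H[OF O(2,4) c]] by blast
  then show ?thesis using lift_of_cmap[OF X(5) Y(5) _ a _ c] by blast
qed

lemma kernel_cov:
  assumes O: "A \<in> Ob C" "B \<in> Ob C" "D \<in> Ob C" "X \<in> Ob C" and x: "x \<in> arr C A B" and y: "y \<in> arr C B D"
    and z: "em y \<odot> em x = 0" and ex: "\<And>f. \<lbrakk>f \<in> H 0 X B; em y \<odot> f = 0\<rbrakk> \<Longrightarrow> \<exists>g\<in>H 0 X A. f = em x \<odot> g"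
  shows "kernel (Hom C X B) (Hom C X D) (\<lambda>f. y \<cdot>\<^bsub>C\<^esub> f) = (\<lambda>f. x \<cdot>\<^bsub>C\<^esub> f) ` arr C X A"
proof (intro equalityI subsetI)
  fix f assume "f \<in> kernel (Hom C X B) (Hom C X D) (\<lambda>f. y \<cdot>\<^bsub>C\<^esub> f)"
  then have f: "f \<in> arr C X B" "em y \<odot> em f = 0" unfolding kernel_def using em_mul_eq_0[OF O(4,2,3) _ y] by auto
  obtain g where "g \<in> H 0 X A" "em f = em x \<odot> g" using ex[OF em_H[OF O(4,2) f(1)] f(2)] by blast
  then obtain g' where g: "g' \<in> arr C X A" "em f = em x \<odot> em g'" using H0_E by metis
  have "f = x \<cdot>\<^bsub>C\<^esub> g'" using em_inj[OF O(4,2) f(1) comp_arr[OF O(4,1,2) g(1) x]] g(2) em_comp[OF O(4,1,2) g(1) x] by simp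
  then show "f \<in> (\<lambda>f. x \<cdot>\<^bsub>C\<^esub> f) ` arr C X A" using g(1) by blast
next
  fix f assume "f \<in> (\<lambda>f. x \<cdot>\<^bsub>C\<^esub> f) ` arr C X A"
  then obtain g where g: "g \<in> arr C X A" "f = x \<cdot>\<^bsub>C\<^esub> g" by blast
  have "em y \<odot> em f = 0" unfolding g em_comp[OF O(4,1,2) g(1) x] using mul_ext[OF z] by simp
  then show "f \<in> kernel (Hom C X B) (Hom C X D) (\<lambda>f. y \<cdot>\<^bsub>C\<^esub> f)"
    unfolding kernel_def using em_mul_eq_0[OF O(4,2,3) comp_arr[OF O(4,1,2) g(1) x] y] comp_arr[OF O(4,1,2) g(1) x] g(2) by auto
qed

lemma kernel_con:
  assumes O: "A \<in> Ob C" "B \<in> Ob C" "D \<in> Ob C" "X \<in> Ob C" and x: "x \<in> arr C A B" and y: "y \<in> arr C B D"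
    and z: "em y \<odot> em x = 0" and ex: "\<And>f. \<lbrakk>f \<in> H 0 B X; f \<odot> em x = 0\<rbrakk> \<Longrightarrow> \<exists>g\<in>H 0 D X. f = g \<odot> em y"
  shows "kernel (Hom C B X) (Hom C A X) (\<lambda>f. f \<cdot>\<^bsub>C\<^esub> x) = (\<lambda>f. f \<cdot>\<^bsub>C\<^esub> y) ` arr C D X"
proof (intro equalityI subsetI)
  fix f assume "f \<in> kernel (Hom C B X) (Hom C A X) (\<lambda>f. f \<cdot>\<^bsub>C\<^esub> x)"
  then have f: "f \<in> arr C B X" "em f \<odot> em x = 0" unfolding kernel_def using em_mul_eq_0[OF O(1,2,4) x] by auto
  obtain g where "g \<in> H 0 D X" "em f = g \<odot> em y" using ex[OF em_H[OF O(2,4) f(1)] f(2)] by blast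
  then obtain g' where g: "g' \<in> arr C D X" "em f = em g' \<odot> em y" using H0_E by metis
  have "f = g' \<cdot>\<^bsub>C\<^esub> y" using em_inj[OF O(2,4) f(1) comp_arr[OF O(2,3,4) y g(1)]] g(2) em_comp[OF O(2,3,4) y g(1)] by simp
  then show "f \<in> (\<lambda>f. f \<cdot>\<^bsub>C\<^esub> y) ` arr C D X" using g(1) by blast
next
  fix f assume "f \<in> (\<lambda>f. f \<cdot>\<^bsub>C\<^esub> y) ` arr C D X"
  then obtain g where g: "g \<in> arr C D X" "f = g \<cdot>\<^bsub>C\<^esub> y" by blast
  have "em f \<odot> em x = 0" unfolding g em_comp[OF O(2,3,4) y g(1)] mul_assoc z by simp
  then show "f \<in> kernel (Hom C B X) (Hom C A X) (\<lambda>f. f \<cdot>\<^bsub>C\<^esub> x)"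
    unfolding kernel_def using em_mul_eq_0[OF O(1,2,4) x comp_arr[OF O(2,3,4) y g(1)]] comp_arr[OF O(2,3,4) y g(1)] g(2) by auto
qed

lemma kernel_pull:
  assumes O: "A \<in> Ob C" "B \<in> Ob C" "D \<in> Ob C" "X \<in> Ob C" and y: "y \<in> arr C B D" and \<delta>: "\<delta> \<in> exts E D ((\<Sigma> ^^ r) A)"
    and z: "ex r D A \<delta> \<odot> em y = 0" and ex: "\<And>f. \<lbrakk>f \<in> H 0 X D; ex r D A \<delta> \<odot> f = 0\<rbrakk> \<Longrightarrow> \<exists>g\<in>H 0 X B. f = em y \<odot> g"
  shows "kernel (Hom C X D) (Ext (Eh n) X A) (\<lambda>f. pull C (Eh n) A f \<delta>) = (\<lambda>f. y \<cdot>\<^bsub>C\<^esub> f) ` arr C X B"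
proof -
  have 1: "pull C (Eh n) A f \<delta> = zero_ext E X ((\<Sigma> ^^ r) A) \<longleftrightarrow> ex r D A \<delta> \<odot> em f = 0" if "f \<in> arr C X D" for f
    using ex_eq_0[OF O(4,1) pull_n(1)[OF O(3,4,1) that \<delta>]] pull_n(2)[OF O(3,4,1) that \<delta>] by simp
  show ?thesis
  proof (intro equalityI subsetI)
    fix f assume "f \<in> kernel (Hom C X D) (Ext (Eh n) X A) (\<lambda>f. pull C (Eh n) A f \<delta>)"
    then have f: "f \<in> arr C X D" "ex r D A \<delta> \<odot> em f = 0" unfolding kernel_def Ext_n using 1 by auto
    obtain g where "g \<in> H 0 X B" "em f = em y \<odot> g" using ex[OF em_H[OF O(4,3) f(1)] f(2)] by blast
    then obtain g' where g: "g' \<in> arr C X B" "em f = em y \<odot> em g'" using H0_E by metis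
    have "f = y \<cdot>\<^bsub>C\<^esub> g'" using em_inj[OF O(4,3) f(1) comp_arr[OF O(4,2,3) g(1) y]] g(2) em_comp[OF O(4,2,3) g(1) y] by simp
    then show "f \<in> (\<lambda>f. y \<cdot>\<^bsub>C\<^esub> f) ` arr C X B" using g(1) by blast
  next
    fix f assume "f \<in> (\<lambda>f. y \<cdot>\<^bsub>C\<^esub> f) ` arr C X B"
    then obtain g where g: "g \<in> arr C X B" "f = y \<cdot>\<^bsub>C\<^esub> g" by blast
    have "ex r D A \<delta> \<odot> em f = 0" unfolding g em_comp[OF O(4,2,3) g(1) y] using mul_ext[OF z] by simp
    then show "f \<in> kernel (Hom C X D) (Ext (Eh n) X A) (\<lambda>f. pull C (Eh n) A f \<delta>)"
      unfolding kernel_def Ext_n using 1 comp_arr[OF O(4,2,3) g(1) y] g(2) by auto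
  qed
qed

lemma kernel_push:
  assumes O: "A \<in> Ob C" "B \<in> Ob C" "D \<in> Ob C" "X \<in> Ob C" and x: "x \<in> arr C A B" and \<delta>: "\<delta> \<in> exts E D ((\<Sigma> ^^ r) A)"
    and z: "em x \<odot> ex r D A \<delta> = 0" and ex: "\<And>f. \<lbrakk>f \<in> H 0 A X; f \<odot> ex r D A \<delta> = 0\<rbrakk> \<Longrightarrow> \<exists>g\<in>H 0 B X. f = g \<odot> em x"
  shows "kernel (Hom C A X) (Ext (Eh n) D X) (\<lambda>f. push C (Eh n) D f \<delta>) = (\<lambda>f. f \<cdot>\<^bsub>C\<^esub> x) ` arr C B X"
proof -
  have 1: "push C (Eh n) D f \<delta> = zero_ext E D ((\<Sigma> ^^ r) X) \<longleftrightarrow> em f \<odot> ex r D A \<delta> = 0" if "f \<in> arr C A X" for f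
    using ex_eq_0[OF O(3,4) push_n(1)[OF O(3,1,4) that \<delta>]] push_n(2)[OF O(3,1,4) that \<delta>] by simp
  show ?thesis
  proof (intro equalityI subsetI)
    fix f assume "f \<in> kernel (Hom C A X) (Ext (Eh n) D X) (\<lambda>f. push C (Eh n) D f \<delta>)"
    then have f: "f \<in> arr C A X" "em f \<odot> ex r D A \<delta> = 0" unfolding kernel_def Ext_n using 1 by auto
    obtain g where "g \<in> H 0 B X" "em f = g \<odot> em x" using ex[OF em_H[OF O(1,4) f(1)] f(2)] by blast
    then obtain g' where g: "g' \<in> arr C B X" "em f = em g' \<odot> em x" using H0_E by metis
    have "f = g' \<cdot>\<^bsub>C\<^esub> x" using em_inj[OF O(1,4) f(1) comp_arr[OF O(1,2,4) x g(1)]] g(2) em_comp[OF O(1,2,4) x g(1)] by simp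
    then show "f \<in> (\<lambda>f. f \<cdot>\<^bsub>C\<^esub> x) ` arr C B X" using g(1) by blast
  next
    fix f assume "f \<in> (\<lambda>f. f \<cdot>\<^bsub>C\<^esub> x) ` arr C B X"
    then obtain g where g: "g \<in> arr C B X" "f = g \<cdot>\<^bsub>C\<^esub> x" by blast
    have "em f \<odot> ex r D A \<delta> = 0" unfolding g em_comp[OF O(1,2,4) x g(1)] mul_assoc z by simp
    then show "f \<in> kernel (Hom C A X) (Ext (Eh n) D X) (\<lambda>f. push C (Eh n) D f \<delta>)"
      unfolding kernel_def Ext_n using 1 comp_arr[OF O(1,2,4) x g(1)] g(2) by auto
  qed
qed

lemma decomposable_exangle:
  assumes D: "decomposable X \<delta>" shows "exangle Ct (Eh n) n X \<delta>"
proof -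
  note X = decomposable_D[OF D]
  obtain M m e \<epsilon> where dX: "dec (obj X) (dif X) (ext_of X \<delta>) M m e \<epsilon>"
    using D by (rule decomposable_E)
  have O: "obj X 0 \<in> Ob C" "obj X 1 \<in> Ob C" "obj X n \<in> Ob C" "obj X (Suc n) \<in> Ob C" using X(4) by auto
  have 1: "kernel (Hom C T (obj X i)) (Hom C T (obj X (Suc i))) (\<lambda>f. diff X i \<cdot>\<^bsub>C\<^esub> f) =
      (\<lambda>f. diff X (i - 1) \<cdot>\<^bsub>C\<^esub> f) ` arr C T (obj X (i - 1))"
    "kernel (Hom C (obj X i) T) (Hom C (obj X (i - 1)) T) (\<lambda>f. f \<cdot>\<^bsub>C\<^esub> diff X (i - 1)) =
      (\<lambda>f. f \<cdot>\<^bsub>C\<^esub> diff X i) ` arr C (obj X (Suc i)) T" if T: "T \<in> \<T>" and i: "1 \<le> i" "i \<le> n" for T i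
  proof -
    obtain j where j: "i = Suc j" using i by (cases i) auto
    have o: "obj X j \<in> Ob C" "obj X (Suc j) \<in> Ob C" "obj X (Suc (Suc j)) \<in> Ob C" using X(4) i j by auto
    have a: "diff X j \<in> arr C (obj X j) (obj X (Suc j))" "diff X (Suc j) \<in> arr C (obj X (Suc j)) (obj X (Suc (Suc j)))"
      using X(1) i j by auto
    have jn: "j < n" using i j by simp
    have TO: "T \<in> Ob C" using T \<T>_Ob by blast
    show "kernel (Hom C T (obj X i)) (Hom C T (obj X (Suc i))) (\<lambda>f. diff X i \<cdot>\<^bsub>C\<^esub> f) =
      (\<lambda>f. diff X (i - 1) \<cdot>\<^bsub>C\<^esub> f) ` arr C T (obj X (i - 1))"
      unfolding j diff_Suc_1 by (rule kernel_cov[OF o TO a dec_zero(1)[OF dX jn] dec_exact_cov[OF dX jn T]])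
    show "kernel (Hom C (obj X i) T) (Hom C (obj X (i - 1)) T) (\<lambda>f. f \<cdot>\<^bsub>C\<^esub> diff X (i - 1)) =
      (\<lambda>f. f \<cdot>\<^bsub>C\<^esub> diff X i) ` arr C (obj X (Suc i)) T"
      unfolding j diff_Suc_1 by (rule kernel_con[OF o TO a dec_zero(1)[OF dX jn] dec_exact_con[OF dX jn T]])
  qed
  have 2: "kernel (Hom C T (obj X (Suc n))) (Ext (Eh n) T (obj X 0)) (\<lambda>f. pull C (Eh n) (obj X 0) f \<delta>) =
      (\<lambda>f. diff X n \<cdot>\<^bsub>C\<^esub> f) ` arr C T (obj X n)" 
    "kernel (Hom C (obj X 0) T) (Ext (Eh n) (obj X (Suc n)) T) (\<lambda>f. push C (Eh n) (obj X (Suc n)) f \<delta>) =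
      (\<lambda>f. f \<cdot>\<^bsub>C\<^esub> diff X 0) ` arr C (obj X 1) T" if T: "T \<in> \<T>" for T
  proof -
    have TO: "T \<in> Ob C" using T \<T>_Ob by blast
    have a: "diff X 0 \<in> arr C (obj X 0) (obj X 1)" "diff X n \<in> arr C (obj X n) (obj X (Suc n))" using X(1)[of 0] X(1)[of n] by auto
    show "kernel (Hom C T (obj X (Suc n))) (Ext (Eh n) T (obj X 0)) (\<lambda>f. pull C (Eh n) (obj X 0) f \<delta>) =
      (\<lambda>f. diff X n \<cdot>\<^bsub>C\<^esub> f) ` arr C T (obj X n)" 
      by (rule kernel_pull[OF O(1,3,4) TO a(2) X(2) dec_zero(3)[OF dX] dec_exact_cov_end[OF dX T]])
    show "kernel (Hom C (obj X 0) T) (Ext (Eh n) (obj X (Suc n)) T) (\<lambda>f. push C (Eh n) (obj X (Suc n)) f \<delta>) =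
      (\<lambda>f. f \<cdot>\<^bsub>C\<^esub> diff X 0) ` arr C (obj X 1) T"
      by (rule kernel_push[OF O(1,2,4) TO a(1) X(2) dec_zero(2)[OF dX]])
        (use dec_exact_con_end[OF dX T] in simp)
  qed
  have "attached_complex Ct (Eh n) n X \<delta>" using s_decomposable_of_decomposable[OF D] unfolding s_decomposable_def by blast
  then show ?thesis unfolding exangle_def full_subcategory_simps push_pull_full Suc_eq_plus1[symmetric] using 1 2 by auto
qed

section \<open>Trivial complexes: condition (R2)\<close>

lemma zero_object_I: assumes "zero_object Ct N" shows "N \<in> \<T>" "N \<in> Ob C" "I N = 0"
proof -
  show N: "N \<in> \<T>" "N \<in> Ob C" using assms \<T>_Ob unfolding zero_object_def by auto
  then have "\<exists>!f. f \<in> arr C N N" using assms unfolding zero_object_def by simp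
  then have "idn C N = zero_arr C N N" using idn_arr[OF N(2)] arr_closed(1)[OF N(2,2)] by blast
  then show "I N = 0" using em_idn[OF N(2)] em_zero[OF N(2,2)] by simp
qed

text \<open>The decomposition consists of the identity triangle of A followed by zero triangles;
  every syzygy beyond \<open>M 0\<close> is the zero object.\<close>

lemma left_trivial_decomposable:
  assumes A: "A \<in> \<T>" and N: "zero_object Ct N"
  shows "decomposable (left_trivial Ct N A) (zero_ext E N ((\<Sigma> ^^ r) A))"
proof -
  note N = zero_object_I[OF N]
  have AO: "A \<in> Ob C" using A \<T>_Ob by blast
  let ?X = "left_trivial Ct N A"
  have X: "obj ?X i = (if i \<le> 1 then A else N)" "diff ?X i = (if i = 0 then idn C A else zero_arr C (if i = 1 then A else N) N)" for i
    by (simp_all add: left_trivial_def)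
  let ?M = "\<lambda>i. if i = 0 then A else N" and ?m = "\<lambda>i. if i = (0::nat) then I A else 0"
  have z: "ex r N A (zero_ext E N ((\<Sigma> ^^ r) A)) = 0" by (rule ex_zero[OF N(2) AO])
  have t: "Tri A (I A) A 0 N 0" "Tri N 0 N 0 N 0"
    using tri_id_left[OF AO N(2,3)] tri_id_left[OF N(2) N(2,3)] N(3) by simp_all
  have "chain 0 n (obj ?X) ?M ?m ?m (\<lambda>i. 0)" unfolding chain_def X using t A N(1) by auto
  moreover have "pr (\<lambda>i. 0) 0 n = 0" by (cases n) (use n in simp_all)
  moreover have "em (diff ?X i) = ?m i \<odot> ?m i" for i
    using id_left[OF H_id[OF AO]] em_idn[OF AO] em_zero[OF _ N(2)] AO N(2) by (simp add: X)
  ultimately have "dec (obj ?X) (\<lambda>i. em (diff ?X i)) (ex r (obj ?X (Suc n)) (obj ?X 0) (zero_ext E N ((\<Sigma> ^^ r) A))) ?M ?m ?m (\<lambda>i. 0)"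
    unfolding dec_def using A N n z by (simp add: X)
  moreover have "diff ?X i \<in> arr C (obj ?X i) (obj ?X (Suc i))" for i
    using idn_arr[OF AO] arr_closed(1)[OF AO N(2)] arr_closed(1)[OF N(2,2)] by (simp add: X)
  moreover have "zero_ext E N ((\<Sigma> ^^ r) A) \<in> exts E (obj ?X (Suc n)) ((\<Sigma> ^^ r) (obj ?X 0))"
    using exts_one[OF N(2) \<Sigma>k_Ob[OF AO]] n by (simp add: X)
  ultimately show ?thesis unfolding decomposable_def by blast
qed

lemma right_trivial_decomposable:
  assumes A: "A \<in> \<T>" and N: "zero_object Ct N"
  shows "decomposable (right_trivial Ct n N A) (zero_ext E A ((\<Sigma> ^^ r) N))"
proof -
  note N = zero_object_I[OF N]
  have AO: "A \<in> Ob C" using A \<T>_Ob by blast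
  let ?X = "right_trivial Ct n N A"
  have X: "obj ?X i = (if i < n then N else A)" "diff ?X i = (if i = n then idn C A else zero_arr C N (if i + 1 = n then A else N))" for i
    by (simp_all add: right_trivial_def)
  let ?M = "\<lambda>i. if i < n then N else A" and ?m = "\<lambda>i. if i = n then I A else 0"
  have z: "ex r A N (zero_ext E A ((\<Sigma> ^^ r) N)) = 0" by (rule ex_zero[OF AO N(2)])
  have t: "Tri N 0 A (I A) A 0" "Tri N 0 N 0 N 0"
    using tri_id_right[OF AO N(2,3)] tri_id_left[OF N(2) N(2,3)] N(3) by simp_all
  have "Tri (?M i) (?m i) (obj ?X (Suc i)) (?m (Suc i)) (?M (Suc i)) 0" if "i < n" for i
    by (cases "Suc i = n") (use t that in \<open>auto simp: X\<close>)
  then have "chain 0 n (obj ?X) ?M ?m ?m (\<lambda>i. 0)" unfolding chain_def using A N(1) by (simp add: X)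
  moreover have "pr (\<lambda>i. 0) 0 n = 0" by (cases n) (use n in simp_all)
  moreover have "em (diff ?X i) = ?m i \<odot> ?m i" for i
    using id_left[OF H_id[OF AO]] em_idn[OF AO] em_zero[OF N(2)] AO N(2) by (simp add: X)
  ultimately have "dec (obj ?X) (\<lambda>i. em (diff ?X i)) (ex r (obj ?X (Suc n)) (obj ?X 0) (zero_ext E A ((\<Sigma> ^^ r) N))) ?M ?m ?m (\<lambda>i. 0)"
    unfolding dec_def using A N n z by (simp add: X)
  moreover have "diff ?X i \<in> arr C (obj ?X i) (obj ?X (Suc i))" if "i \<le> n" for i
    using idn_arr[OF AO] arr_closed(1)[OF N(2) AO] arr_closed(1)[OF N(2,2)] that by (auto simp: X)
  moreover have "zero_ext E A ((\<Sigma> ^^ r) N) \<in> exts E (obj ?X (Suc n)) ((\<Sigma> ^^ r) (obj ?X 0))"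
    using exts_one[OF AO \<Sigma>k_Ob[OF N(2)]] n by (simp add: X)
  ultimately show ?thesis unfolding decomposable_def by blast
qed

lemma exact_realization_higher: "exact_realization Ct (Eh n) sn n"
proof (rule exact_realization.intro[OF biadditive_higher exact_realization_axioms.intro],
    unfold distinguished_iff push_pull_full full_subcategory_simps Ext_n Suc_eq_plus1[symmetric], goal_cases)
  case (1 A Z \<delta>)
  obtain X where X: "obj X 0 = A" "obj X (Suc n) = Z" "decomposable X \<delta>" by (rule decomposable_exists[OF 1])
  then show ?case using higher_realization_eq[OF X(3)] decomposable_D(5)[OF X(3)] unfolding complexes_between_def by auto
next
  case (2 X \<delta> Y \<rho> a c) then show ?case by (rule decomposable_lift)
next
  case (3 X \<delta>) then show ?case by (rule decomposable_exangle)
next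
  case (4 A N)
  show ?case using higher_realization_eq[OF left_trivial_decomposable[OF 4]] n by (simp add: left_trivial_def)
next
  case (5 A N)
  show ?case using higher_realization_eq[OF right_trivial_decomposable[OF 5]] n by (simp add: right_trivial_def)
qed

text \<open>Whether a map of T is an inflation is decided in the ambient category: one direction is
  the beginning of a decomposition, the other is \<open>inflation_dec\<close>. Closure under
  composition is then inherited.\<close>

lemma inflation_iff:
  assumes A: "A \<in> \<T>" and B: "B \<in> \<T>" and f: "f \<in> arr C A B"
  shows "inflation Ct (Eh n) sn n f \<longleftrightarrow> (\<exists>y Z \<delta>. Tri A (em f) B y Z \<delta>)"
proof
  have O: "A \<in> Ob C" "B \<in> Ob C" using A B \<T>_Ob by auto
  {
    assume "inflation Ct (Eh n) sn n f"
    then obtain X \<delta> where D: "decomposable X \<delta>" and fX: "f = diff X 0" unfolding inflation_def distinguished_iff by blast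
    note X = decomposable_D[OF D]
    obtain M m e \<epsilon> where dX: "dec (obj X) (dif X) (ext_of X \<delta>) M m e \<epsilon>"
      using D by (rule decomposable_E)
    have "diff X 0 \<in> arr C (obj X 0) (obj X 1)" using X(1)[of 0] by simp
    then have "obj X 0 = A" "obj X 1 = B" using src_trg[OF O f] src_trg[OF X(4)[of 0] X(4)[of 1]] fX by auto
    then show "\<exists>y Z \<delta>. Tri A (em f) B y Z \<delta>" using dec_D(10)[OF dX, of 0] dec_D(4)[OF dX] dec_zero(5)[OF dX] fX n by auto
  }
  {
    assume "\<exists>y Z \<delta>. Tri A (em f) B y Z \<delta>"
    then obtain X d \<delta> M m e \<epsilon> where D: "dec X d \<delta> M m e \<epsilon>" "X 0 = A" "X (Suc 0) = B" "d 0 = em f"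
      using inflation_dec[OF _ A B] by blast
    obtain K \<kappa> where K: "obj K = X" "\<And>i. i \<le> n \<Longrightarrow> em (diff K i) = d i" "decomposable K \<kappa>"
      using complex_of_dec[OF D(1)] by metis
    have "diff K 0 = f" by (rule em_inj[OF O _ f]) (use decomposable_D(1)[OF K(3), of 0] K(1,2) D in auto)
    then show "inflation Ct (Eh n) sn n f" unfolding inflation_def distinguished_iff using K(3) by auto
  }
qed

lemma deflation_iff:
  assumes A: "A \<in> \<T>" and B: "B \<in> \<T>" and f: "f \<in> arr C A B"
  shows "deflation Ct (Eh n) sn n f \<longleftrightarrow> (\<exists>K x \<delta>. Tri K x A (em f) B \<delta>)"
proof
  have O: "A \<in> Ob C" "B \<in> Ob C" using A B \<T>_Ob by auto
  {
    assume "deflation Ct (Eh n) sn n f"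
    then obtain X \<delta> where D: "decomposable X \<delta>" and fX: "f = diff X n" unfolding deflation_def distinguished_iff by blast
    note X = decomposable_D[OF D]
    obtain M m e \<epsilon> where dX: "dec (obj X) (dif X) (ext_of X \<delta>) M m e \<epsilon>"
      using D by (rule decomposable_E)
    have "diff X n \<in> arr C (obj X n) (obj X (Suc n))" using X(1)[of n] by simp
    then have "obj X n = A" "obj X (Suc n) = B" using src_trg[OF O f] src_trg[OF X(4)[of n] X(4)[of "Suc n"]] fX by auto
    then show "\<exists>K x \<delta>. Tri K x A (em f) B \<delta>"
      using dec_D(10)[OF dX, of r] dec_D(5)[OF dX] dec_zero(6)[OF dX] fX Suc_r by auto
  }
  {
    assume "\<exists>K x \<delta>. Tri K x A (em f) B \<delta>"
    then obtain X d \<delta> M m e \<epsilon> where D: "dec X d \<delta> M m e \<epsilon>" "X (Suc n) = B" "X n = A" "d n = em f"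
      using deflation_dec[OF _ A B] by blast
    obtain K \<kappa> where K: "obj K = X" "\<And>i. i \<le> n \<Longrightarrow> em (diff K i) = d i" "decomposable K \<kappa>"
      using complex_of_dec[OF D(1)] by metis
    have "diff K n = f" by (rule em_inj[OF O _ f]) (use decomposable_D(1)[OF K(3), of n] K(1,2) D in auto)
    then show "deflation Ct (Eh n) sn n f" unfolding deflation_def distinguished_iff using K(3) by auto
  }
qed

text \<open>Keeping arrow, end terms and ring element together allows a matrix formula in the ring
  to be matched with arrows by structural rules.\<close>

definition represents where
  "represents f A B \<phi> \<longleftrightarrow> A \<in> Ob C \<and> B \<in> Ob C \<and> f \<in> arr C A B \<and> em f = \<phi>"

lemma represents_comp: "represents g B D \<gamma> \<Longrightarrow> represents f A B \<phi> \<Longrightarrow> represents (g \<cdot>\<^bsub>C\<^esub> f) A D (\<gamma> \<odot> \<phi>)"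
  unfolding represents_def using em_comp comp_arr by auto

lemma represents_add: "represents f A B \<phi> \<Longrightarrow> represents f' A B \<psi> \<Longrightarrow> represents (f \<boxplus>\<^bsub>C\<^esub> f') A B (\<phi> + \<psi>)"
  unfolding represents_def using em_add arr_closed(2) by auto

lemma represents_minus: "represents f A B \<phi> \<Longrightarrow> represents f' A B \<psi> \<Longrightarrow> represents (f \<boxminus>\<^bsub>C\<^esub> f') A B (\<phi> - \<psi>)"
  unfolding represents_def using em_minus arr_closed(3) by auto

lemma represents_neg: "represents f A B \<phi> \<Longrightarrow> represents (neg_arr C f) A B (- \<phi>)"
  unfolding represents_def using em_neg arr_closed(4) by auto

lemma represents_eq: "represents f A B \<phi> \<Longrightarrow> represents f' A B \<phi> \<Longrightarrow> f = f'"
  unfolding represents_def using em_inj by metis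

lemma represents_choice:
  assumes "\<And>k. P k \<Longrightarrow> \<phi> k \<in> H 0 (A k) (B k)"
  shows "\<exists>a. \<forall>k. P k \<longrightarrow> represents (a k) (A k) (B k) (\<phi> k)"
proof -
  have "\<exists>f. P k \<longrightarrow> represents f (A k) (B k) (\<phi> k)" for k
    unfolding represents_def using H0_E[OF assms[of k]] by metis
  then show ?thesis by metis
qed

lemma biproduct_represents:
  assumes "represents a1 A S i1" "represents a2 B S i2" "represents b1 S A p1" "represents b2 S B p2" "bip A B S i1 i2 p1 p2"
    "A \<in> \<T>" "B \<in> \<T>" "S \<in> \<T>"
  shows "biproduct Ct A B S a1 a2 b1 b2"
  using bip_em_iff[of A B S a1 a2 b1 b2] assms unfolding represents_def biproduct_def by auto

lemma bip_choice:
  assumes "\<And>k. P k \<Longrightarrow> bip (A k) (B k) (S k) (i1 k) (i2 k) (p1 k) (p2 k)"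
  shows "\<exists>a1 a2 b1 b2. \<forall>k. P k \<longrightarrow> represents (a1 k) (A k) (S k) (i1 k) \<and> represents (a2 k) (B k) (S k) (i2 k) \<and>
    represents (b1 k) (S k) (A k) (p1 k) \<and> represents (b2 k) (S k) (B k) (p2 k)"
proof -
  note b = bip_D[OF assms]
  obtain a1 where "\<forall>k. P k \<longrightarrow> represents (a1 k) (A k) (S k) (i1 k)" using represents_choice[of P i1 A S] b(4) by blast
  moreover obtain a2 where "\<forall>k. P k \<longrightarrow> represents (a2 k) (B k) (S k) (i2 k)" using represents_choice[of P i2 B S] b(5) by blast
  moreover obtain b1 where "\<forall>k. P k \<longrightarrow> represents (b1 k) (S k) (A k) (p1 k)" using represents_choice[of P p1 S A] b(6) by blast
  moreover obtain b2 where "\<forall>k. P k \<longrightarrow> represents (b2 k) (S k) (B k) (p2 k)" using represents_choice[of P p2 S B] b(7) by blast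
  ultimately show ?thesis by blast
qed

text \<open>\<open>dec_cone\<close> delivers ring elements. Arrows representing them are chosen, the
  differentials are compared by \<open>represents_eq\<close>, and the extension of the cone is
  identified by injectivity of \<open>ex\<close>.\<close>

lemma decomposable_cone:
  assumes DY: "decomposable Y \<rho>" and c: "c \<in> arr C (obj X (Suc n)) (obj Y (Suc n))" and XY: "obj X 0 = obj Y 0"
    and DX: "decomposable X (pull C (Eh n) (obj Y 0) c \<rho>)"
  shows "\<exists>f M. lift_of Ct n X Y (idn C (obj X 0)) c f \<and> mapping_cone Ct n X Y f M \<and>
    decomposable M (push C (Eh n) (obj Y (Suc n)) (diff X 0) \<rho>)"
proof -
  note X = decomposable_D[OF DX] and Y = decomposable_D[OF DY]
  have O: "obj X 0 \<in> Ob C" "obj X 1 \<in> Ob C" "obj X (Suc n) \<in> Ob C" "obj Y 0 \<in> Ob C" "obj Y (Suc n) \<in> Ob C" using X(4) Y(4) by auto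
  obtain M m e \<epsilon> where dX: "dec (obj X) (dif X) (ext_of X (pull C (Eh n) (obj Y 0) c \<rho>)) M m e \<epsilon>"
    using DX by (rule decomposable_E)
  obtain M' m' e' \<epsilon>' where dY: "dec (obj Y) (dif Y) (ext_of Y \<rho>) M' m' e' \<epsilon>'"
    using DY by (rule decomposable_E)
  have q: "ext_of X (pull C (Eh n) (obj Y 0) c \<rho>) = ext_of Y \<rho> \<odot> em c"
    using pull_n(2)[OF O(5,3,4) c Y(2)] XY by simp
  obtain \<phi> K dK i1 i2 p1 p2 W m2 e2 \<chi> where \<phi>: "cmap (obj X) (dif X) (obj Y) (dif Y) \<phi>"
      "\<phi> 0 = I (obj X 0)" "\<phi> (Suc n) = em c"
    and K: "K 0 = obj X (Suc 0)" "K (Suc n) = obj Y (Suc n)"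
    and b: "\<forall>k. 1 \<le> k \<and> k \<le> n \<longrightarrow> bip (obj X (Suc k)) (obj Y k) (K k) (i1 k) (i2 k) (p1 k) (p2 k)"
    and d0: "dK 0 = i1 1 \<odot> (- em (diff X 1)) + i2 1 \<odot> \<phi> 1"
    and dk: "\<forall>k. 1 \<le> k \<and> k < n \<longrightarrow> dK k = i1 (Suc k) \<odot> (- em (diff X (Suc k)) \<odot> p1 k) +
      i2 (Suc k) \<odot> (\<phi> (Suc k) \<odot> p1 k + em (diff Y k) \<odot> p2 k)"
    and dn: "dK n = \<phi> (Suc n) \<odot> p1 n + em (diff Y n) \<odot> p2 n"
    and dec: "dec K dK (em (diff X 0) \<odot> ext_of Y \<rho>) W m2 e2 \<chi>"
    using dec_cone[OF dX dY XY em_H[OF O(3,5) c] q] by (elim exE conjE) (rule that)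
  obtain f where f: "lift_of Ct n X Y (idn C (obj X 0)) c f" "\<And>i. i \<le> Suc n \<Longrightarrow> represents (f i) (obj X i) (obj Y i) (\<phi> i)"
    using lift_of_cmap[OF X(5) Y(5) \<phi>(1), of "idn C (obj X 0)" c] idn_arr[OF O(1)] em_idn[OF O(1)] c \<phi>(2,3) XY X(4) Y(4)
    unfolding represents_def by auto
  obtain a1 a2 b1 b2 where ab: "\<And>k. 1 \<le> k \<Longrightarrow> k \<le> n \<Longrightarrow> represents (a1 k) (obj X (Suc k)) (K k) (i1 k)"
    "\<And>k. 1 \<le> k \<Longrightarrow> k \<le> n \<Longrightarrow> represents (a2 k) (obj Y k) (K k) (i2 k)"
    "\<And>k. 1 \<le> k \<Longrightarrow> k \<le> n \<Longrightarrow> represents (b1 k) (K k) (obj X (Suc k)) (p1 k)"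
    "\<And>k. 1 \<le> k \<Longrightarrow> k \<le> n \<Longrightarrow> represents (b2 k) (K k) (obj Y k) (p2 k)"
    using bip_choice[of "\<lambda>k. 1 \<le> k \<and> k \<le> n" "\<lambda>k. obj X (Suc k)" "obj Y" K i1 i2 p1 p2] b by blast
  obtain L \<kappa> where L: "obj L = K" "\<And>i. i \<le> n \<Longrightarrow> em (diff L i) = dK i" "decomposable L \<kappa>"
    "ex r (K (Suc n)) (K 0) \<kappa> = em (diff X 0) \<odot> ext_of Y \<rho>"
    using complex_of_dec[OF dec] by metis
  note LD = decomposable_D[OF L(3)]
  have rX: "i \<le> n \<Longrightarrow> represents (diff X i) (obj X i) (obj X (Suc i)) (em (diff X i))" for i
    using X(1,4) unfolding represents_def by simp
  have rY: "i \<le> n \<Longrightarrow> represents (diff Y i) (obj Y i) (obj Y (Suc i)) (em (diff Y i))" for i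
    using Y(1,4) unfolding represents_def by simp
  have rL: "i \<le> n \<Longrightarrow> represents (diff L i) (K i) (K (Suc i)) (dK i)" for i
    using LD(1,4) L(1,2) unfolding represents_def by simp
  have x0: "diff X 0 \<in> arr C (obj Y 0) (obj X 1)" using X(1)[of 0] XY by simp
  have "\<kappa> = push C (Eh n) (obj Y (Suc n)) (diff X 0) \<rho>"
    by (rule ex_inj[OF O(5,2) _ push_n(1)[OF O(5,4,2) x0 Y(2)]])
      (use LD(2) K L(1,4) push_n(2)[OF O(5,4,2) x0 Y(2)] in simp_all)
  moreover have "mapping_cone Ct n X Y f L"
    unfolding mapping_cone_def full_subcategory_simps full_subcategory_ops Suc_eq_plus1[symmetric]
  proof (intro conjI, goal_cases)
    case 3
    show ?case
    proof (rule exI[of _ a1], rule exI[of _ a2], rule exI[of _ b1], rule exI[of _ b2], intro conjI ballI)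
    show "biproduct Ct (obj X (Suc k)) (obj Y k) (obj L k) (a1 k) (a2 k) (b1 k) (b2 k)" if "k \<in> {1..n}" for k
      by (rule biproduct_represents[of _ _ _ "i1 k" _ _ "i2 k" _ "p1 k" _ "p2 k"]) (use that b ab X(3) Y(3) LD(3) L(1) in auto)
    show "diff L 0 = (a1 1 \<cdot>\<^bsub>C\<^esub> neg_arr C (diff X 1)) \<boxplus>\<^bsub>C\<^esub> (a2 1 \<cdot>\<^bsub>C\<^esub> f 1)"
    proof (rule represents_eq[OF rL])
      show "represents ((a1 1 \<cdot>\<^bsub>C\<^esub> neg_arr C (diff X 1)) \<boxplus>\<^bsub>C\<^esub> (a2 1 \<cdot>\<^bsub>C\<^esub> f 1)) (K 0) (K (Suc 0)) (dK 0)"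
        unfolding d0 K(1) One_nat_def[symmetric]
        by (intro represents_add represents_comp[OF ab(1)] represents_comp[OF ab(2)] represents_neg rX f(2)) (use n rX[of 1] in auto)
    qed simp
    show "diff L k = (a1 (Suc k) \<cdot>\<^bsub>C\<^esub> (neg_arr C (diff X (Suc k)) \<cdot>\<^bsub>C\<^esub> b1 k)) \<boxplus>\<^bsub>C\<^esub>
        (a2 (Suc k) \<cdot>\<^bsub>C\<^esub> ((f (Suc k) \<cdot>\<^bsub>C\<^esub> b1 k) \<boxplus>\<^bsub>C\<^esub> (diff Y k \<cdot>\<^bsub>C\<^esub> b2 k)))" (is "_ = ?R") if "k \<in> {1..<n}" for k
    proof (rule represents_eq[OF rL])
      have k: "1 \<le> k \<and> k < n" using that by simp
      show "represents ?R (K k) (K (Suc k)) (dK k)"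
        unfolding dk[rule_format, OF k]
        by (intro represents_add represents_comp[OF ab(1)] represents_comp[OF ab(2)] represents_comp[OF _ ab(3)]
          represents_comp[OF _ ab(4)] represents_neg rX rY f(2)) (use k in auto)
    qed (use that in simp)
    show "diff L n = (f (Suc n) \<cdot>\<^bsub>C\<^esub> b1 n) \<boxplus>\<^bsub>C\<^esub> (diff Y n \<cdot>\<^bsub>C\<^esub> b2 n)" (is "_ = ?R")
    proof (rule represents_eq[OF rL])
      show "represents ?R (K n) (K (Suc n)) (dK n)"
        unfolding dn K(2)
        by (intro represents_add represents_comp[OF _ ab(3)] represents_comp[OF _ ab(4)] rY f(2)) (use n in auto)
    qed simp
    qed
  qed (use L(1) K in auto)
  ultimately show ?thesis using f(1) L(3) by blast
qed

lemma decomposable_cocone: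
  assumes DX: "decomposable X \<delta>" and a: "a \<in> arr C (obj X 0) (obj Y 0)" and XY: "obj X (Suc n) = obj Y (Suc n)"
    and DY: "decomposable Y (push C (Eh n) (obj X (Suc n)) a \<delta>)"
  shows "\<exists>h M. lift_of Ct n X Y a (idn C (obj X (Suc n))) h \<and> mapping_cocone Ct n X Y h M \<and>
    decomposable M (pull C (Eh n) (obj X 0) (diff Y n) \<delta>)"
proof -
  note X = decomposable_D[OF DX] and Y = decomposable_D[OF DY]
  have O: "obj X 0 \<in> Ob C" "obj Y n \<in> Ob C" "obj X (Suc n) \<in> Ob C" "obj Y 0 \<in> Ob C" "obj Y (Suc n) \<in> Ob C" using X(4) Y(4) by auto
  obtain M m e \<epsilon> where dX: "dec (obj X) (dif X) (ext_of X \<delta>) M m e \<epsilon>"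
    using DX by (rule decomposable_E)
  obtain M' m' e' \<epsilon>' where dY: "dec (obj Y) (dif Y) (ext_of Y (push C (Eh n) (obj X (Suc n)) a \<delta>)) M' m' e' \<epsilon>'"
    using DY by (rule decomposable_E)
  have q: "ext_of Y (push C (Eh n) (obj X (Suc n)) a \<delta>) = em a \<odot> ext_of X \<delta>"
    using push_n(2)[OF O(3,1,4) a X(2)] XY by simp
  obtain \<phi> K dK i1 i2 p1 p2 W m2 e2 \<chi> where \<phi>: "cmap (obj X) (dif X) (obj Y) (dif Y) \<phi>"
      "\<phi> 0 = em a" "\<phi> (Suc n) = I (obj X (Suc n))"
    and K: "K 0 = obj X 0" "K (Suc n) = obj Y n"
    and b: "\<forall>k. 1 \<le> k \<and> k \<le> n \<longrightarrow> bip (obj X k) (obj Y (k - 1)) (K k) (i1 k) (i2 k) (p1 k) (p2 k)"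
    and d0: "dK 0 = i1 1 \<odot> em (diff X 0) + i2 1 \<odot> \<phi> 0"
    and dk: "\<forall>k. 1 \<le> k \<and> k < n \<longrightarrow> dK k = i1 (Suc k) \<odot> (em (diff X k) \<odot> p1 k) +
      i2 (Suc k) \<odot> (\<phi> k \<odot> p1 k - em (diff Y (k - 1)) \<odot> p2 k)"
    and dn: "dK n = \<phi> n \<odot> p1 n - em (diff Y (n - 1)) \<odot> p2 n"
    and dec: "dec K dK (ext_of X \<delta> \<odot> em (diff Y n)) W m2 e2 \<chi>"
    using dec_cocone[OF dX dY XY em_H[OF O(1,4) a] q] by (elim exE conjE) (rule that)
  obtain f where f: "lift_of Ct n X Y a (idn C (obj X (Suc n))) f" "\<And>i. i \<le> Suc n \<Longrightarrow> represents (f i) (obj X i) (obj Y i) (\<phi> i)"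
    using lift_of_cmap[OF X(5) Y(5) \<phi>(1), of a "idn C (obj X (Suc n))"] idn_arr[OF O(3)] em_idn[OF O(3)] a \<phi>(2,3) XY X(4) Y(4)
    unfolding represents_def by auto
  obtain a1 a2 b1 b2 where ab: "\<And>k. 1 \<le> k \<Longrightarrow> k \<le> n \<Longrightarrow> represents (a1 k) (obj X k) (K k) (i1 k)"
    "\<And>k. 1 \<le> k \<Longrightarrow> k \<le> n \<Longrightarrow> represents (a2 k) (obj Y (k - 1)) (K k) (i2 k)"
    "\<And>k. 1 \<le> k \<Longrightarrow> k \<le> n \<Longrightarrow> represents (b1 k) (K k) (obj X k) (p1 k)"
    "\<And>k. 1 \<le> k \<Longrightarrow> k \<le> n \<Longrightarrow> represents (b2 k) (K k) (obj Y (k - 1)) (p2 k)"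
    using bip_choice[of "\<lambda>k. 1 \<le> k \<and> k \<le> n" "obj X" "\<lambda>k. obj Y (k - 1)" K i1 i2 p1 p2] b by blast
  have a2': "k < n \<Longrightarrow> represents (a2 (Suc k)) (obj Y k) (K (Suc k)) (i2 (Suc k))" for k using ab(2)[of "Suc k"] by simp
  obtain L \<kappa> where L: "obj L = K" "\<And>i. i \<le> n \<Longrightarrow> em (diff L i) = dK i" "decomposable L \<kappa>"
    "ex r (K (Suc n)) (K 0) \<kappa> = ext_of X \<delta> \<odot> em (diff Y n)"
    using complex_of_dec[OF dec] by metis
  note LD = decomposable_D[OF L(3)]
  have rX: "i \<le> n \<Longrightarrow> represents (diff X i) (obj X i) (obj X (Suc i)) (em (diff X i))" for i
    using X(1,4) unfolding represents_def by simp
  have rY: "1 \<le> i \<Longrightarrow> i \<le> n \<Longrightarrow> represents (diff Y (i - 1)) (obj Y (i - 1)) (obj Y i) (em (diff Y (i - 1)))" for i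
    using Y(1)[of "i - 1"] Y(4) unfolding represents_def by simp
  have rL: "i \<le> n \<Longrightarrow> represents (diff L i) (K i) (K (Suc i)) (dK i)" for i
    using LD(1,4) L(1,2) unfolding represents_def by simp
  have yn: "diff Y n \<in> arr C (obj Y n) (obj X (Suc n))" using Y(1)[of n] XY by simp
  have "\<kappa> = pull C (Eh n) (obj X 0) (diff Y n) \<delta>"
    by (rule ex_inj[OF O(2,1) _ pull_n(1)[OF O(3,2,1) yn X(2)]])
      (use LD(2) K L(1,4) pull_n(2)[OF O(3,2,1) yn X(2)] in simp_all)
  moreover have "mapping_cocone Ct n X Y f L"
    unfolding mapping_cocone_def full_subcategory_simps full_subcategory_ops Suc_eq_plus1[symmetric]
  proof (intro conjI, goal_cases)
    case 3
    show ?case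
    proof (rule exI[of _ a1], rule exI[of _ a2], rule exI[of _ b1], rule exI[of _ b2], intro conjI ballI)
    show "biproduct Ct (obj X k) (obj Y (k - 1)) (obj L k) (a1 k) (a2 k) (b1 k) (b2 k)" if "k \<in> {1..n}" for k
      by (rule biproduct_represents[of _ _ _ "i1 k" _ _ "i2 k" _ "p1 k" _ "p2 k"]) (use that b ab X(3) Y(3) LD(3) L(1) in auto)
    show "diff L 0 = (a1 1 \<cdot>\<^bsub>C\<^esub> diff X 0) \<boxplus>\<^bsub>C\<^esub> (a2 1 \<cdot>\<^bsub>C\<^esub> f 0)" (is "_ = ?R")
    proof (rule represents_eq[OF rL])
      show "represents ?R (K 0) (K (Suc 0)) (dK 0)"
        unfolding d0 K(1) One_nat_def
        by (intro represents_add represents_comp[OF ab(1)] represents_comp[OF a2'] rX f(2)) (use n in auto)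
    qed simp
    show "diff L k = (a1 (Suc k) \<cdot>\<^bsub>C\<^esub> (diff X k \<cdot>\<^bsub>C\<^esub> b1 k)) \<boxplus>\<^bsub>C\<^esub>
        (a2 (Suc k) \<cdot>\<^bsub>C\<^esub> ((f k \<cdot>\<^bsub>C\<^esub> b1 k) \<boxminus>\<^bsub>C\<^esub> (diff Y (k - 1) \<cdot>\<^bsub>C\<^esub> b2 k)))" (is "_ = ?R") if "k \<in> {1..<n}" for k
    proof (rule represents_eq[OF rL])
      have k: "1 \<le> k \<and> k < n" using that by simp
      show "represents ?R (K k) (K (Suc k)) (dK k)"
        unfolding dk[rule_format, OF k]
        by (intro represents_add represents_minus represents_comp[OF ab(1)] represents_comp[OF a2'] represents_comp[OF _ ab(3)]
          represents_comp[OF _ ab(4)] rX rY f(2)) (use k in auto)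
    qed (use that in simp)
    show "diff L n = (f n \<cdot>\<^bsub>C\<^esub> b1 n) \<boxminus>\<^bsub>C\<^esub> (diff Y (n - 1) \<cdot>\<^bsub>C\<^esub> b2 n)" (is "_ = ?R")
    proof (rule represents_eq[OF rL])
      show "represents ?R (K n) (K (Suc n)) (dK n)"
        unfolding dn K(2)
        by (intro represents_minus represents_comp[OF _ ab(3)] represents_comp[OF _ ab(4)] rY f(2)) (use n in auto)
    qed simp
    qed
  qed (use L(1) K in auto)
  ultimately show ?thesis using f(1) L(3) by blast
qed

lemma n_exangulated_higher: "n_exangulated_category Ct (Eh n) sn n"
proof (rule n_exangulated_category.intro[OF exact_realization_higher n_exangulated_category_axioms.intro],
    unfold distinguished_iff push_pull_full full_subcategory_simps Suc_eq_plus1[symmetric], goal_cases)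
  case 1 show ?case by (rule n)
next
  case (2 A B D f g)
  have O: "A \<in> Ob C" "B \<in> Ob C" "D \<in> Ob C" using 2 \<T>_Ob by auto
  note gf = comp_arr[OF O 2(4,5)]
  show ?case using 2(6,7) infl_comp unfolding inflation_iff[OF 2(1,2,4)] inflation_iff[OF 2(2,3,5)] inflation_iff[OF 2(1,3) gf]
      em_comp[OF O 2(4,5)] by blast
next
  case (3 A B D f g)
  have O: "A \<in> Ob C" "B \<in> Ob C" "D \<in> Ob C" using 3 \<T>_Ob by auto
  note gf = comp_arr[OF O 3(4,5)]
  show ?case using 3(6,7) defl_comp unfolding deflation_iff[OF 3(1,2,4)] deflation_iff[OF 3(2,3,5)] deflation_iff[OF 3(1,3) gf]
      em_comp[OF O 3(4,5)] by blast
next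
  case (4 Y \<rho> c X) then show ?case by (rule decomposable_cone)
next
  case (5 X \<delta> a Y) then show ?case by (rule decomposable_cocone)
qed

end

theorem theorem5p39:
  fixes C :: "('o, 'm) category" and E :: "('o, 'm, 'e) bifunctor"
    and s :: "('o, 'm, 'e) correspondence"
    and \<Sigma> \<Omega> :: "'o \<Rightarrow> 'o" and \<iota> \<omega> :: "'o \<Rightarrow> 'e"
    and n :: nat and \<T> :: "'o set"
  assumes n: "1 \<le> n"
    and extriangulated: "n_exangulated_category C E s 1"
    and enough: "enough_projectives C E s" "enough_injectives C E s"
    and data: "suspension_data C E s \<Sigma> \<iota>" "loop_data C E s \<Omega> \<omega>"
    and W_inflation: "\<And>A B D f g. \<lbrakk>A \<in> Ob C; B \<in> Ob C; D \<in> Ob C; f \<in> arr C A B; g \<in> arr C B D;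
          inflation C E s 1 (g \<cdot>\<^bsub>C\<^esub> f)\<rbrakk> \<Longrightarrow> inflation C E s 1 f"
    and W_deflation: "\<And>A B D f g. \<lbrakk>A \<in> Ob C; B \<in> Ob C; D \<in> Ob C; f \<in> arr C A B; g \<in> arr C B D;
          deflation C E s 1 (g \<cdot>\<^bsub>C\<^esub> f)\<rbrakk> \<Longrightarrow> deflation C E s 1 g"
    and tilting: "cluster_tilting C E s \<Sigma> \<iota> n \<T>"
    and c1: "\<And>Z. \<lbrakk>2 \<le> n; Z \<in> Ob C;
          \<forall>T\<in>\<T>. exts (higher_ext C E s \<Sigma> \<iota> (n - 1)) T Z
                 = {zero_ext (higher_ext C E s \<Sigma> \<iota> (n - 1)) T Z}\<rbrakk>
        \<Longrightarrow> \<exists>D q P p \<delta>. s_triangle C E s D q P p Z \<delta> \<and> P \<in> projectives C E s \<and>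
              (\<forall>T\<in>\<T>. inj_on (\<lambda>f. q \<cdot>\<^bsub>C\<^esub> f) (arr C T D))"
    and c2: "\<And>A. \<lbrakk>2 \<le> n; A \<in> Ob C;
          \<forall>T\<in>\<T>. exts (higher_ext C E s \<Sigma> \<iota> (n - 1)) A T
                 = {zero_ext (higher_ext C E s \<Sigma> \<iota> (n - 1)) A T}\<rbrakk>
        \<Longrightarrow> \<exists>i I j S \<delta>. s_triangle C E s A i I j S \<delta> \<and> I \<in> injectives C E s \<and>
              (\<forall>T\<in>\<T>. inj_on (\<lambda>f. f \<cdot>\<^bsub>C\<^esub> j) (arr C S T))"
  shows "(\<forall>A\<in>\<T>. \<forall>Z\<in>\<T>. \<forall>\<delta>\<in>exts (higher_ext C E s \<Sigma> \<iota> n) Z A.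
            \<exists>!K. K \<in> decomposable_classes C E s \<Sigma> \<iota> n \<T> Z A \<delta>) \<and>
         n_exangulated_category (full_subcategory C \<T>) (higher_ext C E s \<Sigma> \<iota> n)
           (higher_realization C E s \<Sigma> \<iota> n \<T>) n"
proof -
  interpret ext: extriangulated_category C E s
    using extriangulated by (simp add: extriangulated_category_def)
  interpret tilted_exangulated C E s \<Sigma> \<iota> \<T> n
  proof
    show "suspension_data C E s \<Sigma> \<iota>" by (rule data(1))
    show "enough_projectives C E s" by (rule enough(1))
    show "1 \<le> n" by (rule n)
    show "cluster_tilting C E s \<Sigma> \<iota> n \<T>" by (rule tilting)
  qed (rule W_inflation W_deflation c1 c2; assumption)+
  show ?thesis using decomposable_class_unique n_exangulated_higher by blast
qed

end
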